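(* Let $X$ and $Y$ be two càdlàg semimartingales on a common filtered probability space satisfying the usual conditions, such that (1) $\{X=X_-=0\}\subset\{Y=Y_-=0\}$, (2) $X^+\le Y^+$. Then $dL^0_t(X)\ll dL^0_t(Y)$ for all $t>0$, and there exists a predictable process $(\theta_s)_{s\ge0}$ with $\theta_s\in[0,1]$ such that $$L^0_t(X)=\int_0^t\theta_s\,dL^0_s(Y),\qquad t\ge0.$$
   Context: For a càdlàg semimartingale $Z$, the local time $L^0(Z)$ of $Z$ at $0$ is the continuous adapted increasing process satisfying $$|Z_t|=|Z_0|+\int_0^t\mathrm{sgn}(Z_{s-})\,dZ_s+2\sum_{0<s\le t}\bigl[Z_s^-1_{\{Z_{s-}>0\}}+Z_s^+1_{\{Z_{s-}\le0\}}\bigr]+L^0_t(Z),$$ with the convention $\mathrm{sgn}(0)=-1$, where $x^+=\max(x,0)$, $x^-=\max(-x,0)$ and $Z_{s-}$ is the left limit of $Z$ at $s$. $\{X=X_-=0\}$ denotes the set of $(s,\omega)$ with $X_s(\omega)=X_{s-}(\omega)=0$. $dL^0_t(Z)$ is the random Stieltjes measure associated with $L^0(Z)$; the assertions are understood almost surely. *)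

theory Defs
  imports "HOL-Probability.Probability"
begin

text \<open>
  Processes are functions \<^typ>\<open>real \<Rightarrow> 'a \<Rightarrow> real\<close> (time first); only times \<open>t \<ge> 0\<close> carry meaning.
  The library's \<^locale>\<open>filtration\<close> is indexed by a whole type, so \<open>F t\<close> exists for \<open>t < 0\<close> as well,
  but it plays no role there.
  Path properties of processes are required for almost every path; under the usual conditions
  this does not affect adaptedness.
\<close>

locale usual_filtered_prob_space =
  prob_space M + complete_measure M + filtration "space M" F
  for M :: "'a measure" and F :: "real \<Rightarrow> 'a measure" +
  assumes sets_F_subset: "\<And>t. sets (F t) \<subseteq> sets M"
    and null_sets_F: "null_sets M \<subseteq> sets (F 0)"
    and right_continuous_F: "\<And>t. 0 \<le> t \<Longrightarrow> sets (F t) = (\<Inter>u\<in>{t<..}. sets (F u))"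

subsection \<open>Processes\<close>

definition adapted :: "(real \<Rightarrow> 'a measure) \<Rightarrow> (real \<Rightarrow> 'a \<Rightarrow> real) \<Rightarrow> bool" where
  "adapted F Z \<longleftrightarrow> (\<forall>t\<ge>0. Z t \<in> borel_measurable (F t))"

definition cadlag_path :: "(real \<Rightarrow> real) \<Rightarrow> bool" where
  "cadlag_path f \<longleftrightarrow>
    (\<forall>t\<ge>0. continuous (at_right t) f) \<and> (\<forall>t>0. \<exists>l. (f \<longlongrightarrow> l) (at_left t))"

definition cadlag_adapted ::
    "'a measure \<Rightarrow> (real \<Rightarrow> 'a measure) \<Rightarrow> (real \<Rightarrow> 'a \<Rightarrow> real) \<Rightarrow> bool" where
  "cadlag_adapted M F Z \<longleftrightarrow> adapted F Z \<and> (AE \<omega> in M. cadlag_path (\<lambda>t. Z t \<omega>))"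

text \<open>The value at time \<open>0\<close> follows the convention \<open>Z\<^sub>0\<^sub>- = Z\<^sub>0\<close>; it never enters a local time.\<close>
definition left_lim :: "(real \<Rightarrow> 'a \<Rightarrow> real) \<Rightarrow> real \<Rightarrow> 'a \<Rightarrow> real" where
  "left_lim Z s \<omega> = (if s \<le> 0 then Z 0 \<omega> else Lim (at_left s) (\<lambda>u. Z u \<omega>))"

definition predictable_sigma :: "'a measure \<Rightarrow> (real \<Rightarrow> 'a measure) \<Rightarrow> (real \<times> 'a) measure" where
  "predictable_sigma M F = sigma ({0..} \<times> space M)
     ({{0} \<times> A | A. A \<in> sets (F 0)} \<union>
      {{s<..t} \<times> A | s t A. 0 \<le> s \<and> s \<le> t \<and> A \<in> sets (F s)})"

definition predictable ::
    "'a measure \<Rightarrow> (real \<Rightarrow> 'a measure) \<Rightarrow> (real \<Rightarrow> 'a \<Rightarrow> real) \<Rightarrow> bool" where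
  "predictable M F H \<longleftrightarrow> (\<lambda>(s, \<omega>). H s \<omega>) \<in> borel_measurable (predictable_sigma M F)"

subsection \<open>Semimartingales\<close>

text \<open>The library's \<^const>\<open>stopping_time\<close> takes values in the index type, hence cannot be infinite.\<close>
definition ext_stopping_time :: "(real \<Rightarrow> 'a measure) \<Rightarrow> ('a \<Rightarrow> ennreal) \<Rightarrow> bool" where
  "ext_stopping_time F \<tau> \<longleftrightarrow> (\<forall>t\<ge>0. Measurable.pred (F t) (\<lambda>\<omega>. \<tau> \<omega> \<le> ennreal t))"

definition stopped :: "(real \<Rightarrow> 'a \<Rightarrow> real) \<Rightarrow> ('a \<Rightarrow> ennreal) \<Rightarrow> real \<Rightarrow> 'a \<Rightarrow> real" where
  "stopped Z \<tau> t \<omega> = Z (enn2real (min (ennreal t) (\<tau> \<omega>))) \<omega>"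

definition martingale ::
    "'a measure \<Rightarrow> (real \<Rightarrow> 'a measure) \<Rightarrow> (real \<Rightarrow> 'a \<Rightarrow> real) \<Rightarrow> bool" where
  "martingale M F N \<longleftrightarrow> adapted F N \<and> (\<forall>t\<ge>0. integrable M (N t)) \<and>
     (\<forall>s t. 0 \<le> s \<longrightarrow> s \<le> t \<longrightarrow> (AE \<omega> in M. real_cond_exp M (F s) (N t) \<omega> = N s \<omega>))"

text \<open>Local martingales are not required to be integrable at time \<open>0\<close>.\<close>
definition local_martingale ::
    "'a measure \<Rightarrow> (real \<Rightarrow> 'a measure) \<Rightarrow> (real \<Rightarrow> 'a \<Rightarrow> real) \<Rightarrow> bool" where
  "local_martingale M F N \<longleftrightarrow> cadlag_adapted M F N \<and>
     (\<exists>\<tau> :: nat \<Rightarrow> 'a \<Rightarrow> ennreal.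
        (\<forall>n. ext_stopping_time F (\<tau> n)) \<and>
        (AE \<omega> in M. incseq (\<lambda>n. \<tau> n \<omega>) \<and> (\<lambda>n. \<tau> n \<omega>) \<longlonglongrightarrow> \<infinity>) \<and>
        (\<forall>n. martingale M F (stopped (\<lambda>t \<omega>. N t \<omega> - N 0 \<omega>) (\<tau> n))))"

definition bounded_variation_path :: "(real \<Rightarrow> real) \<Rightarrow> real \<Rightarrow> bool" where
  "bounded_variation_path f t \<longleftrightarrow>
     (\<exists>C. \<forall>(n::nat) p. mono p \<and> range p \<subseteq> {0..t} \<longrightarrow> (\<Sum>i<n. \<bar>f (p (Suc i)) - f (p i)\<bar>) \<le> C)"

definition semimartingale ::
    "'a measure \<Rightarrow> (real \<Rightarrow> 'a measure) \<Rightarrow> (real \<Rightarrow> 'a \<Rightarrow> real) \<Rightarrow> bool" where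
  "semimartingale M F Z \<longleftrightarrow> cadlag_adapted M F Z \<and>
     (\<exists>N A. local_martingale M F N \<and> cadlag_adapted M F A \<and>
        (AE \<omega> in M. \<forall>t\<ge>0. bounded_variation_path (\<lambda>s. A s \<omega>) t) \<and>
        (AE \<omega> in M. N 0 \<omega> = 0 \<and> A 0 \<omega> = 0) \<and>
        (AE \<omega> in M. \<forall>t\<ge>0. Z t \<omega> = Z 0 \<omega> + N t \<omega> + A t \<omega>))"

subsection \<open>The stochastic integral of bounded predictable processes\<close>

definition elementary_process ::
    "nat \<Rightarrow> (nat \<Rightarrow> real) \<Rightarrow> ('a \<Rightarrow> real) \<Rightarrow> (nat \<Rightarrow> 'a \<Rightarrow> real) \<Rightarrow> real \<Rightarrow> 'a \<Rightarrow> real" where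
  "elementary_process n p \<eta> \<xi> s \<omega> =
     \<eta> \<omega> * indicator {0} s + (\<Sum>i<n. \<xi> i \<omega> * indicator {p i<..p (Suc i)} s)"

definition elementary_integral ::
    "(real \<Rightarrow> 'a \<Rightarrow> real) \<Rightarrow> nat \<Rightarrow> (nat \<Rightarrow> real) \<Rightarrow> (nat \<Rightarrow> 'a \<Rightarrow> real) \<Rightarrow> real \<Rightarrow> 'a \<Rightarrow> real" where
  "elementary_integral Z n p \<xi> t \<omega> =
     (\<Sum>i<n. \<xi> i \<omega> * (Z (min (p (Suc i)) t) \<omega> - Z (min (p i) t) \<omega>))"

definition ucp_limit ::
    "'a measure \<Rightarrow> (nat \<Rightarrow> real \<Rightarrow> 'a \<Rightarrow> real) \<Rightarrow> (real \<Rightarrow> 'a \<Rightarrow> real) \<Rightarrow> bool" where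
  "ucp_limit M Js J \<longleftrightarrow> (\<forall>t\<ge>0. \<forall>\<epsilon>>0.
     (\<lambda>n. measure M {\<omega> \<in> space M. \<exists>s\<in>{0..t}. \<epsilon> < \<bar>Js n s \<omega> - J s \<omega>\<bar>}) \<longlonglongrightarrow> 0)"

text \<open>
  \<open>stochastic_integral M F Z H J\<close> means that \<open>J\<close> is a version of \<open>(\<integral>\<^bsub>(0,t]\<^esub> H\<^sub>s dZ\<^sub>s)\<^bsub>t\<ge>0\<^esub>\<close>.
  For a semimartingale \<open>Z\<close>, the stochastic integral on bounded predictable processes is the unique
  (up to indistinguishability) extension of the elementary integral that satisfies the bounded
  convergence theorem with convergence uniform on compacts in probability. The relation
  is the closure of the elementary integral under such limits: it is single-valued up to
  indistinguishability since the closure steps are instances of that theorem, and by the monotone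
  class theorem it reaches every bounded predictable integrand.
\<close>
inductive stochastic_integral ::
    "'a measure \<Rightarrow> (real \<Rightarrow> 'a measure) \<Rightarrow> (real \<Rightarrow> 'a \<Rightarrow> real) \<Rightarrow>
     (real \<Rightarrow> 'a \<Rightarrow> real) \<Rightarrow> (real \<Rightarrow> 'a \<Rightarrow> real) \<Rightarrow> bool"
  for M F Z where
  elementary:
    "\<lbrakk>0 \<le> p 0; mono p;
      \<eta> \<in> borel_measurable (F 0); \<forall>\<omega>\<in>space M. \<bar>\<eta> \<omega>\<bar> \<le> C;
      \<forall>i<n. \<xi> i \<in> borel_measurable (F (p i)) \<and> (\<forall>\<omega>\<in>space M. \<bar>\<xi> i \<omega>\<bar> \<le> C)\<rbrakk>
     \<Longrightarrow> stochastic_integral M F Z (elementary_process n p \<eta> \<xi>) (elementary_integral Z n p \<xi>)"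
| bounded_limit:
    "\<lbrakk>\<And>n. stochastic_integral M F Z (Hs n) (Js n);
      AE \<omega> in M. \<forall>n. \<forall>s\<ge>0. \<bar>Hs n s \<omega>\<bar> \<le> C;
      AE \<omega> in M. \<forall>s\<ge>0. (\<lambda>n. Hs n s \<omega>) \<longlonglongrightarrow> H s \<omega>;
      cadlag_adapted M F J; ucp_limit M Js J\<rbrakk>
     \<Longrightarrow> stochastic_integral M F Z H J"

subsection \<open>Local time at zero\<close>

definition sgn_left :: "real \<Rightarrow> real" where
  "sgn_left x = (if 0 < x then 1 else - 1)"

definition pos_part :: "real \<Rightarrow> real" where
  "pos_part x = max x 0"

definition neg_part :: "real \<Rightarrow> real" where
  "neg_part x = max (- x) 0"

definition jump_term :: "(real \<Rightarrow> 'a \<Rightarrow> real) \<Rightarrow> 'a \<Rightarrow> real \<Rightarrow> real" where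
  "jump_term Z \<omega> s =
     neg_part (Z s \<omega>) * of_bool (left_lim Z s \<omega> > 0) +
     pos_part (Z s \<omega>) * of_bool (left_lim Z s \<omega> \<le> 0)"

text \<open>
  \<open>local_time M F Z L\<close>: \<open>L\<close> is a version of \<open>L\<^sup>0(Z)\<close>. The formula determines \<open>L\<close> up to
  indistinguishability and, at \<open>t = 0\<close>, forces \<open>L\<^sub>0 = 0\<close>. Summability is stated explicitly
  because \<^const>\<open>infsum\<close> is \<open>0\<close> on non-summable families.
\<close>
definition local_time ::
    "'a measure \<Rightarrow> (real \<Rightarrow> 'a measure) \<Rightarrow> (real \<Rightarrow> 'a \<Rightarrow> real) \<Rightarrow> (real \<Rightarrow> 'a \<Rightarrow> real) \<Rightarrow> bool" where
  "local_time M F Z L \<longleftrightarrow>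
     adapted F L \<and>
     (AE \<omega> in M. continuous_on {0..} (\<lambda>t. L t \<omega>) \<and> mono_on {0..} (\<lambda>t. L t \<omega>)) \<and>
     (\<exists>J. stochastic_integral M F Z (\<lambda>s \<omega>. sgn_left (left_lim Z s \<omega>)) J \<and>
        (AE \<omega> in M. \<forall>t\<ge>0.
           jump_term Z \<omega> summable_on {0<..t} \<and>
           \<bar>Z t \<omega>\<bar> = \<bar>Z 0 \<omega>\<bar> + J t \<omega> + 2 * (\<Sum>\<^sub>\<infinity>s\<in>{0<..t}. jump_term Z \<omega> s) + L t \<omega>))"

text \<open>The random measure \<open>dL\<^sub>t\<close>; freezing \<open>L\<close> at negative times puts no mass there.\<close>
definition stieltjes :: "(real \<Rightarrow> 'a \<Rightarrow> real) \<Rightarrow> 'a \<Rightarrow> real measure" where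
  "stieltjes L \<omega> = interval_measure (\<lambda>t. L (max 0 t) \<omega>)"

end

theory Submission
  imports Defs
begin

text \<open>
  By Tanaka's formula \<open>X\<^sup>+ = X\<^sub>0\<^sup>+ + K\<^sub>X + \<Lambda>\<^sub>X\<close>, where \<open>K\<^sub>X\<close> is the integral of the indicator of
  \<open>{X\<^sub>- > 0}\<close> and \<open>\<Lambda>\<^sub>X\<close> is increasing with continuous part \<open>L(X) / 2\<close>; likewise for \<open>Y\<close>. Put
  \<open>c = w\<^sup>+ / \<delta>\<^sup>2\<close> with \<open>w = \<delta>\<^sup>2 - \<delta> Y\<^sup>+ - (Y\<^sup>+ - X\<^sup>+)\<close>. Along any grid, convexity of \<open>(w\<^sup>+)\<^sup>2\<close> bounds the sum
  of the \<open>c \<cdot> (\<Delta>X\<^sup>+ - (1 + \<delta>) \<Delta>Y\<^sup>+)\<close> by \<open>\<delta>\<^sup>2 / 2\<close>. As the grid is refined and then \<open>\<delta>\<close> tends to 0, the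
  weights localize to \<open>{Y\<^sub>- \<le> 0}\<close>, where the integrands of \<open>K\<^sub>X\<close> and \<open>K\<^sub>Y\<close> vanish; hence
  \<open>d\<Lambda>\<^sub>X \<le> d\<Lambda>\<^sub>Y\<close> on that set. A similar localization shows that \<open>dL(X)\<close> is carried by
  \<open>{X = X\<^sub>- = 0}\<close>, which is contained in \<open>{Y\<^sub>- = 0}\<close>. As \<open>dL(X)\<close> has no atoms, the jumps of \<open>\<Lambda>\<^sub>Y\<close> do not
  matter and \<open>dL(X) \<le> dL(Y)\<close>.

  The integrals are accessible only as limits of elementary ones. All that is used of them is that an
  elementary integral is small in probability when its integrand is small in the \<open>L\<^sup>2\<close> space of a
  suitable finite measure on the predictable sets: a Doleans measure of \<open>sqrt (1 + N\<^sup>2)\<close> for a martingale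
  \<open>N\<close>, and of the truncated variation for a process of finite variation.

  The density \<open>\<theta>\<close> is a Radon-Nikodym derivative, on the predictable sets, of the measures generated
  by \<open>L(X)\<close> and \<open>L(Y)\<close>. The process \<open>L(X) - \<integral>\<theta> dL(Y)\<close> is continuous with increments dominated by
  those of \<open>L(Y)\<close> and orthogonal to the past, so its second moment is at most the limit of the
  expected sums of squared increments of \<open>L(Y)\<close>, which is 0.
\<close>

subsection \<open>Riemann sums along a finite set of times\<close>

text \<open>What shapes the proof is that integrals are given only through the closure relation:
  dominated convergence, quadratic variation and change of variables all have to be replaced.
  \<open>controlled\<close> is the replacement, a continuity of elementary integration from L^2 of a
  finite measure to convergence in probability. It holds for every martingale because the function
  \<open>sqrt (1 + x\<^sup>2)\<close> grows linearly, so plain integrability suffices, while its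
  remainder after the linear term is still quadratic for small increments. No decomposition by jump
  size enters. In \<open>w\<close>, the term with \<delta> Y^+ makes the weight vanish once Y^+
  reaches \<delta>, and the bracket gives the increments of X^+ the coefficient 1 and, together with
  that term, those of Y^+ the coefficient -(1 + \<delta>). The height \<delta>^2 leaves, after
  division by \<delta>^2, a boundary term that tends to 0. A derivative of dL(X) taken path by path
  would come with no joint measurability, so the density is sought on the predictable sets. There
  the two sides agree only in the mean, which is why a further argument must recover equality of
  paths.\<close>

definition prev :: "real set \<Rightarrow> real \<Rightarrow> real" where
  "prev Q t = Max (Q \<inter> {..<t})"

text \<open>The weight is read at the right end of each cell. For a process that is constant on
  left-open cells this is its value on the whole cell, already known at the left end.\<close>

definition riemann_sum :: "real set \<Rightarrow> (real \<Rightarrow> real) \<Rightarrow> (real \<Rightarrow> real) \<Rightarrow> real \<Rightarrow> real" where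
  "riemann_sum Q f z t = (\<Sum>q\<in>Q \<inter> {0<..t}. f q * (z q - z (prev Q q)))"

text \<open>The point 0 gives every positive time a predecessor, so there \<open>prev\<close> is
  never the maximum of an empty set.\<close>

definition time_grid :: "real set \<Rightarrow> bool" where
  "time_grid Q \<longleftrightarrow> finite Q \<and> 0 \<in> Q \<and> Q \<subseteq> {0..}"

lemma time_gridD: "time_grid Q \<Longrightarrow> finite Q" "time_grid Q \<Longrightarrow> 0 \<in> Q" "time_grid Q \<Longrightarrow> q \<in> Q \<Longrightarrow> 0 \<le> q"
  by (auto simp: time_grid_def)

lemma time_grid_Un: "time_grid Q \<Longrightarrow> finite A \<Longrightarrow> A \<subseteq> {0..} \<Longrightarrow> time_grid (Q \<union> A)"
  by (auto simp: time_grid_def)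

lemma
  assumes Q: "time_grid Q" and t: "0 < t"
  shows prev_in: "prev Q t \<in> Q" and prev_less: "prev Q t < t" and prev_nonneg: "0 \<le> prev Q t"
    and prev_gap: "Q \<inter> {prev Q t<..<t} = {}"
    and prev_ge: "q \<in> Q \<Longrightarrow> q < t \<Longrightarrow> q \<le> prev Q t"
proof -
  have fin: "finite (Q \<inter> {..<t})" and ne: "Q \<inter> {..<t} \<noteq> {}"
    using Q t by (auto simp: time_grid_def)
  have "prev Q t \<in> Q \<inter> {..<t}" unfolding prev_def by (rule Max_in[OF fin ne])
  then show "prev Q t \<in> Q" "prev Q t < t" by auto
  then show "0 \<le> prev Q t" using Q by (auto simp: time_grid_def)
  have *: "q \<le> prev Q t" if "q \<in> Q" "q < t" for q
    unfolding prev_def using that by (intro Max_ge[OF fin]) auto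
  then show "q \<in> Q \<Longrightarrow> q < t \<Longrightarrow> q \<le> prev Q t" .
  show "Q \<inter> {prev Q t<..<t} = {}" using * by force
qed

text \<open>Induction on the number of grid points below \<open>t\<close>; sums over
  \<open>Q \<inter> {0<..t}\<close> are thereby peeled off one cell at a time.\<close>

lemma time_grid_induct [consumes 2, case_names zero step]:
  assumes Q: "time_grid Q" and "t \<in> Q" and "P 0"
    and step: "\<And>t. t \<in> Q \<Longrightarrow> 0 < t \<Longrightarrow> P (prev Q t) \<Longrightarrow> P t"
  shows "P t"
  using \<open>t \<in> Q\<close>
proof (induction "card (Q \<inter> {..<t})" arbitrary: t rule: less_induct)
  case less
  show ?case
  proof (cases "t = 0")
    case False
    then have t: "0 < t" using time_gridD(3)[OF Q less.prems] by simp
    have "Q \<inter> {..<prev Q t} \<subset> Q \<inter> {..<t}"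
      using prev_in[OF Q t] prev_less[OF Q t] by auto
    then have "card (Q \<inter> {..<prev Q t}) < card (Q \<inter> {..<t})"
      using Q by (intro psubset_card_mono) (auto simp: time_grid_def)
    then show ?thesis using step[OF less.prems t] less.hyps prev_in[OF Q t] by blast
  qed (use \<open>P 0\<close> in simp)
qed

lemma time_grid_Ioc_step:
  assumes Q: "time_grid Q" and t: "t \<in> Q" "0 < t" and a: "a < t" "a \<in> Q"
  shows "Q \<inter> {a<..t} = insert t (Q \<inter> {a<..prev Q t})" and "t \<notin> Q \<inter> {a<..prev Q t}"
proof -
  have p: "prev Q t < t" "a \<le> prev Q t" using prev_less[OF Q t(2)] prev_ge[OF Q t(2) a(2,1)] by auto
  have *: "q \<le> prev Q t" if "q \<in> Q" "q \<le> t" "q \<noteq> t" for q using prev_ge[OF Q t(2) that(1)] that by simp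
  show "Q \<inter> {a<..t} = insert t (Q \<inter> {a<..prev Q t})"
  proof (rule set_eqI)
    show "q \<in> Q \<inter> {a<..t} \<longleftrightarrow> q \<in> insert t (Q \<inter> {a<..prev Q t})" for q
      using p t a *[of q] by (cases "q = t") auto
  qed
  show "t \<notin> Q \<inter> {a<..prev Q t}" using p by simp
qed

lemma telescope:
  assumes Q: "time_grid Q" and "a \<in> Q" "b \<in> Q" "a \<le> b"
  shows "(\<Sum>q\<in>Q \<inter> {a<..b}. z q - z (prev Q q)) = (z b - z a :: real)"
  using Q \<open>b \<in> Q\<close> \<open>a \<le> b\<close>
proof (induction b rule: time_grid_induct)
  case zero
  then show ?case using time_gridD(3)[OF Q \<open>a \<in> Q\<close>] by simp
next
  case (step t)
  show ?case
  proof (cases "a = t")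
    case False
    then have a: "a < t" using step by simp
    have "a \<le> prev Q t" by (rule prev_ge[OF Q step(2) \<open>a \<in> Q\<close> a])
    then show ?thesis
      using step time_gridD(1)[OF Q] time_grid_Ioc_step[OF Q step(1,2) a \<open>a \<in> Q\<close>] by simp
  qed simp
qed

lemma riemann_sum_0 [simp]: "riemann_sum Q f z 0 = 0"
  by (simp add: riemann_sum_def)

lemma riemann_sum_step:
  assumes Q: "time_grid Q" and t: "t \<in> Q" "0 < t"
  shows "riemann_sum Q f z t = riemann_sum Q f z (prev Q t) + f t * (z t - z (prev Q t))"
  unfolding riemann_sum_def
  using time_grid_Ioc_step[OF Q t t(2) time_gridD(2)[OF Q]] time_gridD(1)[OF Q] by simp

lemma riemann_sum_diff:
  assumes Q: "time_grid Q" and "a \<le> b" "0 \<le> a"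
  shows "riemann_sum Q f z b - riemann_sum Q f z a = (\<Sum>q\<in>Q \<inter> {a<..b}. f q * (z q - z (prev Q q)))"
proof -
  have "Q \<inter> {0<..b} = (Q \<inter> {0<..a}) \<union> (Q \<inter> {a<..b})" using assms by auto
  moreover have "sum g ((Q \<inter> {0<..a}) \<union> (Q \<inter> {a<..b})) = sum g (Q \<inter> {0<..a}) + sum g (Q \<inter> {a<..b})"
    for g :: "real \<Rightarrow> real"
    using time_gridD(1)[OF Q] by (intro sum.union_disjoint) auto
  ultimately show ?thesis unfolding riemann_sum_def by simp
qed

lemma riemann_sum_add:
  "riemann_sum Q (\<lambda>s. f s + g s) z t = riemann_sum Q f z t + riemann_sum Q g z t"
  by (simp add: riemann_sum_def distrib_right sum.distrib)

lemma riemann_sum_cmult: "riemann_sum Q (\<lambda>s. c * f s) z t = c * riemann_sum Q f z t"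
  by (simp add: riemann_sum_def sum_distrib_left algebra_simps)

lemma riemann_sum_const:
  assumes "time_grid Q" "t \<in> Q"
  shows "riemann_sum Q (\<lambda>s. c) z t = c * (z t - z 0)"
  using telescope[OF assms(1) time_gridD(2)[OF assms(1)] assms(2), of z] time_gridD(3)[OF assms]
  by (simp add: riemann_sum_def flip: sum_distrib_left)

text \<open>Absence of grid points from \<open>{s..<x}\<close> means that \<open>s\<close> and
  \<open>x\<close> share a left-open, right-closed cell. In this form the condition covers the
  unbounded cell after the last point and passes to finer grids at once.\<close>

definition step_on :: "real set \<Rightarrow> (real \<Rightarrow> real) \<Rightarrow> bool" where
  "step_on Q f \<longleftrightarrow> (\<forall>s x. 0 < s \<longrightarrow> s \<le> x \<longrightarrow> Q \<inter> {s..<x} = {} \<longrightarrow> f s = f x)"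

lemma step_on_mono: "step_on Q f \<Longrightarrow> Q \<subseteq> Q' \<Longrightarrow> step_on Q' f"
  unfolding step_on_def by blast

lemma step_on_cell: "step_on Q f \<Longrightarrow> time_grid Q \<Longrightarrow> 0 < t \<Longrightarrow> prev Q t < s \<Longrightarrow> s \<le> t \<Longrightarrow> f s = f t"
  using prev_gap[of Q t] prev_nonneg[of Q t] unfolding step_on_def
  by (smt (verit, best) Int_iff disjoint_iff_not_equal atLeastLessThan_iff greaterThanLessThan_iff)

text \<open>On each coarse cell the weight is constant, so the fine increments telescope.\<close>

lemma riemann_sum_refine:
  assumes Q: "time_grid Q" and Q': "time_grid Q'" and sub: "Q \<subseteq> Q'" and f: "step_on Q f" and "t \<in> Q"
  shows "riemann_sum Q' f z t = riemann_sum Q f z t"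
  using Q \<open>t \<in> Q\<close>
proof (induction t rule: time_grid_induct)
  case (step t)
  have p: "prev Q t \<in> Q" "prev Q t < t" "0 \<le> prev Q t"
    using prev_in[OF Q step(2)] prev_less[OF Q step(2)] prev_nonneg[OF Q step(2)] by auto
  have "riemann_sum Q' f z t - riemann_sum Q' f z (prev Q t)
      = (\<Sum>q\<in>Q' \<inter> {prev Q t<..t}. f q * (z q - z (prev Q' q)))"
    by (rule riemann_sum_diff[OF Q']) (use p in auto)
  also have "\<dots> = (\<Sum>q\<in>Q' \<inter> {prev Q t<..t}. f t * (z q - z (prev Q' q)))"
  proof (rule sum.cong)
    fix q assume "q \<in> Q' \<inter> {prev Q t<..t}"
    then have "f q = f t" by (intro step_on_cell[OF f Q step(2)]) auto
    then show "f q * (z q - z (prev Q' q)) = f t * (z q - z (prev Q' q))" by simp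
  qed simp
  also have "\<dots> = f t * (z t - z (prev Q t))"
    unfolding sum_distrib_left[symmetric]
    by (subst telescope[OF Q']) (use p step sub in auto)
  finally show ?case using step riemann_sum_step[OF Q step(1,2), of f z] by simp
qed simp

lemma riemann_sum_Ioc:
  assumes Q: "time_grid Q" and "a \<in> Q" "b \<in> Q" "a \<le> b" "t \<in> Q"
  shows "riemann_sum Q (indicator {a<..b}) z t = z (min b t) - z (min a t)"
proof -
  have a: "0 \<le> a" using time_gridD(3)[OF Q] assms by simp
  have "riemann_sum Q (indicator {a<..b}) z t
     = (\<Sum>q\<in>Q \<inter> {0<..t}. if q \<in> {a<..b} then z q - z (prev Q q) else 0)"
    unfolding riemann_sum_def by (intro sum.cong) auto
  also have "\<dots> = (\<Sum>q\<in>Q \<inter> {0<..t} \<inter> {a<..b}. z q - z (prev Q q))"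
    using time_gridD(1)[OF Q] by (simp add: sum.inter_restrict)
  also have "Q \<inter> {0<..t} \<inter> {a<..b} = Q \<inter> {min a t<..min b t}" using a by auto
  also have "(\<Sum>q\<in>\<dots>. z q - z (prev Q q)) = z (min b t) - z (min a t)"
    by (rule telescope[OF Q]) (use assms in \<open>auto simp: min_def\<close>)
  finally show ?thesis .
qed

lemma riemann_sum_sum:
  "riemann_sum Q (\<lambda>s. \<Sum>i\<in>I. f i s) z t = (\<Sum>i\<in>I. riemann_sum Q (f i) z t)"
  unfolding riemann_sum_def sum_distrib_right by (rule sum.swap)

text \<open>The link between the integrals of the definition and Riemann sums. The value at time 0
  drops out because the sum runs over positive times.\<close>

lemma elementary_integral_eq_riemann_sum:
  assumes Q: "time_grid Q" and p: "mono p" "p ` {..n} \<subseteq> Q" and "t \<in> Q"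
  shows "elementary_integral Z n p \<xi> t w =
    riemann_sum Q (\<lambda>s. elementary_process n p \<eta> \<xi> s w) (\<lambda>u. Z u w) t"
proof -
  have "riemann_sum Q (\<lambda>s. elementary_process n p \<eta> \<xi> s w) (\<lambda>u. Z u w) t
     = riemann_sum Q (\<lambda>s. \<Sum>i<n. \<xi> i w * indicator {p i<..p (Suc i)} s) (\<lambda>u. Z u w) t"
    unfolding riemann_sum_def elementary_process_def by (intro sum.cong) auto
  also have "\<dots> = (\<Sum>i<n. \<xi> i w * riemann_sum Q (indicator {p i<..p (Suc i)}) (\<lambda>u. Z u w) t)"
    by (simp only: riemann_sum_sum riemann_sum_cmult)
  also have "\<dots> = elementary_integral Z n p \<xi> t w"
    unfolding elementary_integral_def
  proof (rule sum.cong)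
    fix i assume "i \<in> {..<n}"
    then have "p i \<in> Q" "p (Suc i) \<in> Q" "p i \<le> p (Suc i)" using p by (auto simp: mono_def)
    then show "\<xi> i w * riemann_sum Q (indicator {p i<..p (Suc i)}) (\<lambda>u. Z u w) t =
       \<xi> i w * (Z (min (p (Suc i)) t) w - Z (min (p i) t) w)"
      using riemann_sum_Ioc[OF Q] \<open>t \<in> Q\<close> by simp
  qed simp
  finally show ?thesis by simp
qed

context usual_filtered_prob_space
begin

abbreviation (input) \<P> :: "(real \<times> 'a) measure" where
  "\<P> \<equiv> predictable_sigma M F"

abbreviation (input) path_sum ::
    "real set \<Rightarrow> (real \<Rightarrow> 'a \<Rightarrow> real) \<Rightarrow> (real \<Rightarrow> 'a \<Rightarrow> real) \<Rightarrow> real \<Rightarrow> 'a \<Rightarrow> real" where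
  "path_sum Q h Z t w \<equiv> riemann_sum Q (\<lambda>s. h s w) (\<lambda>u. Z u w) t"

abbreviation (input) energy :: "(real \<times> 'a) measure \<Rightarrow> (real \<Rightarrow> 'a \<Rightarrow> real) \<Rightarrow> ennreal" where
  "energy \<nu> h \<equiv> (\<integral>\<^sup>+(s, w). ennreal ((h s w)\<^sup>2) \<partial>\<nu>)"

abbreviation (input) L0 :: "('a \<Rightarrow> real) \<Rightarrow> real" where
  "L0 f \<equiv> (\<integral>w. min 1 \<bar>f w\<bar> \<partial>M)"

subsection \<open>Elementary predictable processes\<close>

text \<open>The clause with \<open>Q \<inter> {q<..<s} = {}\<close> asks that the value on a cell be
  known from its left end on. It includes the cell after the last grid point and survives refinement
  of the grid.\<close>

definition elementary_predictable :: "real set \<Rightarrow> (real \<Rightarrow> 'a \<Rightarrow> real) \<Rightarrow> bool" where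
  "elementary_predictable Q h \<longleftrightarrow> time_grid Q \<and>
     (\<exists>C. \<forall>s\<ge>0. \<forall>w\<in>space M. \<bar>h s w\<bar> \<le> C) \<and>
     h 0 \<in> borel_measurable (F 0) \<and>
     (\<forall>q s. 0 \<le> q \<longrightarrow> q < s \<longrightarrow> Q \<inter> {q<..<s} = {} \<longrightarrow> h s \<in> borel_measurable (F q)) \<and>
     (\<forall>w\<in>space M. step_on Q (\<lambda>s. h s w))"

lemma measurable_F_mono: "f \<in> measurable (F s) N \<Longrightarrow> s \<le> t \<Longrightarrow> f \<in> measurable (F t) N"
  using measurable_mono[of N N "F s" "F t"] sets_F_mono[of s t] by (auto simp: space_F)

lemma measurable_F_M: "f \<in> measurable (F s) N \<Longrightarrow> f \<in> measurable M N"
  using measurable_mono[of N N "F s" M] sets_F_subset[of s] by (auto simp: space_F)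

lemma sets_F_M: "B \<in> sets (F s) \<Longrightarrow> B \<in> sets M"
  using sets_F_subset by blast

lemma subalgebra_F: "subalgebra M (F s)"
  by (simp add: subalgebra_def space_F sets_F_subset)

lemma elementary_predictable_mono:
  "elementary_predictable Q h \<Longrightarrow> Q \<subseteq> Q' \<Longrightarrow> time_grid Q' \<Longrightarrow> elementary_predictable Q' h"
  unfolding elementary_predictable_def by (blast intro: step_on_mono)

text \<open>Continuity gives measurability and, since the values stay in a compact box, also
  boundedness. All closure properties below are instances.\<close>

lemma elementary_predictable_comp:
  assumes h: "elementary_predictable Q h" and g: "elementary_predictable Q g"
    and \<phi>: "continuous_on UNIV (\<lambda>(x::real, y::real). \<phi> x y :: real)"
  shows "elementary_predictable Q (\<lambda>s w. \<phi> (h s w) (g s w))"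
proof -
  have [measurable]: "(\<lambda>(x::real, y::real). \<phi> x y :: real) \<in> borel_measurable borel"
    using \<phi> by (rule borel_measurable_continuous_onI)
  have m: "(\<lambda>w. \<phi> (u w) (v w)) \<in> borel_measurable N"
    if "u \<in> borel_measurable N" "v \<in> borel_measurable N" for u v :: "'a \<Rightarrow> real" and N
  proof -
    have "(\<lambda>w. (\<lambda>(x, y). \<phi> x y) (u w, v w)) \<in> borel_measurable N"
      using that by measurable
    then show ?thesis by simp
  qed
  obtain C where C: "\<forall>s\<ge>0. \<forall>w\<in>space M. \<bar>h s w\<bar> \<le> C" using h unfolding elementary_predictable_def by auto
  obtain D where D: "\<forall>s\<ge>0. \<forall>w\<in>space M. \<bar>g s w\<bar> \<le> D" using g unfolding elementary_predictable_def by auto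
  have "compact ((\<lambda>(x, y). \<phi> x y) ` ({-C..C} \<times> {-D..D}))"
    by (intro compact_continuous_image compact_Times continuous_on_subset[OF \<phi>]) auto
  then obtain B where B: "\<And>z. z \<in> (\<lambda>(x, y). \<phi> x y) ` ({-C..C} \<times> {-D..D}) \<Longrightarrow> \<bar>z\<bar> \<le> B"
    using compact_imp_bounded bounded_iff by (metis real_norm_def)
  have "\<forall>s\<ge>0. \<forall>w\<in>space M. \<bar>\<phi> (h s w) (g s w)\<bar> \<le> B"
  proof (intro allI impI ballI B)
    fix s w assume "0 \<le> (s::real)" "w \<in> space M"
    then have "\<bar>h s w\<bar> \<le> C" "\<bar>g s w\<bar> \<le> D" using C D by auto
    then show "\<phi> (h s w) (g s w) \<in> (\<lambda>(x, y). \<phi> x y) ` ({-C..C} \<times> {-D..D})"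
      by (intro image_eqI[of _ _ "(h s w, g s w)"]) auto
  qed
  then show ?thesis
    using h g unfolding elementary_predictable_def step_on_def by (auto intro!: m)
qed

lemma elementary_predictable_const: "time_grid Q \<Longrightarrow> elementary_predictable Q (\<lambda>s w. c)"
  by (auto simp: elementary_predictable_def step_on_def)

lemma elementary_predictable_mult:
  "elementary_predictable Q h \<Longrightarrow> elementary_predictable Q g \<Longrightarrow>
    elementary_predictable Q (\<lambda>s w. h s w * g s w)"
  by (rule elementary_predictable_comp) (auto simp: split_def intro!: continuous_intros)

lemma elementary_predictable_add:
  "elementary_predictable Q h \<Longrightarrow> elementary_predictable Q g \<Longrightarrow>
    elementary_predictable Q (\<lambda>s w. h s w + g s w)"
  by (rule elementary_predictable_comp) (auto simp: split_def intro!: continuous_intros)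

lemma elementary_predictable_diff:
  "elementary_predictable Q h \<Longrightarrow> elementary_predictable Q g \<Longrightarrow>
    elementary_predictable Q (\<lambda>s w. h s w - g s w)"
  by (rule elementary_predictable_comp) (auto simp: split_def intro!: continuous_intros)

lemma elementary_predictable_max:
  "elementary_predictable Q h \<Longrightarrow> elementary_predictable Q g \<Longrightarrow>
    elementary_predictable Q (\<lambda>s w. max (h s w) (g s w))"
  by (rule elementary_predictable_comp) (auto simp: split_def intro!: continuous_intros)

lemma elementary_predictable_sum:
  assumes "finite I" "time_grid Q" "\<And>i. i \<in> I \<Longrightarrow> elementary_predictable Q (h i)"
  shows "elementary_predictable Q (\<lambda>s w. \<Sum>i\<in>I. h i s w)"
  using assms(1,3)
  by (induction I rule: finite_induct)
    (simp_all add: elementary_predictable_const[OF assms(2)] elementary_predictable_add)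

lemma elementary_predictableD:
  assumes "elementary_predictable Q h"
  shows "time_grid Q" "w \<in> space M \<Longrightarrow> step_on Q (\<lambda>s. h s w)"
    "h 0 \<in> borel_measurable (F 0)" "0 < t \<Longrightarrow> h t \<in> borel_measurable (F (prev Q t))"
    "0 \<le> t \<Longrightarrow> h t \<in> borel_measurable M"
proof -
  show Q: "time_grid Q" and 0: "h 0 \<in> borel_measurable (F 0)"
    and "w \<in> space M \<Longrightarrow> step_on Q (\<lambda>s. h s w)"
    using assms by (auto simp: elementary_predictable_def)
  show *: "h t \<in> borel_measurable (F (prev Q t))" if "0 < t" for t
    using assms prev_nonneg[OF Q that] prev_less[OF Q that] prev_gap[OF Q that]
    by (auto simp: elementary_predictable_def)
  show "0 \<le> t \<Longrightarrow> h t \<in> borel_measurable M"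
    using measurable_F_M[OF *] measurable_F_M[OF 0] by (cases "t = 0") auto
qed

lemma elementary_predictable_Ioc:
  assumes Q: "time_grid Q" and ab: "0 \<le> a" "a \<in> Q" "b \<in> Q"
    and \<xi>: "\<xi> \<in> borel_measurable (F a)" "\<forall>w\<in>space M. \<bar>\<xi> w\<bar> \<le> C"
  shows "elementary_predictable Q (\<lambda>s w. \<xi> w * indicator {a<..b} s)"
  unfolding elementary_predictable_def
proof (intro conjI allI impI ballI)
  show "\<exists>C. \<forall>s\<ge>0. \<forall>w\<in>space M. \<bar>\<xi> w * indicator {a<..b} s\<bar> \<le> C"
    using \<xi> by (intro exI[of _ "max C 0"]) (auto simp: indicator_def)
  show "(\<lambda>w. \<xi> w * indicator {a<..b} s) \<in> borel_measurable (F q)"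
    if "0 \<le> q" "q < s" "Q \<inter> {q<..<s} = {}" for q s
  proof (cases "s \<in> {a<..b}")
    case True
    then have "a \<le> q" using that ab by force
    then show ?thesis using measurable_F_mono[OF \<xi>(1)] True by simp
  qed simp
  show "step_on Q (\<lambda>s. \<xi> w * indicator {a<..b} s)" for w
    unfolding step_on_def
  proof (intro allI impI)
    fix s x :: real assume s: "0 < s" "s \<le> x" "Q \<inter> {s..<x} = {}"
    then have "s \<in> {a<..b} \<longleftrightarrow> x \<in> {a<..b}" using ab(2,3)
      by (auto simp: disjoint_iff)
    then show "\<xi> w * indicator {a<..b} s = \<xi> w * indicator {a<..b} x" by (simp add: indicator_def)
  qed
qed (use Q ab in auto)

lemma elementary_process_elementary_predictable:
  assumes p: "0 \<le> p 0" "mono p" and \<eta>: "\<eta> \<in> borel_measurable (F 0)" "\<forall>w\<in>space M. \<bar>\<eta> w\<bar> \<le> C"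
    and \<xi>: "\<forall>i<n. \<xi> i \<in> borel_measurable (F (p i)) \<and> (\<forall>w\<in>space M. \<bar>\<xi> i w\<bar> \<le> C)"
    and Q: "time_grid Q" "p ` {..n} \<subseteq> Q"
  shows "elementary_predictable Q (elementary_process n p \<eta> \<xi>)"
proof -
  have "elementary_predictable Q (\<lambda>s w. \<eta> w * indicator {0} s)"
    unfolding elementary_predictable_def
    using \<eta> Q by (auto simp: step_on_def indicator_def intro!: exI[of _ "max C 0"])
  moreover have "elementary_predictable Q (\<lambda>s w. \<Sum>i<n. \<xi> i w * indicator {p i<..p (Suc i)} s)"
  proof (intro elementary_predictable_sum Q elementary_predictable_Ioc)
    fix i assume i: "i \<in> {..<n}"
    show "0 \<le> p i" using p by (metis le0 monoD order_trans)
    show "\<xi> i \<in> borel_measurable (F (p i))" "\<forall>w\<in>space M. \<bar>\<xi> i w\<bar> \<le> C" using \<xi> i by auto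
    show "p i \<in> Q" "p (Suc i) \<in> Q" using Q i by auto
  qed simp
  ultimately show ?thesis
    unfolding elementary_process_def by (rule elementary_predictable_add)
qed

subsection \<open>The predictable sigma-algebra\<close>

lemma space_predictable_sigma [simp]: "space \<P> = {0..} \<times> space M"
  and sets_predictable_sigma: "sets \<P> = sigma_sets ({0..} \<times> space M)
     ({{0} \<times> A | A. A \<in> sets (F 0)} \<union> {{s<..t} \<times> A | s t A. 0 \<le> s \<and> s \<le> t \<and> A \<in> sets (F s)})"
proof -
  have *: "A \<subseteq> space M" if "A \<in> sets (F s)" for A s using sets.sets_into_space[OF that] by (simp add: space_F)
  have "{{0} \<times> A | A. A \<in> sets (F 0)} \<union> {{s<..t} \<times> A | s t A. 0 \<le> s \<and> s \<le> t \<and> A \<in> sets (F s)}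
    \<subseteq> Pow ({0..} \<times> space M)"
    using * by fastforce
  then show "space \<P> = {0..} \<times> space M"
    "sets \<P> = sigma_sets ({0..} \<times> space M)
     ({{0} \<times> A | A. A \<in> sets (F 0)} \<union> {{s<..t} \<times> A | s t A. 0 \<le> s \<and> s \<le> t \<and> A \<in> sets (F s)})"
    unfolding predictable_sigma_def by (auto simp: space_measure_of_conv sets_measure_of)
qed

lemma predictable_rectangle:
  "A \<in> sets (F 0) \<Longrightarrow> {0} \<times> A \<in> sets \<P>"
  "0 \<le> s \<Longrightarrow> A \<in> sets (F s) \<Longrightarrow> {s<..t} \<times> A \<in> sets \<P>"
  "0 \<le> s \<Longrightarrow> A \<in> sets (F s) \<Longrightarrow> {s<..} \<times> A \<in> sets \<P>"
proof -
  show "A \<in> sets (F 0) \<Longrightarrow> {0} \<times> A \<in> sets \<P>"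
    unfolding sets_predictable_sigma by (rule sigma_sets.Basic) auto
  show *: "{s<..t} \<times> A \<in> sets \<P>" if "0 \<le> s" "A \<in> sets (F s)" for t
  proof (cases "s \<le> t")
    case True
    then show ?thesis unfolding sets_predictable_sigma using that by (intro sigma_sets.Basic) blast
  qed simp
  have "{s<..} \<times> A = (\<Union>n. {s<..s + real n} \<times> A)" if "0 \<le> s"
  proof -
    have "\<exists>n. x \<le> s + real n" for x using real_arch_simple[of "x - s"] by (auto simp: algebra_simps)
    then show ?thesis by auto
  qed
  then show "0 \<le> s \<Longrightarrow> A \<in> sets (F s) \<Longrightarrow> {s<..} \<times> A \<in> sets \<P>"
    using * by auto
qed

lemma predictable_times_indicator:
  assumes g: "g \<in> borel_measurable (F s)" and I: "\<And>A. A \<in> sets (F s) \<Longrightarrow> I \<times> A \<in> sets \<P>"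
  shows "(\<lambda>(u, w). g w * indicator I u :: real) \<in> borel_measurable \<P>"
proof (rule measurableI)
  fix B :: "real set" assume B: "B \<in> sets borel"
  have "g -` B \<inter> space M \<in> sets (F s)" using measurable_sets[OF g B] by (simp add: space_F)
  note 1 = I[OF this]
  have 2: "I \<times> space M \<in> sets \<P>" using I[OF sets.top] by (simp add: space_F)
  have "(\<lambda>(u, w). g w * indicator I u) -` B \<inter> space \<P> =
    I \<times> (g -` B \<inter> space M) \<union> (if 0 \<in> B then space \<P> - I \<times> space M else {})"
    using sets.sets_into_space[OF 1] sets.sets_into_space[OF 2]
    by (auto simp: indicator_def of_bool_def split: if_splits)
  then show "(\<lambda>(u, w). g w * indicator I u) -` B \<inter> space \<P> \<in> sets \<P>"
    using 1 2 sets.top[of "\<P>"] by (auto intro!: sets.Un sets.Diff)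
qed auto

lemma step_on_eq_sum:
  assumes Q: "time_grid Q" and f: "step_on Q f" and t: "t \<in> Q" and u: "0 < u" "u \<le> t"
  shows "f u = (\<Sum>q\<in>Q \<inter> {0<..t}. f q * indicator {prev Q q<..q} u)"
  using Q t u(2)
proof (induction t rule: time_grid_induct)
  case zero
  then show ?case using u by simp
next
  case (step t)
  have eq: "(\<Sum>q\<in>Q \<inter> {0<..t}. f q * indicator {prev Q q<..q} u) =
    f t * indicator {prev Q t<..t} u + (\<Sum>q\<in>Q \<inter> {0<..prev Q t}. f q * indicator {prev Q q<..q} u)"
    using time_grid_Ioc_step[OF Q step(1,2) step(2) time_gridD(2)[OF Q]] time_gridD(1)[OF Q]
    by (simp del: sum_mult_indicator)
  show ?case
  proof (cases "u \<le> prev Q t")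
    case True
    then show ?thesis using step eq by simp
  next
    case False
    then have "(\<Sum>q\<in>Q \<inter> {0<..prev Q t}. f q * indicator {prev Q q<..q} u) = 0"
      by (intro sum.neutral) (auto simp: indicator_def)
    then show ?thesis using eq False step(4) step_on_cell[OF f Q step(2), of u] by simp
  qed
qed

lemma elementary_predictable_measurable:
  assumes h: "elementary_predictable Q h"
  shows "(\<lambda>(s, w). h s w) \<in> borel_measurable \<P>"
proof -
  note Q = elementary_predictableD(1)[OF h]
  define T where "T = Max Q"
  have T: "T \<in> Q" "\<And>q. q \<in> Q \<Longrightarrow> q \<le> T" "0 \<le> T"
    using Q by (auto simp: T_def time_grid_def intro!: Max_in Max_ge)
  define h' where "h' = (\<lambda>x. h 0 (snd x) * indicator {0} (fst x)
    + (\<Sum>q\<in>Q \<inter> {0<..T}. h q (snd x) * indicator {prev Q q<..q} (fst x)) + h (T + 1) (snd x) * indicator {T<..} (fst x))"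
  have [measurable]: "(\<lambda>x. h 0 (snd x) * indicator {0} (fst x)) \<in> borel_measurable \<P>"
    by (rule predictable_times_indicator[unfolded split_def, OF elementary_predictableD(3)[OF h]]) (rule predictable_rectangle)
  \<comment> \<open>The time \<open>T + 1\<close> stands for the unbounded cell after the last grid
    point \<open>T\<close>, so the value there is known at \<open>T\<close>.\<close>
  have "h (T + 1) \<in> borel_measurable (F T)"
    using h T unfolding elementary_predictable_def by (force simp: disjoint_iff not_less)
  then have [measurable]: "(\<lambda>x. h (T + 1) (snd x) * indicator {T<..} (fst x)) \<in> borel_measurable \<P>"
    by (rule predictable_times_indicator[unfolded split_def]) (rule predictable_rectangle(3)[OF T(3)])
  have [measurable]: "(\<lambda>x. h q (snd x) * indicator {prev Q q<..q} (fst x)) \<in> borel_measurable \<P>"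
    if "q \<in> Q \<inter> {0<..T}" for q
  proof (rule predictable_times_indicator[unfolded split_def, OF elementary_predictableD(4)[OF h]])
    show q: "0 < q" using that by simp
    show "A \<in> sets (F (prev Q q)) \<Longrightarrow> {prev Q q<..q} \<times> A \<in> sets \<P>" for A
      by (rule predictable_rectangle(2)[OF prev_nonneg[OF Q q]])
  qed
  have "h' \<in> borel_measurable \<P>"
    unfolding h'_def by (intro borel_measurable_add borel_measurable_sum) measurable
  moreover have "h' x = (\<lambda>(s, w). h s w) x" if in_space: "x \<in> space \<P>" for x
  proof -
    obtain s w where x: "x = (s, w)" "0 \<le> s" "w \<in> space M"
      using in_space by (cases x) auto
    note st = elementary_predictableD(2)[OF h x(3)]
    consider "s = 0" | "0 < s" "s \<le> T" | "T < s" using x by linarith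
    then show ?thesis
    proof cases
      case 1
      have "(\<Sum>q\<in>Q \<inter> {0<..T}. h q w * indicator {prev Q q<..q} s) = 0"
        using prev_nonneg[OF Q] 1 by (intro sum.neutral) (force simp: indicator_def)
      then show ?thesis using 1 T x by (simp add: h'_def)
    next
      case 2
      then show ?thesis using step_on_eq_sum[OF Q st T(1) 2] x by (simp add: h'_def)
    next
      case 3
      have z: "(\<Sum>q\<in>Q \<inter> {0<..T}. h q w * indicator {prev Q q<..q} s) = 0"
        using 3 by (intro sum.neutral) (auto simp: indicator_def)
      have "0 < min s (T + 1)" "min s (T + 1) \<le> max s (T + 1)" "Q \<inter> {min s (T + 1)..<max s (T + 1)} = {}"
        using 3 T by (force simp: min_def)+
      then have "h (min s (T + 1)) w = h (max s (T + 1)) w"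
        using st unfolding step_on_def by blast
      then have "h s w = h (T + 1) w" by (auto simp: min_def max_def split: if_splits)
      then show ?thesis using 3 T x z by (simp add: h'_def)
    qed
  qed
  ultimately show ?thesis using measurable_cong[of "\<P>" h' "\<lambda>(s, w). h s w"] by simp
qed

subsection \<open>Doleans measures\<close>

lemma integrable_bounded_mult:
  assumes f: "integrable M f" and g: "g \<in> borel_measurable M" "\<And>w. w \<in> space M \<Longrightarrow> \<bar>g w\<bar> \<le> C"
  shows "integrable M (\<lambda>w. g w * f w :: real)"
proof (rule Bochner_Integration.integrable_bound)
  show "integrable M (\<lambda>w. C * f w)" using f by simp
  show "AE w in M. norm (g w * f w) \<le> norm (C * f w)"
  proof (rule AE_I2)
    fix w assume "w \<in> space M"
    then have "\<bar>g w\<bar> \<le> \<bar>C\<bar>" using g(2)[of w] by simp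
    then show "norm (g w * f w) \<le> norm (C * f w)" by (simp add: abs_mult mult_right_mono)
  qed
qed (use f g in measurable)

lemma indicator_F:
  "B \<in> sets (F s) \<Longrightarrow> (indicator B :: 'a \<Rightarrow> real) \<in> borel_measurable M"
  "\<bar>indicator B w :: real\<bar> \<le> 1"
  using sets_F_M[of B s] by (simp_all add: indicator_def)

text \<open>Right-continuity is asked of the mean only. As the mean is nondecreasing, the bound at
  one later time bounds the loss when a cell is shrunk from the left. Freezing after
  \<open>T\<close> keeps the Doleans measure finite.\<close>

definition right_continuous_submartingale :: "(real \<Rightarrow> 'a \<Rightarrow> real) \<Rightarrow> real \<Rightarrow> bool" where
  "right_continuous_submartingale S T \<longleftrightarrow> 0 \<le> T \<and> (\<forall>t\<ge>0. S t \<in> borel_measurable (F t) \<and> integrable M (S t)) \<and>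
     (\<forall>t w. 0 \<le> S t w) \<and>
     (\<forall>s t B. 0 \<le> s \<longrightarrow> s \<le> t \<longrightarrow> B \<in> sets (F s) \<longrightarrow>
        (\<integral>w. indicator B w * S s w \<partial>M) \<le> (\<integral>w. indicator B w * S t w \<partial>M)) \<and>
     (\<forall>s\<ge>0. \<forall>e>0. \<exists>t>s. (\<integral>w. S t w \<partial>M) < (\<integral>w. S s w \<partial>M) + e) \<and>
     (\<forall>t\<ge>T. S t = S T)"

context
  fixes S :: "real \<Rightarrow> 'a \<Rightarrow> real" and T :: real
  assumes S: "right_continuous_submartingale S T"
begin

lemma
  shows submartingale_T: "0 \<le> T"
    and submartingale_measurable: "0 \<le> t \<Longrightarrow> S t \<in> borel_measurable (F t)"
    and submartingale_integrable: "0 \<le> t \<Longrightarrow> integrable M (S t)"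
    and submartingale_nonneg: "0 \<le> S t w"
    and submartingale_right_continuous:
      "0 \<le> s \<Longrightarrow> 0 < e \<Longrightarrow> \<exists>t>s. (\<integral>w. S t w \<partial>M) < (\<integral>w. S s w \<partial>M) + e"
    and submartingale_stopped: "T \<le> t \<Longrightarrow> S t = S T"
    and submartingale_mono: "0 \<le> s \<Longrightarrow> s \<le> t \<Longrightarrow> B \<in> sets (F s) \<Longrightarrow>
      (\<integral>w. indicator B w * S s w \<partial>M) \<le> (\<integral>w. indicator B w * S t w \<partial>M)"
proof -
  note * = S[unfolded right_continuous_submartingale_def]
  show "0 \<le> T" by (rule *[THEN conjunct1])
  show "0 \<le> t \<Longrightarrow> S t \<in> borel_measurable (F t)" "0 \<le> t \<Longrightarrow> integrable M (S t)"
    using *[THEN conjunct2, THEN conjunct1] by simp_all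
  show "0 \<le> S t w" by (rule *[THEN conjunct2, THEN conjunct2, THEN conjunct1, rule_format])
  show "0 \<le> s \<Longrightarrow> s \<le> t \<Longrightarrow> B \<in> sets (F s) \<Longrightarrow>
      (\<integral>w. indicator B w * S s w \<partial>M) \<le> (\<integral>w. indicator B w * S t w \<partial>M)"
    by (rule *[THEN conjunct2, THEN conjunct2, THEN conjunct2, THEN conjunct1, rule_format])
  show "0 \<le> s \<Longrightarrow> 0 < e \<Longrightarrow> \<exists>t>s. (\<integral>w. S t w \<partial>M) < (\<integral>w. S s w \<partial>M) + e"
    by (rule *[THEN conjunct2, THEN conjunct2, THEN conjunct2, THEN conjunct2, THEN conjunct1, rule_format])
  show "T \<le> t \<Longrightarrow> S t = S T"
    by (rule *[THEN conjunct2, THEN conjunct2, THEN conjunct2, THEN conjunct2, THEN conjunct2, rule_format])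
qed

lemma submartingale_indicator_integrable:
  assumes "B \<in> sets (F s)" "0 \<le> t"
  shows "integrable M (\<lambda>w. indicator B w * S t w)"
  by (rule integrable_bounded_mult[OF submartingale_integrable[OF assms(2)] indicator_F(1)[OF assms(1)] indicator_F(2)])

lemma submartingale_increment_nonneg:
  assumes "0 \<le> s" "s \<le> t" "B \<in> sets (F s)"
  shows "0 \<le> (\<integral>w. indicator B w * (S t w - S s w) \<partial>M)"
proof -
  have "(\<integral>w. indicator B w * (S t w - S s w) \<partial>M) =
     (\<integral>w. indicator B w * S t w \<partial>M) - (\<integral>w. indicator B w * S s w \<partial>M)"
    unfolding right_diff_distrib
    using assms(1,2) by (intro Bochner_Integration.integral_diff submartingale_indicator_integrable[OF assms(3)]) simp_all
  then show ?thesis using submartingale_mono[OF assms] by simp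
qed

lemma submartingale_increment_integrable:
  assumes "g \<in> borel_measurable M" "\<And>w. w \<in> space M \<Longrightarrow> \<bar>g w\<bar> \<le> C" "0 \<le> s" "0 \<le> t"
  shows "integrable M (\<lambda>w. g w * (S t w - S s w))"
  by (rule integrable_bounded_mult[OF _ assms(1,2)])
    (intro Bochner_Integration.integrable_diff submartingale_integrable assms)

lemma submartingale_increment_mono:
  assumes "0 \<le> s" "s \<le> t" "A \<in> sets (F s)" "B \<in> sets (F s)" "A \<subseteq> B"
  shows "(\<integral>w. indicator A w * (S t w - S s w) \<partial>M) \<le> (\<integral>w. indicator B w * (S t w - S s w) \<partial>M)"
proof -
  have i: "integrable M (\<lambda>w. indicator D w * (S t w - S s w))" if "D \<in> sets (F s)" for D
    using assms(1,2) by (intro submartingale_increment_integrable[OF indicator_F(1)[OF that] indicator_F(2)]) simp_all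
  have "0 \<le> (\<integral>w. indicator (B - A) w * (S t w - S s w) \<partial>M)"
    using assms by (intro submartingale_increment_nonneg) auto
  also have "\<dots> = (\<integral>w. indicator B w * (S t w - S s w) - indicator A w * (S t w - S s w) \<partial>M)"
    using assms by (intro Bochner_Integration.integral_cong) (auto simp: indicator_def)
  also have "\<dots> = (\<integral>w. indicator B w * (S t w - S s w) \<partial>M) - (\<integral>w. indicator A w * (S t w - S s w) \<partial>M)"
    using assms by (intro Bochner_Integration.integral_diff i)
  finally show ?thesis by simp
qed

definition doleans_value :: "real set \<Rightarrow> (real \<Rightarrow> 'a \<Rightarrow> real) \<Rightarrow> real" where
  "doleans_value Q h = (\<integral>w. path_sum Q h S T w \<partial>M)"

lemma
  assumes h: "elementary_predictable Q h"
  shows doleans_integrable: "integrable M (\<lambda>w. path_sum Q h S T w)"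
    and doleans_value_eq: "doleans_value Q h = (\<Sum>q\<in>Q \<inter> {0<..T}. \<integral>w. h q w * (S q w - S (prev Q q) w) \<partial>M)"
proof -
  note Q = elementary_predictableD(1)[OF h]
  obtain C where C: "\<And>s w. 0 \<le> s \<Longrightarrow> w \<in> space M \<Longrightarrow> \<bar>h s w\<bar> \<le> C"
    using h unfolding elementary_predictable_def by auto
  have "integrable M (\<lambda>w. h q w * (S q w - S (prev Q q) w))" if "q \<in> Q \<inter> {0<..T}" for q
    using that C prev_nonneg[OF Q, of q]
    by (intro submartingale_increment_integrable[of _ C] elementary_predictableD(5)[OF h]) auto
  then show "integrable M (\<lambda>w. path_sum Q h S T w)"
    "doleans_value Q h = (\<Sum>q\<in>Q \<inter> {0<..T}. \<integral>w. h q w * (S q w - S (prev Q q) w) \<partial>M)"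
    unfolding riemann_sum_def doleans_value_def by (auto intro!: Bochner_Integration.integral_sum)
qed

text \<open>Both grids are compared with their union; \<open>T\<close> must belong to both for the
  sums to end at the same time.\<close>

lemma doleans_value_refine:
  assumes "elementary_predictable Q h" "elementary_predictable Q' h" "T \<in> Q" "T \<in> Q'"
  shows "doleans_value Q h = doleans_value Q' h"
proof -
  note Q = elementary_predictableD(1)[OF assms(1)] and Q' = elementary_predictableD(1)[OF assms(2)]
  have QQ: "time_grid (Q \<union> Q')" using Q Q' by (auto simp: time_grid_def)
  show ?thesis unfolding doleans_value_def
  proof (rule Bochner_Integration.integral_cong)
    fix w assume "w \<in> space M"
    then have st: "step_on Q (\<lambda>s. h s w)" "step_on Q' (\<lambda>s. h s w)"
      using elementary_predictableD(2) assms by auto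
    show "path_sum Q h S T w = path_sum Q' h S T w"
      using riemann_sum_refine[OF Q QQ _ st(1) assms(3)] riemann_sum_refine[OF Q' QQ _ st(2) assms(4)]
      by simp
  qed simp
qed

text \<open>A substitute for optional stopping at the first entry into the sets \<open>C q\<close>.
  Enlarging each \<open>C q\<close> by the earlier ones only increases the left side; the increments
  from the first entry on then telescope to at most \<open>S t\<close>, because \<open>S\<close> is
  nonnegative.\<close>

lemma submartingale_maximal:
  assumes Q: "time_grid Q" and t: "t \<in> Q"
    and C: "\<And>q. q \<in> Q \<Longrightarrow> 0 < q \<Longrightarrow> C q \<in> sets (F (prev Q q))"
  shows "(\<Sum>q\<in>Q \<inter> {0<..t}. \<integral>w. indicator (C q) w * (S q w - S (prev Q q) w) \<partial>M)
    \<le> (\<integral>w. indicator (\<Union>q\<in>Q \<inter> {0<..t}. C q) w * S t w \<partial>M)"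
  using Q t
proof (induction t rule: time_grid_induct)
  case (step t)
  define p where "p = prev Q t"
  have p: "p \<in> Q" "p < t" "0 \<le> p"
    using prev_in[OF Q step(2)] prev_less[OF Q step(2)] prev_nonneg[OF Q step(2)] by (auto simp: p_def)
  define A where "A = (\<Union>q\<in>Q \<inter> {0<..p}. C q)"
  have A: "A \<in> sets (F p)" unfolding A_def
  proof (rule sets.finite_UN)
    fix q assume q: "q \<in> Q \<inter> {0<..p}"
    then have "prev Q q < q" by (intro prev_less[OF Q]) auto
    then show "C q \<in> sets (F p)" using C[of q] q sets_F_mono[of "prev Q q" p] by auto
  qed (use time_gridD[OF Q] in auto)
  have B: "C t \<in> sets (F p)" using C[OF step(1,2)] by (simp add: p_def)
  have U: "(\<Union>q\<in>Q \<inter> {0<..t}. C q) = A \<union> C t"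
    unfolding time_grid_Ioc_step(1)[OF Q step(1,2,2) time_gridD(2)[OF Q]] by (auto simp: A_def p_def)
  have "(\<Sum>q\<in>Q \<inter> {0<..t}. \<integral>w. indicator (C q) w * (S q w - S (prev Q q) w) \<partial>M)
    = (\<integral>w. indicator (C t) w * (S t w - S p w) \<partial>M) +
      (\<Sum>q\<in>Q \<inter> {0<..p}. \<integral>w. indicator (C q) w * (S q w - S (prev Q q) w) \<partial>M)"
    using time_grid_Ioc_step[OF Q step(1,2,2) time_gridD(2)[OF Q]] time_gridD(1)[OF Q] by (simp add: p_def)
  also have "\<dots> \<le> (\<integral>w. indicator (A \<union> C t) w * (S t w - S p w) \<partial>M) + (\<integral>w. indicator A w * S p w \<partial>M)"
    using step(3) A B p by (intro add_mono submartingale_increment_mono) (auto simp: A_def p_def)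
  also have "\<dots> = (\<integral>w. indicator (A \<union> C t) w * (S t w - S p w) + indicator A w * S p w \<partial>M)"
  proof (rule Bochner_Integration.integral_add[symmetric])
    show "integrable M (\<lambda>w. indicator (A \<union> C t) w * (S t w - S p w))"
      using p by (intro submartingale_increment_integrable[OF indicator_F(1)[OF sets.Un[OF A B]] indicator_F(2)]) simp_all
    show "integrable M (\<lambda>w. indicator A w * S p w)"
      using A p by (intro submartingale_indicator_integrable)
  qed
  also have "\<dots> \<le> (\<integral>w. indicator (A \<union> C t) w * S t w \<partial>M)"
  proof (rule integral_mono)
    show "integrable M (\<lambda>w. indicator (A \<union> C t) w * (S t w - S p w) + indicator A w * S p w)"
      using p by (intro Bochner_Integration.integrable_add submartingale_indicator_integrable[OF A]
          submartingale_increment_integrable[OF indicator_F(1)[OF sets.Un[OF A B]] indicator_F(2)]) simp_all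
    show "integrable M (\<lambda>w. indicator (A \<union> C t) w * S t w)"
      using p by (intro submartingale_indicator_integrable[OF sets.Un[OF A B]]) simp
    show "indicator (A \<union> C t) w * (S t w - S p w) + indicator A w * S p w \<le> indicator (A \<union> C t) w * S t w" for w
      using submartingale_nonneg[of p w] by (auto simp: indicator_def)
  qed
  finally show ?case unfolding U .
qed simp

section \<open>The Doleans content on the ring of elementary sets and its extension to a
  measure\<close>

definition elementary_set :: "real set \<Rightarrow> (real \<times> 'a) set \<Rightarrow> bool" where
  "elementary_set Q G \<longleftrightarrow> G \<subseteq> {0..} \<times> space M \<and> T \<in> Q \<and> elementary_predictable Q (\<lambda>s w. indicator G (s, w))"

lemma elementary_set_mono:
  "elementary_set Q G \<Longrightarrow> Q \<subseteq> Q' \<Longrightarrow> time_grid Q' \<Longrightarrow> elementary_set Q' G"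
  by (auto simp: elementary_set_def intro: elementary_predictable_mono)

lemma elementary_set_common:
  assumes "elementary_set Q G" "elementary_set Q' G'"
  shows "elementary_set (Q \<union> Q') G" "elementary_set (Q \<union> Q') G'"
proof -
  have "time_grid (Q \<union> Q')"
    using assms by (auto simp: elementary_set_def time_grid_def dest!: elementary_predictableD(1))
  then show "elementary_set (Q \<union> Q') G" "elementary_set (Q \<union> Q') G'"
    using elementary_set_mono[OF assms(1)] elementary_set_mono[OF assms(2)] by auto
qed

lemma elementary_set_Un:
  assumes "elementary_set Q G" "elementary_set Q G'"
  shows "elementary_set Q (G \<union> G')"
proof -
  have "indicator (G \<union> G') x = max (indicator G x) (indicator G' x :: real)" for x by (auto simp: indicator_def)
  then show ?thesis using assms by (auto simp: elementary_set_def intro!: elementary_predictable_max)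
qed

lemma elementary_set_Diff:
  assumes "elementary_set Q G" "elementary_set Q G'"
  shows "elementary_set Q (G - G')"
proof -
  have *: "indicator (G - G') x = indicator G x - indicator G x * (indicator G' x :: real)" for x
    by (auto simp: indicator_def)
  show ?thesis using assms unfolding elementary_set_def *
    by (auto intro!: elementary_predictable_diff elementary_predictable_mult)
qed

definition elementary_sets :: "(real \<times> 'a) set set" where
  "elementary_sets = {G. \<exists>Q. elementary_set Q G}"

text \<open>The choice of the grid is immaterial by \<open>doleans_value_refine\<close>.\<close>

definition doleans_content :: "(real \<times> 'a) set \<Rightarrow> real" where
  "doleans_content G = doleans_value (SOME Q. elementary_set Q G) (\<lambda>s w. indicator G (s, w))"

lemma doleans_content_eq:
  assumes "elementary_set Q G"
  shows "doleans_content G = doleans_value Q (\<lambda>s w. indicator G (s, w))"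
proof -
  have "elementary_set (SOME Q. elementary_set Q G) G" using assms by (rule someI)
  then show ?thesis
    using assms unfolding doleans_content_def elementary_set_def by (intro doleans_value_refine) auto
qed

lemma elementary_set_section:
  assumes "elementary_set Q G" "0 < q"
  shows "{w \<in> space M. (q, w) \<in> G} \<in> sets (F (prev Q q))"
proof -
  have [measurable]: "(\<lambda>w. indicator G (q, w) :: real) \<in> borel_measurable (F (prev Q q))"
    using assms by (auto simp: elementary_set_def intro: elementary_predictableD(4))
  have "{w \<in> space (F (prev Q q)). indicator G (q, w) = (1::real)} \<in> sets (F (prev Q q))" by measurable
  then show ?thesis by (simp add: space_F indicator_eq_1_iff)
qed

lemma doleans_content_sum:
  assumes G: "elementary_set Q G"
  shows "doleans_content G =
    (\<Sum>q\<in>Q \<inter> {0<..T}. \<integral>w. indicator {w \<in> space M. (q, w) \<in> G} w * (S q w - S (prev Q q) w) \<partial>M)"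
proof -
  have h: "elementary_predictable Q (\<lambda>s w. indicator G (s, w))" using G by (simp add: elementary_set_def)
  show ?thesis unfolding doleans_content_eq[OF G] doleans_value_eq[OF h]
    by (intro sum.cong Bochner_Integration.integral_cong) (auto simp: indicator_def)
qed

lemma doleans_content_nonneg: "G \<in> elementary_sets \<Longrightarrow> 0 \<le> doleans_content G"
  unfolding elementary_sets_def
proof clarify
  fix Q assume G: "elementary_set Q G"
  then have Q: "time_grid Q" using elementary_predictableD(1) by (auto simp: elementary_set_def)
  show "0 \<le> doleans_content G" unfolding doleans_content_sum[OF G]
    using prev_nonneg[OF Q] prev_less[OF Q]
    by (intro sum_nonneg submartingale_increment_nonneg elementary_set_section[OF G]) (auto intro: less_imp_le)
qed

lemma doleans_content_add:
  assumes "G \<in> elementary_sets" "G' \<in> elementary_sets" "G \<inter> G' = {}"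
  shows "doleans_content (G \<union> G') = doleans_content G + doleans_content G'"
proof -
  obtain Q Q' where "elementary_set Q G" "elementary_set Q' G'" using assms by (auto simp: elementary_sets_def)
  note G = elementary_set_common[OF this] and GG = elementary_set_Un[OF elementary_set_common[OF this]]
  have i: "(\<lambda>s w. indicator (G \<union> G') (s, w) :: real) = (\<lambda>s w. indicator G (s, w) + indicator G' (s, w))"
    using assms(3) by (auto simp: indicator_def fun_eq_iff)
  have h: "elementary_predictable (Q \<union> Q') (\<lambda>s w. indicator G (s, w))"
    "elementary_predictable (Q \<union> Q') (\<lambda>s w. indicator G' (s, w))"
    using G by (auto simp: elementary_set_def)
  show ?thesis
    unfolding doleans_content_eq[OF GG] doleans_content_eq[OF G(1)] doleans_content_eq[OF G(2)] i
    unfolding doleans_value_def riemann_sum_add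
    by (rule Bochner_Integration.integral_add[OF doleans_integrable[OF h(1)] doleans_integrable[OF h(2)]])
qed

lemma elementary_sets_ring: "ring_of_sets ({0..} \<times> space M) elementary_sets"
proof (rule ring_of_setsI)
  show "elementary_sets \<subseteq> Pow ({0..} \<times> space M)" by (auto simp: elementary_sets_def elementary_set_def)
  have "elementary_set {0, T} {}"
    using submartingale_T
    by (auto simp: elementary_set_def time_grid_def intro!: elementary_predictable_const)
  then show "{} \<in> elementary_sets" by (auto simp: elementary_sets_def)
  fix a b assume "a \<in> elementary_sets" "b \<in> elementary_sets"
  then obtain Q Q' where "elementary_set Q a" "elementary_set Q' b" by (auto simp: elementary_sets_def)
  note * = elementary_set_common[OF this]
  show "a \<union> b \<in> elementary_sets" "a - b \<in> elementary_sets"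
    using elementary_set_Un[OF *] elementary_set_Diff[OF *] by (auto simp: elementary_sets_def)
qed

lemma cell_unique:
  assumes Q: "time_grid Q" and "q \<in> Q" "q' \<in> Q" "0 < q" "0 < q'" "prev Q q < s" "s \<le> q" "prev Q q' < s" "s \<le> q'"
  shows "q = q'"
  using prev_ge[OF Q \<open>0 < q\<close> \<open>q' \<in> Q\<close>] prev_ge[OF Q \<open>0 < q'\<close> \<open>q \<in> Q\<close>] assms by linarith

lemma elementary_set_section_eq:
  assumes G: "elementary_set Q G" and q: "q \<in> Q" "0 < q" and s: "prev Q q < s" "s \<le> q"
  shows "(s, w) \<in> G \<longleftrightarrow> (q, w) \<in> G"
proof (cases "w \<in> space M")
  case True
  have h: "elementary_predictable Q (\<lambda>s w. indicator G (s, w))" using G by (simp add: elementary_set_def)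
  have "indicator G (s, w) = (indicator G (q, w) :: real)"
    by (rule step_on_cell[OF elementary_predictableD(2)[OF h True] elementary_predictableD(1)[OF h] q(2) s])
  then show ?thesis by (auto simp: indicator_def split: if_splits)
qed (use G in \<open>auto simp: elementary_set_def\<close>)

text \<open>Cells are shortened from the left. The closure of a shortened cell lies in the original
  left-open cell, and right-continuity of the mean makes the loss small.\<close>

lemma elementary_set_shrink:
  assumes G: "elementary_set Q G" and e: "0 < e"
  obtains Q' G' where "elementary_set Q' G'" "G' \<subseteq> G" "G' \<subseteq> {0<..T} \<times> space M"
    "doleans_content G \<le> doleans_content G' + e"
    "\<And>w. closure {s. (s, w) \<in> G'} \<subseteq> {s. (s, w) \<in> G}"
proof -
  have h: "elementary_predictable Q (\<lambda>s w. indicator G (s, w))" and TQ: "T \<in> Q"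
    using G by (auto simp: elementary_set_def)
  note Q = elementary_predictableD(1)[OF h]
  define I where "I = Q \<inter> {0<..T}"
  have finI: "finite I" using time_gridD[OF Q] by (simp add: I_def)
  \<comment> \<open>Each of the \<open>card I\<close> cells may lose \<open>\<delta>\<close>; the
    added 1 covers the case of no cells.\<close>
  define \<delta> where "\<delta> = e / (real (card I) + 1)"
  have \<delta>: "0 < \<delta>" "real (card I) * \<delta> \<le> e" using e by (auto simp: \<delta>_def field_simps)
  \<comment> \<open>A time \<open>t\<close> at which the mean has hardly grown may lie beyond
    \<open>q\<close>; cutting it at \<open>q\<close> only lowers the mean.\<close>
  have "\<exists>r. prev Q q < r \<and> r \<le> q \<and> (\<integral>w. S r w \<partial>M) \<le> (\<integral>w. S (prev Q q) w \<partial>M) + \<delta>" if "q \<in> I" for q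
  proof -
    have q: "0 < q" using that by (simp add: I_def)
    obtain t where t: "prev Q q < t" "(\<integral>w. S t w \<partial>M) < (\<integral>w. S (prev Q q) w \<partial>M) + \<delta>"
      using submartingale_right_continuous[OF prev_nonneg[OF Q q] \<delta>(1)] by blast
    have 0: "0 \<le> min t q" using t(1) q prev_nonneg[OF Q q] by simp
    have "(\<integral>w. S (min t q) w \<partial>M) = (\<integral>w. indicator (space M) w * S (min t q) w \<partial>M)"
      by (intro Bochner_Integration.integral_cong) auto
    also have "\<dots> \<le> (\<integral>w. indicator (space M) w * S t w \<partial>M)"
      using submartingale_mono[OF 0, of t "space M"] sets.top[of "F (min t q)"] by (simp add: space_F)
    also have "\<dots> = (\<integral>w. S t w \<partial>M)" by (intro Bochner_Integration.integral_cong) auto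
    finally show ?thesis using t prev_less[OF Q q] by (intro exI[of _ "min t q"]) auto
  qed
  then obtain r where r: "\<And>q. q \<in> I \<Longrightarrow> prev Q q < r q" "\<And>q. q \<in> I \<Longrightarrow> r q \<le> q"
    "\<And>q. q \<in> I \<Longrightarrow> (\<integral>w. S (r q) w \<partial>M) \<le> (\<integral>w. S (prev Q q) w \<partial>M) + \<delta>"
    by metis
  have I: "0 < q" "q \<in> Q" "0 \<le> prev Q q" "0 < r q" "prev Q q < q" "q \<le> T" if "q \<in> I" for q
    using that prev_nonneg[OF Q, of q] prev_less[OF Q, of q] r(1)[OF that] by (auto simp: I_def)
  define C where "C q = {w \<in> space M. (q, w) \<in> G}" for q
  have C: "C q \<in> sets (F (prev Q q))" if "q \<in> I" for q
    unfolding C_def by (rule elementary_set_section[OF G I(1)[OF that]])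
  define G' where "G' = {(s, w). \<exists>q\<in>I. r q < s \<and> s \<le> q \<and> w \<in> C q}"
  define Q' where "Q' = Q \<union> r ` I"
  have "0 \<le> r q" if "q \<in> I" for q using I(4)[OF that] by simp
  then have Q': "time_grid Q'" "Q \<subseteq> Q'" unfolding Q'_def
    by (intro time_grid_Un[OF Q] finite_imageI finI image_subsetI; simp) simp
  have ind: "(\<lambda>s w. indicator G' (s, w) :: real) = (\<lambda>s w. \<Sum>q\<in>I. indicator (C q) w * indicator {r q<..q} s)"
  proof (intro ext)
    fix s w
    show "(indicator G' (s, w) :: real) = (\<Sum>q\<in>I. indicator (C q) w * indicator {r q<..q} s)"
    proof (cases "(s, w) \<in> G'")
      case True
      then obtain q where q: "q \<in> I" "r q < s" "s \<le> q" "w \<in> C q" by (auto simp: G'_def)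
      have "(\<Sum>q\<in>I. indicator (C q) w * indicator {r q<..q} s) = (\<Sum>q'\<in>I. if q' = q then 1 else (0::real))"
      proof (rule sum.cong)
        fix q' assume q': "q' \<in> I"
        show "indicator (C q') w * indicator {r q'<..q'} s = (if q' = q then 1 else (0::real))"
        proof (cases "q' = q")
          case False
          then have "s \<notin> {r q'<..q'}"
            using cell_unique[OF Q I(2)[OF q(1)] I(2)[OF q'] I(1)[OF q(1)] I(1)[OF q'], of s] q r(1)[OF q'] r(1)[OF q(1)]
            by auto
          then show ?thesis using False by simp
        qed (use q in simp)
      qed simp
      also have "\<dots> = 1" using q finI by simp
      finally show ?thesis using True by simp
    next
      case False
      then have "(\<Sum>q\<in>I. indicator (C q) w * indicator {r q<..q} s) = (0::real)"
        by (intro sum.neutral) (auto simp: G'_def indicator_def)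
      then show ?thesis using False by simp
    qed
  qed
  have h': "elementary_predictable Q' (\<lambda>s w. indicator G' (s, w))"
    unfolding ind
  proof (intro elementary_predictable_sum finI Q' elementary_predictable_Ioc)
    fix q assume q: "q \<in> I"
    show "(indicator (C q) :: 'a \<Rightarrow> real) \<in> borel_measurable (F (r q))"
      using C[OF q] r(1)[OF q] sets_F_mono[of "prev Q q" "r q"]
      by (intro borel_measurable_indicator) (simp add: subset_iff)
    show "0 \<le> r q" "r q \<in> Q'" "q \<in> Q'" using I[OF q] q by (auto simp: Q'_def)
    show "\<forall>w\<in>space M. \<bar>indicator (C q) w :: real\<bar> \<le> 1" by (simp add: indicator_F(2))
  qed
  have G': "elementary_set Q' G'"
    unfolding elementary_set_def using h' TQ Q' by (auto simp: G'_def C_def dest: I)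
  have iC: "integrable M (\<lambda>w. indicator (C q) w * (S t w - S s w))" if "q \<in> I" "0 \<le> s" "0 \<le> t" for q s t
    using that by (intro submartingale_increment_integrable[OF indicator_F(1)[OF C] indicator_F(2)]) auto
  have "doleans_content G' = (\<integral>w. (\<Sum>q\<in>I. indicator (C q) w * (S q w - S (r q) w)) \<partial>M)"
    unfolding doleans_content_eq[OF G'] doleans_value_def
  proof (rule Bochner_Integration.integral_cong)
    fix w
    show "riemann_sum Q' (\<lambda>s. indicator G' (s, w)) (\<lambda>u. S u w) T = (\<Sum>q\<in>I. indicator (C q) w * (S q w - S (r q) w))"
      unfolding ind[THEN fun_cong, THEN fun_cong] riemann_sum_sum riemann_sum_cmult
    proof (rule sum.cong)
      fix q assume q: "q \<in> I"
      have "riemann_sum Q' (indicator {r q<..q}) (\<lambda>u. S u w) T = S (min q T) w - S (min (r q) T) w"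
        using q r(2)[OF q] I[OF q] TQ Q' by (intro riemann_sum_Ioc) (auto simp: Q'_def)
      then show "indicator (C q) w * riemann_sum Q' (indicator {r q<..q}) (\<lambda>u. S u w) T
        = indicator (C q) w * (S q w - S (r q) w)"
        using I(6)[OF q] r(2)[OF q] by (simp add: min_def)
    qed simp
  qed simp
  also have "\<dots> = (\<Sum>q\<in>I. \<integral>w. indicator (C q) w * (S q w - S (r q) w) \<partial>M)"
    using I by (intro Bochner_Integration.integral_sum iC) (auto intro: less_imp_le)
  finally have G'_eq: "doleans_content G' = (\<Sum>q\<in>I. \<integral>w. indicator (C q) w * (S q w - S (r q) w) \<partial>M)" .
  have "doleans_content G - doleans_content G' =
    (\<Sum>q\<in>I. (\<integral>w. indicator (C q) w * (S q w - S (prev Q q) w) \<partial>M)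
      - (\<integral>w. indicator (C q) w * (S q w - S (r q) w) \<partial>M))"
    unfolding G'_eq doleans_content_sum[OF G] I_def[symmetric] C_def[symmetric] by (simp add: sum_subtractf)
  also have "\<dots> \<le> (\<Sum>q\<in>I. \<delta>)"
  proof (rule sum_mono)
    fix q assume q: "q \<in> I"
    have "(\<integral>w. indicator (C q) w * (S q w - S (prev Q q) w) \<partial>M)
      - (\<integral>w. indicator (C q) w * (S q w - S (r q) w) \<partial>M) =
      (\<integral>w. indicator (C q) w * (S q w - S (prev Q q) w) - indicator (C q) w * (S q w - S (r q) w) \<partial>M)"
      using I[OF q] by (intro Bochner_Integration.integral_diff[symmetric] iC q) auto
    also have "\<dots> = (\<integral>w. indicator (C q) w * (S (r q) w - S (prev Q q) w) \<partial>M)"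
      by (intro Bochner_Integration.integral_cong) (auto simp: algebra_simps)
    \<comment> \<open>Passing to the whole space makes the loss on a cell independent of
      \<open>G\<close>: increments of \<open>S\<close> have nonnegative mean on the complement of
      \<open>C q\<close> too.\<close>
    also have "\<dots> \<le> (\<integral>w. indicator (space M) w * (S (r q) w - S (prev Q q) w) \<partial>M)"
      using I[OF q] r(1)[OF q] C[OF q] sets.top[of "F (prev Q q)"]
      by (intro submartingale_increment_mono) (auto simp: space_F C_def)
    also have "\<dots> = (\<integral>w. S (r q) w - S (prev Q q) w \<partial>M)"
      by (intro Bochner_Integration.integral_cong) auto
    also have "\<dots> = (\<integral>w. S (r q) w \<partial>M) - (\<integral>w. S (prev Q q) w \<partial>M)"
      using I[OF q] by (intro Bochner_Integration.integral_diff submartingale_integrable) auto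
    also have "\<dots> \<le> \<delta>" using r(3)[OF q] by simp
    finally show "(\<integral>w. indicator (C q) w * (S q w - S (prev Q q) w) \<partial>M)
      - (\<integral>w. indicator (C q) w * (S q w - S (r q) w) \<partial>M) \<le> \<delta>" .
  qed
  also have "\<dots> \<le> e" using \<delta> by simp
  finally have le: "doleans_content G \<le> doleans_content G' + e" by simp
  have cell: "(s, w) \<in> G" if "q \<in> I" "r q \<le> s" "s \<le> q" "w \<in> C q" for q s w
    using elementary_set_section_eq[OF G I(2,1)[OF that(1)], of s w] r(1)[OF that(1)] that by (auto simp: C_def)
  show ?thesis
  proof (rule that[OF G' _ _ le])
    show "G' \<subseteq> G" unfolding G'_def using cell by (auto intro: less_imp_le)
    show "G' \<subseteq> {0<..T} \<times> space M"
    proof (rule subsetI)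
      fix x assume "x \<in> G'"
      then obtain q where "q \<in> I" "r q < fst x" "fst x \<le> q" "snd x \<in> C q" by (auto simp: G'_def)
      then show "x \<in> {0<..T} \<times> space M" using I(4,6)[of q] by (cases x) (auto simp: C_def)
    qed
    fix w
    have "closure {s. (s, w) \<in> G'} \<subseteq> (\<Union>q\<in>{q\<in>I. w \<in> C q}. {r q..q})"
    proof (rule closure_minimal)
      show "{s. (s, w) \<in> G'} \<subseteq> (\<Union>q\<in>{q\<in>I. w \<in> C q}. {r q..q})" by (auto simp: G'_def)
      show "closed (\<Union>q\<in>{q\<in>I. w \<in> C q}. {r q..q})" using finI by (intro closed_UN) simp_all
    qed
    also have "\<dots> \<subseteq> {s. (s, w) \<in> G}" using cell by auto
    finally show "closure {s. (s, w) \<in> G'} \<subseteq> {s. (s, w) \<in> G}" .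
  qed
qed

text \<open>\<open>\<Gamma>\<close> collects the paths that meet \<open>G\<close> at a grid time in
  \<open>(0, T]\<close>. By the maximal estimate the content is at most the mean of
  \<open>S T\<close> on these paths.\<close>

lemma doleans_content_le_sections:
  assumes G: "elementary_set Q G"
  obtains \<Gamma> where "\<Gamma> \<in> sets M" "\<And>w. w \<in> \<Gamma> \<Longrightarrow> \<exists>s. (s, w) \<in> G"
    "doleans_content G \<le> (\<integral>w. indicator \<Gamma> w * S T w \<partial>M)"
proof
  have Q: "time_grid Q" and T: "T \<in> Q"
    using G elementary_predictableD(1) by (auto simp: elementary_set_def)
  let ?\<Gamma> = "\<Union>q\<in>Q \<inter> {0<..T}. {w \<in> space M. (q, w) \<in> G}"
  have "{w \<in> space M. (q, w) \<in> G} \<in> sets M" if "q \<in> Q \<inter> {0<..T}" for q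
    by (rule sets_F_M[OF elementary_set_section[OF G]]) (use that in simp)
  then show "?\<Gamma> \<in> sets M" using time_gridD[OF Q] by (intro sets.finite_UN) auto
  show "doleans_content G \<le> (\<integral>w. indicator ?\<Gamma> w * S T w \<partial>M)"
    unfolding doleans_content_sum[OF G]
    by (rule submartingale_maximal[OF Q T elementary_set_section[OF G]])
qed auto

lemma doleans_content_Diff:
  assumes "G \<in> elementary_sets" "G' \<in> elementary_sets" "G' \<subseteq> G"
  shows "doleans_content (G - G') = doleans_content G - doleans_content G'"
proof -
  interpret R: ring_of_sets "{0..} \<times> space M" elementary_sets by (rule elementary_sets_ring)
  have "doleans_content (G' \<union> (G - G')) = doleans_content G' + doleans_content (G - G')"
    using assms by (intro doleans_content_add) auto
  moreover have "G' \<union> (G - G') = G" using assms by auto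
  ultimately show ?thesis by simp
qed

lemma doleans_content_subadditive:
  assumes G: "G \<in> elementary_sets" "A \<in> elementary_sets" "B \<in> elementary_sets" "G \<subseteq> A \<union> B"
  shows "doleans_content G \<le> doleans_content A + doleans_content B"
proof -
  interpret R: ring_of_sets "{0..} \<times> space M" elementary_sets by (rule elementary_sets_ring)
  have "0 \<le> doleans_content ((A \<union> B) - G)" using G by (intro doleans_content_nonneg) auto
  then have "doleans_content G \<le> doleans_content (A \<union> B)" using G by (subst (asm) doleans_content_Diff) auto
  also have "doleans_content (A \<union> B) = doleans_content (A \<union> (B - A))" by (simp add: Un_Diff_cancel)
  also have "\<dots> = doleans_content A + doleans_content (B - A)" using G by (intro doleans_content_add) auto
  also have "doleans_content (B - A) = doleans_content (B - B \<inter> A)" by (rule arg_cong[of _ _ doleans_content]) blast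
  also have "\<dots> = doleans_content B - doleans_content (B \<inter> A)" using G by (intro doleans_content_Diff) auto
  also have "\<dots> \<le> doleans_content B" using R.Int[OF G(3,2)] by (simp add: doleans_content_nonneg)
  finally show ?thesis by simp
qed

text \<open>The usual compactness argument, run along paths: sets with closed sections approximate
  from inside, a decreasing sequence of compact sections with empty intersection is eventually
  empty, and the maximal estimate turns this into convergence of the contents.\<close>

lemma doleans_content_empty_continuous:
  assumes A: "range A \<subseteq> elementary_sets" "decseq A" "(\<Inter>i. A i) = {}"
  shows "(\<lambda>i. doleans_content (A i)) \<longlonglongrightarrow> 0"
proof (rule LIMSEQ_I)
  interpret R: ring_of_sets "{0..} \<times> space M" elementary_sets by (rule elementary_sets_ring)
  fix e :: real assume e: "0 < e"
  \<comment> \<open>The errors \<open>e / 4 * (1/2) ^ n\<close> add up to at most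
    \<open>e / 2\<close>; the other half is spent on the dominated convergence below.\<close>
  have "\<exists>A'. \<forall>n. A' n \<in> elementary_sets \<and> A' n \<subseteq> A n \<and> A' n \<subseteq> {0<..T} \<times> space M \<and>
    doleans_content (A n) \<le> doleans_content (A' n) + e / 4 * (1/2) ^ n \<and>
    (\<forall>w. closure {s. (s, w) \<in> A' n} \<subseteq> {s. (s, w) \<in> A n})"
  proof (intro choice allI)
    fix n
    obtain Q where Q: "elementary_set Q (A n)" using A(1) by (auto simp: elementary_sets_def)
    have "0 < e / 4 * (1/2) ^ n" using e by simp
    then show "\<exists>G'. G' \<in> elementary_sets \<and> G' \<subseteq> A n \<and> G' \<subseteq> {0<..T} \<times> space M \<and>
      doleans_content (A n) \<le> doleans_content G' + e / 4 * (1/2) ^ n \<and>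
      (\<forall>w. closure {s. (s, w) \<in> G'} \<subseteq> {s. (s, w) \<in> A n})"
      by (rule elementary_set_shrink[OF Q]) (unfold elementary_sets_def, blast)
  qed
  then obtain A' where "\<forall>n. A' n \<in> elementary_sets \<and> A' n \<subseteq> A n \<and> A' n \<subseteq> {0<..T} \<times> space M \<and>
    doleans_content (A n) \<le> doleans_content (A' n) + e / 4 * (1/2) ^ n \<and>
    (\<forall>w. closure {s. (s, w) \<in> A' n} \<subseteq> {s. (s, w) \<in> A n})" ..
  then have A': "\<And>n. A' n \<in> elementary_sets" "\<And>n. A' n \<subseteq> A n" "\<And>n. A' n \<subseteq> {0<..T} \<times> space M"
    "\<And>n. doleans_content (A n) \<le> doleans_content (A' n) + e / 4 * (1/2) ^ n"
    "\<And>n w. closure {s. (s, w) \<in> A' n} \<subseteq> {s. (s, w) \<in> A n}"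
    by simp_all
  \<comment> \<open>The shrunken sets need not decrease, so they are intersected; the losses then
    accumulate over all earlier indices.\<close>
  define G where "G n = (\<Inter>i\<le>n. A' i)" for n
  have G_Suc: "G (Suc n) = G n \<inter> A' (Suc n)" for n by (auto simp: G_def atMost_Suc)
  have G: "G n \<in> elementary_sets" for n
  proof (induction n)
    case 0
    then show ?case using A'(1)[of 0] by (simp add: G_def)
  next
    case (Suc n)
    then show ?case unfolding G_Suc using A'(1) by (intro R.Int)
  qed
  have AE: "A n \<in> elementary_sets" for n using A(1) by auto
  have GA: "G n \<subseteq> A n" for n using A'(2)[of n] by (auto simp: G_def)
  have diff: "doleans_content (A n - G n) \<le> (\<Sum>i\<le>n. e / 4 * (1/2) ^ i)" for n
  proof (induction n)
    case 0
    then show ?case using A'(1,4)[of 0] AE GA[of 0] by (subst doleans_content_Diff) (auto simp: G_def A')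
  next
    case (Suc n)
    have "doleans_content (A (Suc n) - G (Suc n))
      \<le> doleans_content (A n - G n) + doleans_content (A (Suc n) - A' (Suc n))"
    proof (rule doleans_content_subadditive)
      have "A (Suc n) \<subseteq> A n" using A(2) by (simp add: decseq_Suc_iff)
      then show "A (Suc n) - G (Suc n) \<subseteq> A n - G n \<union> (A (Suc n) - A' (Suc n))" by (auto simp: G_Suc)
    qed (use AE G A'(1) in auto)
    also have "doleans_content (A (Suc n) - A' (Suc n)) \<le> e / 4 * (1/2) ^ Suc n"
      using A'(2,4)[of "Suc n"] AE A'(1) by (subst doleans_content_Diff) auto
    finally show ?case using Suc by simp
  qed
  have half: "(\<Sum>i\<le>n. e / 4 * (1/2) ^ i) \<le> e / 2" for n
  proof -
    have "(\<Sum>i\<le>n. (1/2::real) ^ i) \<le> 2" by (subst sum_gp0) simp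
    then have "e / 4 * (\<Sum>i\<le>n. (1/2) ^ i) \<le> e / 4 * 2" using e by (intro mult_left_mono) auto
    then show ?thesis by (simp add: sum_distrib_left)
  qed
  have "\<exists>\<Gamma>. \<Gamma> \<in> sets M \<and> (\<forall>w\<in>\<Gamma>. \<exists>s. (s, w) \<in> G n) \<and> doleans_content (G n) \<le> (\<integral>w. indicator \<Gamma> w * S T w \<partial>M)" for n
  proof -
    obtain Q where Q: "elementary_set Q (G n)" using G[of n] by (auto simp: elementary_sets_def)
    from doleans_content_le_sections[OF Q] show ?thesis by metis
  qed
  then obtain \<Gamma> where \<Gamma>: "\<And>n. \<Gamma> n \<in> sets M" "\<And>n w. w \<in> \<Gamma> n \<Longrightarrow> \<exists>s. (s, w) \<in> G n"
    "\<And>n. doleans_content (G n) \<le> (\<integral>w. indicator (\<Gamma> n) w * S T w \<partial>M)"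
    by metis
  \<comment> \<open>Otherwise the closures of the sections of \<open>G n\<close> would be nonempty
    nested compact sets, and a common point would lie in every \<open>A n\<close>.\<close>
  have ev: "\<exists>N. \<forall>n\<ge>N. w \<notin> \<Gamma> n" for w
  proof (rule ccontr)
    assume "\<nexists>N. \<forall>n\<ge>N. w \<notin> \<Gamma> n"
    then have inf: "\<exists>n\<ge>N. w \<in> \<Gamma> n" for N by blast
    define K where "K n = closure {s. (s, w) \<in> G n}" for n
    have mono: "G n \<subseteq> G m" if "m \<le> n" for m n using that by (auto simp: G_def)
    have "\<Inter> (range K) \<noteq> {}"
    proof (rule compact_nest)
      fix n
      have "{s. (s, w) \<in> G n} \<subseteq> {0..T}" using A'(3)[of n] by (auto simp: G_def)
      then show "compact (K n)" unfolding K_def by (meson bounded_closed_interval bounded_subset compact_closure)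
      obtain m where "n \<le> m" "w \<in> \<Gamma> m" using inf by blast
      then have "{s. (s, w) \<in> G n} \<noteq> {}" using \<Gamma>(2)[of w m] mono[of n m] by auto
      then show "K n \<noteq> {}" by (simp add: K_def)
    next
      fix m n :: nat assume "m \<le> n"
      then show "K n \<subseteq> K m" unfolding K_def using mono by (intro closure_mono) auto
    qed
    then obtain s where s: "\<And>n. s \<in> K n" by auto
    have "(s, w) \<in> A n" for n
    proof -
      have "K n \<subseteq> closure {s. (s, w) \<in> A' n}" unfolding K_def by (intro closure_mono) (auto simp: G_def)
      then show ?thesis using s[of n] A'(5) by blast
    qed
    then show False using A(3) by auto
  qed
  have "(\<lambda>n. \<integral>w. indicator (\<Gamma> n) w * S T w \<partial>M) \<longlonglongrightarrow> (\<integral>w. 0 \<partial>M)"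
  proof (rule integral_dominated_convergence)
    show "integrable M (S T)" by (rule submartingale_integrable[OF submartingale_T])
    show "(\<lambda>w. indicator (\<Gamma> n) w * S T w) \<in> borel_measurable M" for n
      using \<Gamma>(1)[of n] measurable_F_M[OF submartingale_measurable[OF submartingale_T]] by measurable
    show "AE w in M. (\<lambda>n. indicator (\<Gamma> n) w * S T w) \<longlonglongrightarrow> 0"
    proof (rule AE_I2)
      fix w
      obtain N where "\<forall>n\<ge>N. w \<notin> \<Gamma> n" using ev[of w] by blast
      then show "(\<lambda>n. indicator (\<Gamma> n) w * S T w) \<longlonglongrightarrow> 0"
        by (intro tendsto_eventually) (auto simp: eventually_sequentially intro!: exI[of _ N])
    qed
    show "AE w in M. norm (indicator (\<Gamma> n) w * S T w) \<le> S T w" for n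
      using submartingale_nonneg by (intro AE_I2) (auto simp: indicator_def)
  qed simp
  then have "(\<lambda>n. \<integral>w. indicator (\<Gamma> n) w * S T w \<partial>M) \<longlonglongrightarrow> 0" by simp
  from LIMSEQ_D[OF this, of "e / 2"] obtain N where
    N: "\<And>n. n \<ge> N \<Longrightarrow> \<bar>\<integral>w. indicator (\<Gamma> n) w * S T w \<partial>M\<bar> < e / 2"
    using e by auto
  show "\<exists>N. \<forall>n\<ge>N. norm (doleans_content (A n) - 0) < e"
  proof (intro exI allI impI)
    fix n assume "N \<le> n"
    have "doleans_content (A n) = doleans_content (A n - G n) + doleans_content (G n)"
      by (simp add: doleans_content_Diff[OF AE G GA])
    also have "\<dots> < e" using diff[of n] half[of n] N[OF \<open>N \<le> n\<close>] \<Gamma>(3)[of n] by simp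
    finally show "norm (doleans_content (A n) - 0) < e" using doleans_content_nonneg[OF AE] by simp
  qed
qed

lemma elementary_set_Ioc:
  assumes "0 \<le> s" "s \<le> t" "A \<in> sets (F s)"
  shows "elementary_set {0, s, t, T} ({s<..t} \<times> A)"
proof -
  have "elementary_predictable {0, s, t, T} (\<lambda>u w. indicator A w * indicator {s<..t} u)"
    using assms submartingale_T indicator_F(2)
    by (intro elementary_predictable_Ioc[where C = 1]) (auto simp: time_grid_def)
  moreover have "(\<lambda>u w. indicator ({s<..t} \<times> A) (u, w) :: real) = (\<lambda>u w. indicator A w * indicator {s<..t} u)"
    by (auto simp: indicator_def fun_eq_iff)
  moreover have "A \<subseteq> space M" using sets.sets_into_space[OF assms(3)] by (simp add: space_F)
  ultimately show ?thesis using assms by (auto simp: elementary_set_def)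
qed

lemma sets_elementary_sets: "sigma_sets ({0..} \<times> space M) elementary_sets = sets \<P>"
proof (rule antisym)
  show "sigma_sets ({0..} \<times> space M) elementary_sets \<subseteq> sets \<P>"
  proof -
    have "G \<in> sets \<P>" if el: "G \<in> elementary_sets" for G
    proof -
      obtain Q where G: "elementary_set Q G" using el by (auto simp: elementary_sets_def)
      have [measurable]: "(\<lambda>x. indicator G x :: real) \<in> borel_measurable \<P>"
        using elementary_predictable_measurable[of Q "\<lambda>s w. indicator G (s, w)"] G
        by (simp add: elementary_set_def split_def)
      have "{x \<in> space \<P>. indicator G x = (1::real)} \<in> sets \<P>"
        by measurable
      also have "{x \<in> space \<P>. indicator G x = (1::real)} = G"
        using G by (auto simp: elementary_set_def indicator_eq_1_iff)
      finally show ?thesis .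
    qed
    then show ?thesis
      using sets.sigma_sets_subset[of elementary_sets "\<P>"] by auto
  qed
  show "sets \<P> \<subseteq> sigma_sets ({0..} \<times> space M) elementary_sets"
    unfolding sets_predictable_sigma
  proof (rule sigma_sets_mono', safe)
    fix A assume A: "A \<in> sets (F 0)"
    have "A \<subseteq> space M" using sets.sets_into_space[OF A] by (simp add: space_F)
    have "elementary_predictable {0, T} (\<lambda>s w. indicator ({0} \<times> A) (s, w))"
      unfolding elementary_predictable_def
      using A submartingale_T
      by (auto simp: time_grid_def step_on_def indicator_times indicator_le_1 mult_le_one intro!: exI[of _ 1])
    then have "elementary_set {0, T} ({0} \<times> A)" using \<open>A \<subseteq> space M\<close> by (auto simp: elementary_set_def)
    then show "{0} \<times> A \<in> elementary_sets" by (auto simp: elementary_sets_def)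
  next
    fix s t A assume st: "0 \<le> (s::real)" "s \<le> t" and A: "A \<in> sets (F s)"
    then show "{s<..t} \<times> A \<in> elementary_sets"
      using elementary_set_Ioc unfolding elementary_sets_def by blast
  qed
qed

text \<open>Caratheodory's extension theorem. The whole space is itself an elementary set, so the
  measure is finite.\<close>

lemma doleans_measure_aux:
  "\<exists>\<nu>. finite_measure \<nu> \<and> sets \<nu> = sets \<P> \<and>
    (\<forall>s t B. 0 \<le> s \<longrightarrow> s \<le> t \<longrightarrow> B \<in> sets (F s) \<longrightarrow>
      measure \<nu> ({s<..t} \<times> B) = (\<integral>w. indicator B w * (S t w - S s w) \<partial>M))"
proof -
  interpret R: ring_of_sets "{0..} \<times> space M" elementary_sets by (rule elementary_sets_ring)
  have "\<exists>\<mu>::_ \<Rightarrow> ennreal. (\<forall>G\<in>elementary_sets. \<mu> G = ennreal (doleans_content G)) \<and>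
    measure_space ({0..} \<times> space M) (sigma_sets ({0..} \<times> space M) elementary_sets) \<mu>"
  proof (rule R.caratheodory_empty_continuous)
    have "doleans_content {} = 0" using doleans_content_add[of "{}" "{}"] by auto
    then show "positive elementary_sets (\<lambda>G. ennreal (doleans_content G))" by (simp add: positive_def)
    show "additive elementary_sets (\<lambda>G. ennreal (doleans_content G))"
      unfolding additive_def by (simp add: doleans_content_add doleans_content_nonneg ennreal_plus)
    show "(\<lambda>i. ennreal (doleans_content (A i))) \<longlonglongrightarrow> 0"
      if "range A \<subseteq> elementary_sets" "decseq A" "(\<Inter>i. A i) = {}" for A
      using tendsto_ennrealI[OF doleans_content_empty_continuous[OF that]] by simp
  qed simp
  then obtain \<mu> :: "_ \<Rightarrow> ennreal" where \<mu>: "\<And>G. G \<in> elementary_sets \<Longrightarrow> \<mu> G = ennreal (doleans_content G)"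
    "measure_space ({0..} \<times> space M) (sigma_sets ({0..} \<times> space M) elementary_sets) \<mu>"
    by blast
  define \<nu> where "\<nu> = measure_of ({0..} \<times> space M) (sigma_sets ({0..} \<times> space M) elementary_sets) \<mu>"
  have sub: "sigma_sets ({0..} \<times> space M) elementary_sets \<subseteq> Pow ({0..} \<times> space M)"
    using sigma_sets_into_sp[OF R.space_closed] by blast
  have sets: "sets \<nu> = sets \<P>" and space: "space \<nu> = {0..} \<times> space M"
    unfolding \<nu>_def using sub by (simp_all add: sets_measure_of space_measure_of sigma_sets_sigma_sets_eq[OF R.space_closed] sets_elementary_sets[symmetric])
  have em: "emeasure \<nu> G = ennreal (doleans_content G)" if "G \<in> elementary_sets" for G
  proof -
    have "emeasure \<nu> G = \<mu> G"
      unfolding \<nu>_def using \<mu>(2) sub that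
      by (intro emeasure_measure_of_sigma) (auto simp: measure_space_def)
    then show ?thesis using \<mu>(1)[OF that] by simp
  qed
  have \<Omega>: "{0..} \<times> space M \<in> elementary_sets"
  proof -
    have "(indicator (space M) :: 'a \<Rightarrow> real) \<in> borel_measurable (F q)" for q
      using sets.top[of "F q"] by (simp add: space_F borel_measurable_indicator)
    then have "elementary_predictable {0, T} (\<lambda>s w. indicator ({0..} \<times> space M) (s, w))"
      unfolding elementary_predictable_def using submartingale_T
      by (auto simp: time_grid_def step_on_def indicator_times space_F cong: measurable_cong intro!: exI[of _ 1])
    then show ?thesis by (auto simp: elementary_sets_def elementary_set_def)
  qed
  have "finite_measure \<nu>" by (rule finite_measureI) (simp add: space em[OF \<Omega>])
  moreover have "measure \<nu> ({s<..t} \<times> B) = (\<integral>w. indicator B w * (S t w - S s w) \<partial>M)"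
    if "0 \<le> s" "s \<le> t" "B \<in> sets (F s)" for s t B
  proof -
    have G: "elementary_set {0, s, t, T} ({s<..t} \<times> B)" by (rule elementary_set_Ioc[OF that])
    \<comment> \<open>Intervals may reach beyond \<open>T\<close>, but \<open>S\<close> is frozen
      there, so summing up to \<open>T\<close> captures the full increment.\<close>
    have mins: "S (min u T) = S u" for u using submartingale_stopped[of u] by (auto simp: min_def)
    have "doleans_content ({s<..t} \<times> B) = (\<integral>w. indicator B w * (S t w - S s w) \<partial>M)"
      unfolding doleans_content_eq[OF G] doleans_value_def
    proof (rule Bochner_Integration.integral_cong)
      fix w
      have *: "(\<lambda>u. indicator ({s<..t} \<times> B) (u, w) :: real) = (\<lambda>u. indicator B w * indicator {s<..t} u)"
        by (auto simp: indicator_def)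
      show "riemann_sum {0, s, t, T} (\<lambda>u. indicator ({s<..t} \<times> B) (u, w)) (\<lambda>u. S u w) T
        = indicator B w * (S t w - S s w)"
        unfolding * riemann_sum_cmult
        by (subst riemann_sum_Ioc) (use that submartingale_T in \<open>auto simp: time_grid_def mins\<close>)
    qed simp
    moreover have "{s<..t} \<times> B \<in> elementary_sets" using G by (auto simp: elementary_sets_def)
    ultimately show ?thesis
      using em[of "{s<..t} \<times> B"] doleans_content_nonneg[of "{s<..t} \<times> B"]
      unfolding measure_def by (simp add: enn2real_ennreal)
  qed
  ultimately show ?thesis using sets by blast
qed

end

end

subsection \<open>The convex function \<open>sqrt (1 + x\<^sup>2)\<close>\<close>

definition \<phi> :: "real \<Rightarrow> real" where "\<phi> x = sqrt (1 + x\<^sup>2)"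

text \<open>The remainder of \<open>\<phi>\<close> after its tangent at \<open>a\<close>, whose
  slope is \<open>a / \<phi> a\<close>. For a martingale the tangent part has conditional mean zero,
  so this remainder carries the whole growth of the mean of \<open>\<phi>\<close>.\<close>

definition \<phi>_excess :: "real \<Rightarrow> real \<Rightarrow> real" where
  "\<phi>_excess a b = \<phi> b - \<phi> a - a / \<phi> a * (b - a)"

lemma \<phi>_ge_1: "1 \<le> \<phi> x" and \<phi>_pos: "0 < \<phi> x" and abs_le_\<phi>: "\<bar>x\<bar> \<le> \<phi> x" and \<phi>_le: "\<phi> x \<le> 1 + \<bar>x\<bar>"
  and \<phi>_square: "(\<phi> x)\<^sup>2 = 1 + x\<^sup>2" and \<phi>_0: "\<phi> 0 = 1"
proof -
  show 1: "1 \<le> \<phi> x" and "\<bar>x\<bar> \<le> \<phi> x" by (auto simp: \<phi>_def intro!: real_le_rsqrt)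
  then show "0 < \<phi> x" by simp
  show "\<phi> x \<le> 1 + \<bar>x\<bar>" unfolding \<phi>_def by (rule real_le_lsqrt) (auto simp: power2_eq_square algebra_simps)
  show "(\<phi> x)\<^sup>2 = 1 + x\<^sup>2" by (simp add: \<phi>_def add_nonneg_nonneg)
  show "\<phi> 0 = 1" by (simp add: \<phi>_def)
qed

lemma \<phi>_measurable [measurable]: "\<phi> \<in> borel_measurable borel"
  unfolding \<phi>_def by measurable

text \<open>Cauchy-Schwarz for the vectors \<open>(1, a)\<close> and \<open>(1, b)\<close>.\<close>

lemma \<phi>_prod_gt: "\<bar>1 + a * b\<bar> \<le> \<phi> a * \<phi> b"
proof -
  have "(1 + a * b)\<^sup>2 \<le> (1 + a\<^sup>2) * (1 + b\<^sup>2)"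
    using zero_le_power2[of "a - b"] by (simp add: power2_eq_square algebra_simps)
  then have "sqrt ((1 + a * b)\<^sup>2) \<le> sqrt ((1 + a\<^sup>2) * (1 + b\<^sup>2))" by (rule real_sqrt_le_mono)
  then show ?thesis by (simp add: \<phi>_def real_sqrt_mult)
qed

text \<open>Expresses the remainder as the defect in that Cauchy-Schwarz inequality, from which
  sign, upper and lower bounds can be read off.\<close>

lemma \<phi>_excess_eq: "\<phi> a * \<phi>_excess a b = \<phi> a * \<phi> b - (1 + a * b)"
proof -
  have "\<phi> a * \<phi>_excess a b = \<phi> a * \<phi> b - (\<phi> a)\<^sup>2 - a * (b - a)"
    using \<phi>_pos[of a] by (simp add: \<phi>_excess_def field_simps power2_eq_square)
  also have "\<dots> = \<phi> a * \<phi> b - (1 + a * b)"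
    unfolding \<phi>_square by (simp add: algebra_simps power2_eq_square)
  finally show ?thesis .
qed

lemma \<phi>_excess_nonneg: "0 \<le> \<phi>_excess a b"
proof -
  have "0 \<le> \<phi> a * \<phi>_excess a b" unfolding \<phi>_excess_eq using \<phi>_prod_gt[of a b] by (simp add: abs_le_iff)
  then show ?thesis using \<phi>_pos[of a] by (simp add: zero_le_mult_iff)
qed

lemma abs_\<phi>_deriv: "\<bar>a / \<phi> a\<bar> \<le> 1"
  using abs_le_\<phi>[of a] \<phi>_pos[of a] by (simp add: divide_le_eq)

lemma \<phi>_excess_le_square: "\<phi>_excess a b \<le> (b - a)\<^sup>2"
proof -
  have "2 * (\<phi> a * \<phi> b) \<le> (\<phi> a)\<^sup>2 + (\<phi> b)\<^sup>2" using sum_squares_bound[of "\<phi> a" "\<phi> b"] by (simp add: mult.assoc)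
  then have "\<phi> a * \<phi>_excess a b \<le> (b - a)\<^sup>2"
    unfolding \<phi>_excess_eq \<phi>_square using zero_le_power2[of "b - a"] by (simp add: power2_eq_square algebra_simps)
  moreover have "\<phi>_excess a b \<le> \<phi> a * \<phi>_excess a b"
    using \<phi>_ge_1[of a] \<phi>_excess_nonneg[of a b] by (simp add: mult_le_cancel_right1)
  ultimately show ?thesis by simp
qed

lemma abs_\<phi>_deriv_mult: "\<bar>a / \<phi> a * d\<bar> \<le> \<bar>d\<bar>"
proof -
  have "\<bar>a / \<phi> a\<bar> * \<bar>d\<bar> \<le> 1 * \<bar>d\<bar>" by (rule mult_right_mono[OF abs_\<phi>_deriv]) simp
  then show ?thesis by (simp only: abs_mult mult_1)
qed

lemma \<phi>_lipschitz: "\<phi> b \<le> \<phi> a + \<bar>b - a\<bar>"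
proof -
  define u where "u = b / \<phi> b * (a - b)"
  have "\<phi>_excess b a = \<phi> a - \<phi> b - u" unfolding \<phi>_excess_def u_def ..
  moreover have "\<bar>u\<bar> \<le> \<bar>a - b\<bar>" unfolding u_def by (rule abs_\<phi>_deriv_mult)
  ultimately show ?thesis using \<phi>_excess_nonneg[of b a] by linarith
qed

lemma \<phi>_excess_le_abs: "\<phi>_excess a b \<le> 2 * \<bar>b - a\<bar>"
proof -
  have "\<phi>_excess a b = (\<phi> b - \<phi> a) + - (a / \<phi> a * (b - a))" unfolding \<phi>_excess_def by (rule diff_conv_add_uminus)
  also have "\<dots> \<le> \<bar>b - a\<bar> + \<bar>b - a\<bar>"
    using \<phi>_lipschitz[of b a] by (intro add_mono abs_le_D2[OF abs_\<phi>_deriv_mult]) linarith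
  finally show ?thesis by simp
qed

text \<open>The remainder is quadratic for small increments and linear for large ones. The bound on
  \<open>\<phi> a\<close> is essential: far from 0 the function is almost straight.\<close>

lemma \<phi>_excess_lower:
  assumes R: "\<phi> a \<le> R"
  shows "min (d\<^sup>2) \<bar>d\<bar> \<le> 2 * R\<^sup>2 * (R + 1) * \<phi>_excess a (a + d)"
proof -
  let ?b = "a + d" let ?p = "\<phi> a * \<phi> ?b"
  have R1: "1 \<le> R" using R \<phi>_ge_1[of a] by simp
  have b: "\<phi> ?b \<le> R + \<bar>d\<bar>" using \<phi>_lipschitz[of ?b a] R by simp
  \<comment> \<open>Lagrange's identity; factoring the difference of squares isolates the
    defect.\<close>
  have sq: "?p\<^sup>2 - (1 + a * ?b)\<^sup>2 = d\<^sup>2"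
    unfolding power_mult_distrib \<phi>_square by (simp add: power2_eq_square algebra_simps)
  have "d\<^sup>2 = (?p - (1 + a * ?b)) * (?p + (1 + a * ?b))" unfolding sq[symmetric] by (simp add: power2_eq_square algebra_simps)
  also have "\<dots> \<le> (?p - (1 + a * ?b)) * (2 * ?p)"
    using \<phi>_prod_gt[of a ?b] by (intro mult_left_mono) auto
  also have "\<dots> = 2 * \<phi>_excess a ?b * ((\<phi> a)\<^sup>2 * \<phi> ?b)"
    unfolding \<phi>_excess_eq[symmetric] by (simp add: power2_eq_square)
  also have "\<dots> \<le> 2 * \<phi>_excess a ?b * (R\<^sup>2 * (R + \<bar>d\<bar>))"
    using R b \<phi>_excess_nonneg[of a ?b] \<phi>_pos[of a] \<phi>_pos[of ?b]
    by (intro mult_left_mono mult_mono power_mono) auto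
  finally have *: "d\<^sup>2 \<le> 2 * R\<^sup>2 * \<phi>_excess a ?b * (R + \<bar>d\<bar>)" by (simp add: mult_ac)
  have c: "0 \<le> 2 * R\<^sup>2 * \<phi>_excess a ?b" using \<phi>_excess_nonneg by simp
  show ?thesis
  proof (cases "\<bar>d\<bar> \<le> 1")
    case True
    then have "d\<^sup>2 \<le> 2 * R\<^sup>2 * \<phi>_excess a ?b * (R + 1)"
      using * mult_left_mono[OF _ c, of "R + \<bar>d\<bar>" "R + 1"] by simp
    then show ?thesis by (simp add: mult_ac min_le_iff_disj)
  next
    case False
    have "\<bar>d\<bar> * \<bar>d\<bar> \<le> 2 * R\<^sup>2 * \<phi>_excess a ?b * (R + \<bar>d\<bar>)" using * by (simp add: power2_eq_square)
    also have "\<dots> \<le> 2 * R\<^sup>2 * \<phi>_excess a ?b * ((R + 1) * \<bar>d\<bar>)"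
    proof (rule mult_left_mono[OF _ c])
      have "R * 1 \<le> R * \<bar>d\<bar>" using False R1 by (intro mult_left_mono) auto
      then show "R + \<bar>d\<bar> \<le> (R + 1) * \<bar>d\<bar>" by (simp add: algebra_simps)
    qed
    finally have "\<bar>d\<bar> * \<bar>d\<bar> \<le> (2 * R\<^sup>2 * \<phi>_excess a ?b * (R + 1)) * \<bar>d\<bar>" by (simp add: mult_ac)
    then have "\<bar>d\<bar> \<le> 2 * R\<^sup>2 * \<phi>_excess a ?b * (R + 1)"
      by (rule mult_right_le_imp_le) (use False in simp)
    then show ?thesis by (simp add: mult_ac min_le_iff_disj)
  qed
qed

text \<open>Both remainders are compared with \<open>min (d\<^sup>2) \<bar>d\<bar>\<close>. Small
  steps scale with \<open>h\<^sup>2\<close> and large ones with \<open>\<bar>h\<bar>\<close>, hence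
  the weight \<open>h\<^sup>2 + \<bar>h\<bar>\<close>; the base point \<open>g\<close> is
  arbitrary.\<close>

lemma \<phi>_excess_transform:
  assumes R: "\<phi> a \<le> R"
  shows "\<phi>_excess g (g + h * d) \<le> 4 * R\<^sup>2 * (R + 1) * ((h\<^sup>2 + \<bar>h\<bar>) * \<phi>_excess a (a + d))"
proof -
  have "\<phi>_excess g (g + h * d) \<le> 2 * ((h\<^sup>2 + \<bar>h\<bar>) * min (d\<^sup>2) \<bar>d\<bar>)"
  proof (cases "\<bar>d\<bar> \<le> 1")
    case True
    then have "d\<^sup>2 \<le> \<bar>d\<bar>" using mult_left_le_one_le[of "\<bar>d\<bar>" "\<bar>d\<bar>"] by (simp add: power2_eq_square)
    have "\<phi>_excess g (g + h * d) \<le> h\<^sup>2 * d\<^sup>2" using \<phi>_excess_le_square[of g "g + h * d"] by (simp add: power_mult_distrib)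
    also have "\<dots> \<le> 2 * ((h\<^sup>2 + \<bar>h\<bar>) * d\<^sup>2)" by (simp add: algebra_simps)
    finally show ?thesis using \<open>d\<^sup>2 \<le> \<bar>d\<bar>\<close> by (simp add: min_def)
  next
    case False
    then have "\<bar>d\<bar> \<le> d\<^sup>2" using mult_left_mono[of 1 "\<bar>d\<bar>" "\<bar>d\<bar>"] by (simp add: power2_eq_square)
    have "\<phi>_excess g (g + h * d) \<le> 2 * (\<bar>h\<bar> * \<bar>d\<bar>)" using \<phi>_excess_le_abs[of g "g + h * d"] by (simp add: abs_mult)
    also have "\<dots> \<le> 2 * ((h\<^sup>2 + \<bar>h\<bar>) * \<bar>d\<bar>)" by (simp add: algebra_simps)
    finally show ?thesis using \<open>\<bar>d\<bar> \<le> d\<^sup>2\<close> by (simp add: min_def)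
  qed
  also have "\<dots> \<le> 2 * ((h\<^sup>2 + \<bar>h\<bar>) * (2 * R\<^sup>2 * (R + 1) * \<phi>_excess a (a + d)))"
    using \<phi>_excess_lower[OF R] by (intro mult_left_mono) auto
  finally show ?thesis by (simp add: mult_ac)
qed

text \<open>Returns from means of \<open>\<phi>\<close> to convergence in probability: the truncated
  value has square at most \<open>3 * (\<phi> g - 1)\<close>, and a number is at most
  \<open>\<kappa>\<close> plus its square over \<open>\<kappa>\<close>.\<close>

lemma min_1_abs_le_\<phi>:
  assumes \<kappa>: "0 < \<kappa>"
  shows "min 1 \<bar>g\<bar> \<le> \<kappa> + 3 * (\<phi> g - 1) / \<kappa>"
proof -
  let ?m = "min 1 \<bar>g\<bar>"
  have "?m\<^sup>2 \<le> 3 * (\<phi> g - 1)"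
  proof -
    have m: "0 \<le> ?m" "?m \<le> 1" "?m \<le> \<bar>g\<bar>" by auto
    \<comment> \<open>The factor 3 leaves room for the quadratic term: for \<open>x \<le> 1\<close>
      it is at most \<open>x / 9\<close>, and \<open>2 / 3 + 1 / 9 \<le> 1\<close>.\<close>
    have *: "(1 + x / 3)\<^sup>2 \<le> 1 + x" if "0 \<le> x" "x \<le> 1" for x :: real
      using mult_left_mono[OF that(2,1)] that by (simp add: power2_eq_square algebra_simps)
    have "(1 + ?m\<^sup>2 / 3)\<^sup>2 \<le> 1 + ?m\<^sup>2" using m by (intro *) (auto simp: power_le_one)
    also have "\<dots> \<le> 1 + g\<^sup>2" using power_mono[OF m(3,1), of 2] by simp
    finally have "1 + ?m\<^sup>2 / 3 \<le> \<phi> g" unfolding \<phi>_def by (rule real_le_rsqrt)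
    then show ?thesis by simp
  qed
  moreover have "?m \<le> \<kappa> + ?m\<^sup>2 / \<kappa>"
  proof (cases "?m \<le> \<kappa>")
    case False
    then have "\<kappa> * ?m \<le> ?m\<^sup>2" unfolding power2_eq_square using \<kappa> by (intro mult_right_mono) auto
    then have "\<kappa> * ?m \<le> \<kappa> * \<kappa> + ?m\<^sup>2" using \<kappa> by (simp add: add_increasing)
    then show ?thesis using \<kappa> by (simp add: field_simps)
  qed (use \<kappa> in \<open>auto intro: add_increasing2\<close>)
  moreover have "?m\<^sup>2 / \<kappa> \<le> 3 * (\<phi> g - 1) / \<kappa>" using calculation(1) \<kappa> by (intro divide_right_mono) auto
  ultimately show ?thesis by linarith
qed

text \<open>Serves to control two integrators by one measure, and later to recognize a measure as
  the sum of a smaller one and a positive remainder.\<close>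

lemma finite_measure_sum:
  assumes "finite_measure \<mu>" "finite_measure \<nu>" "sets \<mu> = sets \<nu>"
  obtains \<rho> where "finite_measure \<rho>" "sets \<rho> = sets \<nu>"
    "\<And>A. A \<in> sets \<nu> \<Longrightarrow> emeasure \<rho> A = emeasure \<mu> A + emeasure \<nu> A"
    "\<And>f. nn_integral \<mu> f \<le> nn_integral \<rho> f" "\<And>f. nn_integral \<nu> f \<le> nn_integral \<rho> f"
proof -
  define \<rho> where "\<rho> = measure_of (space \<nu>) (sets \<nu>) (\<lambda>A. emeasure \<mu> A + emeasure \<nu> A)"
  have sets: "sets \<rho> = sets \<nu>" by (simp add: \<rho>_def)
  have space: "space \<mu> = space \<nu>" using assms(3) by (rule sets_eq_imp_space_eq)
  have em: "emeasure \<rho> A = emeasure \<mu> A + emeasure \<nu> A" if "A \<in> sets \<nu>" for A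
    unfolding \<rho>_def
  proof (rule emeasure_measure_of_sigma[OF sets.sigma_algebra_axioms _ _ that])
    show "positive (sets \<nu>) (\<lambda>A. emeasure \<mu> A + emeasure \<nu> A)" by (simp add: positive_def)
    show "countably_additive (sets \<nu>) (\<lambda>A. emeasure \<mu> A + emeasure \<nu> A)"
    proof (rule countably_additiveI)
      fix A :: "nat \<Rightarrow> 'a set" assume A: "range A \<subseteq> sets \<nu>" "disjoint_family A"
      show "(\<Sum>i. emeasure \<mu> (A i) + emeasure \<nu> (A i)) = emeasure \<mu> (\<Union>i. A i) + emeasure \<nu> (\<Union>i. A i)"
        using A assms(3) by (subst suminf_add[symmetric]) (auto simp: suminf_emeasure)
    qed
  qed
  have fin: "finite_measure \<rho>"
  proof (rule finite_measureI)
    have "space \<rho> = space \<nu>" using sets by (rule sets_eq_imp_space_eq)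
    then show "emeasure \<rho> (space \<rho>) \<noteq> \<infinity>"
      using em[OF sets.top] assms(1,2) finite_measure.emeasure_finite[OF assms(1)]
        finite_measure.emeasure_finite[OF assms(2)] by simp
  qed
  have "\<mu> \<le> \<rho>" "\<nu> \<le> \<rho>" using em assms(3) sets by (auto simp: le_measure)
  then show ?thesis using that[OF fin sets em] sets assms(3) by (simp add: nn_integral_mono_measure)
qed

section \<open>Doleans measures of elementary predictable processes\<close>

context usual_filtered_prob_space
begin

text \<open>Monotone approximation from indicators to nonnegative functions known at
  \<open>s\<close>. The term with \<open>S s\<close> stands on the left so that no difference of
  possibly infinite integrals occurs.\<close>

lemma doleans_cell:
  assumes S: "right_continuous_submartingale S T"
    and \<nu>: "finite_measure \<nu>" "sets \<nu> = sets \<P>"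
      "\<And>s t B. 0 \<le> s \<Longrightarrow> s \<le> t \<Longrightarrow> B \<in> sets (F s) \<Longrightarrow>
        measure \<nu> ({s<..t} \<times> B) = (\<integral>w. indicator B w * (S t w - S s w) \<partial>M)"
    and st: "0 \<le> s" "s \<le> t" and g: "g \<in> borel_measurable (F s)"
  shows "(\<integral>\<^sup>+(u, w). g w * indicator {s<..t} u \<partial>\<nu>) + (\<integral>\<^sup>+w. g w * ennreal (S s w) \<partial>M)
    = (\<integral>\<^sup>+w. g w * ennreal (S t w) \<partial>M)"
  using g
proof (induction rule: borel_measurable_induct)
  have [measurable]: "S s \<in> borel_measurable M" "S t \<in> borel_measurable M"
    using st by (intro measurable_F_M[OF submartingale_measurable[OF S]]; simp)+
  have I: "{s<..t} \<times> A \<in> sets \<nu>" if "A \<in> sets (F s)" for A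
    using predictable_rectangle(2)[OF st(1) that] by (simp add: \<nu>(2))
  have space: "space \<nu> = {0..} \<times> space M" using sets_eq_imp_space_eq[OF \<nu>(2)] by simp
  have meas: "(\<lambda>(u, w). g w * indicator {s<..t} u) \<in> borel_measurable \<nu>"
    if g: "g \<in> borel_measurable (F s)" for g :: "'a \<Rightarrow> ennreal"
  proof (rule measurableI)
    fix B :: "ennreal set" assume B: "B \<in> sets borel"
    have "g -` B \<inter> space M \<in> sets (F s)" using measurable_sets[OF g B] by (simp add: space_F)
    note 1 = I[OF this]
    have 2: "{s<..t} \<times> space M \<in> sets \<nu>" using I[OF sets.top] by (simp add: space_F)
    have "(\<lambda>(u, w). g w * indicator {s<..t} u) -` B \<inter> space \<nu> =
      {s<..t} \<times> (g -` B \<inter> space M) \<union> (if 0 \<in> B then space \<nu> - {s<..t} \<times> space M else {})"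
      using sets.sets_into_space[OF 1] sets.sets_into_space[OF 2]
      by (auto simp: indicator_def of_bool_def space split: if_splits)
    then show "(\<lambda>(u, w). g w * indicator {s<..t} u) -` B \<inter> space \<nu> \<in> sets \<nu>"
      using 1 2 sets.top[of \<nu>] by (auto intro!: sets.Un sets.Diff)
  qed auto
  {
    case (cong f g)
    have "(\<integral>\<^sup>+w. f w * ennreal (S r w) \<partial>M) = (\<integral>\<^sup>+w. g w * ennreal (S r w) \<partial>M)" for r
      using cong by (intro nn_integral_cong) (simp add: space_F)
    moreover have "(\<integral>\<^sup>+(u, w). f w * indicator {s<..t} u \<partial>\<nu>) = (\<integral>\<^sup>+(u, w). g w * indicator {s<..t} u \<partial>\<nu>)"
      using cong by (intro nn_integral_cong) (auto simp: space_F space)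
    ultimately show ?case using cong by simp
  next
    case (set A)
    have A: "A \<in> sets M" using sets_F_M[OF set] .
    have *: "(\<integral>\<^sup>+w. indicator A w * ennreal (S r w) \<partial>M) = ennreal (\<integral>w. indicator A w * S r w \<partial>M)"
      if "0 \<le> r" for r
    proof -
      have "(\<integral>\<^sup>+w. indicator A w * ennreal (S r w) \<partial>M) = (\<integral>\<^sup>+w. ennreal (indicator A w * S r w) \<partial>M)"
        by (intro nn_integral_cong) (auto simp: indicator_def)
      also have "\<dots> = ennreal (\<integral>w. indicator A w * S r w \<partial>M)"
        using submartingale_indicator_integrable[OF S set that] submartingale_nonneg[OF S]
        by (intro nn_integral_eq_integral) auto
      finally show ?thesis .
    qed
    have "(\<integral>\<^sup>+(u, w). indicator A w * indicator {s<..t} u \<partial>\<nu>) = (\<integral>\<^sup>+x. indicator ({s<..t} \<times> A) x \<partial>\<nu>)"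
      by (intro nn_integral_cong) (auto simp: indicator_def)
    also have "\<dots> = emeasure \<nu> ({s<..t} \<times> A)" using I[OF set] by simp
    also have "\<dots> = ennreal (\<integral>w. indicator A w * (S t w - S s w) \<partial>M)"
      using \<nu>(3)[OF st set] finite_measure.emeasure_eq_measure[OF \<nu>(1)] by simp
    also have "(\<integral>w. indicator A w * (S t w - S s w) \<partial>M) =
       (\<integral>w. indicator A w * S t w \<partial>M) - (\<integral>w. indicator A w * S s w \<partial>M)"
      unfolding right_diff_distrib using st
      by (intro Bochner_Integration.integral_diff submartingale_indicator_integrable[OF S set]) simp_all
    finally show ?case
      using *[of s] *[of t] st submartingale_mono[OF S st set] submartingale_nonneg[OF S]
      by (simp add: ennreal_plus[symmetric] del: ennreal_plus)
  next
    case (mult u c)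
    have u: "u \<in> borel_measurable (F s)" by fact
    then have [measurable]: "u \<in> borel_measurable M" by (rule measurable_F_M)
    have "(\<integral>\<^sup>+w. c * u w * ennreal (S r w) \<partial>M) = c * (\<integral>\<^sup>+w. u w * ennreal (S r w) \<partial>M)"
      if "r \<in> {s, t}" for r
      unfolding mult.assoc using that by (intro nn_integral_cmult) auto
    moreover have "(\<integral>\<^sup>+(v, w). c * u w * indicator {s<..t} v \<partial>\<nu>) = c * (\<integral>\<^sup>+(v, w). u w * indicator {s<..t} v \<partial>\<nu>)"
      using nn_integral_cmult[OF meas[OF u], of c] by (simp add: split_def mult.assoc)
    ultimately show ?case using mult.IH by (simp add: distrib_left[symmetric])
  next
    case (add u v)
    have uv: "u \<in> borel_measurable (F s)" "v \<in> borel_measurable (F s)" by fact+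
    then have [measurable]: "u \<in> borel_measurable M" "v \<in> borel_measurable M" by (auto intro: measurable_F_M[of _ s])
    have *: "(\<integral>\<^sup>+w. (v w + u w) * ennreal (S r w) \<partial>M) = (\<integral>\<^sup>+w. v w * ennreal (S r w) \<partial>M) + (\<integral>\<^sup>+w. u w * ennreal (S r w) \<partial>M)"
      if "r \<in> {s, t}" for r
      unfolding distrib_right using that by (intro nn_integral_add) auto
    have **: "(\<integral>\<^sup>+(x, w). (v w + u w) * indicator {s<..t} x \<partial>\<nu>) =
      (\<integral>\<^sup>+(x, w). v w * indicator {s<..t} x \<partial>\<nu>) + (\<integral>\<^sup>+(x, w). u w * indicator {s<..t} x \<partial>\<nu>)"
      using nn_integral_add[OF meas[OF uv(2)] meas[OF uv(1)]] by (simp add: split_def distrib_right)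
    show ?case unfolding ** *[OF insertI1] *[OF insertI2[OF singletonI]]
      unfolding add.IH[symmetric] by (simp only: add_ac)
  next
    case (seq U)
    have U: "U i \<in> borel_measurable (F s)" for i by fact
    then have [measurable]: "U i \<in> borel_measurable M" for i by (rule measurable_F_M)
    have mono: "U i w \<le> U j w" if "i \<le> j" for i j w using \<open>incseq U\<close> that by (simp add: incseq_def le_fun_def)
    have *: "(\<integral>\<^sup>+w. (SUP i. U i) w * ennreal (S r w) \<partial>M) = (SUP i. \<integral>\<^sup>+w. U i w * ennreal (S r w) \<partial>M)"
      if "r \<in> {s, t}" for r
      unfolding SUP_apply SUP_mult_right_ennreal using that
      by (intro nn_integral_monotone_convergence_SUP) (auto simp: incseq_def le_fun_def mono mult_right_mono)
    have **: "(\<integral>\<^sup>+(x, w). (SUP i. U i) w * indicator {s<..t} x \<partial>\<nu>) =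
      (SUP i. \<integral>\<^sup>+(x, w). U i w * indicator {s<..t} x \<partial>\<nu>)"
      unfolding SUP_apply SUP_mult_right_ennreal split_def using meas[OF U]
      by (intro nn_integral_monotone_convergence_SUP) (auto simp: incseq_def le_fun_def mono mult_right_mono split_def)
    show ?case unfolding ** *[OF insertI1] *[OF insertI2[OF singletonI]]
      unfolding seq.IH[symmetric]
      by (rule ennreal_SUP_add[symmetric])
        (auto simp: incseq_def mono split_def intro!: nn_integral_mono mult_right_mono)
  }
qed

text \<open>The two sides agree on the cells in \<open>(0, T]\<close>; the rest of the right side is
  nonnegative.\<close>

lemma doleans_measure:
  assumes S: "right_continuous_submartingale S T"
  obtains \<nu> where "finite_measure \<nu>" "sets \<nu> = sets \<P>"
    "\<And>Q g. elementary_predictable Q g \<Longrightarrow> (\<And>s w. 0 \<le> g s w) \<Longrightarrow> T \<in> Q \<Longrightarrow>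
       ennreal (\<Sum>q\<in>Q \<inter> {0<..T}. \<integral>w. g q w * (S q w - S (prev Q q) w) \<partial>M)
         \<le> (\<integral>\<^sup>+(s, w). ennreal (g s w) \<partial>\<nu>)"
proof -
  obtain \<nu> where \<nu>: "finite_measure \<nu>" "sets \<nu> = sets \<P>"
      "\<And>s t B. 0 \<le> s \<Longrightarrow> s \<le> t \<Longrightarrow> B \<in> sets (F s) \<Longrightarrow>
        measure \<nu> ({s<..t} \<times> B) = (\<integral>w. indicator B w * (S t w - S s w) \<partial>M)"
    using doleans_measure_aux[OF S] by blast
  have "ennreal (\<Sum>q\<in>Q \<inter> {0<..T}. \<integral>w. g q w * (S q w - S (prev Q q) w) \<partial>M)
         \<le> (\<integral>\<^sup>+(s, w). ennreal (g s w) \<partial>\<nu>)"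
    if g: "elementary_predictable Q g" and g0: "\<And>s w. 0 \<le> g s w" and T: "T \<in> Q" for Q g
  proof -
    note Q = elementary_predictableD(1)[OF g]
    obtain C where C: "\<And>s w. 0 \<le> s \<Longrightarrow> w \<in> space M \<Longrightarrow> \<bar>g s w\<bar> \<le> C"
      using g unfolding elementary_predictable_def by auto
    have cell: "0 \<le> (\<integral>w. g q w * (S q w - S (prev Q q) w) \<partial>M) \<and>
       (\<integral>\<^sup>+(u, w). ennreal (g q w) * indicator {prev Q q<..q} u \<partial>\<nu>) =
       ennreal (\<integral>w. g q w * (S q w - S (prev Q q) w) \<partial>M)"
      if q: "q \<in> Q \<inter> {0<..T}" for q
    proof -
      let ?p = "prev Q q" let ?I = "\<integral>\<^sup>+(u, w). ennreal (g q w) * indicator {prev Q q<..q} u \<partial>\<nu>"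
      have p: "0 \<le> ?p" "?p \<le> q" using prev_nonneg[OF Q, of q] prev_less[OF Q, of q] q by auto
      have i: "integrable M (\<lambda>w. g q w * S r w)" if "0 \<le> r" for r
        using that q by (intro integrable_bounded_mult[OF submartingale_integrable[OF S] elementary_predictableD(5)[OF g] C]) auto
      have e: "(\<integral>\<^sup>+w. ennreal (g q w) * ennreal (S r w) \<partial>M) = ennreal (\<integral>w. g q w * S r w \<partial>M)" if "0 \<le> r" for r
        unfolding ennreal_mult[symmetric, OF g0 submartingale_nonneg[OF S]]
        using i[OF that] g0 submartingale_nonneg[OF S] by (intro nn_integral_eq_integral) auto
      have gm: "(\<lambda>w. ennreal (g q w)) \<in> borel_measurable (F ?p)"
        using elementary_predictableD(4)[OF g, of q] q by simp
      have q0: "0 \<le> q" using q by simp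
      have eq: "?I + ennreal (\<integral>w. g q w * S ?p w \<partial>M) = ennreal (\<integral>w. g q w * S q w \<partial>M)"
        using doleans_cell[OF S \<nu> p gm] unfolding e[OF p(1)] e[OF q0] .
      have nn: "0 \<le> (\<integral>w. g q w * S r w \<partial>M)" for r
        by (rule integral_nonneg_AE) (simp add: g0 submartingale_nonneg[OF S])
      have d: "(\<integral>w. g q w * (S q w - S ?p w) \<partial>M) = (\<integral>w. g q w * S q w \<partial>M) - (\<integral>w. g q w * S ?p w \<partial>M)"
        unfolding right_diff_distrib by (rule Bochner_Integration.integral_diff[OF i[OF q0] i[OF p(1)]])
      \<comment> \<open>Cancelling is legitimate in \<open>ennreal\<close> because
        \<open>ennreal b\<close> is finite.\<close>
      have *: "b \<le> c \<and> I = ennreal (c - b)" if "I + ennreal b = ennreal c" "0 \<le> b" "0 \<le> c" for I b c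
      proof -
        have "ennreal b \<le> ennreal c" unfolding that(1)[symmetric] by simp
        moreover have "I = ennreal c - ennreal b" unfolding that(1)[symmetric] by simp
        ultimately show ?thesis using that by (simp add: ennreal_minus)
      qed
      show ?thesis unfolding d using *[OF eq nn nn] by simp
    qed
    have meas: "(\<lambda>(u, w). ennreal (g q w) * indicator {prev Q q<..q} u) \<in> borel_measurable \<nu>"
      if q: "q \<in> Q \<inter> {0<..T}" for q
    proof -
      have "(\<lambda>(u, w). g q w * indicator {prev Q q<..q} u :: real) \<in> borel_measurable \<P>"
        using q predictable_rectangle(2)[OF prev_nonneg[OF Q]]
        by (intro predictable_times_indicator[OF elementary_predictableD(4)[OF g]]) auto
      then have "(\<lambda>x. ennreal ((\<lambda>(u, w). g q w * indicator {prev Q q<..q} u) x)) \<in> borel_measurable \<nu>"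
        unfolding measurable_cong_sets[OF \<nu>(2) refl] by measurable
      moreover have "(\<lambda>x. ennreal ((\<lambda>(u, w). g q w * indicator {prev Q q<..q} u) x)) =
        (\<lambda>(u, w). ennreal (g q w) * indicator {prev Q q<..q} u)"
        by (auto simp: indicator_def fun_eq_iff)
      ultimately show ?thesis by simp
    qed
    have "ennreal (\<Sum>q\<in>Q \<inter> {0<..T}. \<integral>w. g q w * (S q w - S (prev Q q) w) \<partial>M)
      = (\<Sum>q\<in>Q \<inter> {0<..T}. \<integral>\<^sup>+(u, w). ennreal (g q w) * indicator {prev Q q<..q} u \<partial>\<nu>)"
      using cell by (subst sum_ennreal[symmetric]) auto
    also have "\<dots> = (\<integral>\<^sup>+x. (\<Sum>q\<in>Q \<inter> {0<..T}. (\<lambda>(u, w). ennreal (g q w) * indicator {prev Q q<..q} u) x) \<partial>\<nu>)"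
      using meas by (intro nn_integral_sum[symmetric]) auto
    also have "\<dots> \<le> (\<integral>\<^sup>+(s, w). ennreal (g s w) \<partial>\<nu>)"
    proof (rule nn_integral_mono)
      fix x assume "x \<in> space \<nu>"
      then obtain u w where x: "x = (u, w)" "w \<in> space M" using sets_eq_imp_space_eq[OF \<nu>(2)] by (cases x) auto
      have "(\<Sum>q\<in>Q \<inter> {0<..T}. g q w * indicator {prev Q q<..q} u) \<le> g u w"
      proof (cases "u \<in> {0<..T}")
        case True
        then show ?thesis
          using step_on_eq_sum[OF Q elementary_predictableD(2)[OF g x(2)] T] by simp
      next
        case False
        have "(\<Sum>q\<in>Q \<inter> {0<..T}. g q w * indicator {prev Q q<..q} u) = 0"
          using False prev_nonneg[OF Q] by (intro sum.neutral) (force simp: indicator_def)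
        then show ?thesis using g0 by simp
      qed
      then have "ennreal (\<Sum>q\<in>Q \<inter> {0<..T}. g q w * indicator {prev Q q<..q} u) \<le> ennreal (g u w)"
        by (rule ennreal_leI)
      then show "(\<Sum>q\<in>Q \<inter> {0<..T}. (\<lambda>(u, w). ennreal (g q w) * indicator {prev Q q<..q} u) x)
        \<le> (\<lambda>(s, w). ennreal (g s w)) x"
        using g0 by (simp add: x sum_ennreal[symmetric] ennreal_mult ennreal_indicator del: sum_mult_indicator sum_ennreal)
    qed
    finally show ?thesis .
  qed
  then show ?thesis using that \<nu> by blast
qed

text \<open>Continuity at 0 of elementary integration up to \<open>T\<close>, uniform over the grids
  that contain \<open>T\<close>. The measure may depend on \<open>d\<close>, which leaves room for
  discarding an event of small probability.\<close>

definition controlled :: "(real \<Rightarrow> 'a \<Rightarrow> real) \<Rightarrow> real \<Rightarrow> bool" where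
  "controlled Z T \<longleftrightarrow> (\<forall>d>0. \<exists>\<nu>. finite_measure \<nu> \<and> sets \<nu> = sets \<P> \<and>
     (\<exists>\<eta>>0. \<forall>Q h. elementary_predictable Q h \<longrightarrow> T \<in> Q \<longrightarrow>
        energy \<nu> h \<le> ennreal \<eta> \<longrightarrow>
        L0 (path_sum Q h Z T) \<le> d))"

section \<open>Martingales are controlled\<close>

lemma martingale_increment:
  assumes N: "martingale M F N" and st: "0 \<le> s" "s \<le> t"
    and \<psi>: "\<psi> \<in> borel_measurable (F s)" "\<And>w. w \<in> space M \<Longrightarrow> \<bar>\<psi> w\<bar> \<le> C"
  shows "integrable M (\<lambda>w. \<psi> w * (N t w - N s w))" "(\<integral>w. \<psi> w * (N t w - N s w) \<partial>M) = 0"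
proof -
  interpret sub: finite_measure_subalgebra M "F s"
    by unfold_locales (rule subalgebra_F)
  have iN: "integrable M (N s)" "integrable M (N t)" and AE: "AE w in M. real_cond_exp M (F s) (N t) w = N s w"
    and "N s \<in> borel_measurable (F s)"
    using N st by (auto simp: martingale_def adapted_def)
  have i: "integrable M (\<lambda>w. \<psi> w * N s w)" "integrable M (\<lambda>w. \<psi> w * N t w)"
    using integrable_bounded_mult[OF iN(1) measurable_F_M[OF \<psi>(1)] \<psi>(2)]
      integrable_bounded_mult[OF iN(2) measurable_F_M[OF \<psi>(1)] \<psi>(2)] by auto
  then show "integrable M (\<lambda>w. \<psi> w * (N t w - N s w))" by (simp add: right_diff_distrib)
  have "(\<integral>w. \<psi> w * N s w \<partial>M) = (\<integral>w. \<psi> w * real_cond_exp M (F s) (N t) w \<partial>M)"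
    using AE measurable_F_M[OF \<psi>(1)] measurable_F_M[OF \<open>N s \<in> _\<close>]
    by (intro integral_cong_AE) auto
  also have "\<dots> = (\<integral>w. \<psi> w * N t w \<partial>M)"
    using i(2) \<psi>(1) iN by (intro sub.real_cond_exp_intg) auto
  finally show "(\<integral>w. \<psi> w * (N t w - N s w) \<partial>M) = 0" using i by (simp add: right_diff_distrib)
qed

text \<open>The tangent term has the coefficient \<open>\<psi> w * (N s w / \<phi> (N s w))\<close>,
  bounded and known at \<open>s\<close>, so the martingale property removes it from the
  mean.\<close>

lemma martingale_\<phi>_increment:
  assumes N: "martingale M F N" and st: "0 \<le> s" "s \<le> t"
    and \<psi>: "\<psi> \<in> borel_measurable (F s)" "\<And>w. w \<in> space M \<Longrightarrow> \<bar>\<psi> w\<bar> \<le> C"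
  shows "integrable M (\<lambda>w. \<psi> w * \<phi>_excess (N s w) (N t w))"
    and "(\<integral>w. \<psi> w * \<phi>_excess (N s w) (N t w) \<partial>M) = (\<integral>w. \<psi> w * (\<phi> (N t w) - \<phi> (N s w)) \<partial>M)"
    and "integrable M (\<lambda>w. \<psi> w * (\<phi> (N t w) - \<phi> (N s w)))"
    and "integrable M (\<lambda>w. \<phi> (N t w))"
proof -
  have Ns: "N s \<in> borel_measurable (F s)" using N st by (auto simp: martingale_def adapted_def)
  have i\<phi>: "integrable M (\<lambda>w. \<phi> (N r w))" if "0 \<le> r" for r
  proof (rule Bochner_Integration.integrable_bound)
    have "integrable M (N r)" using N that by (auto simp: martingale_def)
    then show "integrable M (\<lambda>w. 1 + \<bar>N r w\<bar>)" by simp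
    show "(\<lambda>w. \<phi> (N r w)) \<in> borel_measurable M" using borel_measurable_integrable[OF \<open>integrable M (N r)\<close>] by measurable
    show "AE w in M. norm (\<phi> (N r w)) \<le> norm (1 + \<bar>N r w\<bar>)" using \<phi>_le \<phi>_pos by (intro AE_I2) (simp add: less_imp_le)
  qed
  then show "integrable M (\<lambda>w. \<phi> (N t w))" using st by simp
  show 1: "integrable M (\<lambda>w. \<psi> w * (\<phi> (N t w) - \<phi> (N s w)))"
    using st by (intro integrable_bounded_mult[OF _ measurable_F_M[OF \<psi>(1)] \<psi>(2)] Bochner_Integration.integrable_diff i\<phi>) auto
  have \<psi>': "(\<lambda>w. \<psi> w * (N s w / \<phi> (N s w))) \<in> borel_measurable (F s)" using \<psi>(1) Ns by measurable
  have b: "\<bar>\<psi> w * (N s w / \<phi> (N s w))\<bar> \<le> C" if "w \<in> space M" for w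
    using \<psi>(2)[OF that] abs_\<phi>_deriv_mult[of "N s w" "\<psi> w"] by (simp add: mult.commute)
  note 2 = martingale_increment[OF N st \<psi>' b]
  have eq: "(\<lambda>w. \<psi> w * \<phi>_excess (N s w) (N t w)) = (\<lambda>w. \<psi> w * (\<phi> (N t w) - \<phi> (N s w)) - \<psi> w * (N s w / \<phi> (N s w)) * (N t w - N s w))"
    by (rule ext) (simp add: \<phi>_excess_def right_diff_distrib)
  show "integrable M (\<lambda>w. \<psi> w * \<phi>_excess (N s w) (N t w))"
    unfolding eq by (rule Bochner_Integration.integrable_diff[OF 1 2(1)])
  show "(\<integral>w. \<psi> w * \<phi>_excess (N s w) (N t w) \<partial>M) = (\<integral>w. \<psi> w * (\<phi> (N t w) - \<phi> (N s w)) \<partial>M)"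
    unfolding eq using Bochner_Integration.integral_diff[OF 1 2(1)] 2(2) by simp
qed

text \<open>The submartingale property is the sign of \<open>\<phi>_excess\<close>. Right-continuity
  of the mean is derived by contradiction from Fatou's lemma.\<close>

lemma martingale_doleans_submartingale:
  assumes N: "martingale M F N" and rc: "AE w in M. \<forall>t\<ge>0. continuous (at_right t) (\<lambda>t. N t w)" and T: "0 \<le> T"
  shows "right_continuous_submartingale (\<lambda>t w. \<phi> (N (min t T) w)) T"
  unfolding right_continuous_submartingale_def
proof (intro conjI allI impI T)
  have Nm: "N t \<in> borel_measurable (F t)" "integrable M (N t)" if "0 \<le> t" for t
    using N that by (auto simp: martingale_def adapted_def)
  fix t :: real assume t: "0 \<le> t"
  have "N (min t T) \<in> borel_measurable (F t)"
    using measurable_F_mono[OF Nm(1)[of "min t T"]] t T by simp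
  then show "(\<lambda>w. \<phi> (N (min t T) w)) \<in> borel_measurable (F t)" by measurable
  show "integrable M (\<lambda>w. \<phi> (N (min t T) w))"
    using martingale_\<phi>_increment(4)[OF N, of 0 "min t T" "\<lambda>_. 0" 0] t T by simp
next
  show "0 \<le> \<phi> (N (min t T) w)" for t w using \<phi>_pos by (rule less_imp_le)
next
  fix s t :: real and B assume st: "0 \<le> s" "s \<le> t" and B: "B \<in> sets (F s)"
  show "(\<integral>w. indicator B w * \<phi> (N (min s T) w) \<partial>M) \<le> (\<integral>w. indicator B w * \<phi> (N (min t T) w) \<partial>M)"
  proof (cases "s \<le> T")
    case True
    have st': "s \<le> min t T" using True st by simp
    have ind: "indicator B \<in> borel_measurable (F s)" using B by simp
    note inc = martingale_\<phi>_increment[OF N st(1) st' ind indicator_F(2)]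
    have i: "integrable M (\<lambda>w. indicator B w * \<phi> (N r w))" if "0 \<le> r" for r
      using martingale_\<phi>_increment(4)[OF N, of 0 r "\<lambda>_. 0" 0] that
      by (intro integrable_bounded_mult[OF _ measurable_F_M[OF ind] indicator_F(2)]) simp
    have "0 \<le> (\<integral>w. indicator B w * (\<phi> (N (min t T) w) - \<phi> (N s w)) \<partial>M)"
      unfolding inc(2)[symmetric] by (rule integral_nonneg_AE) (simp add: \<phi>_excess_nonneg)
    also have "\<dots> = (\<integral>w. indicator B w * \<phi> (N (min t T) w) \<partial>M) - (\<integral>w. indicator B w * \<phi> (N s w) \<partial>M)"
      unfolding right_diff_distrib using st T by (intro Bochner_Integration.integral_diff i) auto
    finally show ?thesis using True by (simp add: min_def)
  next
    case False
    then show ?thesis using st by (simp add: min_def)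
  qed
next
  fix s e :: real assume s: "0 \<le> s" and e: "0 < e"
  show "\<exists>t>s. (\<integral>w. \<phi> (N (min t T) w) \<partial>M) < (\<integral>w. \<phi> (N (min s T) w) \<partial>M) + e"
  proof (cases "s < T")
    case False
    then show ?thesis using e by (intro exI[of _ "s + 1"]) (simp add: min_def)
  next
    case True
    show ?thesis
    proof (rule ccontr)
      assume "\<not> ?thesis"
      then have neg: "(\<integral>w. \<phi> (N s w) \<partial>M) + e \<le> (\<integral>w. \<phi> (N t w) \<partial>M)" if "s < t" "t \<le> T" for t
      proof -
        have "\<not> (\<integral>w. \<phi> (N (min t T) w) \<partial>M) < (\<integral>w. \<phi> (N (min s T) w) \<partial>M) + e"
          using \<open>\<not> (\<exists>t>s. _)\<close> that(1) by blast
        then show ?thesis using that True by (simp add: min_absorb1)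
      qed
      define r where "r n = s + (T - s) / (real n + 2)" for n :: nat
      have r: "s < r n" "r n \<le> T" for n
      proof -
        show "s < r n" using True by (simp add: r_def)
        have "(T - s) / (real n + 2) \<le> (T - s) / 1" using True by (intro divide_left_mono) auto
        then show "r n \<le> T" by (simp add: r_def)
      qed
      have r_lim: "r \<longlonglongrightarrow> s"
      proof -
        have "(\<lambda>n. (T - s) / (real (n + 2))) \<longlonglongrightarrow> 0"
          using LIMSEQ_ignore_initial_segment[OF lim_const_over_n[of "T - s"], of 2] by simp
        then have "(\<lambda>n. s + (T - s) / (real n + 2)) \<longlonglongrightarrow> s + 0" by (intro tendsto_add) (auto simp: add.commute)
        then show ?thesis by (simp add: r_def[abs_def])
      qed
      \<comment> \<open>Fatou's lemma applies to the nonnegative remainder between \<open>t\<close>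
        and \<open>T\<close>. Its mean falls exactly as the mean of \<open>\<phi> (N t)\<close>
        rises, so a lower bound for the one is the upper bound needed for the other.\<close>
      define D where "D t w = \<phi>_excess (N t w) (N T w)" for t w
      have D: "integrable M (D t)" "(\<integral>w. D t w \<partial>M) = (\<integral>w. \<phi> (N T w) \<partial>M) - (\<integral>w. \<phi> (N t w) \<partial>M)"
        if "0 \<le> t" "t \<le> T" for t
      proof -
        note inc = martingale_\<phi>_increment[OF N that, of "\<lambda>_. 1" 1, simplified]
        note i = martingale_\<phi>_increment(4)[OF N order_refl, of _ "\<lambda>_. 1" 1, simplified]
        show "integrable M (D t)" using inc(1) by (simp add: D_def[abs_def])
        have "(\<integral>w. D t w \<partial>M) = (\<integral>w. \<phi> (N T w) - \<phi> (N t w) \<partial>M)" using inc(2) by (simp add: D_def)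
        also have "\<dots> = (\<integral>w. \<phi> (N T w) \<partial>M) - (\<integral>w. \<phi> (N t w) \<partial>M)"
          by (rule Bochner_Integration.integral_diff[OF i[OF T] i[OF that(1)]])
        finally show "(\<integral>w. D t w \<partial>M) = (\<integral>w. \<phi> (N T w) \<partial>M) - (\<integral>w. \<phi> (N t w) \<partial>M)" .
      qed
      have D0: "0 \<le> D t w" for t w by (simp add: D_def \<phi>_excess_nonneg)
      have nnD: "(\<integral>\<^sup>+w. ennreal (D t w) \<partial>M) = ennreal (\<integral>w. D t w \<partial>M)" if "0 \<le> t" "t \<le> T" for t
        using D(1)[OF that] D0 by (intro nn_integral_eq_integral) auto
      have r0: "0 \<le> r n" for n using r(1)[of n] s by simp
      have lim: "AE w in M. (\<lambda>n. D (r n) w) \<longlonglongrightarrow> D s w"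
        using rc
      proof eventually_elim
        fix w assume "\<forall>t\<ge>0. continuous (at_right t) (\<lambda>t. N t w)"
        then have "((\<lambda>t. N t w) \<longlongrightarrow> N s w) (at_right s)" using s by (simp add: continuous_within)
        moreover have "filterlim r (at_right s) sequentially"
          unfolding filterlim_at using r_lim r(1) by (simp add: less_imp_neq[THEN not_sym])
        ultimately have "(\<lambda>n. N (r n) w) \<longlonglongrightarrow> N s w" by (rule filterlim_compose)
        then show "(\<lambda>n. D (r n) w) \<longlonglongrightarrow> D s w"
          unfolding D_def \<phi>_excess_def using \<phi>_pos[of "N s w"]
          by (intro tendsto_intros) (auto simp: \<phi>_def intro!: tendsto_intros)
      qed
      have "(\<integral>\<^sup>+w. ennreal (D s w) \<partial>M) = (\<integral>\<^sup>+w. liminf (\<lambda>n. ennreal (D (r n) w)) \<partial>M)"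
        using lim by (intro nn_integral_cong_AE, eventually_elim)
          (auto intro!: lim_imp_Liminf[symmetric] tendsto_ennrealI)
      also have "\<dots> \<le> liminf (\<lambda>n. \<integral>\<^sup>+w. ennreal (D (r n) w) \<partial>M)"
        using D(1)[OF r0 r(2)] by (intro nn_integral_liminf) auto
      also have "\<dots> \<le> liminf (\<lambda>n. ennreal ((\<integral>w. D s w \<partial>M) - e))"
      proof (intro Liminf_mono always_eventually allI)
        fix n
        have "(\<integral>w. D (r n) w \<partial>M) \<le> (\<integral>w. D s w \<partial>M) - e"
          using neg[OF r, of n] D(2)[OF r0 r(2), of n] D(2)[OF s] True by simp
        then show "(\<integral>\<^sup>+w. ennreal (D (r n) w) \<partial>M) \<le> ennreal ((\<integral>w. D s w \<partial>M) - e)"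
          unfolding nnD[OF r0 r(2)] by (rule ennreal_leI)
      qed
      also have "\<dots> = ennreal ((\<integral>w. D s w \<partial>M) - e)" by (simp add: Liminf_const)
      finally have le: "ennreal (\<integral>w. D s w \<partial>M) \<le> ennreal ((\<integral>w. D s w \<partial>M) - e)"
        using nnD[OF s] True by simp
      \<comment> \<open>\<open>ennreal\<close> cuts negative numbers off at 0, so the difference has
        to be seen nonnegative before the two sides are compared.\<close>
      have "e \<le> (\<integral>w. D s w \<partial>M)"
      proof -
        have "0 \<le> (\<integral>w. D (r 0) w \<partial>M)" by (rule integral_nonneg_AE) (simp add: D0)
        then show ?thesis using neg[OF r, of 0] D(2)[OF r0 r(2), of 0] D(2)[OF s] True by simp
      qed
      then show False using le e by (simp add: ennreal_le_iff2)
    qed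
  qed
next
  show "(\<lambda>w. \<phi> (N (min t T) w)) = (\<lambda>w. \<phi> (N (min T T) w))" if "T \<le> t" for t
    using that by (simp add: min_def)
qed

text \<open>Only the part \<open>h\<^sup>2\<close> of the weight is given to be small. The part
  \<open>\<bar>h\<bar>\<close> is at most \<open>h\<^sup>2 / \<kappa> + \<kappa>\<close>, and the
  constant is integrated over a finite measure.\<close>

lemma doleans_small:
  assumes S: "right_continuous_submartingale S T" and e: "0 < e"
  obtains \<nu> \<eta> where "finite_measure \<nu>" "sets \<nu> = sets \<P>" "0 < \<eta>"
    "\<And>Q h. elementary_predictable Q h \<Longrightarrow> T \<in> Q \<Longrightarrow>
      energy \<nu> h \<le> ennreal \<eta> \<Longrightarrow>
      (\<Sum>q\<in>Q \<inter> {0<..T}. \<integral>w. ((h q w)\<^sup>2 + \<bar>h q w\<bar>) * (S q w - S (prev Q q) w) \<partial>M) \<le> e"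
proof -
  obtain \<nu> where \<nu>: "finite_measure \<nu>" "sets \<nu> = sets \<P>"
    "\<And>Q g. elementary_predictable Q g \<Longrightarrow> (\<And>s w. 0 \<le> g s w) \<Longrightarrow> T \<in> Q \<Longrightarrow>
       ennreal (\<Sum>q\<in>Q \<inter> {0<..T}. \<integral>w. g q w * (S q w - S (prev Q q) w) \<partial>M)
         \<le> (\<integral>\<^sup>+(s, w). ennreal (g s w) \<partial>\<nu>)"
    by (rule doleans_measure[OF S]) blast
  define V where "V = measure \<nu> (space \<nu>)"
  \<comment> \<open>With total mass \<open>V\<close>, this \<open>\<kappa>\<close> lets the constant
    contribute at most \<open>e / 2\<close>; \<open>\<eta>\<close> is then chosen so that the
    quadratic part contributes at most the other half.\<close>
  define \<kappa> where "\<kappa> = e / (2 * (V + 1))"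
  define \<eta> where "\<eta> = e / (2 * (1 + 1 / \<kappa>))"
  have V: "0 \<le> V" by (simp add: V_def)
  have \<kappa>: "0 < \<kappa>" "\<kappa> * V \<le> e / 2"
  proof -
    show "0 < \<kappa>" using V e by (simp add: \<kappa>_def)
    have "\<kappa> * V = e / 2 * (V / (V + 1))" by (simp add: \<kappa>_def)
    also have "\<dots> \<le> e / 2 * 1" using V e by (intro mult_left_mono) auto
    finally show "\<kappa> * V \<le> e / 2" by simp
  qed
  have "0 < 1 + 1 / \<kappa>" using \<kappa> by (simp add: add_pos_pos)
  then have \<eta>: "0 < \<eta>" unfolding \<eta>_def using e by simp
  have \<eta>2: "(1 + 1 / \<kappa>) * \<eta> = e / 2"
  proof -
    define z where "z = 1 + 1 / \<kappa>"
    have "0 < z" using \<kappa> by (simp add: z_def add_pos_pos)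
    then show ?thesis unfolding \<eta>_def z_def[symmetric] by simp
  qed
  have "(\<Sum>q\<in>Q \<inter> {0<..T}. \<integral>w. ((h q w)\<^sup>2 + \<bar>h q w\<bar>) * (S q w - S (prev Q q) w) \<partial>M) \<le> e"
    if h: "elementary_predictable Q h" and TQ: "T \<in> Q" and small: "energy \<nu> h \<le> ennreal \<eta>" for Q h
  proof -
    let ?g = "\<lambda>s w. (h s w)\<^sup>2 + \<bar>h s w\<bar>"
    have g: "elementary_predictable Q ?g"
      using elementary_predictable_comp[OF h h, of "\<lambda>x y. x\<^sup>2 + \<bar>x\<bar>"]
      by (simp add: split_def continuous_intros)
    have "ennreal (\<Sum>q\<in>Q \<inter> {0<..T}. \<integral>w. ?g q w * (S q w - S (prev Q q) w) \<partial>M)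
      \<le> (\<integral>\<^sup>+(s, w). ennreal (?g s w) \<partial>\<nu>)"
      by (rule \<nu>(3)[OF g _ TQ]) simp
    also have "\<dots> \<le> (\<integral>\<^sup>+x. ennreal (1 + 1 / \<kappa>) * (\<lambda>(s, w). ennreal ((h s w)\<^sup>2)) x + ennreal \<kappa> \<partial>\<nu>)"
    proof (rule nn_integral_mono, clarify)
      fix s w
      have "0 \<le> (\<bar>h s w\<bar> - \<kappa> / 2)\<^sup>2 + 3 / 4 * \<kappa>\<^sup>2" by simp
      then have "\<kappa> * \<bar>h s w\<bar> \<le> (h s w)\<^sup>2 + \<kappa>\<^sup>2" by (simp add: power2_eq_square algebra_simps)
      then have "?g s w \<le> (1 + 1 / \<kappa>) * (h s w)\<^sup>2 + \<kappa>" using \<kappa>(1) by (simp add: field_simps power2_eq_square)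
      then have "ennreal (?g s w) \<le> ennreal ((1 + 1 / \<kappa>) * (h s w)\<^sup>2 + \<kappa>)" by (rule ennreal_leI)
      also have "\<dots> = ennreal (1 + 1 / \<kappa>) * ennreal ((h s w)\<^sup>2) + ennreal \<kappa>"
        using \<kappa>(1) by (subst ennreal_mult[symmetric]) (auto simp: ennreal_plus[symmetric] simp del: ennreal_plus)
      finally show "ennreal (?g s w) \<le> ennreal (1 + 1 / \<kappa>) * ennreal ((h s w)\<^sup>2) + ennreal \<kappa>" .
    qed
    also have "\<dots> = ennreal (1 + 1 / \<kappa>) * energy \<nu> h + ennreal \<kappa> * emeasure \<nu> (space \<nu>)"
    proof -
      have "(\<lambda>(s, w). h s w) \<in> borel_measurable \<nu>"
        using elementary_predictable_measurable[OF h] measurable_cong_sets[OF \<nu>(2) refl] by blast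
      then have "(\<lambda>(s, w). ennreal ((h s w)\<^sup>2)) \<in> borel_measurable \<nu>" unfolding split_def by measurable
      then show ?thesis by (simp add: nn_integral_add nn_integral_cmult)
    qed
    also have "\<dots> \<le> ennreal (1 + 1 / \<kappa>) * ennreal \<eta> + ennreal \<kappa> * ennreal V"
      unfolding V_def using small finite_measure.emeasure_eq_measure[OF \<nu>(1)]
      by (intro add_mono mult_left_mono) auto
    also have "\<dots> = ennreal ((1 + 1 / \<kappa>) * \<eta> + \<kappa> * V)"
      using \<kappa>(1) \<eta> V by (simp add: ennreal_mult[symmetric] ennreal_plus[symmetric] del: ennreal_plus)
    finally have "ennreal (\<Sum>q\<in>Q \<inter> {0<..T}. \<integral>w. ?g q w * (S q w - S (prev Q q) w) \<partial>M) \<le> ennreal ((1 + 1 / \<kappa>) * \<eta> + \<kappa> * V)" .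
    moreover have "(1 + 1 / \<kappa>) * \<eta> + \<kappa> * V \<le> e" unfolding \<eta>2 using \<kappa>(2) by linarith
    moreover have "0 \<le> (1 + 1 / \<kappa>) * \<eta> + \<kappa> * V" using \<kappa>(1) \<eta> V by simp
    ultimately show ?thesis by (simp add: ennreal_le_iff)
  qed
  then show ?thesis using that \<nu>(1,2) \<eta> by blast
qed

text \<open>Doob's maximal inequality for the submartingale \<open>\<phi> (N q)\<close>, time 0
  included. Membership in \<open>F t\<close> runs through the induction because the next step
  multiplies an increment by the indicator of the earlier event.\<close>

lemma martingale_maximal:
  assumes N: "martingale M F N" and Q: "time_grid Q" and t: "t \<in> Q"
  shows "{w \<in> space M. \<exists>q\<in>Q. q \<le> t \<and> R < \<phi> (N q w)} \<in> sets (F t) \<and>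
    R * prob {w \<in> space M. \<exists>q\<in>Q. q \<le> t \<and> R < \<phi> (N q w)}
      \<le> (\<integral>w. indicator {w \<in> space M. \<exists>q\<in>Q. q \<le> t \<and> R < \<phi> (N q w)} w * \<phi> (N t w) \<partial>M)"
    (is "?C t \<in> _ \<and> _")
  using Q t
proof (induction t rule: time_grid_induct)
  have Nm: "N t \<in> borel_measurable (F t)" if "0 \<le> t" for t
    using N that by (auto simp: martingale_def adapted_def)
  have i: "integrable M (\<lambda>w. indicator A w * \<phi> (N r w))" if "0 \<le> r" "A \<in> sets (F s)" for r s A
    using martingale_\<phi>_increment(4)[OF N, of 0 r "\<lambda>_. 0" 0] that
    by (intro integrable_bounded_mult[OF _ indicator_F]) auto
  have level: "{w \<in> space M. R < \<phi> (N r w)} \<in> sets (F r)" if "0 \<le> r" for r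
  proof -
    have [measurable]: "N r \<in> borel_measurable (F r)" by (rule Nm[OF that])
    have "{w \<in> space (F r). R < \<phi> (N r w)} \<in> sets (F r)" by measurable
    then show ?thesis by (simp add: space_F)
  qed
  have cheb: "R * prob A \<le> (\<integral>w. indicator A w * \<phi> (N r w) \<partial>M)"
    if A: "A \<in> sets (F r)" "0 \<le> r" "\<And>w. w \<in> A \<Longrightarrow> R < \<phi> (N r w)" for A r
  proof -
    have "R * prob A = (\<integral>w. indicator A w * R \<partial>M)" using sets_F_M[OF A(1)] by (simp add: mult.commute)
    also have "\<dots> \<le> (\<integral>w. indicator A w * \<phi> (N r w) \<partial>M)"
    proof (rule integral_mono[OF _ i[OF A(2,1)]])
      show "integrable M (\<lambda>w. indicator A w * R)"
        using integrable_bounded_mult[OF _ indicator_F(1)[OF A(1)] indicator_F(2), of "\<lambda>_. R"] by simp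
      show "indicator A w * R \<le> indicator A w * \<phi> (N r w)" for w
        using A(3)[of w] by (simp add: indicator_def less_imp_le)
    qed
    finally show ?thesis .
  qed
  {
    case zero
    have "q \<in> Q \<and> q \<le> 0 \<longleftrightarrow> q = 0" for q using time_gridD(2,3)[OF Q] by (auto intro: antisym)
    then have "(\<exists>q\<in>Q. q \<le> 0 \<and> R < \<phi> (N q w)) \<longleftrightarrow> R < \<phi> (N 0 w)" for w by metis
    then have eq: "?C 0 = {w \<in> space M. R < \<phi> (N 0 w)}" by blast
    have "R * prob {w \<in> space M. R < \<phi> (N 0 w)}
      \<le> (\<integral>w. indicator {w \<in> space M. R < \<phi> (N 0 w)} w * \<phi> (N 0 w) \<partial>M)"
      by (rule cheb[OF level[OF order_refl] order_refl]) simp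
    then show ?case unfolding eq by (rule conjI[OF level[OF order_refl]])
  next
    case (step t)
    let ?p = "prev Q t"
    have p: "?p \<in> Q" "?p < t" "0 \<le> ?p"
      using prev_in[OF Q step(2)] prev_less[OF Q step(2)] prev_nonneg[OF Q step(2)] by auto
    have Cp: "?C ?p \<in> sets (F ?p)" and IH: "R * prob (?C ?p) \<le> (\<integral>w. indicator (?C ?p) w * \<phi> (N ?p w) \<partial>M)"
      using step(3) by auto
    have Cp_t: "?C ?p \<in> sets (F t)" using Cp sets_F_mono[of ?p t] p by auto
    \<comment> \<open>The paths that exceed the level for the first time at
      \<open>t\<close>.\<close>
    define D where "D = {w \<in> space M. R < \<phi> (N t w)} - ?C ?p"
    have D: "D \<in> sets (F t)" unfolding D_def using level[of t] step(2) Cp_t by (intro sets.Diff) auto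
    have "q \<in> Q \<and> q \<le> t \<longleftrightarrow> q = t \<or> (q \<in> Q \<and> q \<le> ?p)" for q
      using prev_ge[OF Q step(2), of q] p step(1) by auto
    then have "(\<exists>q\<in>Q. q \<le> t \<and> R < \<phi> (N q w)) \<longleftrightarrow> R < \<phi> (N t w) \<or> (\<exists>q\<in>Q. q \<le> ?p \<and> R < \<phi> (N q w))" for w
      by metis
    then have Ct: "?C t = ?C ?p \<union> D" unfolding D_def by blast
    have disj: "?C ?p \<inter> D = {}" by (auto simp: D_def)
    have "?C t \<in> sets (F t)" unfolding Ct using Cp_t D by (rule sets.Un)
    moreover have "R * prob (?C t) \<le> (\<integral>w. indicator (?C t) w * \<phi> (N t w) \<partial>M)"
    proof -
      have ind: "indicator (?C ?p) \<in> borel_measurable (F ?p)" using Cp by simp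
      note inc = martingale_\<phi>_increment[OF N p(3) less_imp_le[OF p(2)] ind indicator_F(2)]
      have "0 \<le> (\<integral>w. indicator (?C ?p) w * (\<phi> (N t w) - \<phi> (N ?p w)) \<partial>M)"
        unfolding inc(2)[symmetric] by (rule integral_nonneg_AE) (simp add: \<phi>_excess_nonneg)
      also have "\<dots> = (\<integral>w. indicator (?C ?p) w * \<phi> (N t w) \<partial>M) - (\<integral>w. indicator (?C ?p) w * \<phi> (N ?p w) \<partial>M)"
        unfolding right_diff_distrib using step(2) p by (intro Bochner_Integration.integral_diff i[OF _ Cp]) auto
      finally have 1: "R * prob (?C ?p) \<le> (\<integral>w. indicator (?C ?p) w * \<phi> (N t w) \<partial>M)" using IH by simp
      have 2: "R * prob D \<le> (\<integral>w. indicator D w * \<phi> (N t w) \<partial>M)"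
        using step(2) by (intro cheb[OF D]) (auto simp: D_def)
      have "prob (?C t) = prob (?C ?p) + prob D"
        unfolding Ct using disj sets_F_M[OF Cp] sets_F_M[OF D] by (intro finite_measure_Union) auto
      then have "R * prob (?C t) \<le> (\<integral>w. indicator (?C ?p) w * \<phi> (N t w) \<partial>M) + (\<integral>w. indicator D w * \<phi> (N t w) \<partial>M)"
        using 1 2 by (simp add: distrib_left)
      also have "\<dots> = (\<integral>w. indicator (?C ?p) w * \<phi> (N t w) + indicator D w * \<phi> (N t w) \<partial>M)"
        using step(2) by (intro Bochner_Integration.integral_add[symmetric] i[OF _ Cp] i[OF _ D]) auto
      also have "\<dots> = (\<integral>w. indicator (?C t) w * \<phi> (N t w) \<partial>M)"
        unfolding Ct using disj by (intro Bochner_Integration.integral_cong) (auto simp: indicator_def)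
      finally show ?thesis .
    qed
    ultimately show ?case by simp
  }
qed

text \<open>Expand \<open>\<phi>\<close> of the transform at the previous grid point. The tangent
  term has mean zero, and the remainder becomes a remainder of \<open>N\<close> by
  \<open>\<phi>_excess_transform\<close>, applicable because \<open>h\<close> vanishes where
  \<open>\<phi> (N)\<close> exceeds \<open>R\<close>. The leading 1 is
  \<open>\<phi> 0\<close>.\<close>

lemma martingale_transform_\<phi>:
  assumes N: "martingale M F N" and Q: "time_grid Q" and t: "t \<in> Q"
    and h: "\<And>q. q \<in> Q \<Longrightarrow> 0 < q \<Longrightarrow> h q \<in> borel_measurable (F (prev Q q))"
      "\<And>q w. q \<in> Q \<Longrightarrow> w \<in> space M \<Longrightarrow> \<bar>h q w\<bar> \<le> C"
    and R: "\<And>q w. q \<in> Q \<Longrightarrow> 0 < q \<Longrightarrow> R < \<phi> (N (prev Q q) w) \<Longrightarrow> h q w = 0" "0 \<le> R"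
  shows "(\<lambda>w. riemann_sum Q (\<lambda>q. h q w) (\<lambda>u. N u w) t) \<in> borel_measurable (F t) \<and>
    integrable M (\<lambda>w. riemann_sum Q (\<lambda>q. h q w) (\<lambda>u. N u w) t) \<and>
    (\<integral>w. \<phi> (riemann_sum Q (\<lambda>q. h q w) (\<lambda>u. N u w) t) \<partial>M) \<le>
      1 + 4 * R\<^sup>2 * (R + 1) * (\<Sum>q\<in>Q \<inter> {0<..t}. \<integral>w. ((h q w)\<^sup>2 + \<bar>h q w\<bar>) * (\<phi> (N q w) - \<phi> (N (prev Q q) w)) \<partial>M)"
    (is "?G t \<in> _ \<and> integrable M (?G t) \<and> _ \<le> 1 + ?K * ?\<Sigma> t")
  using Q t
proof (induction t rule: time_grid_induct)
  case zero
  then show ?case by (simp add: \<phi>_0 prob_space)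
next
  case (step t)
  let ?p = "prev Q t"
  have p: "?p \<in> Q" "?p < t" "0 \<le> ?p"
    using prev_in[OF Q step(2)] prev_less[OF Q step(2)] prev_nonneg[OF Q step(2)] by auto
  have Nm: "N t \<in> borel_measurable (F t)" if "0 \<le> t" for t
    using N that by (auto simp: martingale_def adapted_def)
  have Gp: "?G ?p \<in> borel_measurable (F ?p)" and iGp: "integrable M (?G ?p)"
    and IH: "(\<integral>w. \<phi> (?G ?p w) \<partial>M) \<le> 1 + ?K * ?\<Sigma> ?p"
    using step(3) by auto
  have Gt: "?G t w = ?G ?p w + h t w * (N t w - N ?p w)" for w
    by (rule riemann_sum_step[OF Q step(1,2)])
  have ht: "h t \<in> borel_measurable (F ?p)" "\<And>w. w \<in> space M \<Longrightarrow> \<bar>h t w\<bar> \<le> C"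
    using h step by auto
  have pt: "?p \<le> t" using p by simp
  have [measurable]: "?G ?p \<in> borel_measurable (F t)" "h t \<in> borel_measurable (F t)"
    "N ?p \<in> borel_measurable (F t)" "N t \<in> borel_measurable (F t)"
    using measurable_F_mono[OF Gp pt] measurable_F_mono[OF ht(1) pt] measurable_F_mono[OF Nm[OF p(3)] pt] Nm[of t] step(2)
    by auto
  have G_meas: "?G t \<in> borel_measurable (F t)" unfolding Gt by measurable
  have iG: "integrable M (?G t)"
    unfolding Gt using martingale_increment(1)[OF N p(3) pt ht] iGp by simp
  have i\<phi>: "integrable M (\<lambda>w. \<phi> (g w))" if "integrable M g" for g :: "'a \<Rightarrow> real"
  proof (rule Bochner_Integration.integrable_bound)
    show "integrable M (\<lambda>w. 1 + \<bar>g w\<bar>)" using that by simp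
    show "(\<lambda>w. \<phi> (g w)) \<in> borel_measurable M" using borel_measurable_integrable[OF that] by measurable
    show "AE w in M. norm (\<phi> (g w)) \<le> norm (1 + \<bar>g w\<bar>)" using \<phi>_le \<phi>_pos by (intro AE_I2) (simp add: less_imp_le)
  qed
  \<comment> \<open>The tangent slope at the previous value times the weight: bounded by
    \<open>C\<close> and known at the left end of the cell.\<close>
  have \<psi>1: "(\<lambda>w. ?G ?p w / \<phi> (?G ?p w) * h t w) \<in> borel_measurable (F ?p)" using Gp ht(1) by measurable
  have \<psi>1b: "\<bar>?G ?p w / \<phi> (?G ?p w) * h t w\<bar> \<le> C" if "w \<in> space M" for w
    using ht(2)[OF that] abs_\<phi>_deriv_mult[of "?G ?p w" "h t w"] by simp
  note mid = martingale_increment[OF N p(3) pt \<psi>1 \<psi>1b]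
  let ?\<psi> = "\<lambda>w. (h t w)\<^sup>2 + \<bar>h t w\<bar>"
  have \<psi>2: "?\<psi> \<in> borel_measurable (F ?p)" using ht(1) by measurable
  have \<psi>2b: "\<bar>?\<psi> w\<bar> \<le> C\<^sup>2 + C" if "w \<in> space M" for w
    using power_mono[OF ht(2)[OF that], of 2] ht(2)[OF that] by simp
  note inc = martingale_\<phi>_increment[OF N p(3) pt \<psi>2 \<psi>2b]
  have "(\<integral>w. \<phi> (?G t w) \<partial>M) \<le>
    (\<integral>w. \<phi> (?G ?p w) + ?G ?p w / \<phi> (?G ?p w) * h t w * (N t w - N ?p w)
       + ?K * (?\<psi> w * \<phi>_excess (N ?p w) (N t w)) \<partial>M)"
  proof (rule integral_mono)
    fix w
    let ?e = "\<phi>_excess (?G ?p w) (?G ?p w + h t w * (N t w - N ?p w))"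
    have "\<phi> (?G t w) = \<phi> (?G ?p w) + ?G ?p w / \<phi> (?G ?p w) * h t w * (N t w - N ?p w) + ?e"
      unfolding Gt by (simp add: \<phi>_excess_def)
    moreover have "?e \<le> ?K * (?\<psi> w * \<phi>_excess (N ?p w) (N t w))"
    proof (cases "\<phi> (N ?p w) \<le> R")
      case True
      show ?thesis using \<phi>_excess_transform[OF True, of "?G ?p w" "h t w" "N t w - N ?p w"] by simp
    next
      case False
      then have "h t w = 0" using R(1)[OF step(1,2)] by simp
      then show ?thesis by (simp add: \<phi>_excess_def)
    qed
    ultimately show "\<phi> (?G t w) \<le> \<phi> (?G ?p w) + ?G ?p w / \<phi> (?G ?p w) * h t w * (N t w - N ?p w)
       + ?K * (?\<psi> w * \<phi>_excess (N ?p w) (N t w))" by simp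
  qed (intro Bochner_Integration.integrable_add i\<phi> iG iGp mid(1) integrable_mult_right inc(1))+
  also have "\<dots> = (\<integral>w. \<phi> (?G ?p w) \<partial>M) + (\<integral>w. ?G ?p w / \<phi> (?G ?p w) * h t w * (N t w - N ?p w) \<partial>M)
     + ?K * (\<integral>w. ?\<psi> w * \<phi>_excess (N ?p w) (N t w) \<partial>M)"
    using i\<phi>[OF iGp] mid(1) inc(1) by simp
  also have "\<dots> = (\<integral>w. \<phi> (?G ?p w) \<partial>M) + ?K * (\<integral>w. ?\<psi> w * (\<phi> (N t w) - \<phi> (N ?p w)) \<partial>M)"
  proof -
    have "(\<integral>w. ?G ?p w / \<phi> (?G ?p w) * h t w * (N t w - N ?p w) \<partial>M) = 0" using mid(2) .
    moreover have "(\<integral>w. ?\<psi> w * \<phi>_excess (N ?p w) (N t w) \<partial>M) = (\<integral>w. ?\<psi> w * (\<phi> (N t w) - \<phi> (N ?p w)) \<partial>M)"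
      using inc(2) .
    ultimately show ?thesis by (simp only: add_0_right)
  qed
  also have "\<dots> \<le> 1 + ?K * ?\<Sigma> t"
    using IH time_grid_Ioc_step[OF Q step(1,2,2) time_gridD(2)[OF Q]] time_gridD(1)[OF Q]
    by (simp add: distrib_left)
  finally show ?case using G_meas iG by simp
qed

text \<open>The integrand is switched off on cells at whose left end \<open>\<phi> (N)\<close>
  exceeds \<open>R\<close>. By Doob's inequality this alters the sum with small probability only,
  and the altered sum is small by the estimate for transforms.\<close>

lemma martingale_controlled:
  assumes N: "martingale M F N" and rc: "AE w in M. \<forall>t\<ge>0. continuous (at_right t) (\<lambda>t. N t w)" and T: "0 \<le> T"
  shows "controlled N T"
  unfolding controlled_def
proof (intro allI impI)
  fix d :: real assume d: "0 < d"
  let ?S = "\<lambda>t w. \<phi> (N (min t T) w)"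
  define E0 where "E0 = (\<integral>w. \<phi> (N T w) \<partial>M)"
  have i\<phi>T: "integrable M (\<lambda>w. \<phi> (N T w))" using martingale_\<phi>_increment(4)[OF N, of 0 T "\<lambda>_. 0" 0] T by simp
  have E0: "0 \<le> E0" unfolding E0_def using \<phi>_pos by (intro integral_nonneg_AE) (simp add: less_imp_le)
  \<comment> \<open>\<open>d\<close> is split into \<open>d / 4\<close> for the probability of
    exceeding \<open>R\<close>, \<open>d / 4\<close> for the parameter of
    \<open>min_1_abs_le_\<phi>\<close>, and \<open>d / 2\<close> for its second term, which
    determines \<open>\<epsilon>\<close>.\<close>
  define R where "R = 4 * E0 / d + 1"
  have R: "0 < R" "E0 / R \<le> d / 4" using E0 d by (auto simp: R_def field_simps add_nonneg_pos add_pos_pos)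
  define K where "K = 4 * R\<^sup>2 * (R + 1)"
  have K: "0 < K" using R by (simp add: K_def)
  define \<epsilon> where "\<epsilon> = d\<^sup>2 / (24 * K)"
  have \<epsilon>: "0 < \<epsilon>" "3 * (K * \<epsilon>) / (d / 4) = d / 2"
    using K d by (simp_all add: \<epsilon>_def power2_eq_square)
  obtain \<nu> \<eta> where \<nu>: "finite_measure \<nu>" "sets \<nu> = sets \<P>" "0 < \<eta>"
    "\<And>Q h. elementary_predictable Q h \<Longrightarrow> T \<in> Q \<Longrightarrow>
      energy \<nu> h \<le> ennreal \<eta> \<Longrightarrow>
      (\<Sum>q\<in>Q \<inter> {0<..T}. \<integral>w. ((h q w)\<^sup>2 + \<bar>h q w\<bar>) * (?S q w - ?S (prev Q q) w) \<partial>M) \<le> \<epsilon>"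
    by (rule doleans_small[OF martingale_doleans_submartingale[OF N rc T] \<epsilon>(1)]) blast
  have main: "L0 (path_sum Q h N T) \<le> d"
    if h: "elementary_predictable Q h" and TQ: "T \<in> Q" and small: "energy \<nu> h \<le> ennreal \<eta>" for Q h
  proof -
    note Q = elementary_predictableD(1)[OF h]
    obtain C where C: "\<And>s w. 0 \<le> s \<Longrightarrow> w \<in> space M \<Longrightarrow> \<bar>h s w\<bar> \<le> C"
      using h unfolding elementary_predictable_def by auto
    have Nm: "N t \<in> borel_measurable (F t)" if "0 \<le> t" for t
      using N that by (auto simp: martingale_def adapted_def)
    define h' where "h' q w = (if \<phi> (N (prev Q q) w) \<le> R then h q w else 0)" for q w
    let ?G = "\<lambda>w. riemann_sum Q (\<lambda>q. h' q w) (\<lambda>u. N u w) T"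
    let ?\<Sigma> = "\<lambda>h. \<Sum>q\<in>Q \<inter> {0<..T}. \<integral>w. ((h q w)\<^sup>2 + \<bar>h q w\<bar>) * (\<phi> (N q w) - \<phi> (N (prev Q q) w)) \<partial>M"
    have "integrable M ?G \<and> (\<integral>w. \<phi> (?G w) \<partial>M) \<le> 1 + K * ?\<Sigma> h'"
      unfolding K_def
    proof (rule martingale_transform_\<phi>[OF N Q TQ, THEN conjunct2])
      fix q assume q: "q \<in> Q" "0 < q"
      have [measurable]: "h q \<in> borel_measurable (F (prev Q q))" "N (prev Q q) \<in> borel_measurable (F (prev Q q))"
        using elementary_predictableD(4)[OF h q(2)] Nm[OF prev_nonneg[OF Q q(2)]] by auto
      show "h' q \<in> borel_measurable (F (prev Q q))" unfolding h'_def by measurable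
    next
      show "\<bar>h' q w\<bar> \<le> max C 0" if "q \<in> Q" "w \<in> space M" for q w
        using C[of q w] time_gridD(3)[OF Q] that by (auto simp: h'_def)
    qed (use R in \<open>auto simp: h'_def\<close>)
    moreover have "?\<Sigma> h' \<le> \<epsilon>"
    proof -
      \<comment> \<open>Increments of \<open>\<phi> (N)\<close> have no sign, so the comparison of
        weights goes through the equal means of \<open>\<phi>_excess\<close>, which is nonnegative
        on every path.\<close>
      have "?\<Sigma> h' \<le> ?\<Sigma> h"
      proof (rule sum_mono)
        fix q assume "q \<in> Q \<inter> {0<..T}"
        then have q: "q \<in> Q" "0 < q" "0 \<le> prev Q q" "prev Q q \<le> q"
          using prev_nonneg[OF Q, of q] prev_less[OF Q, of q] by auto
        have [measurable]: "h q \<in> borel_measurable (F (prev Q q))" "N (prev Q q) \<in> borel_measurable (F (prev Q q))"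
          using elementary_predictableD(4)[OF h q(2)] Nm[OF q(3)] by auto
        have m: "(\<lambda>w. (h q w)\<^sup>2 + \<bar>h q w\<bar>) \<in> borel_measurable (F (prev Q q))"
          "(\<lambda>w. (h' q w)\<^sup>2 + \<bar>h' q w\<bar>) \<in> borel_measurable (F (prev Q q))"
          unfolding h'_def by measurable
        have b: "\<bar>(h q w)\<^sup>2 + \<bar>h q w\<bar>\<bar> \<le> C\<^sup>2 + C" if "w \<in> space M" for w
          using power_mono[OF C[OF less_imp_le[OF q(2)] that], of 2] C[OF less_imp_le[OF q(2)] that] by simp
        have b': "\<bar>(h' q w)\<^sup>2 + \<bar>h' q w\<bar>\<bar> \<le> C\<^sup>2 + C" if "w \<in> space M" for w
        proof -
          have "(h' q w)\<^sup>2 + \<bar>h' q w\<bar> \<le> (h q w)\<^sup>2 + \<bar>h q w\<bar>" by (simp add: h'_def)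
          then show ?thesis using b[OF that] by simp
        qed
        note inc = martingale_\<phi>_increment[OF N q(3,4) m(1) b] and inc' = martingale_\<phi>_increment[OF N q(3,4) m(2) b']
        show "(\<integral>w. ((h' q w)\<^sup>2 + \<bar>h' q w\<bar>) * (\<phi> (N q w) - \<phi> (N (prev Q q) w)) \<partial>M)
          \<le> (\<integral>w. ((h q w)\<^sup>2 + \<bar>h q w\<bar>) * (\<phi> (N q w) - \<phi> (N (prev Q q) w)) \<partial>M)"
        proof -
          have "(\<integral>w. ((h' q w)\<^sup>2 + \<bar>h' q w\<bar>) * (\<phi> (N q w) - \<phi> (N (prev Q q) w)) \<partial>M)
            = (\<integral>w. ((h' q w)\<^sup>2 + \<bar>h' q w\<bar>) * \<phi>_excess (N (prev Q q) w) (N q w) \<partial>M)"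
            by (rule inc'(2)[symmetric])
          also have "\<dots> \<le> (\<integral>w. ((h q w)\<^sup>2 + \<bar>h q w\<bar>) * \<phi>_excess (N (prev Q q) w) (N q w) \<partial>M)"
          proof (rule integral_mono)
            show "integrable M (\<lambda>w. ((h' q w)\<^sup>2 + \<bar>h' q w\<bar>) * \<phi>_excess (N (prev Q q) w) (N q w))"
              using inc'(1) .
            show "integrable M (\<lambda>w. ((h q w)\<^sup>2 + \<bar>h q w\<bar>) * \<phi>_excess (N (prev Q q) w) (N q w))"
              using inc(1) .
            show "((h' q w)\<^sup>2 + \<bar>h' q w\<bar>) * \<phi>_excess (N (prev Q q) w) (N q w)
              \<le> ((h q w)\<^sup>2 + \<bar>h q w\<bar>) * \<phi>_excess (N (prev Q q) w) (N q w)" for w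
              by (rule mult_right_mono[OF _ \<phi>_excess_nonneg]) (simp add: h'_def)
          qed
          also have "\<dots> = (\<integral>w. ((h q w)\<^sup>2 + \<bar>h q w\<bar>) * (\<phi> (N q w) - \<phi> (N (prev Q q) w)) \<partial>M)"
            by (rule inc(2))
          finally show ?thesis .
        qed
      qed
      moreover have "?\<Sigma> h = (\<Sum>q\<in>Q \<inter> {0<..T}. \<integral>w. ((h q w)\<^sup>2 + \<bar>h q w\<bar>) * (?S q w - ?S (prev Q q) w) \<partial>M)"
        using prev_less[OF Q] by (intro sum.cong Bochner_Integration.integral_cong) (force simp: min_def)+
      ultimately show ?thesis using \<nu>(4)[OF h TQ small] by simp
    qed
    ultimately have G: "integrable M ?G" "(\<integral>w. \<phi> (?G w) \<partial>M) \<le> 1 + K * \<epsilon>"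
      using K by (auto intro: order_trans)
    have i\<phi>G: "integrable M (\<lambda>w. \<phi> (?G w))"
    proof (rule Bochner_Integration.integrable_bound)
      show "integrable M (\<lambda>w. 1 + \<bar>?G w\<bar>)" using G(1) by simp
      show "(\<lambda>w. \<phi> (?G w)) \<in> borel_measurable M" using borel_measurable_integrable[OF G(1)] by measurable
      show "AE w in M. norm (\<phi> (?G w)) \<le> norm (1 + \<bar>?G w\<bar>)" using \<phi>_le \<phi>_pos by (intro AE_I2) (simp add: less_imp_le)
    qed
    let ?C = "{w \<in> space M. \<exists>q\<in>Q. q \<le> T \<and> R < \<phi> (N q w)}"
    have Cm: "?C \<in> sets M" and PC: "R * prob ?C \<le> (\<integral>w. indicator ?C w * \<phi> (N T w) \<partial>M)"
      by (rule sets_F_M[OF martingale_maximal[OF N Q TQ, THEN conjunct1]], rule martingale_maximal[OF N Q TQ, THEN conjunct2])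
    have "(\<integral>w. indicator ?C w * \<phi> (N T w) \<partial>M) \<le> E0"
      unfolding E0_def
    proof (rule integral_mono[OF _ i\<phi>T])
      show "integrable M (\<lambda>w. indicator ?C w * \<phi> (N T w))"
        using Cm by (intro integrable_bounded_mult[OF i\<phi>T, of _ 1]) (auto simp: indicator_le_1)
      show "indicator ?C w * \<phi> (N T w) \<le> \<phi> (N T w)" for w using \<phi>_pos[of "N T w"] by (simp add: indicator_def)
    qed
    then have "R * prob ?C \<le> E0" using PC by (rule order_trans[rotated])
    then have "prob ?C \<le> E0 / R" using R(1) by (simp add: pos_le_divide_eq mult.commute)
    then have PC': "prob ?C \<le> d / 4" using R(2) by (rule order_trans)
    have iC: "integrable M (indicator ?C :: 'a \<Rightarrow> real)" "(\<integral>w. indicator ?C w \<partial>M) = prob ?C"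
      using integrable_bounded_mult[of "\<lambda>_. 1" "indicator ?C" 1] Cm by (simp_all add: indicator_le_1)
    have iG: "integrable M (\<lambda>w. d / 4 + 3 * (\<phi> (?G w) - 1) / (d / 4))"
      by (intro Bochner_Integration.integrable_add integrable_divide integrable_mult_right
          Bochner_Integration.integrable_diff i\<phi>G) simp_all
    \<comment> \<open>On \<open>?C\<close> the truncated value is at most 1; off \<open>?C\<close>
      the altered and the original sum coincide.\<close>
    have "L0 (path_sum Q h N T)
      \<le> (\<integral>w. indicator ?C w + (d / 4 + 3 * (\<phi> (?G w) - 1) / (d / 4)) \<partial>M)"
    proof (rule integral_mono')
      show "integrable M (\<lambda>w. indicator ?C w + (d / 4 + 3 * (\<phi> (?G w) - 1) / (d / 4)))"
        by (rule Bochner_Integration.integrable_add[OF iC(1) iG])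
      fix w assume w: "w \<in> space M"
      have nn: "0 \<le> d / 4 + 3 * (\<phi> (?G w) - 1) / (d / 4)" using d \<phi>_ge_1[of "?G w"] by simp
      then show "0 \<le> indicator ?C w + (d / 4 + 3 * (\<phi> (?G w) - 1) / (d / 4))" by simp
      show "min 1 \<bar>path_sum Q h N T w\<bar>
        \<le> indicator ?C w + (d / 4 + 3 * (\<phi> (?G w) - 1) / (d / 4))"
      proof (cases "w \<in> ?C")
        case True
        then have "indicator ?C w = (1::real)" by simp
        then show ?thesis using nn by linarith
      next
        case False
        have "path_sum Q h N T w = ?G w"
          unfolding riemann_sum_def
        proof (rule sum.cong)
          fix q assume q: "q \<in> Q \<inter> {0<..T}"
          then have "prev Q q \<in> Q" "prev Q q \<le> T" using prev_in[OF Q, of q] prev_less[OF Q, of q] by auto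
          then have "\<phi> (N (prev Q q) w) \<le> R" using False w by (auto simp: not_less)
          then show "h q w * (N q w - N (prev Q q) w) = h' q w * (N q w - N (prev Q q) w)" by (simp add: h'_def)
        qed simp
        moreover have "min 1 \<bar>?G w\<bar> \<le> d / 4 + 3 * (\<phi> (?G w) - 1) / (d / 4)"
          using d by (intro min_1_abs_le_\<phi>) simp
        ultimately show ?thesis using False by simp
      qed
    qed
    also have "\<dots> = prob ?C + (d / 4 + 3 * ((\<integral>w. \<phi> (?G w) \<partial>M) - 1) / (d / 4))"
    proof -
      have "(\<integral>w. d / 4 + 3 * (\<phi> (?G w) - 1) / (d / 4) \<partial>M) = d / 4 + 3 * ((\<integral>w. \<phi> (?G w) \<partial>M) - 1) / (d / 4)"
        using i\<phi>G by (subst Bochner_Integration.integral_add) (simp_all add: prob_space)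
      then show ?thesis unfolding Bochner_Integration.integral_add[OF iC(1) iG] iC(2) by simp
    qed
    also have "\<dots> \<le> d / 4 + (d / 4 + 3 * (K * \<epsilon>) / (d / 4))"
      using PC' G(2) d by (intro add_mono divide_right_mono) auto
    also have "\<dots> = d" unfolding \<epsilon>(2) by simp
    finally show ?thesis .
  qed
  show "\<exists>\<nu>. finite_measure \<nu> \<and> sets \<nu> = sets \<P> \<and>
     (\<exists>\<eta>>0. \<forall>Q h. elementary_predictable Q h \<longrightarrow> T \<in> Q \<longrightarrow>
        energy \<nu> h \<le> ennreal \<eta> \<longrightarrow>
        L0 (path_sum Q h N T) \<le> d)"
    using \<nu>(1,2,3) main by blast
qed

end

subsection \<open>Variation along dyadic grids\<close>

text \<open>Only sampling times up to \<open>t\<close> enter, which keeps the process adapted, and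
  one grid serves all \<open>t\<close>, so that variation over consecutive dyadic intervals adds
  up.\<close>

definition dyadic_variation :: "(real \<Rightarrow> real) \<Rightarrow> nat \<Rightarrow> real \<Rightarrow> real" where
  "dyadic_variation f n t = (\<Sum>k<nat \<lfloor>t * 2 ^ n\<rfloor>. \<bar>f (real (Suc k) / 2 ^ n) - f (real k / 2 ^ n)\<bar>)"

lemma dyadic_variation_nonneg: "0 \<le> dyadic_variation f n t"
  by (simp add: dyadic_variation_def sum_nonneg)

lemma dyadic_variation_mono: "s \<le> t \<Longrightarrow> dyadic_variation f n s \<le> dyadic_variation f n t"
  unfolding dyadic_variation_def
  by (intro sum_mono2) (auto intro!: nat_mono floor_mono mult_right_mono order_less_le_trans)

text \<open>The midpoint is inserted into every cell; rounding down can only add a further cell at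
  the end.\<close>

lemma dyadic_variation_Suc:
  assumes "0 \<le> t" shows "dyadic_variation f n t \<le> dyadic_variation f (Suc n) t"
proof -
  have fine: "(\<Sum>k<m. \<bar>f (real (Suc k) / 2 ^ n) - f (real k / 2 ^ n)\<bar>)
    \<le> (\<Sum>k<2 * m. \<bar>f (real (Suc k) / 2 ^ Suc n) - f (real k / 2 ^ Suc n)\<bar>)" for m
  proof (induction m)
    case (Suc m)
    have e: "real m / 2 ^ n = real (2 * m) / 2 ^ Suc n" "real (Suc m) / 2 ^ n = real (Suc (Suc (2 * m))) / 2 ^ Suc n"
      by (simp_all add: field_simps)
    have "\<bar>f (real (Suc m) / 2 ^ n) - f (real m / 2 ^ n)\<bar> \<le>
      \<bar>f (real (Suc (Suc (2 * m))) / 2 ^ Suc n) - f (real (Suc (2 * m)) / 2 ^ Suc n)\<bar> +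
      \<bar>f (real (Suc (2 * m)) / 2 ^ Suc n) - f (real (2 * m) / 2 ^ Suc n)\<bar>"
      unfolding e by linarith
    moreover have "2 * Suc m = Suc (Suc (2 * m))" by simp
    ultimately show ?case using Suc by (simp only: sum.lessThan_Suc)
  qed simp
  have "2 * nat \<lfloor>t * 2 ^ n\<rfloor> \<le> nat \<lfloor>t * 2 ^ Suc n\<rfloor>"
  proof -
    have "of_int \<lfloor>t * 2 ^ n\<rfloor> \<le> t * 2 ^ n" by (rule of_int_floor_le)
    then have "of_int (2 * \<lfloor>t * 2 ^ n\<rfloor>) \<le> t * 2 ^ Suc n" by simp
    then have "2 * \<lfloor>t * 2 ^ n\<rfloor> \<le> \<lfloor>t * 2 ^ Suc n\<rfloor>" by (simp only: le_floor_iff)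
    then show ?thesis using assms by (simp add: nat_le_eq_zle)
  qed
  then have "(\<Sum>k<2 * nat \<lfloor>t * 2 ^ n\<rfloor>. \<bar>f (real (Suc k) / 2 ^ Suc n) - f (real k / 2 ^ Suc n)\<bar>)
    \<le> dyadic_variation f (Suc n) t"
    unfolding dyadic_variation_def by (intro sum_mono2) auto
  then show ?thesis using fine[of "nat \<lfloor>t * 2 ^ n\<rfloor>"] unfolding dyadic_variation_def by (rule order_trans[rotated])
qed

lemma dyadic_variation_increment:
  assumes "i \<le> j"
  shows "\<bar>f (real j / 2 ^ n) - f (real i / 2 ^ n)\<bar> \<le>
    dyadic_variation f n (real j / 2 ^ n) - dyadic_variation f n (real i / 2 ^ n)"
proof -
  have n: "nat \<lfloor>real k / 2 ^ n * 2 ^ n\<rfloor> = k" for k by simp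
  show ?thesis
    unfolding dyadic_variation_def n using assms
  proof (induction j rule: dec_induct)
    case (step j)
    then show ?case by (simp only: sum.lessThan_Suc)
  qed simp
qed

lemma dyadic_variation_increment':
  assumes "i \<le> j" "m \<le> n"
  shows "\<bar>f (real j / 2 ^ m) - f (real i / 2 ^ m)\<bar> \<le>
    dyadic_variation f n (real j / 2 ^ m) - dyadic_variation f n (real i / 2 ^ m)"
proof -
  have "real k / 2 ^ m = real (k * 2 ^ (n - m)) / 2 ^ n" for k
    using assms(2) by (simp add: field_simps flip: power_add)
  then show ?thesis using dyadic_variation_increment[of "i * 2 ^ (n - m)" "j * 2 ^ (n - m)" f n] assms(1) by simp
qed

lemma dyadic_between:
  assumes "0 \<le> x" "x < y"
  obtains n :: nat where "\<And>m. n \<le> m \<Longrightarrow> \<exists>k. x < real k / 2 ^ m \<and> real k / 2 ^ m < y"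
proof -
  obtain n where n: "1 / (y - x) < 2 ^ n" using real_arch_pow[of 2 "1 / (y - x)"] by auto
  have "\<exists>k. x < real k / 2 ^ m \<and> real k / 2 ^ m < y" if "n \<le> m" for m
  proof -
    have "1 / (y - x) < 2 ^ m" using n that by (meson less_le_trans one_le_numeral power_increasing)
    then have m: "1 / 2 ^ m < y - x" using assms by (simp add: field_simps)
    define k where "k = nat \<lfloor>x * 2 ^ m\<rfloor> + 1"
    have k: "real k = of_int \<lfloor>x * 2 ^ m\<rfloor> + 1" using assms by (simp add: k_def)
    have "x * 2 ^ m < real k" "real k \<le> x * 2 ^ m + 1" unfolding k by linarith+
    then have "x < real k / 2 ^ m" "real k / 2 ^ m \<le> x + 1 / 2 ^ m" by (simp_all add: field_simps)
    then show ?thesis using m by (intro exI[of _ k]) linarith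
  qed
  then show ?thesis using that by blast
qed

lemma dyadic_variation_bounded:
  assumes "bounded_variation_path f t" "0 \<le> t"
  obtains C where "\<And>n. dyadic_variation f n t \<le> C"
proof -
  obtain C where C: "\<And>(n::nat) p. mono p \<Longrightarrow> range p \<subseteq> {0..t} \<Longrightarrow> (\<Sum>i<n. \<bar>f (p (Suc i)) - f (p i)\<bar>) \<le> C"
    using assms(1) unfolding bounded_variation_path_def by blast
  have "dyadic_variation f n t \<le> C" for n
  proof -
    define N where "N = nat \<lfloor>t * 2 ^ n\<rfloor>"
    \<comment> \<open>The subdivision is continued as a constant after index \<open>N\<close>, since
      a monotone sequence on all naturals is required.\<close>
    define p where "p i = real (min i N) / 2 ^ n" for i
    have "real N \<le> t * 2 ^ n" unfolding N_def using assms(2) by (simp add: of_nat_floor)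
    then have "real N / 2 ^ n \<le> t" by (simp add: field_simps)
    moreover have "real (min i N) / 2 ^ n \<le> real N / 2 ^ n" for i by (intro divide_right_mono) auto
    ultimately have "real (min i N) / 2 ^ n \<le> t" for i by (rule order_trans[rotated])
    then have "range p \<subseteq> {0..t}" unfolding p_def by (intro image_subsetI) simp
    moreover have "mono p" unfolding p_def mono_def by (auto intro!: divide_right_mono simp: min_def)
    ultimately have "(\<Sum>i<N. \<bar>f (p (Suc i)) - f (p i)\<bar>) \<le> C" by (intro C)
    moreover have "(\<Sum>i<N. \<bar>f (p (Suc i)) - f (p i)\<bar>) = dyadic_variation f n t"
      unfolding dyadic_variation_def N_def[symmetric]
    proof (rule sum.cong)
      fix i assume "i \<in> {..<N}"
      then have "p (Suc i) = real (Suc i) / 2 ^ n" "p i = real i / 2 ^ n" unfolding p_def by (simp_all add: min_absorb1)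
      then show "\<bar>f (p (Suc i)) - f (p i)\<bar> = \<bar>f (real (Suc i) / 2 ^ n) - f (real i / 2 ^ n)\<bar>" by simp
    qed simp
    ultimately show ?thesis by simp
  qed
  then show ?thesis using that by blast
qed

text \<open>The truncation makes the variation process integrable, and the infimum over later times makes it
  right-continuous, as is required for its Doleans measure to exist.\<close>

definition truncated_variation :: "(real \<Rightarrow> real) \<Rightarrow> real \<Rightarrow> real \<Rightarrow> real" where
  "truncated_variation f K t = (SUP n. min K (dyadic_variation f n t))"

definition right_variation :: "(real \<Rightarrow> real) \<Rightarrow> real \<Rightarrow> real \<Rightarrow> real" where
  "right_variation f K t = (INF j. truncated_variation f K (t + 1 / real (Suc j)))"

context
  fixes f :: "real \<Rightarrow> real" and K :: real
  assumes K: "0 \<le> K"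
begin

lemma truncated_variation_bdd: "bdd_above (range (\<lambda>n. min K (dyadic_variation f n t)))"
  by (rule bdd_aboveI[of _ K]) auto

lemma truncated_variation_range: "0 \<le> truncated_variation f K t" "truncated_variation f K t \<le> K"
proof -
  show "truncated_variation f K t \<le> K" unfolding truncated_variation_def by (rule cSUP_least) auto
  have "0 \<le> min K (dyadic_variation f 0 t)" using K dyadic_variation_nonneg by simp
  then show "0 \<le> truncated_variation f K t"
    unfolding truncated_variation_def by (rule cSUP_upper2[OF truncated_variation_bdd _, rotated]) simp
qed

lemma truncated_variation_mono: "s \<le> t \<Longrightarrow> truncated_variation f K s \<le> truncated_variation f K t"
  unfolding truncated_variation_def
proof (rule cSUP_mono[OF _ truncated_variation_bdd])
  show "\<exists>m\<in>UNIV. min K (dyadic_variation f n s) \<le> min K (dyadic_variation f m t)" if "s \<le> t" for n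
    by (intro bexI[of _ n] min.mono dyadic_variation_mono that order_refl UNIV_I)
qed simp_all

lemma right_variation_bdd: "bdd_below (range (\<lambda>j. truncated_variation f K (t + 1 / real (Suc j))))"
  by (rule bdd_belowI[of _ 0]) (auto simp: truncated_variation_range)

lemma right_variation_le: "t < u \<Longrightarrow> right_variation f K t \<le> truncated_variation f K u"
proof -
  assume "t < u"
  then obtain j where "1 / real (Suc j) < u - t" using nat_approx_posE[of "u - t"] by auto
  then have "truncated_variation f K (t + 1 / real (Suc j)) \<le> truncated_variation f K u"
    by (intro truncated_variation_mono) simp
  then show ?thesis unfolding right_variation_def by (rule cINF_lower2[OF right_variation_bdd, rotated]) simp
qed

lemma right_variation_greatest: "(\<And>u. t < u \<Longrightarrow> c \<le> truncated_variation f K u) \<Longrightarrow> c \<le> right_variation f K t"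
  unfolding right_variation_def by (rule cINF_greatest) auto

lemma right_variation_range: "0 \<le> right_variation f K t" "right_variation f K t \<le> K"
proof -
  show "0 \<le> right_variation f K t" by (rule right_variation_greatest) (rule truncated_variation_range)
  have "right_variation f K t \<le> truncated_variation f K (t + 1)" by (rule right_variation_le) simp
  then show "right_variation f K t \<le> K" using truncated_variation_range(2) by (rule order_trans)
qed

lemma right_variation_mono: "s \<le> t \<Longrightarrow> right_variation f K s \<le> right_variation f K t"
  by (rule right_variation_greatest) (auto intro: right_variation_le)

lemma right_variation_limit: "(\<lambda>j. truncated_variation f K (t + 1 / real (Suc j))) \<longlonglongrightarrow> right_variation f K t"
  unfolding right_variation_def
proof (rule LIMSEQ_decseq_INF[OF right_variation_bdd])
  show "decseq (\<lambda>j. truncated_variation f K (t + 1 / real (Suc j)))"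
    by (intro decseq_SucI truncated_variation_mono) (simp add: frac_le)
qed

text \<open>Between dyadic times an increment is bounded by the variation at any finer level, and by
  right-continuity arbitrary times are approached from the right. The extra unit in
  \<open>T + 1\<close> leaves room to the right of \<open>T\<close>.\<close>

lemma right_variation_increment:
  assumes rc: "\<And>t. 0 \<le> t \<Longrightarrow> continuous (at_right t) f" and bd: "\<And>n. dyadic_variation f n (T + 1) \<le> K"
    and st: "0 \<le> s" "s \<le> t" "t \<le> T"
  shows "\<bar>f t - f s\<bar> \<le> right_variation f K t - right_variation f K s"
proof (cases "s = t")
  case False
  then have st': "s < t" using st by simp
  have tv: "truncated_variation f K u = (SUP n. dyadic_variation f n u)" if "u \<le> T + 1" for u
  proof -
    have "min K (dyadic_variation f n u) = dyadic_variation f n u" for n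
      using order_trans[OF dyadic_variation_mono[OF that, of f n] bd] by (simp add: min_absorb2)
    then show ?thesis by (simp add: truncated_variation_def)
  qed
  have key: "right_variation f K s + \<bar>f t - f s\<bar> - e \<le> truncated_variation f K u" if e: "0 < e" and u: "t < u" for e u
  proof -
    have near: "\<exists>d>0. \<forall>y. x < y \<and> y < x + d \<longrightarrow> \<bar>f y - f x\<bar> < e / 2" if "0 \<le> x" for x
    proof -
      have "(f \<longlongrightarrow> f x) (at_right x)" using rc[OF that] by (simp add: continuous_within)
      then have "\<forall>\<^sub>F y in at_right x. dist (f y) (f x) < e / 2" by (rule tendstoD) (use e in simp)
      then obtain b where "x < b" "\<And>y. x < y \<Longrightarrow> y < b \<Longrightarrow> dist (f y) (f x) < e / 2"
        by (auto simp: eventually_at_right_field)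
      then show ?thesis by (intro exI[of _ "b - x"]) (auto simp: dist_real_def)
    qed
    obtain d1 where d1: "0 < d1" "\<And>y. t < y \<Longrightarrow> y < t + d1 \<Longrightarrow> \<bar>f y - f t\<bar> < e / 2" using near[of t] st by auto
    obtain d2 where d2: "0 < d2" "\<And>y. s < y \<Longrightarrow> y < s + d2 \<Longrightarrow> \<bar>f y - f s\<bar> < e / 2" using near[of s] st by auto
    \<comment> \<open>Dyadic times shortly after \<open>t\<close> and \<open>s\<close>: the first
      stays below \<open>u\<close> and \<open>T + 1\<close>, the second below \<open>t\<close>, and
      each moves \<open>f\<close> by less than \<open>e / 2\<close>.\<close>
    obtain n1 where n1: "\<And>m. n1 \<le> m \<Longrightarrow> \<exists>k. t < real k / 2 ^ m \<and> real k / 2 ^ m < min (min u (t + d1)) (T + 1)"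
      by (rule dyadic_between[of t "min (min u (t + d1)) (T + 1)"]) (use st u d1 in auto)
    obtain n2 where n2: "\<And>m. n2 \<le> m \<Longrightarrow> \<exists>k. s < real k / 2 ^ m \<and> real k / 2 ^ m < min t (s + d2)"
      by (rule dyadic_between[of s "min t (s + d2)"]) (use st st' d2 in auto)
    define m where "m = max n1 n2"
    obtain j i where j: "t < real j / 2 ^ m" "real j / 2 ^ m < min (min u (t + d1)) (T + 1)"
      and i: "s < real i / 2 ^ m" "real i / 2 ^ m < min t (s + d2)"
      using n1[of m] n2[of m] by (auto simp: m_def)
    let ?t = "real j / 2 ^ m" let ?s = "real i / 2 ^ m"
    have "?s < ?t" using i j by linarith
    then have ij: "i \<le> j" by (simp add: divide_less_cancel)
    have bdd: "bdd_above (range (\<lambda>n. dyadic_variation f n v))" if "v \<le> T + 1" for v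
      using order_trans[OF dyadic_variation_mono[OF that] bd] by (intro bdd_aboveI[of _ K]) auto
    have "truncated_variation f K ?s \<le> truncated_variation f K ?t - \<bar>f ?t - f ?s\<bar>"
    proof -
      have "dyadic_variation f n ?s \<le> truncated_variation f K ?t - \<bar>f ?t - f ?s\<bar>" for n
      proof -
        have "dyadic_variation f n ?s \<le> dyadic_variation f (max n m) ?s"
          by (rule lift_Suc_mono_le[of "\<lambda>n. dyadic_variation f n ?s"]) (auto intro: dyadic_variation_Suc)
        also have "\<dots> \<le> dyadic_variation f (max n m) ?t - \<bar>f ?t - f ?s\<bar>"
          using dyadic_variation_increment'[OF ij, of m "max n m" f] by simp
        also have "dyadic_variation f (max n m) ?t \<le> truncated_variation f K ?t"
          using j by (subst tv) (auto intro!: cSUP_upper bdd)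
        finally show ?thesis by simp
      qed
      then show ?thesis using i st by (subst tv) (auto intro!: cSUP_least)
    qed
    moreover have "truncated_variation f K ?t \<le> truncated_variation f K u" using j by (intro truncated_variation_mono) simp
    moreover have "right_variation f K s \<le> truncated_variation f K ?s" by (rule right_variation_le[OF i(1)])
    moreover have "\<bar>f ?t - f t\<bar> < e / 2" "\<bar>f ?s - f s\<bar> < e / 2" using d1(2)[of ?t] d2(2)[of ?s] i j by auto
    ultimately show ?thesis by linarith
  qed
  have "right_variation f K s + \<bar>f t - f s\<bar> \<le> right_variation f K t"
  proof (rule field_le_epsilon)
    fix e :: real assume "0 < e"
    have "right_variation f K s + \<bar>f t - f s\<bar> - e \<le> right_variation f K t"
      by (rule right_variation_greatest) (rule key[OF \<open>0 < e\<close>])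
    then show "right_variation f K s + \<bar>f t - f s\<bar> \<le> right_variation f K t + e" by linarith
  qed
  then show ?thesis by linarith
qed simp

end

section \<open>Processes of finite variation are controlled\<close>

context usual_filtered_prob_space
begin

lemma measurable_F_right:
  assumes t: "0 \<le> t" and f: "\<And>u. t < u \<Longrightarrow> f \<in> borel_measurable (F u)"
  shows "f \<in> borel_measurable (F t)"
proof (rule measurableI)
  fix B :: "'b set" assume "B \<in> sets borel"
  then have "f -` B \<inter> space M \<in> sets (F u)" if "t < u" for u
    using measurable_sets[OF f[OF that]] by (simp add: space_F)
  then show "f -` B \<inter> space (F t) \<in> sets (F t)" using right_continuous_F[OF t] by (simp add: space_F)
qed auto

text \<open>The process increases, so the submartingale property is monotonicity. Its value at
  \<open>t\<close> looks slightly into the future, which right-continuity of the filtration permits;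
  dominated convergence gives right-continuity of the mean.\<close>

lemma right_variation_submartingale:
  assumes A: "adapted F A" and K: "0 \<le> K" and T: "0 \<le> T"
  shows "right_continuous_submartingale (\<lambda>t w. right_variation (\<lambda>s. A s w) K (min t T)) T"
proof -
  have Am: "A t \<in> borel_measurable (F t)" if "0 \<le> t" for t using A that by (simp add: adapted_def)
  have W: "(\<lambda>w. dyadic_variation (\<lambda>s. A s w) n t) \<in> borel_measurable (F t)" if t: "0 \<le> t" for n t
  proof -
    have "A (real k / 2 ^ n) \<in> borel_measurable (F t)" if k: "k \<le> nat \<lfloor>t * 2 ^ n\<rfloor>" for k
    proof (rule measurable_F_mono[OF Am])
      have "real k \<le> t * 2 ^ n" using k t by (meson of_nat_floor of_nat_le_iff order_trans zero_le_mult_iff zero_le_numeral zero_le_power)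
      then show "real k / 2 ^ n \<le> t" by (simp add: field_simps)
    qed simp
    then show ?thesis unfolding dyadic_variation_def
      by (intro borel_measurable_sum borel_measurable_abs borel_measurable_diff; simp only: lessThan_iff Suc_leI less_imp_le)
  qed
  have V: "(\<lambda>w. truncated_variation (\<lambda>s. A s w) K t) \<in> borel_measurable (F t)" if "0 \<le> t" for t
    unfolding truncated_variation_def
  proof (rule borel_measurable_cSUP)
    show "(\<lambda>w. min K (dyadic_variation (\<lambda>s. A s w) n t)) \<in> borel_measurable (F t)" for n
      using W[OF that, of n] by measurable
    show "bdd_above (range (\<lambda>n. min K (dyadic_variation (\<lambda>s. A s w) n t)))" for w
      by (rule truncated_variation_bdd[OF K])
  qed simp
  have R: "(\<lambda>w. right_variation (\<lambda>s. A s w) K t) \<in> borel_measurable (F t)" if t: "0 \<le> t" for t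
  proof (rule measurable_F_right[OF t])
    fix u assume "t < u"
    \<comment> \<open>Dropping the first \<open>J\<close> terms leaves only times up to
      \<open>u\<close>.\<close>
    then obtain J where J: "1 / real (Suc J) < u - t" using nat_approx_posE[of "u - t"] by auto
    show "(\<lambda>w. right_variation (\<lambda>s. A s w) K t) \<in> borel_measurable (F u)"
    proof (rule borel_measurable_LIMSEQ_real)
      show "(\<lambda>j. truncated_variation (\<lambda>s. A s w) K (t + 1 / real (Suc (j + J)))) \<longlonglongrightarrow> right_variation (\<lambda>s. A s w) K t" for w
        by (rule LIMSEQ_ignore_initial_segment[OF right_variation_limit[OF K]])
      show "(\<lambda>w. truncated_variation (\<lambda>s. A s w) K (t + 1 / real (Suc (j + J)))) \<in> borel_measurable (F u)" for j
      proof (rule measurable_F_mono[OF V])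
        have "1 / real (Suc (j + J)) \<le> 1 / real (Suc J)" by (intro divide_left_mono) auto
        then show "t + 1 / real (Suc (j + J)) \<le> u" using J by linarith
      qed (use t in simp)
    qed
  qed
  have iR: "integrable M (\<lambda>w. right_variation (\<lambda>s. A s w) K t)" if "0 \<le> t" for t
    by (rule integrable_const_bound[of _ K])
      (use right_variation_range[OF K] measurable_F_M[OF R[OF that]] in auto)
  show ?thesis
    unfolding right_continuous_submartingale_def
  proof (intro conjI allI impI T)
    fix t :: real assume t: "0 \<le> t"
    show "(\<lambda>w. right_variation (\<lambda>s. A s w) K (min t T)) \<in> borel_measurable (F t)"
      by (rule measurable_F_mono[OF R]) (use t T in auto)
    show "integrable M (\<lambda>w. right_variation (\<lambda>s. A s w) K (min t T))" using t T by (intro iR) simp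
  next
    show "0 \<le> right_variation (\<lambda>s. A s w) K (min t T)" for t w by (rule right_variation_range[OF K])
  next
    fix s t :: real and B assume st: "0 \<le> s" "s \<le> t" and B: "B \<in> sets (F s)"
    have i: "integrable M (\<lambda>w. indicator B w * right_variation (\<lambda>s. A s w) K (min r T))" if "0 \<le> r" for r
      using that T by (intro integrable_bounded_mult[OF iR indicator_F(1)[OF B] indicator_F(2)]) simp
    show "(\<integral>w. indicator B w * right_variation (\<lambda>s. A s w) K (min s T) \<partial>M)
      \<le> (\<integral>w. indicator B w * right_variation (\<lambda>s. A s w) K (min t T) \<partial>M)"
      using st by (intro integral_mono i mult_left_mono right_variation_mono[OF K]) auto
  next
    fix s e :: real assume s: "0 \<le> s" and e: "0 < e"
    show "\<exists>t>s. (\<integral>w. right_variation (\<lambda>s. A s w) K (min t T) \<partial>M)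
      < (\<integral>w. right_variation (\<lambda>s. A s w) K (min s T) \<partial>M) + e"
    proof (cases "s < T")
      case False
      then show ?thesis using e by (intro exI[of _ "s + 1"]) (simp add: min_def)
    next
      case True
      have "(\<lambda>j. \<integral>w. truncated_variation (\<lambda>s. A s w) K (s + 1 / real (Suc j)) \<partial>M)
        \<longlonglongrightarrow> (\<integral>w. right_variation (\<lambda>s. A s w) K s \<partial>M)"
      proof (rule integral_dominated_convergence[where w = "\<lambda>_. K"])
        show "(\<lambda>w. right_variation (\<lambda>s. A s w) K s) \<in> borel_measurable M" by (rule measurable_F_M[OF R[OF s]])
        show "(\<lambda>w. truncated_variation (\<lambda>s. A s w) K (s + 1 / real (Suc j))) \<in> borel_measurable M" for j
          by (rule measurable_F_M[OF V]) (use s in simp)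
        show "AE w in M. (\<lambda>j. truncated_variation (\<lambda>s. A s w) K (s + 1 / real (Suc j))) \<longlonglongrightarrow> right_variation (\<lambda>s. A s w) K s"
          by (intro AE_I2 right_variation_limit[OF K])
        show "AE w in M. norm (truncated_variation (\<lambda>s. A s w) K (s + 1 / real (Suc j))) \<le> K" for j
          using truncated_variation_range[OF K] by (intro AE_I2) simp
      qed simp
      then have "\<forall>\<^sub>F j in sequentially. (\<integral>w. truncated_variation (\<lambda>s. A s w) K (s + 1 / real (Suc j)) \<partial>M)
        < (\<integral>w. right_variation (\<lambda>s. A s w) K s \<partial>M) + e"
        using e by (intro order_tendstoD(2)[where a = "_ + e"]) auto
      then obtain j where j: "(\<integral>w. truncated_variation (\<lambda>s. A s w) K (s + 1 / real (Suc j)) \<partial>M)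
        < (\<integral>w. right_variation (\<lambda>s. A s w) K s \<partial>M) + e"
        by (auto simp: eventually_sequentially)
      obtain t where t: "s < t" "t < s + 1 / real (Suc j)" using dense[of s "s + 1 / real (Suc j)"] by auto
      have "(\<integral>w. right_variation (\<lambda>s. A s w) K (min t T) \<partial>M) \<le> (\<integral>w. truncated_variation (\<lambda>s. A s w) K (s + 1 / real (Suc j)) \<partial>M)"
      proof (rule integral_mono)
        show "integrable M (\<lambda>w. right_variation (\<lambda>s. A s w) K (min t T))" using s t T by (intro iR) simp
        show "integrable M (\<lambda>w. truncated_variation (\<lambda>s. A s w) K (s + 1 / real (Suc j)))"
          by (rule integrable_const_bound[of _ K])
            (use truncated_variation_range[OF K] measurable_F_M[OF V[of "s + 1 / real (Suc j)"]] s in auto)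
        show "right_variation (\<lambda>s. A s w) K (min t T) \<le> truncated_variation (\<lambda>s. A s w) K (s + 1 / real (Suc j))" for w
          using t by (intro right_variation_le[OF K]) simp
      qed
      then show ?thesis using j t True by (intro exI[of _ t]) (simp add: min_absorb1)
    qed
  next
    show "(\<lambda>w. right_variation (\<lambda>s. A s w) K (min t T)) = (\<lambda>w. right_variation (\<lambda>s. A s w) K (min T T))" if "T \<le> t" for t
      using that by (simp add: min_absorb2)
  qed
qed

text \<open>Off an event of small probability the variation up to \<open>T + 1\<close> stays below
  the truncation level. There the truncated variation dominates the increments of \<open>A\<close>,
  and \<open>\<bar>h\<bar>\<close> is at most the weight handled by
  \<open>doleans_small\<close>.\<close>

lemma finite_variation_controlled:
  assumes A: "adapted F A" and rc: "AE w in M. \<forall>t\<ge>0. continuous (at_right t) (\<lambda>t. A t w)"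
    and bv: "AE w in M. \<forall>t\<ge>0. bounded_variation_path (\<lambda>s. A s w) t" and T: "0 \<le> T"
  shows "controlled A T"
  unfolding controlled_def
proof (intro allI impI)
  fix d :: real assume d: "0 < d"
  have Am: "A t \<in> borel_measurable M" if "0 \<le> t" for t using A that by (auto simp: adapted_def intro: measurable_F_M)
  have Wm[measurable]: "(\<lambda>w. dyadic_variation (\<lambda>s. A s w) n (T + 1)) \<in> borel_measurable M" for n
    unfolding dyadic_variation_def
    by (intro borel_measurable_sum borel_measurable_abs borel_measurable_diff Am) auto
  define B where "B k = {w \<in> space M. \<exists>n. real k < dyadic_variation (\<lambda>s. A s w) n (T + 1)}" for k :: nat
  have Bm: "B k \<in> sets M" for k unfolding B_def by measurable
  have "(\<lambda>k. prob (B k)) \<longlonglongrightarrow> prob (\<Inter>k. B k)"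
  proof (rule finite_Lim_measure_decseq)
    show "range B \<subseteq> sets M" using Bm by auto
    show "decseq B" unfolding B_def decseq_def by (auto intro: less_le_trans le_less_trans[OF of_nat_mono])
  qed
  moreover have "prob (\<Inter>k. B k) = 0"
  proof -
    have "AE w in M. w \<notin> (\<Inter>k. B k)"
      using bv
    proof eventually_elim
      case (elim w)
      then have "bounded_variation_path (\<lambda>s. A s w) (T + 1)" using T by simp
      then obtain C where C: "\<And>n. dyadic_variation (\<lambda>s. A s w) n (T + 1) \<le> C"
        by (rule dyadic_variation_bounded) (use T in auto)
      obtain k :: nat where "C \<le> real k" using real_arch_simple by blast
      then have "w \<notin> B k" unfolding B_def using C by (auto simp: not_less intro: order_trans)
      then show ?case by auto
    qed
    then show ?thesis using Bm by (subst prob_eq_0) auto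
  qed
  ultimately have "\<forall>\<^sub>F k in sequentially. prob (B k) < d / 2"
    using d by (intro order_tendstoD(2)[of _ "prob (\<Inter>k. B k)"]) auto
  then obtain k where PB: "prob (B k) < d / 2" by (auto simp: eventually_sequentially)
  define K where "K = real k"
  have K: "0 \<le> K" by (simp add: K_def)
  let ?S = "\<lambda>t w. right_variation (\<lambda>s. A s w) K (min t T)"
  note S = right_variation_submartingale[OF A K T]
  obtain \<nu> \<eta> where \<nu>: "finite_measure \<nu>" "sets \<nu> = sets \<P>" "0 < \<eta>"
    "\<And>Q h. elementary_predictable Q h \<Longrightarrow> T \<in> Q \<Longrightarrow>
      energy \<nu> h \<le> ennreal \<eta> \<Longrightarrow>
      (\<Sum>q\<in>Q \<inter> {0<..T}. \<integral>w. ((h q w)\<^sup>2 + \<bar>h q w\<bar>) * (?S q w - ?S (prev Q q) w) \<partial>M) \<le> d / 2"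
    by (rule doleans_small[OF S, of "d / 2"]) (use d in \<open>auto\<close>)
  have "L0 (path_sum Q h A T) \<le> d"
    if h: "elementary_predictable Q h" and TQ: "T \<in> Q" and small: "energy \<nu> h \<le> ennreal \<eta>" for Q h
  proof -
    note Q = elementary_predictableD(1)[OF h]
    let ?g = "\<lambda>q w. (h q w)\<^sup>2 + \<bar>h q w\<bar>"
    have g: "elementary_predictable Q ?g"
      using elementary_predictable_comp[OF h h, of "\<lambda>x y. x\<^sup>2 + \<bar>x\<bar>"]
      by (simp add: split_def continuous_intros)
    obtain C where C: "\<And>s w. 0 \<le> s \<Longrightarrow> w \<in> space M \<Longrightarrow> \<bar>?g s w\<bar> \<le> C"
      using g unfolding elementary_predictable_def by blast
    let ?\<Sigma> = "\<lambda>w. \<Sum>q\<in>Q \<inter> {0<..T}. ?g q w * (?S q w - ?S (prev Q q) w)"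
    have i: "integrable M (\<lambda>w. ?g q w * (?S q w - ?S (prev Q q) w))" if "q \<in> Q \<inter> {0<..T}" for q
    proof -
      have q: "0 \<le> q" "0 \<le> prev Q q" using that prev_nonneg[OF Q, of q] by auto
      show ?thesis
        by (rule submartingale_increment_integrable[OF S elementary_predictableD(5)[OF g q(1)] C[OF q(1)] q(2,1)])
    qed
    have i\<Sigma>: "integrable M ?\<Sigma>" by (rule Bochner_Integration.integrable_sum[OF i])
    have iB: "integrable M (indicator (B k) :: 'a \<Rightarrow> real)" "(\<integral>w. indicator (B k) w \<partial>M) = prob (B k)"
      using integrable_bounded_mult[of "\<lambda>_. 1" "indicator (B k)" 1] Bm by (simp_all add: indicator_le_1)
    have \<Sigma>0: "0 \<le> ?\<Sigma> w" for w
    proof (intro sum_nonneg mult_nonneg_nonneg)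
      fix q assume "q \<in> Q \<inter> {0<..T}"
      then have "prev Q q < q" by (intro prev_less[OF Q]) simp
      then have "?S (prev Q q) w \<le> ?S q w" by (intro right_variation_mono[OF K] min.mono) auto
      then show "0 \<le> ?S q w - ?S (prev Q q) w" by simp
    qed simp
    have "L0 (path_sum Q h A T) \<le> (\<integral>w. indicator (B k) w + ?\<Sigma> w \<partial>M)"
    proof (rule integral_mono_AE')
      show "integrable M (\<lambda>w. indicator (B k) w + ?\<Sigma> w)" by (rule Bochner_Integration.integrable_add[OF iB(1) i\<Sigma>])
      show "AE w in M. 0 \<le> indicator (B k) w + ?\<Sigma> w"
        by (intro AE_I2 add_nonneg_nonneg \<Sigma>0) simp
      show "AE w in M. min 1 \<bar>path_sum Q h A T w\<bar> \<le> indicator (B k) w + ?\<Sigma> w"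
        using rc AE_space
      proof eventually_elim
        case (elim w)
        show ?case
        proof (cases "w \<in> B k")
          case True
          then have "indicator (B k) w = (1::real)" by simp
          then show ?thesis using \<Sigma>0[of w] by linarith
        next
          case False
          then have bd: "dyadic_variation (\<lambda>s. A s w) n (T + 1) \<le> K" for n
            using elim by (auto simp: B_def K_def not_less)
          have "\<bar>path_sum Q h A T w\<bar> \<le> (\<Sum>q\<in>Q \<inter> {0<..T}. \<bar>h q w * (A q w - A (prev Q q) w)\<bar>)"
            unfolding riemann_sum_def by (rule sum_abs)
          also have "\<dots> \<le> ?\<Sigma> w"
          proof (rule sum_mono)
            fix q assume q: "q \<in> Q \<inter> {0<..T}"
            have p: "0 \<le> prev Q q" "prev Q q \<le> q" using q prev_nonneg[OF Q, of q] prev_less[OF Q, of q] by auto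
            have "\<bar>A q w - A (prev Q q) w\<bar> \<le> right_variation (\<lambda>s. A s w) K q - right_variation (\<lambda>s. A s w) K (prev Q q)"
              using q p elim by (intro right_variation_increment[OF K _ bd]) auto
            also have "\<dots> = ?S q w - ?S (prev Q q) w" using q p by (simp add: min_absorb1)
            finally show "\<bar>h q w * (A q w - A (prev Q q) w)\<bar> \<le> ?g q w * (?S q w - ?S (prev Q q) w)"
              unfolding abs_mult by (intro mult_mono) auto
          qed
          finally show ?thesis using False by simp
        qed
      qed
    qed
    also have "\<dots> = prob (B k) + (\<integral>w. ?\<Sigma> w \<partial>M)"
      unfolding Bochner_Integration.integral_add[OF iB(1) i\<Sigma>] iB(2) ..
    also have "(\<integral>w. ?\<Sigma> w \<partial>M) = (\<Sum>q\<in>Q \<inter> {0<..T}. \<integral>w. ?g q w * (?S q w - ?S (prev Q q) w) \<partial>M)"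
      by (rule Bochner_Integration.integral_sum[OF i])
    also have "\<dots> \<le> d / 2" by (rule \<nu>(4)[OF h TQ small])
    finally show ?thesis using PB by linarith
  qed
  then show "\<exists>\<nu>. finite_measure \<nu> \<and> sets \<nu> = sets \<P> \<and>
     (\<exists>\<eta>>0. \<forall>Q h. elementary_predictable Q h \<longrightarrow> T \<in> Q \<longrightarrow>
        energy \<nu> h \<le> ennreal \<eta> \<longrightarrow>
        L0 (path_sum Q h A T) \<le> d)"
    using \<nu>(1,2,3) by blast
qed

end

section \<open>Local martingales and semimartingales are controlled\<close>

lemma stopped_right_continuous:
  assumes f: "\<And>t. 0 \<le> t \<Longrightarrow> continuous (at_right t) (\<lambda>t. Z t w)" and t: "0 \<le> t"
  shows "continuous (at_right t) (\<lambda>t. stopped Z \<tau> t w)"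
proof (cases "ennreal t < \<tau> w")
  case True
  have "\<exists>b>t. \<forall>u. t < u \<and> u < b \<longrightarrow> ennreal u < \<tau> w"
  proof (cases "\<tau> w")
    case (real r)
    then have "t < r" using True t by (simp add: ennreal_less_iff)
    then show ?thesis using real t by (intro exI[of _ r]) (auto simp: ennreal_less_iff)
  next
    case top
    then show ?thesis by (intro exI[of _ "t + 1"]) simp
  qed
  then obtain b where "t < b" "\<And>u. t < u \<Longrightarrow> u < b \<Longrightarrow> ennreal u < \<tau> w" by blast
  then have "\<forall>\<^sub>F u in at_right t. ennreal u < \<tau> w" by (intro eventually_at_rightI) simp_all
  then have "\<forall>\<^sub>F u in at_right t. stopped Z \<tau> u w = Z u w"
    using eventually_at_right_less[of t]
  proof eventually_elim
    case (elim u)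
    then have "min (ennreal u) (\<tau> w) = ennreal u" by (intro min_absorb1 less_imp_le)
    then show ?case using elim(2) t by (simp add: stopped_def)
  qed
  from tendsto_cong[OF this] f[OF t] have lim: "((\<lambda>u. stopped Z \<tau> u w) \<longlongrightarrow> Z t w) (at_right t)"
    unfolding continuous_within by (rule iffD2)
  have "min (ennreal t) (\<tau> w) = ennreal t" using True by (intro min_absorb1 less_imp_le)
  then have "stopped Z \<tau> t w = Z t w" using t by (simp add: stopped_def)
  then show ?thesis using lim unfolding continuous_within by (rule ssubst)
next
  case False
  then have "\<tau> w \<le> ennreal t" by simp
  then have "stopped Z \<tau> u w = stopped Z \<tau> t w" if "t \<le> u" for u
    using that order_trans[of "\<tau> w" "ennreal t" "ennreal u"] by (simp add: stopped_def min_absorb2 ennreal_leI)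
  from eventually_mono[OF eventually_at_right_less this, of t, OF less_imp_le]
  have "\<forall>\<^sub>F u in at_right t. stopped Z \<tau> u w = stopped Z \<tau> t w" .
  then show ?thesis by (simp add: continuous_within tendsto_eventually)
qed

context usual_filtered_prob_space
begin

lemma riemann_sum_measurable:
  assumes h: "elementary_predictable Q h" and Z: "adapted F Z" and t: "0 \<le> t"
  shows "(\<lambda>w. path_sum Q h Z t w) \<in> borel_measurable (F t)"
  unfolding riemann_sum_def
proof (rule borel_measurable_sum)
  note Q = elementary_predictableD(1)[OF h]
  fix q assume q: "q \<in> Q \<inter> {0<..t}"
  have p: "0 \<le> prev Q q" "prev Q q \<le> q" using q prev_nonneg[OF Q, of q] prev_less[OF Q, of q] by auto
  have Zm: "Z u \<in> borel_measurable (F t)" if "0 \<le> u" "u \<le> t" for u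
    using measurable_F_mono[of "Z u" u borel t] Z that by (simp add: adapted_def)
  have [measurable]: "h q \<in> borel_measurable (F t)"
    by (rule measurable_F_mono[OF elementary_predictableD(4)[OF h]]) (use q p in auto)
  have [measurable]: "Z q \<in> borel_measurable (F t)" "Z (prev Q q) \<in> borel_measurable (F t)"
    using q p by (auto intro: Zm)
  show "(\<lambda>w. h q w * (Z q w - Z (prev Q q) w)) \<in> borel_measurable (F t)" by measurable
qed

lemma integrable_min_1_abs: "g \<in> borel_measurable M \<Longrightarrow> integrable M (\<lambda>w. min 1 \<bar>g w :: real\<bar>)"
  by (rule integrable_const_bound[of _ 1]) auto

text \<open>For large \<open>n\<close> the event \<open>\<tau> n \<le> T\<close> has small
  probability. Off it the stopped process has the same increments as \<open>N\<close> on
  \<open>[0, T]\<close>, and subtracting \<open>N 0\<close> does not alter increments.\<close>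

lemma local_martingale_controlled:
  assumes N: "local_martingale M F N" and T: "0 \<le> T"
  shows "controlled N T"
  unfolding controlled_def
proof (intro allI impI)
  fix d :: real assume d: "0 < d"
  have cad: "AE w in M. cadlag_path (\<lambda>t. N t w)" and ad: "adapted F N"
    using N by (auto simp: local_martingale_def cadlag_adapted_def)
  obtain \<tau> :: "nat \<Rightarrow> 'a \<Rightarrow> ennreal" where \<tau>: "\<And>n. ext_stopping_time F (\<tau> n)"
    "AE w in M. incseq (\<lambda>n. \<tau> n w) \<and> (\<lambda>n. \<tau> n w) \<longlonglongrightarrow> \<infinity>"
    "\<And>n. martingale M F (stopped (\<lambda>t w. N t w - N 0 w) (\<tau> n))"
    using N by (auto simp: local_martingale_def)
  define B where "B n = {w \<in> space M. \<tau> n w \<le> ennreal T}" for n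
  have Bm: "B n \<in> sets M" for n
  proof -
    have "{w \<in> space (F T). \<tau> n w \<le> ennreal T} \<in> sets (F T)"
      using \<tau>(1)[of n] T by (simp add: ext_stopping_time_def pred_def)
    from sets_F_M[OF this] show ?thesis by (simp add: B_def space_F)
  qed
  have "(\<lambda>n. \<integral>w. indicator (B n) w \<partial>M) \<longlonglongrightarrow> (\<integral>w. 0 \<partial>M :: real)"
  proof (rule integral_dominated_convergence[where w = "\<lambda>_. 1"])
    show "AE w in M. (\<lambda>n. indicator (B n) w :: real) \<longlonglongrightarrow> 0"
      using \<tau>(2)
    proof eventually_elim
      case (elim w)
      then have "\<forall>\<^sub>F n in sequentially. ennreal T < \<tau> n w" by (auto intro: order_tendstoD(1))
      then have "\<forall>\<^sub>F n in sequentially. indicator (B n) w = (0::real)"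
        by eventually_elim (auto simp: B_def indicator_def)
      then show ?case by (rule tendsto_eventually)
    qed
  qed (use Bm in \<open>auto simp: indicator_le_1\<close>)
  then have "(\<lambda>n. prob (B n)) \<longlonglongrightarrow> 0" using Bm by simp
  then have "\<forall>\<^sub>F n in sequentially. prob (B n) < d / 2" by (rule order_tendstoD(2)) (use d in simp)
  then obtain n where PB: "prob (B n) < d / 2" by (auto simp: eventually_sequentially)
  let ?N = "stopped (\<lambda>t w. N t w - N 0 w) (\<tau> n)"
  have "AE w in M. \<forall>t\<ge>0. continuous (at_right t) (\<lambda>t. ?N t w)"
    using cad
  proof eventually_elim
    case (elim w)
    then show ?case
      by (intro allI impI stopped_right_continuous) (auto simp: cadlag_path_def intro!: continuous_intros)
  qed
  then have "controlled ?N T" by (rule martingale_controlled[OF \<tau>(3) _ T])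
  then obtain \<nu> \<eta> where \<nu>: "finite_measure \<nu>" "sets \<nu> = sets \<P>" "0 < \<eta>"
    "\<And>Q h. elementary_predictable Q h \<Longrightarrow> T \<in> Q \<Longrightarrow>
        energy \<nu> h \<le> ennreal \<eta> \<Longrightarrow>
        L0 (path_sum Q h ?N T) \<le> d / 2"
    unfolding controlled_def using half_gt_zero[OF d] by blast
  have "L0 (path_sum Q h N T) \<le> d"
    if h: "elementary_predictable Q h" and TQ: "T \<in> Q" and small: "energy \<nu> h \<le> ennreal \<eta>" for Q h
  proof -
    note Q = elementary_predictableD(1)[OF h]
    let ?r = "\<lambda>w. path_sum Q h ?N T w"
    have "adapted F ?N" using \<tau>(3)[of n] by (simp add: martingale_def)
    then have iN: "integrable M (\<lambda>w. min 1 \<bar>?r w\<bar>)"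
      by (intro integrable_min_1_abs measurable_F_M[OF riemann_sum_measurable[OF h _ T]])
    have iB: "integrable M (indicator (B n) :: 'a \<Rightarrow> real)" "(\<integral>w. indicator (B n) w \<partial>M) = prob (B n)"
      using integrable_bounded_mult[of "\<lambda>_. 1" "indicator (B n)" 1] Bm by (simp_all add: indicator_le_1)
    have "L0 (path_sum Q h N T) \<le> (\<integral>w. indicator (B n) w + min 1 \<bar>?r w\<bar> \<partial>M)"
    proof (rule integral_mono')
      show "integrable M (\<lambda>w. indicator (B n) w + min 1 \<bar>?r w\<bar>)"
        by (rule Bochner_Integration.integrable_add[OF iB(1) iN])
      fix w assume w: "w \<in> space M"
      show "0 \<le> indicator (B n) w + min 1 \<bar>?r w\<bar>" by simp
      show "min 1 \<bar>path_sum Q h N T w\<bar> \<le> indicator (B n) w + min 1 \<bar>?r w\<bar>"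
      proof (cases "w \<in> B n")
        case False
        then have "ennreal T < \<tau> n w" using w by (auto simp: B_def)
        then have eq: "?N u w = N u w - N 0 w" if "0 \<le> u" "u \<le> T" for u
          using that order_le_less_trans[OF ennreal_leI[OF that(2)]] by (simp add: stopped_def min_absorb1 less_imp_le)
        have "path_sum Q h N T w = ?r w"
          unfolding riemann_sum_def
        proof (rule sum.cong)
          fix q assume q: "q \<in> Q \<inter> {0<..T}"
          then have "0 \<le> prev Q q" "prev Q q \<le> T" using prev_nonneg[OF Q, of q] prev_less[OF Q, of q] by auto
          then show "h q w * (N q w - N (prev Q q) w) = h q w * (?N q w - ?N (prev Q q) w)"
            using q by (simp add: eq)
        qed simp
        then show ?thesis using False by simp
      qed simp
    qed
    also have "\<dots> = prob (B n) + L0 ?r"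
      unfolding Bochner_Integration.integral_add[OF iB(1) iN] iB(2) ..
    also have "\<dots> \<le> d" using PB \<nu>(4)[OF h TQ small] by simp
    finally show ?thesis .
  qed
  then show "\<exists>\<nu>. finite_measure \<nu> \<and> sets \<nu> = sets \<P> \<and>
     (\<exists>\<eta>>0. \<forall>Q h. elementary_predictable Q h \<longrightarrow> T \<in> Q \<longrightarrow>
        energy \<nu> h \<le> ennreal \<eta> \<longrightarrow>
        L0 (path_sum Q h N T) \<le> d)"
    using \<nu>(1,2,3) by blast
qed

text \<open>Both parts are controlled by the sum of their measures, with the smaller threshold and
  half of \<open>d\<close> each.\<close>

lemma semimartingale_controlled:
  assumes Z: "semimartingale M F Z" and T: "0 \<le> T"
  shows "controlled Z T"
  unfolding controlled_def
proof (intro allI impI)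
  fix d :: real assume d: "0 < d"
  obtain N A where N: "local_martingale M F N" and A: "cadlag_adapted M F A"
    "AE w in M. \<forall>t\<ge>0. bounded_variation_path (\<lambda>s. A s w) t"
    and dec: "AE w in M. \<forall>t\<ge>0. Z t w = Z 0 w + N t w + A t w"
    using Z unfolding semimartingale_def by blast
  have ad: "adapted F N" "adapted F A" using N A by (auto simp: local_martingale_def cadlag_adapted_def)
  have "AE w in M. \<forall>t\<ge>0. continuous (at_right t) (\<lambda>t. A t w)"
    using A(1) by (auto simp: cadlag_adapted_def cadlag_path_def elim: AE_mp)
  then have "controlled A T" by (rule finite_variation_controlled[OF ad(2) _ A(2) T])
  then obtain \<nu>1 \<eta>1 where \<nu>1: "finite_measure \<nu>1" "sets \<nu>1 = sets \<P>" "0 < \<eta>1"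
    "\<And>Q h. elementary_predictable Q h \<Longrightarrow> T \<in> Q \<Longrightarrow>
        energy \<nu>1 h \<le> ennreal \<eta>1 \<Longrightarrow>
        L0 (path_sum Q h A T) \<le> d / 2"
    unfolding controlled_def using half_gt_zero[OF d] by blast
  from local_martingale_controlled[OF N T]
  obtain \<nu>2 \<eta>2 where \<nu>2: "finite_measure \<nu>2" "sets \<nu>2 = sets \<P>" "0 < \<eta>2"
    "\<And>Q h. elementary_predictable Q h \<Longrightarrow> T \<in> Q \<Longrightarrow>
        energy \<nu>2 h \<le> ennreal \<eta>2 \<Longrightarrow>
        L0 (path_sum Q h N T) \<le> d / 2"
    unfolding controlled_def using half_gt_zero[OF d] by blast
  have "sets \<nu>1 = sets \<nu>2" using \<nu>1(2) \<nu>2(2) by simp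
  from finite_measure_sum[OF \<nu>1(1) \<nu>2(1) this]
  obtain \<nu> where \<nu>: "finite_measure \<nu>" "sets \<nu> = sets \<P>"
    "\<And>f. nn_integral \<nu>1 f \<le> nn_integral \<nu> f" "\<And>f. nn_integral \<nu>2 f \<le> nn_integral \<nu> f"
    using \<nu>2(2) by metis
  have "L0 (path_sum Q h Z T) \<le> d"
    if h: "elementary_predictable Q h" and TQ: "T \<in> Q" and small: "energy \<nu> h \<le> ennreal (min \<eta>1 \<eta>2)" for Q h
  proof -
    note Q = elementary_predictableD(1)[OF h]
    let ?N = "\<lambda>w. path_sum Q h N T w" and ?A = "\<lambda>w. path_sum Q h A T w"
    have s: "ennreal (min \<eta>1 \<eta>2) \<le> ennreal \<eta>1" "ennreal (min \<eta>1 \<eta>2) \<le> ennreal \<eta>2" by (auto intro: ennreal_leI)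
    have i: "integrable M (\<lambda>w. min 1 \<bar>?N w\<bar>)" "integrable M (\<lambda>w. min 1 \<bar>?A w\<bar>)"
      using ad by (auto intro!: integrable_min_1_abs measurable_F_M[OF riemann_sum_measurable[OF h _ T]])
    have "L0 (path_sum Q h Z T) \<le> (\<integral>w. min 1 \<bar>?N w\<bar> + min 1 \<bar>?A w\<bar> \<partial>M)"
    proof (rule integral_mono_AE')
      show "integrable M (\<lambda>w. min 1 \<bar>?N w\<bar> + min 1 \<bar>?A w\<bar>)" by (rule Bochner_Integration.integrable_add[OF i])
      show "AE w in M. 0 \<le> min 1 \<bar>?N w\<bar> + min 1 \<bar>?A w\<bar>" by simp
      show "AE w in M. min 1 \<bar>path_sum Q h Z T w\<bar> \<le> min 1 \<bar>?N w\<bar> + min 1 \<bar>?A w\<bar>"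
        using dec
      proof eventually_elim
        case (elim w)
        have "path_sum Q h Z T w = ?N w + ?A w"
          unfolding riemann_sum_def sum.distrib[symmetric]
        proof (rule sum.cong)
          fix q assume q: "q \<in> Q \<inter> {0<..T}"
          have "Z q w - Z (prev Q q) w = (N q w - N (prev Q q) w) + (A q w - A (prev Q q) w)"
            using elim[rule_format, of q] elim[rule_format, of "prev Q q"] q prev_nonneg[OF Q, of q] by simp
          then show "h q w * (Z q w - Z (prev Q q) w) = h q w * (N q w - N (prev Q q) w) + h q w * (A q w - A (prev Q q) w)"
            by (simp add: distrib_left)
        qed simp
        then show ?case by linarith
      qed
    qed
    also have "\<dots> = L0 ?N + L0 ?A"
      by (rule Bochner_Integration.integral_add[OF i])
    also have "\<dots> \<le> d / 2 + d / 2"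
      by (intro add_mono \<nu>1(4)[OF h TQ] \<nu>2(4)[OF h TQ] order_trans[OF \<nu>(3)] order_trans[OF \<nu>(4)] order_trans[OF small] s)
    finally show ?thesis by simp
  qed
  moreover have "0 < min \<eta>1 \<eta>2" using \<nu>1(3) \<nu>2(3) by simp
  ultimately show "\<exists>\<nu>. finite_measure \<nu> \<and> sets \<nu> = sets \<P> \<and>
     (\<exists>\<eta>>0. \<forall>Q h. elementary_predictable Q h \<longrightarrow> T \<in> Q \<longrightarrow>
        energy \<nu> h \<le> ennreal \<eta> \<longrightarrow>
        L0 (path_sum Q h Z T) \<le> d)"
    using \<nu>(1,2) by blast
qed

end

lemma square_add_le: "(a + b)\<^sup>2 \<le> 2 * a\<^sup>2 + 2 * b\<^sup>2" for a b :: real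
  using zero_le_power2[of "a - b"] by (simp add: power2_eq_square algebra_simps)

lemma square_diff_le: "(a - b)\<^sup>2 \<le> 2 * a\<^sup>2 + 2 * b\<^sup>2" for a b :: real
  using square_add_le[of a "- b"] by simp

lemma min_1_abs_triangle: "min 1 \<bar>y - z\<bar> \<le> min 1 \<bar>x - y\<bar> + min 1 \<bar>x - z :: real\<bar>"
proof -
  have *: "min 1 a \<le> min 1 b + min 1 c" if "a \<le> b + c" "0 \<le> b" "0 \<le> c" for a b c :: real
    using that by (auto simp: min_def)
  show ?thesis by (rule *) linarith+
qed

context usual_filtered_prob_space
begin

subsection \<open>Approximation of stochastic integrals by elementary integrals\<close>

text \<open>The measure and the finite set of times are arbitrary because both are fixed only later,
  by \<open>controlled\<close> and by the grid on which \<open>J\<close> is summed. One elementary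
  process has to serve the energy and all these times at once.\<close>

definition approximable :: "(real \<Rightarrow> 'a \<Rightarrow> real) \<Rightarrow> (real \<Rightarrow> 'a \<Rightarrow> real) \<Rightarrow> (real \<Rightarrow> 'a \<Rightarrow> real) \<Rightarrow> bool" where
  "approximable Z H J \<longleftrightarrow> predictable M F H \<and> (\<exists>C. \<forall>s\<ge>0. \<forall>w\<in>space M. \<bar>H s w\<bar> \<le> C) \<and>
     (\<forall>\<nu> \<Theta> e. finite_measure \<nu> \<longrightarrow> sets \<nu> = sets \<P> \<longrightarrow> finite \<Theta> \<longrightarrow> \<Theta> \<subseteq> {0..} \<longrightarrow> 0 < e \<longrightarrow>
        (\<exists>Q h. elementary_predictable Q h \<and> \<Theta> \<subseteq> Q \<and>
           energy \<nu> (\<lambda>s w. H s w - h s w) \<le> ennreal e \<and>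
           (\<forall>t\<in>\<Theta>. L0 (\<lambda>w. J t w - path_sum Q h Z t w) \<le> e)))"

lemma integrable_indicator_prob:
  assumes "A \<in> sets M"
  shows "integrable M (indicator A :: 'a \<Rightarrow> real)" "(\<integral>w. indicator A w \<partial>M) = prob A"
  using integrable_bounded_mult[of "\<lambda>_. 1" "indicator A" 1] assms by (simp_all add: indicator_le_1)

text \<open>Since null sets belong to \<open>F 0\<close>, exceptional paths can be removed by an
  indicator without losing adaptedness or predictability.\<close>

lemma prob_one_F0:
  assumes "AE w in M. P w"
  obtains G where "G \<in> sets (F 0)" "\<And>w. w \<in> G \<Longrightarrow> w \<in> space M \<and> P w" "AE w in M. w \<in> G"
proof -
  obtain N where N: "{w \<in> space M. \<not> P w} \<subseteq> N" "N \<in> null_sets M" using assms by (auto elim!: AE_E2 simp: eventually_ae_filter)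
  have "N \<in> sets (F 0)" using null_sets_F N(2) by blast
  then have "space M - N \<in> sets (F 0)" using sets.compl_sets[of N "F 0"] by (simp add: space_F)
  moreover have "AE w in M. w \<in> space M - N" using AE_not_in[OF N(2)] by auto
  ultimately show ?thesis using that N(1) by blast
qed

lemma predictable_section_F0:
  assumes G: "G \<in> sets (F 0)"
  shows "{0..} \<times> G \<in> sets \<P>"
proof -
  have "({0..} :: real set) \<times> G = {0} \<times> G \<union> {0<..} \<times> G" by (auto simp: less_le)
  then show ?thesis using predictable_rectangle(1)[OF G] predictable_rectangle(3)[OF order_refl G] by auto
qed

lemma elementary_predictable_indicator_F0:
  assumes G: "G \<in> sets (F 0)" and Q: "time_grid Q"
  shows "elementary_predictable Q (\<lambda>s w. indicator G w)"
proof -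
  have "indicator G \<in> borel_measurable (F q)" if "0 \<le> q" for q
    using G sets_F_mono[OF that] by (intro borel_measurable_indicator) blast
  then show ?thesis using Q
    by (auto simp: elementary_predictable_def step_on_def indicator_le_1 intro!: exI[of _ 1])
qed

lemma elementary_integral_adapted:
  assumes Z: "adapted F Z" and p: "0 \<le> p 0" "mono p"
    and \<xi>: "\<forall>i<n. \<xi> i \<in> borel_measurable (F (p i)) \<and> (\<forall>w\<in>space M. \<bar>\<xi> i w\<bar> \<le> C)"
  shows "adapted F (elementary_integral Z n p \<xi>)"
  unfolding adapted_def
proof (intro allI impI)
  fix t :: real assume t: "0 \<le> t"
  have p0: "0 \<le> p i" for i using p by (metis le0 monoD order_trans)
  define Q where "Q = insert 0 (insert t (p ` {..n}))"
  have Q: "time_grid Q" using t p0 by (auto simp: Q_def time_grid_def)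
  have h: "elementary_predictable Q (elementary_process n p (\<lambda>_. 0) \<xi>)"
    by (rule elementary_process_elementary_predictable[OF p _ _ _ Q, where C = "max C 0"])
      (use \<xi> in \<open>auto simp: Q_def le_max_iff_disj\<close>)
  have "elementary_integral Z n p \<xi> t = (\<lambda>w. riemann_sum Q (\<lambda>s. elementary_process n p (\<lambda>_. 0) \<xi> s w) (\<lambda>u. Z u w) t)"
    by (rule ext, rule elementary_integral_eq_riemann_sum[OF Q p(2)]) (auto simp: Q_def)
  then show "elementary_integral Z n p \<xi> t \<in> borel_measurable (F t)"
    using riemann_sum_measurable[OF h Z t] by simp
qed

lemma elementary_integral_right_continuous:
  assumes Z: "\<And>t. 0 \<le> t \<Longrightarrow> continuous (at_right t) (\<lambda>t. Z t w)" and p0: "\<And>i. 0 \<le> p i" and t: "0 \<le> t"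
  shows "continuous (at_right t) (\<lambda>t. elementary_integral Z n p \<xi> t w)"
proof -
  have *: "continuous (at_right t) (\<lambda>t. Z (min a t) w)" if "0 \<le> a" for a
  proof (cases "t < a")
    case True
    then have "\<forall>\<^sub>F u in at_right t. Z (min a u) w = Z u w"
      by (intro eventually_at_rightI[of t a]) (auto simp: min_def)
    from tendsto_cong[OF this] Z[OF t] have "((\<lambda>u. Z (min a u) w) \<longlongrightarrow> Z t w) (at_right t)"
      unfolding continuous_within by (rule iffD2)
    then show ?thesis using True by (simp add: continuous_within min_def)
  next
    case False
    then have "\<forall>\<^sub>F u in at_right t. Z (min a u) w = Z a w"
      by (intro eventually_at_rightI[of t "t + 1"]) (auto simp: min_def)
    then have "((\<lambda>u. Z (min a u) w) \<longlongrightarrow> Z a w) (at_right t)" by (rule tendsto_eventually)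
    then show ?thesis using False by (simp add: continuous_within min_def)
  qed
  show ?thesis unfolding elementary_integral_def
    by (intro continuous_sum continuous_mult continuous_const continuous_diff * p0)
qed

text \<open>Since \<open>M\<close> is complete, the suprema in the definition of convergence u.c.p. are measurable.\<close>

lemma ucp_limit_pointwise:
  assumes Js: "\<And>n. adapted F (Js n)" "\<And>n. AE w in M. \<forall>t\<ge>0. continuous (at_right t) (\<lambda>t. Js n t w)"
    and J: "adapted F J" "AE w in M. \<forall>t\<ge>0. continuous (at_right t) (\<lambda>t. J t w)"
    and ucp: "ucp_limit M Js J" and t: "0 \<le> t"
  shows "(\<lambda>n. \<integral>w. min 1 \<bar>Js n t w - J t w\<bar> \<partial>M) \<longlonglongrightarrow> 0"
proof (rule LIMSEQ_I)
  fix e :: real assume e: "0 < e"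
  define A where "A n = {w \<in> space M. \<exists>s\<in>{0..t}. e / 2 < \<bar>Js n s w - J s w\<bar>}" for n
  have Am: "A n \<in> sets M" for n
  proof -
    let ?D = "\<lambda>s w. \<bar>Js n s w - J s w\<bar>"
    have Dm: "?D s \<in> borel_measurable M" if "0 \<le> s" for s
      using Js(1)[of n] J(1) that unfolding adapted_def
      by (intro borel_measurable_abs borel_measurable_diff measurable_F_M[of _ s]) auto
    \<comment> \<open>By right-continuity a deviation above \<open>e / 2\<close> at a time before
      \<open>t\<close> already shows at a rational time; the end point \<open>t\<close> is added by
      hand.\<close>
    define B where "B = (\<Union>s\<in>insert t ({0..t} \<inter> \<rat>). {w \<in> space M. e / 2 < ?D s w})"
    have B: "B \<in> sets M" unfolding B_def
    proof (rule sets.countable_UN')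
      show "countable (insert t ({0..t} \<inter> \<rat>))" using countable_rat by (auto intro: countable_Int2)
      show "(\<lambda>s. {w \<in> space M. e / 2 < ?D s w}) ` insert t ({0..t} \<inter> \<rat>) \<subseteq> sets M"
      proof (rule image_subsetI)
        fix s assume "s \<in> insert t ({0..t} \<inter> \<rat>)"
        then have [measurable]: "?D s \<in> borel_measurable M" using t by (intro Dm) auto
        show "{w \<in> space M. e / 2 < ?D s w} \<in> sets M" by measurable
      qed
    qed
    obtain N where N: "{w \<in> space M. \<not> ((\<forall>t\<ge>0. continuous (at_right t) (\<lambda>t. Js n t w)) \<and> (\<forall>t\<ge>0. continuous (at_right t) (\<lambda>t. J t w)))} \<subseteq> N"
      "N \<in> null_sets M"
      using AE_conjI[OF Js(2)[of n] J(2)] unfolding eventually_ae_filter by blast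
    have "A n - N \<subseteq> B"
    proof
      fix w assume "w \<in> A n - N"
      then obtain s where s: "s \<in> {0..t}" "e / 2 < ?D s w" and w: "w \<in> space M" "w \<notin> N"
        by (auto simp: A_def)
      then have "0 \<le> s" "(\<forall>t\<ge>0. continuous (at_right t) (\<lambda>t. Js n t w)) \<and> (\<forall>t\<ge>0. continuous (at_right t) (\<lambda>t. J t w))"
        using N(1) by (simp, blast)
      then have "continuous (at_right s) (\<lambda>t. Js n t w)" "continuous (at_right s) (\<lambda>t. J t w)" by simp_all
      then have "continuous (at_right s) (\<lambda>s. ?D s w)" by (intro continuous_rabs continuous_diff)
      then have "((\<lambda>s. ?D s w) \<longlongrightarrow> ?D s w) (at_right s)" by (simp add: continuous_within)
      then have "\<forall>\<^sub>F u in at_right s. e / 2 < ?D u w" by (rule order_tendstoD(1)) (rule s(2))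
      then obtain b where b: "s < b" "\<And>u. s < u \<Longrightarrow> u < b \<Longrightarrow> e / 2 < ?D u w"
        unfolding eventually_at_right_field by blast
      show "w \<in> B"
      proof (cases "s = t")
        case True
        then show ?thesis using s(2) w by (auto simp: B_def)
      next
        case False
        then have "s < min b t" using b(1) s(1) by auto
        then obtain r where r: "r \<in> \<rat>" "s < r" "r < min b t" using Rats_dense_in_real by blast
        then have "e / 2 < ?D r w" "r \<in> {0..t}" using b(2)[of r] s(1) by auto
        then show ?thesis using r(1) w unfolding B_def by blast
      qed
    qed
    \<comment> \<open>\<open>A n\<close> agrees with a measurable set off \<open>N\<close>, and
      completeness makes its part inside \<open>N\<close> measurable.\<close>
    then have "A n = (B - N) \<union> (A n \<inter> N)" using t by (auto simp: A_def B_def)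
    moreover have "A n \<inter> N \<in> sets M" using complete[OF _ N(2), of "A n \<inter> N"] by auto
    ultimately show ?thesis using B N(2) by (metis null_setsD2 sets.Diff sets.Un)
  qed
  have "(\<lambda>n. measure M (A n)) \<longlonglongrightarrow> 0"
    unfolding A_def by (rule ucp[unfolded ucp_limit_def, rule_format, OF t half_gt_zero[OF e]])
  then have "\<forall>\<^sub>F n in sequentially. measure M (A n) < e / 2" by (rule order_tendstoD(2)) (use e in simp)
  then obtain N where N: "\<And>n. N \<le> n \<Longrightarrow> measure M (A n) < e / 2" by (auto simp: eventually_sequentially)
  show "\<exists>N. \<forall>n\<ge>N. norm (L0 (\<lambda>w. Js n t w - J t w) - 0) < e"
  proof (intro exI allI impI)
    fix n assume "N \<le> n"
    have "L0 (\<lambda>w. Js n t w - J t w) \<le> (\<integral>w. indicator (A n) w + e / 2 \<partial>M)"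
    proof (rule integral_mono')
      show "integrable M (\<lambda>w. indicator (A n) w + e / 2)"
        by (intro Bochner_Integration.integrable_add integrable_indicator_prob Am) simp
      show "min 1 \<bar>Js n t w - J t w\<bar> \<le> indicator (A n) w + e / 2" if "w \<in> space M" for w
      proof (cases "w \<in> A n")
        case False
        then have "\<bar>Js n t w - J t w\<bar> \<le> e / 2" using that t by (auto simp: A_def not_less)
        then have "min 1 \<bar>Js n t w - J t w\<bar> \<le> e / 2" by (rule order_trans[OF min.cobounded2])
        then show ?thesis using False by simp
      qed (use e in simp)
      show "0 \<le> indicator (A n) w + e / 2" for w using e by simp
    qed
    also have "\<dots> = measure M (A n) + e / 2"
      using integrable_indicator_prob[OF Am[of n]] by (subst Bochner_Integration.integral_add) (simp_all add: prob_space)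
    also have "\<dots> < e" using N[OF \<open>N \<le> n\<close>] by simp
    finally have "L0 (\<lambda>w. Js n t w - J t w) < e" .
    moreover have "0 \<le> L0 (\<lambda>w. Js n t w - J t w)" by (rule integral_nonneg_AE) simp
    ultimately show "norm (L0 (\<lambda>w. Js n t w - J t w) - 0) < e" by simp
  qed
qed

lemma stochastic_integral_regular:
  assumes "stochastic_integral M F Z H J" and Z: "cadlag_adapted M F Z"
  shows "adapted F J \<and> (AE w in M. \<forall>t\<ge>0. continuous (at_right t) (\<lambda>t. J t w))"
  using assms(1)
proof (induction rule: stochastic_integral.induct)
  case (elementary p \<eta> C n \<xi>)
  have "0 \<le> p i" for i using elementary(1,2) by (metis le0 monoD order_trans)
  then have "AE w in M. \<forall>t\<ge>0. continuous (at_right t) (\<lambda>t. elementary_integral Z n p \<xi> t w)"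
    using Z elementary_integral_right_continuous[of Z _ p _ n \<xi>]
    by (auto simp: cadlag_adapted_def cadlag_path_def elim!: AE_mp)
  moreover have "adapted F (elementary_integral Z n p \<xi>)"
    using Z elementary by (intro elementary_integral_adapted) (auto simp: cadlag_adapted_def)
  ultimately show ?case by simp
next
  case (bounded_limit Hs Js C H J)
  then show ?case by (auto simp: cadlag_adapted_def cadlag_path_def elim!: AE_mp)
qed

text \<open>Induction over the closure relation. The limit integrand is prescribed almost surely
  only and need not be predictable itself, so a predictable version is carried along.\<close>

lemma stochastic_integral_approximable:
  assumes "stochastic_integral M F Z H J" and Z: "cadlag_adapted M F Z"
  shows "\<exists>H'. approximable Z H' J \<and> (AE w in M. \<forall>s\<ge>0. H' s w = H s w)"
  using assms(1)
proof (induction rule: stochastic_integral.induct)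
  case (elementary p \<eta> C n \<xi>)
  let ?H = "elementary_process n p \<eta> \<xi>"
  have p0: "0 \<le> p i" for i using elementary(1,2) by (metis le0 monoD order_trans)
  have el: "elementary_predictable Q ?H" if "time_grid Q" "p ` {..n} \<subseteq> Q" for Q
    by (rule elementary_process_elementary_predictable[OF elementary that])
  have Q0: "time_grid (insert 0 (p ` {..n}))" using p0 by (auto simp: time_grid_def)
  note el0 = el[OF Q0, simplified]
  have "approximable Z ?H (elementary_integral Z n p \<xi>)"
    unfolding approximable_def
  proof (intro conjI allI impI)
    show "predictable M F ?H" unfolding predictable_def by (rule elementary_predictable_measurable[OF el0]) auto
    show "\<exists>C. \<forall>s\<ge>0. \<forall>w\<in>space M. \<bar>?H s w\<bar> \<le> C" using el0 unfolding elementary_predictable_def by blast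
    fix \<nu> :: "(real \<times> 'a) measure" and \<Theta> :: "real set" and e :: real
    assume \<Theta>: "finite \<Theta>" "\<Theta> \<subseteq> {0..}" and e: "0 < e"
    define Q where "Q = insert 0 (\<Theta> \<union> p ` {..n})"
    have Q: "time_grid Q" "p ` {..n} \<subseteq> Q" "\<Theta> \<subseteq> Q" using \<Theta> p0 by (auto simp: Q_def time_grid_def)
    have "elementary_integral Z n p \<xi> t w = path_sum Q ?H Z t w" if "t \<in> \<Theta>" for t w
      using that Q by (intro elementary_integral_eq_riemann_sum elementary) auto
    then show "\<exists>Q h. elementary_predictable Q h \<and> \<Theta> \<subseteq> Q \<and>
           energy \<nu> (\<lambda>s w. ?H s w - h s w) \<le> ennreal e \<and>
           (\<forall>t\<in>\<Theta>. L0 (\<lambda>w. elementary_integral Z n p \<xi> t w - path_sum Q h Z t w) \<le> e)"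
      using el[OF Q(1,2)] Q(3) e by (intro exI[of _ Q] exI[of _ ?H]) (simp add: split_def)
  qed
  then show ?case by (intro exI[of _ ?H]) simp
next
  case (bounded_limit Hs Js C H J)
  have "\<forall>n. \<exists>H'. approximable Z H' (Js n) \<and> (AE w in M. \<forall>s\<ge>0. H' s w = Hs n s w)"
    using bounded_limit.IH by simp
  from choice[OF this] obtain H' where H': "\<And>n. approximable Z (H' n) (Js n)"
    "\<And>n. AE w in M. \<forall>s\<ge>0. H' n s w = Hs n s w"
    by blast
  have "AE w in M. (\<forall>n. \<forall>s\<ge>0. H' n s w = Hs n s w) \<and> (\<forall>n. \<forall>s\<ge>0. \<bar>Hs n s w\<bar> \<le> C) \<and>
    (\<forall>s\<ge>0. (\<lambda>n. Hs n s w) \<longlonglongrightarrow> H s w)"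
    using H'(2) bounded_limit(2,3) by (simp add: AE_all_countable)
  then obtain G where G: "G \<in> sets (F 0)" "AE w in M. w \<in> G"
    and G': "\<And>w. w \<in> G \<Longrightarrow> w \<in> space M \<and> (\<forall>n. \<forall>s\<ge>0. H' n s w = Hs n s w) \<and> (\<forall>n. \<forall>s\<ge>0. \<bar>Hs n s w\<bar> \<le> C) \<and>
    (\<forall>s\<ge>0. (\<lambda>n. Hs n s w) \<longlonglongrightarrow> H s w)"
    by (rule prob_one_F0) blast
  \<comment> \<open>On \<open>G\<close> the bounds and limits hold at all nonnegative times; off
    \<open>G\<close> everything is 0. Hence \<open>K\<close> is an everywhere limit of bounded
    predictable processes.\<close>
  define K where "K s w = H s w * indicator G w" for s w
  have lim: "(\<lambda>n. H' n s w * indicator G w) \<longlonglongrightarrow> K s w" if "0 \<le> s" for s w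
    using G'[of w] that by (cases "w \<in> G") (auto simp: K_def)
  have bd: "\<bar>H' n s w * indicator G w\<bar> \<le> max C 0" if "0 \<le> s" for n s w
    using G'[of w] that by (cases "w \<in> G") (auto simp: le_max_iff_disj)
  have bdK: "\<bar>K s w\<bar> \<le> max C 0" if "0 \<le> s" for s w
    by (rule LIMSEQ_le_const2[OF tendsto_rabs[OF lim[OF that]]]) (use bd[OF that] in auto)
  have GP: "(\<lambda>x. indicator G (snd x) :: real) \<in> borel_measurable \<P>"
  proof -
    have "(\<lambda>x. indicator ({0..} \<times> G) x :: real) \<in> borel_measurable \<P>"
      by (rule borel_measurable_indicator[OF predictable_section_F0[OF G(1)]])
    moreover have "indicator ({0..} \<times> G) x = (indicator G (snd x) :: real)" if "x \<in> space \<P>" for x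
      using that by (cases x) (auto simp: indicator_def)
    ultimately show ?thesis by (subst measurable_cong[symmetric]) auto
  qed
  have H'm: "(\<lambda>x. H' n (fst x) (snd x) * indicator G (snd x)) \<in> borel_measurable \<P>" for n
    using H'(1)[of n] GP unfolding approximable_def predictable_def split_def by (intro borel_measurable_times) auto
  have Km: "(\<lambda>x. K (fst x) (snd x)) \<in> borel_measurable \<P>"
    by (rule borel_measurable_LIMSEQ_real[OF _ H'm]) (auto intro: lim)
  have "approximable Z K J"
    unfolding approximable_def
  proof (intro conjI allI impI)
    show "predictable M F K" using Km by (simp add: predictable_def split_def)
    show "\<exists>C. \<forall>s\<ge>0. \<forall>w\<in>space M. \<bar>K s w\<bar> \<le> C" using bdK by blast
    fix \<nu> :: "(real \<times> 'a) measure" and \<Theta> :: "real set" and e :: real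
    assume \<nu>: "finite_measure \<nu>" "sets \<nu> = sets \<P>" and \<Theta>: "finite \<Theta>" "\<Theta> \<subseteq> {0..}" and e: "0 < e"
    interpret \<nu>: finite_measure \<nu> by fact
    have sp: "space \<nu> = {0..} \<times> space M" using sets_eq_imp_space_eq[OF \<nu>(2)] by simp
    let ?d = "\<lambda>n x. (K (fst x) (snd x) - H' n (fst x) (snd x) * indicator G (snd x))\<^sup>2"
    have dm: "?d n \<in> borel_measurable \<nu>" for n
      using Km H'm[of n] unfolding measurable_cong_sets[OF \<nu>(2) refl] by measurable
    have "(\<lambda>n. \<integral>\<^sup>+x. ennreal (?d n x) \<partial>\<nu>) \<longlonglongrightarrow> (\<integral>\<^sup>+x. 0 \<partial>\<nu>)"
    proof (rule nn_integral_dominated_convergence[where w = "\<lambda>_. ennreal ((2 * max C 0)\<^sup>2)"])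
      show "(\<integral>\<^sup>+x. ennreal ((2 * max C 0)\<^sup>2) \<partial>\<nu>) < \<infinity>"
        by (simp add: ennreal_mult_eq_top_iff \<nu>.emeasure_eq_measure less_top[symmetric])
      show "AE x in \<nu>. ennreal (?d n x) \<le> ennreal ((2 * max C 0)\<^sup>2)" for n
      proof (rule AE_I2)
        fix x assume "x \<in> space \<nu>"
        then have "0 \<le> fst x" by (auto simp: sp)
        from bd[OF this, of n "snd x"] bdK[OF this, of "snd x"]
        have "\<bar>K (fst x) (snd x) - H' n (fst x) (snd x) * indicator G (snd x)\<bar> \<le> \<bar>2 * max C 0\<bar>" by linarith
        then show "ennreal (?d n x) \<le> ennreal ((2 * max C 0)\<^sup>2)" by (intro ennreal_leI) (rule power2_le_iff_abs_le[THEN iffD2], auto)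
      qed
      show "AE x in \<nu>. (\<lambda>n. ennreal (?d n x)) \<longlonglongrightarrow> 0"
      proof (rule AE_I2)
        fix x assume "x \<in> space \<nu>"
        then have "0 \<le> fst x" by (auto simp: sp)
        from tendsto_power[OF tendsto_diff[OF tendsto_const lim[OF this, of "snd x"]], of "K (fst x) (snd x)" 2]
        have "(\<lambda>n. ?d n x) \<longlonglongrightarrow> 0" by simp
        from tendsto_ennrealI[OF this] show "(\<lambda>n. ennreal (?d n x)) \<longlonglongrightarrow> 0" by simp
      qed
    qed (use dm in \<open>auto\<close>)
    then have "(\<lambda>n. \<integral>\<^sup>+x. ennreal (?d n x) \<partial>\<nu>) \<longlonglongrightarrow> 0" by simp
    then have "\<forall>\<^sub>F n in sequentially. (\<integral>\<^sup>+x. ennreal (?d n x) \<partial>\<nu>) < ennreal (e / 4)"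
      by (rule order_tendstoD(2)) (use e in simp)
    moreover have "\<forall>\<^sub>F n in sequentially. \<forall>t\<in>\<Theta>. L0 (\<lambda>w. Js n t w - J t w) < e / 2"
    proof (rule eventually_ball_finite[OF \<Theta>(1)], rule ballI)
      fix t assume "t \<in> \<Theta>"
      then have t: "0 \<le> t" using \<Theta>(2) by auto
      have "(\<lambda>n. \<integral>w. min 1 \<bar>Js n t w - J t w\<bar> \<partial>M) \<longlonglongrightarrow> 0"
      proof (rule ucp_limit_pointwise[OF _ _ _ _ bounded_limit(5) t])
        show "adapted F (Js n)" "AE w in M. \<forall>t\<ge>0. continuous (at_right t) (\<lambda>t. Js n t w)" for n
          using stochastic_integral_regular[OF bounded_limit(1) Z] by auto
        show "adapted F J" "AE w in M. \<forall>t\<ge>0. continuous (at_right t) (\<lambda>t. J t w)"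
          using bounded_limit(4) by (auto simp: cadlag_adapted_def cadlag_path_def elim!: AE_mp)
      qed
      then show "\<forall>\<^sub>F n in sequentially. L0 (\<lambda>w. Js n t w - J t w) < e / 2"
        by (rule order_tendstoD(2)) (use e in simp)
    qed
    ultimately have "\<forall>\<^sub>F n in sequentially. (\<integral>\<^sup>+x. ennreal (?d n x) \<partial>\<nu>) < ennreal (e / 4) \<and>
      (\<forall>t\<in>\<Theta>. L0 (\<lambda>w. Js n t w - J t w) < e / 2)" by eventually_elim simp
    then obtain n where n1: "(\<integral>\<^sup>+x. ennreal (?d n x) \<partial>\<nu>) < ennreal (e / 4)"
      and n2: "\<And>t. t \<in> \<Theta> \<Longrightarrow> L0 (\<lambda>w. Js n t w - J t w) < e / 2"
      by (auto simp: eventually_sequentially)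
    \<comment> \<open>The energy of a sum costs a factor 2, so two errors of \<open>e / 4\<close>
      give \<open>e\<close>. In probability the budget is \<open>e / 2\<close> for the limit and
      \<open>e / 4\<close> for the approximation of \<open>Js n\<close>.\<close>
    have "0 < e / 4" using e by simp
    from H'(1)[of n, unfolded approximable_def, THEN conjunct2, THEN conjunct2, rule_format, OF \<nu> \<Theta> this]
    obtain Q h where h: "elementary_predictable Q h" "\<Theta> \<subseteq> Q"
      and h1: "energy \<nu> (\<lambda>s w. H' n s w - h s w) \<le> ennreal (e / 4)"
      and h2: "\<And>t. t \<in> \<Theta> \<Longrightarrow> L0 (\<lambda>w. Js n t w - path_sum Q h Z t w) \<le> e / 4"
      by (elim exE conjE) blast
    define g where "g s w = h s w * indicator G w" for s w
    have g: "elementary_predictable Q g"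
      unfolding g_def[abs_def]
      by (rule elementary_predictable_mult[OF h(1) elementary_predictable_indicator_F0[OF G(1) elementary_predictableD(1)[OF h(1)]]])
    have hm: "(\<lambda>x. ennreal ((H' n (fst x) (snd x) - h (fst x) (snd x))\<^sup>2)) \<in> borel_measurable \<nu>"
    proof -
      have "(\<lambda>x. H' n (fst x) (snd x)) \<in> borel_measurable \<nu>" "(\<lambda>x. h (fst x) (snd x)) \<in> borel_measurable \<nu>"
        using H'(1)[of n] elementary_predictable_measurable[OF h(1)] unfolding measurable_cong_sets[OF \<nu>(2) refl]
        by (auto simp: approximable_def predictable_def split_def)
      then show ?thesis by measurable
    qed
    have "energy \<nu> (\<lambda>s w. K s w - g s w)
      \<le> (\<integral>\<^sup>+x. 2 * ennreal (?d n x) + 2 * ennreal ((H' n (fst x) (snd x) - h (fst x) (snd x))\<^sup>2) \<partial>\<nu>)"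
    proof (rule nn_integral_mono)
      fix x
      let ?a = "K (fst x) (snd x) - H' n (fst x) (snd x) * indicator G (snd x)"
      let ?b = "H' n (fst x) (snd x) - h (fst x) (snd x)"
      have "K (fst x) (snd x) - g (fst x) (snd x) = ?a + ?b * indicator G (snd x)"
        unfolding g_def left_diff_distrib by simp
      then have "(K (fst x) (snd x) - g (fst x) (snd x))\<^sup>2 \<le> 2 * ?d n x + 2 * (?b * indicator G (snd x))\<^sup>2"
        by (simp only: square_add_le)
      also have "\<dots> \<le> 2 * ?d n x + 2 * ?b\<^sup>2"
        by (intro add_left_mono mult_left_mono) (simp_all add: indicator_def)
      finally have "(K (fst x) (snd x) - g (fst x) (snd x))\<^sup>2 \<le> 2 * ?d n x + 2 * ?b\<^sup>2" .
      then have "ennreal ((K (fst x) (snd x) - g (fst x) (snd x))\<^sup>2) \<le> ennreal (2 * ?d n x + 2 * ?b\<^sup>2)" by (rule ennreal_leI)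
      also have "\<dots> = 2 * ennreal (?d n x) + 2 * ennreal (?b\<^sup>2)" by (simp add: ennreal_plus ennreal_mult)
      finally show "(case x of (s, w) \<Rightarrow> ennreal ((K s w - g s w)\<^sup>2)) \<le> 2 * ennreal (?d n x) + 2 * ennreal (?b\<^sup>2)"
        by (simp add: split_def)
    qed
    also have "\<dots> = 2 * (\<integral>\<^sup>+x. ennreal (?d n x) \<partial>\<nu>) + 2 * energy \<nu> (\<lambda>s w. H' n s w - h s w)"
      using dm[of n] hm by (simp add: nn_integral_add nn_integral_cmult split_def)
    also have "\<dots> \<le> 2 * ennreal (e / 4) + 2 * ennreal (e / 4)"
      using n1 h1 by (intro add_mono mult_left_mono) auto
    also have "\<dots> = ennreal e" using e by (simp add: mult_2 ennreal_plus[symmetric] del: ennreal_plus)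
    finally have 1: "energy \<nu> (\<lambda>s w. K s w - g s w) \<le> ennreal e" .
    have 2: "L0 (\<lambda>w. J t w - path_sum Q g Z t w) \<le> e" if t: "t \<in> \<Theta>" for t
    proof -
      have t0: "0 \<le> t" using t \<Theta>(2) by auto
      have m: "Js n t \<in> borel_measurable M" "J t \<in> borel_measurable M"
        using stochastic_integral_regular[OF bounded_limit(1)[of n] Z] bounded_limit(4) t0
        by (auto simp: adapted_def cadlag_adapted_def intro: measurable_F_M[of _ t])
      have mr: "(\<lambda>w. path_sum Q h Z t w) \<in> borel_measurable M"
        using Z by (intro measurable_F_M[OF riemann_sum_measurable[OF h(1) _ t0]]) (simp add: cadlag_adapted_def)
      have i: "integrable M (\<lambda>w. min 1 \<bar>Js n t w - J t w\<bar>)"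
        "integrable M (\<lambda>w. min 1 \<bar>Js n t w - path_sum Q h Z t w\<bar>)"
        using m mr by (auto intro!: integrable_min_1_abs borel_measurable_diff)
      have "L0 (\<lambda>w. J t w - path_sum Q g Z t w) \<le>
        (\<integral>w. min 1 \<bar>Js n t w - J t w\<bar> + min 1 \<bar>Js n t w - path_sum Q h Z t w\<bar> \<partial>M)"
      proof (rule integral_mono_AE')
        show "AE w in M. min 1 \<bar>J t w - path_sum Q g Z t w\<bar> \<le>
          min 1 \<bar>Js n t w - J t w\<bar> + min 1 \<bar>Js n t w - path_sum Q h Z t w\<bar>"
          using G(2)
        proof eventually_elim
          case (elim w)
          then have "(\<lambda>s. g s w) = (\<lambda>s. h s w)" by (simp add: g_def)
          then show ?case by (simp only: min_1_abs_triangle)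
        qed
      qed (use i in \<open>auto intro: Bochner_Integration.integrable_add\<close>)
      also have "\<dots> = L0 (\<lambda>w. Js n t w - J t w) + L0 (\<lambda>w. Js n t w - path_sum Q h Z t w)"
        by (rule Bochner_Integration.integral_add[OF i])
      also have "\<dots> \<le> e" using n2[OF t] h2[OF t] e by linarith
      finally show ?thesis .
    qed
    show "\<exists>Q h. elementary_predictable Q h \<and> \<Theta> \<subseteq> Q \<and>
           energy \<nu> (\<lambda>s w. K s w - h s w) \<le> ennreal e \<and>
           (\<forall>t\<in>\<Theta>. L0 (\<lambda>w. J t w - path_sum Q h Z t w) \<le> e)"
      using g h(2) 1 2 by blast
  qed
  moreover have "AE w in M. \<forall>s\<ge>0. K s w = H s w"
    using G(2) by eventually_elim (simp add: K_def)
  ultimately show ?case by blast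
qed

end

subsection \<open>Dyadic subdivisions of an interval\<close>

text \<open>The \<open>min\<close> holds the sequence at \<open>b\<close> from index
  \<open>2 ^ n\<close> on, so that it is monotone on all naturals as elementary integrals
  require.\<close>

definition grid :: "real \<Rightarrow> real \<Rightarrow> nat \<Rightarrow> nat \<Rightarrow> real" where
  "grid a b n k = a + (b - a) * (real (min k (2 ^ n)) / 2 ^ n)"

text \<open>The value at the left end is used on a left-open cell. This keeps the step process
  predictable and is the reason why left limits appear.\<close>

definition grid_step :: "real \<Rightarrow> real \<Rightarrow> nat \<Rightarrow> (real \<Rightarrow> real) \<Rightarrow> real \<Rightarrow> real" where
  "grid_step a b n f s = (\<Sum>k<2 ^ n. f (grid a b n k) * indicator {grid a b n k<..grid a b n (Suc k)} s)"

definition grid_sum :: "real \<Rightarrow> real \<Rightarrow> nat \<Rightarrow> (real \<Rightarrow> real) \<Rightarrow> (real \<Rightarrow> real) \<Rightarrow> real" where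
  "grid_sum a b n f z = (\<Sum>k<2 ^ n. f (grid a b n k) * (z (grid a b n (Suc k)) - z (grid a b n k)))"

lemma grid_0 [simp]: "grid a b n 0 = a"
  and grid_last: "grid a b n (2 ^ n) = b"
  by (simp_all add: grid_def)

context
  fixes a b :: real
  assumes ab: "a < b"
begin

lemma grid_mono: "mono (grid a b n)"
  unfolding grid_def mono_def
  using ab by (auto intro!: mult_left_mono divide_right_mono min.mono)

lemma grid_ge: "a \<le> grid a b n k" and grid_le: "grid a b n k \<le> b"
proof -
  show "a \<le> grid a b n k" using monoD[OF grid_mono, of 0 k n] by simp
  have "real (min k (2 ^ n)) \<le> real (2 ^ n)" by (simp only: of_nat_le_iff min.cobounded2)
  then have "real (min k (2 ^ n)) / 2 ^ n \<le> 1" by simp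
  then have "(b - a) * (real (min k (2 ^ n)) / 2 ^ n) \<le> (b - a) * 1" using ab by (intro mult_left_mono) auto
  then show "grid a b n k \<le> b" by (simp add: grid_def)
qed

lemma grid_Suc: "k < 2 ^ n \<Longrightarrow> grid a b n (Suc k) = grid a b n k + (b - a) / 2 ^ n"
  by (simp add: grid_def min_absorb1 add_divide_distrib distrib_left)

lemma grid_cell:
  assumes s: "a < s" "s \<le> b"
  obtains k where "k < 2 ^ n" "grid a b n k < s" "s \<le> grid a b n (Suc k)"
proof -
  define k where "k = (LEAST k. s \<le> grid a b n k)"
  have ex: "s \<le> grid a b n (2 ^ n)" using s by (simp add: grid_last)
  have 1: "s \<le> grid a b n k" unfolding k_def by (rule LeastI[of "\<lambda>k. s \<le> grid a b n k", OF ex])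
  have 2: "k \<le> 2 ^ n" unfolding k_def by (rule Least_le[of "\<lambda>k. s \<le> grid a b n k", OF ex])
  have "k \<noteq> 0" using 1 s by (metis grid_0 not_le)
  then obtain j where j: "k = Suc j" by (cases k) auto
  have "\<not> s \<le> grid a b n j" using not_less_Least[of j "\<lambda>k. s \<le> grid a b n k"] j by (simp add: k_def)
  then show ?thesis using that[of j] 1 2 j by simp
qed

lemma grid_step_cell:
  assumes "k < 2 ^ n" "grid a b n k < s" "s \<le> grid a b n (Suc k)"
  shows "grid_step a b n f s = f (grid a b n k)"
proof -
  have "f (grid a b n j) * indicator {grid a b n j<..grid a b n (Suc j)} s = (if j = k then f (grid a b n k) else 0)" for j
  proof (cases "j = k")
    case False
    then consider "Suc j \<le> k" | "Suc k \<le> j" by linarith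
    then have "s \<notin> {grid a b n j<..grid a b n (Suc j)}"
    proof cases
      case 1
      then show ?thesis using monoD[OF grid_mono 1, of n] assms by auto
    next
      case 2
      then show ?thesis using monoD[OF grid_mono 2, of n] assms by auto
    qed
    then show ?thesis using False by simp
  qed (use assms in simp)
  then show ?thesis using assms(1) by (simp add: grid_step_def)
qed

lemma grid_step_outside:
  assumes "s \<notin> {a<..b}"
  shows "grid_step a b n f s = 0"
  unfolding grid_step_def
proof (rule sum.neutral, rule ballI)
  fix k
  have "s \<notin> {grid a b n k<..grid a b n (Suc k)}" using assms grid_ge[of n k] grid_le[of n "Suc k"] by auto
  then show "f (grid a b n k) * indicator {grid a b n k<..grid a b n (Suc k)} s = 0" by simp
qed

lemma grid_step_bound:
  assumes "\<And>s. a \<le> s \<Longrightarrow> s \<le> b \<Longrightarrow> \<bar>f s\<bar> \<le> C" "0 \<le> C"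
  shows "\<bar>grid_step a b n f s\<bar> \<le> C"
proof (cases "s \<in> {a<..b}")
  case True
  then obtain k where "k < 2 ^ n" "grid a b n k < s" "s \<le> grid a b n (Suc k)" using grid_cell[of s n] by auto
  then show ?thesis using assms(1)[OF grid_ge grid_le] by (simp add: grid_step_cell)
qed (use assms in \<open>simp add: grid_step_outside\<close>)

text \<open>The left ends of the cells containing \<open>s\<close> tend to \<open>s\<close> and stay
  strictly below it.\<close>

lemma grid_step_tendsto:
  assumes s: "a < s" "s \<le> b" and l: "(f \<longlongrightarrow> l) (at_left s)"
  shows "(\<lambda>n. grid_step a b n f s) \<longlonglongrightarrow> l"
proof -
  have "\<forall>n. \<exists>k. k < 2 ^ n \<and> grid a b n k < s \<and> s \<le> grid a b n (Suc k)"
    using grid_cell[OF s] by metis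
  from choice[OF this] obtain k where k: "\<And>n. k n < 2 ^ n" "\<And>n. grid a b n (k n) < s" "\<And>n. s \<le> grid a b n (Suc (k n))"
    by blast
  let ?g = "\<lambda>n. grid a b n (k n)"
  have "(\<lambda>n. (b - a) / 2 ^ n) \<longlonglongrightarrow> 0"
    by (rule LIMSEQ_divide_realpow_zero) simp
  from tendsto_diff[OF tendsto_const this, of s] have "(\<lambda>n. s - (b - a) / 2 ^ n) \<longlonglongrightarrow> s" by simp
  moreover have "s - (b - a) / 2 ^ n \<le> ?g n" for n using k(3)[of n] grid_Suc[OF k(1), of n] by simp
  ultimately have "?g \<longlonglongrightarrow> s"
    by (intro tendsto_sandwich[OF _ _ _ tendsto_const, of _ ?g]) (auto intro!: always_eventually less_imp_le k(2))
  then have "filterlim ?g (at_left s) sequentially"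
    unfolding filterlim_at using k(2) by (simp add: less_imp_neq)
  from filterlim_compose[OF l this] show ?thesis
    by (simp add: grid_step_cell[OF k])
qed

end

text \<open>Associativity of integration: on each coarse cell the constant value of \<open>f\<close>
  factors out of the finer sum.\<close>

lemma riemann_sum_assoc:
  assumes Q: "time_grid Q" and Q': "time_grid Q'" and sub: "Q \<subseteq> Q'" and f: "step_on Q f" and "t \<in> Q"
  shows "riemann_sum Q' (\<lambda>s. f s * h s) z t = riemann_sum Q f (\<lambda>u. riemann_sum Q' h z u) t"
  using Q \<open>t \<in> Q\<close>
proof (induction t rule: time_grid_induct)
  case (step t)
  have p: "prev Q t < t" "0 \<le> prev Q t"
    using prev_less[OF Q step(2)] prev_nonneg[OF Q step(2)] by auto
  have "riemann_sum Q' (\<lambda>s. f s * h s) z t - riemann_sum Q' (\<lambda>s. f s * h s) z (prev Q t)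
      = (\<Sum>q\<in>Q' \<inter> {prev Q t<..t}. f q * h q * (z q - z (prev Q' q)))"
    by (rule riemann_sum_diff[OF Q']) (use p in auto)
  also have "\<dots> = (\<Sum>q\<in>Q' \<inter> {prev Q t<..t}. f t * (h q * (z q - z (prev Q' q))))"
  proof (rule sum.cong)
    fix q assume "q \<in> Q' \<inter> {prev Q t<..t}"
    then have "f q = f t" by (intro step_on_cell[OF f Q step(2)]) auto
    then show "f q * h q * (z q - z (prev Q' q)) = f t * (h q * (z q - z (prev Q' q)))" by simp
  qed simp
  also have "\<dots> = f t * (riemann_sum Q' h z t - riemann_sum Q' h z (prev Q t))"
    unfolding sum_distrib_left[symmetric]
    by (subst riemann_sum_diff[OF Q']) (use p in auto)
  finally show ?case using step riemann_sum_step[OF Q step(1,2), of f] by simp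
qed simp

lemma min_1_abs_sum: "min 1 \<bar>\<Sum>i\<in>I. x i\<bar> \<le> (\<Sum>i\<in>I. min 1 \<bar>x i :: real\<bar>)"
proof (induction I rule: infinite_finite_induct)
  case (insert i I)
  have "min 1 \<bar>x i + y\<bar> \<le> min 1 \<bar>x i\<bar> + min 1 \<bar>y\<bar>" for y
    using min_1_abs_triangle[of "x i" "- y" 0] by (simp add: add.commute)
  from order_trans[OF this add_left_mono[OF insert.IH]] show ?case using insert by simp
qed simp_all

section \<open>Grid sums against a stochastic integral\<close>

context usual_filtered_prob_space
begin

text \<open>At the finitely many times of \<open>Q\<close> the process \<open>J\<close> is replaced
  by the elementary integral of some \<open>h\<close>. Associativity then yields an elementary
  integral of \<open>c * h\<close> against \<open>Z\<close>, which \<open>controlled\<close> bounds.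
  The threshold does not depend on \<open>Q\<close>.\<close>

lemma approximable_transform_small:
  assumes H: "approximable Z H J" and Z: "controlled Z b" "adapted F Z" and J: "adapted F J" and d: "0 < d"
  obtains \<nu> \<eta> where "finite_measure \<nu>" "sets \<nu> = sets \<P>" "0 < \<eta>"
    "\<And>Q c. elementary_predictable Q c \<Longrightarrow> b \<in> Q \<Longrightarrow> (\<And>s w. \<bar>c s w\<bar> \<le> 1) \<Longrightarrow>
      energy \<nu> (\<lambda>s w. c s w * H s w) \<le> ennreal \<eta> \<Longrightarrow>
      L0 (path_sum Q c J b) \<le> d"
proof -
  obtain \<nu> \<eta> where \<nu>: "finite_measure \<nu>" "sets \<nu> = sets \<P>" "0 < \<eta>"
    and ctl: "\<And>Q h. elementary_predictable Q h \<Longrightarrow> b \<in> Q \<Longrightarrow>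
        energy \<nu> h \<le> ennreal \<eta> \<Longrightarrow>
        L0 (path_sum Q h Z b) \<le> d / 2"
    using Z(1)[unfolded controlled_def, rule_format, OF half_gt_zero[OF d]] by blast
  have "L0 (path_sum Q c J b) \<le> d"
    if c: "elementary_predictable Q c" and bQ: "b \<in> Q" and c1: "\<And>s w. \<bar>c s w\<bar> \<le> 1"
      and small: "energy \<nu> (\<lambda>s w. c s w * H s w) \<le> ennreal (\<eta> / 4)" for Q c
  proof -
    note Q = elementary_predictableD(1)[OF c]
    \<comment> \<open>Chosen after \<open>Q\<close>. The first bound keeps the energy of
      \<open>c * h\<close> below \<open>2 * (\<eta> / 4) + 2 * (\<eta> / 4)\<close>; the second pays
      for two errors per cell out of \<open>d / 2\<close>.\<close>
    define \<epsilon> where "\<epsilon> = min (\<eta> / 4) (d / (4 * (real (card Q) + 1)))"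
    have \<epsilon>: "0 < \<epsilon>" "\<epsilon> \<le> \<eta> / 4" "\<epsilon> \<le> d / (4 * (real (card Q) + 1))" unfolding \<epsilon>_def by (rule min.cobounded1 min.cobounded2 | use \<nu>(3) d in \<open>simp add: add_pos_nonneg\<close>)+
    have Qf: "finite Q" "Q \<subseteq> {0..}" using Q by (auto simp: time_grid_def)
    from H[unfolded approximable_def, THEN conjunct2, THEN conjunct2, rule_format, OF \<nu>(1,2) Qf \<epsilon>(1)]
    obtain R h where h: "elementary_predictable R h" "Q \<subseteq> R"
      and h1: "energy \<nu> (\<lambda>s w. H s w - h s w) \<le> ennreal \<epsilon>"
      and h2: "\<And>t. t \<in> Q \<Longrightarrow> L0 (\<lambda>w. J t w - path_sum R h Z t w) \<le> \<epsilon>"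
      by (elim exE conjE) blast
    note R = elementary_predictableD(1)[OF h(1)]
    have ch: "elementary_predictable R (\<lambda>s w. c s w * h s w)"
      by (rule elementary_predictable_mult[OF elementary_predictable_mono[OF c h(2) R] h(1)])
    have meas: "(\<lambda>x. c (fst x) (snd x)) \<in> borel_measurable \<nu>" "(\<lambda>x. h (fst x) (snd x)) \<in> borel_measurable \<nu>"
      "(\<lambda>x. H (fst x) (snd x)) \<in> borel_measurable \<nu>"
      using elementary_predictable_measurable[OF c] elementary_predictable_measurable[OF h(1)] H
      unfolding measurable_cong_sets[OF \<nu>(2) refl] approximable_def predictable_def by (simp_all add: split_def)
    have "energy \<nu> (\<lambda>s w. c s w * h s w) \<le>
      (\<integral>\<^sup>+x. 2 * ennreal ((c (fst x) (snd x) * H (fst x) (snd x))\<^sup>2) + 2 * ennreal ((H (fst x) (snd x) - h (fst x) (snd x))\<^sup>2) \<partial>\<nu>)"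
    proof (rule nn_integral_mono)
      fix x
      let ?c = "c (fst x) (snd x)" let ?h = "h (fst x) (snd x)" let ?H = "H (fst x) (snd x)"
      have "(?c * ?h)\<^sup>2 = (?c * ?H - ?c * (?H - ?h))\<^sup>2" by (simp add: right_diff_distrib)
      also have "\<dots> \<le> 2 * (?c * ?H)\<^sup>2 + 2 * (?c * (?H - ?h))\<^sup>2" by (rule square_diff_le)
      also have "(?c * (?H - ?h))\<^sup>2 \<le> (?H - ?h)\<^sup>2"
      proof -
        have "?c\<^sup>2 \<le> 1" using c1 by (simp add: abs_square_le_1)
        then have "?c\<^sup>2 * (?H - ?h)\<^sup>2 \<le> 1 * (?H - ?h)\<^sup>2" by (rule mult_right_mono) simp
        then show ?thesis by (simp add: power_mult_distrib)
      qed
      finally have "ennreal ((?c * ?h)\<^sup>2) \<le> ennreal (2 * (?c * ?H)\<^sup>2 + 2 * (?H - ?h)\<^sup>2)" by (intro ennreal_leI) simp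
      also have "\<dots> = 2 * ennreal ((?c * ?H)\<^sup>2) + 2 * ennreal ((?H - ?h)\<^sup>2)" by (simp add: ennreal_plus ennreal_mult)
      finally show "(case x of (s, w) \<Rightarrow> ennreal ((c s w * h s w)\<^sup>2)) \<le> 2 * ennreal ((?c * ?H)\<^sup>2) + 2 * ennreal ((?H - ?h)\<^sup>2)"
        by (simp add: split_def)
    qed
    also have "\<dots> = 2 * energy \<nu> (\<lambda>s w. c s w * H s w) + 2 * energy \<nu> (\<lambda>s w. H s w - h s w)"
      using meas by (simp add: nn_integral_add nn_integral_cmult split_def)
    also have "\<dots> \<le> 2 * ennreal (\<eta> / 4) + 2 * ennreal (\<eta> / 4)"
      using small order_trans[OF h1 ennreal_leI[OF \<epsilon>(2)]] by (intro add_mono mult_left_mono) auto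
    also have "\<dots> = ennreal \<eta>" using \<nu>(3) by (simp add: mult_2 ennreal_plus[symmetric] del: ennreal_plus)
    finally have 1: "L0 (\<lambda>w. riemann_sum R (\<lambda>s. c s w * h s w) (\<lambda>u. Z u w) b) \<le> d / 2"
      using h(2) bQ by (intro ctl[OF ch]) auto
    let ?I = "\<lambda>t w. path_sum R h Z t w"
    let ?D = "\<lambda>t w. min 1 \<bar>J t w - ?I t w\<bar>"
    have b0: "0 \<le> b" using time_gridD(3)[OF Q bQ] .
    have Im: "?I t \<in> borel_measurable M" if "0 \<le> t" for t
      by (rule measurable_F_M[OF riemann_sum_measurable[OF h(1) Z(2) that]])
    have Jm: "J t \<in> borel_measurable M" if "0 \<le> t" for t
      using J that unfolding adapted_def by (intro measurable_F_M[of _ t]) simp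
    have Di: "integrable M (?D t)" if "0 \<le> t" for t
      using Im[OF that] Jm[OF that] by (intro integrable_min_1_abs borel_measurable_diff)
    have iR: "integrable M (\<lambda>w. min 1 \<bar>riemann_sum R (\<lambda>s. c s w * h s w) (\<lambda>u. Z u w) b\<bar>)"
      by (intro integrable_min_1_abs measurable_F_M[OF riemann_sum_measurable[OF ch Z(2) b0]])
    have p: "0 \<le> q" "0 \<le> prev Q q" "prev Q q \<in> Q" "q \<in> Q" if "q \<in> Q \<inter> {0<..b}" for q
      using that prev_nonneg[OF Q, of q] prev_in[OF Q, of q] by auto
    have iS: "integrable M (\<lambda>w. \<Sum>q\<in>Q \<inter> {0<..b}. ?D q w + ?D (prev Q q) w)"
      using p by (intro Bochner_Integration.integrable_sum Bochner_Integration.integrable_add Di) auto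
    have "L0 (path_sum Q c J b) \<le>
      (\<integral>w. min 1 \<bar>riemann_sum R (\<lambda>s. c s w * h s w) (\<lambda>u. Z u w) b\<bar> + (\<Sum>q\<in>Q \<inter> {0<..b}. ?D q w + ?D (prev Q q) w) \<partial>M)"
    proof (rule integral_mono'[OF Bochner_Integration.integrable_add[OF iR iS]])
      fix w assume w: "w \<in> space M"
      show "0 \<le> min 1 \<bar>riemann_sum R (\<lambda>s. c s w * h s w) (\<lambda>u. Z u w) b\<bar> + (\<Sum>q\<in>Q \<inter> {0<..b}. ?D q w + ?D (prev Q q) w)"
        by (intro add_nonneg_nonneg sum_nonneg) auto
      let ?X = "riemann_sum R (\<lambda>s. c s w * h s w) (\<lambda>u. Z u w) b" and ?Y = "path_sum Q c J b w"
      have X: "?X = path_sum Q c ?I b w"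
        by (rule riemann_sum_assoc[OF Q R h(2) elementary_predictableD(2)[OF c w] bQ])
      have "?Y - ?X = (\<Sum>q\<in>Q \<inter> {0<..b}. c q w * ((J q w - ?I q w) - (J (prev Q q) w - ?I (prev Q q) w)))"
        unfolding X unfolding riemann_sum_def[of Q] sum_subtractf[symmetric] by (intro sum.cong) (auto simp: algebra_simps)
      then have "min 1 \<bar>?Y - ?X\<bar> \<le> (\<Sum>q\<in>Q \<inter> {0<..b}. min 1 \<bar>c q w * ((J q w - ?I q w) - (J (prev Q q) w - ?I (prev Q q) w))\<bar>)"
        by (simp only: min_1_abs_sum)
      also have "\<dots> \<le> (\<Sum>q\<in>Q \<inter> {0<..b}. ?D q w + ?D (prev Q q) w)"
      proof (rule sum_mono)
        fix q
        let ?x = "J q w - ?I q w" and ?y = "J (prev Q q) w - ?I (prev Q q) w"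
        have "\<bar>c q w * (?x - ?y)\<bar> \<le> 1 * \<bar>?x - ?y\<bar>" unfolding abs_mult by (rule mult_right_mono[OF c1]) simp
        then have "min 1 \<bar>c q w * (?x - ?y)\<bar> \<le> min 1 \<bar>?x - ?y\<bar>" by (intro min.mono) simp_all
        also have "\<dots> \<le> min 1 \<bar>0 - ?x\<bar> + min 1 \<bar>0 - ?y\<bar>" by (rule min_1_abs_triangle)
        also have "\<dots> = ?D q w + ?D (prev Q q) w" by (simp only: diff_0 abs_minus_cancel)
        finally show "min 1 \<bar>c q w * (?x - ?y)\<bar> \<le> ?D q w + ?D (prev Q q) w" .
      qed
      finally have *: "min 1 \<bar>?Y - ?X\<bar> \<le> (\<Sum>q\<in>Q \<inter> {0<..b}. ?D q w + ?D (prev Q q) w)" .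
      have "min 1 \<bar>?Y - 0\<bar> \<le> min 1 \<bar>?X - ?Y\<bar> + min 1 \<bar>?X - 0\<bar>" by (rule min_1_abs_triangle)
      then have "min 1 \<bar>?Y\<bar> \<le> min 1 \<bar>?Y - ?X\<bar> + min 1 \<bar>?X\<bar>" by (simp only: diff_0_right abs_minus_commute)
      then show "min 1 \<bar>?Y\<bar> \<le> min 1 \<bar>?X\<bar> + (\<Sum>q\<in>Q \<inter> {0<..b}. ?D q w + ?D (prev Q q) w)" using * by (simp only: add.commute)
    qed
    also have "\<dots> = L0 (\<lambda>w. riemann_sum R (\<lambda>s. c s w * h s w) (\<lambda>u. Z u w) b) +
        (\<integral>w. (\<Sum>q\<in>Q \<inter> {0<..b}. ?D q w + ?D (prev Q q) w) \<partial>M)"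
      by (rule Bochner_Integration.integral_add[OF iR iS])
    also have "(\<integral>w. (\<Sum>q\<in>Q \<inter> {0<..b}. ?D q w + ?D (prev Q q) w) \<partial>M) =
      (\<Sum>q\<in>Q \<inter> {0<..b}. (\<integral>w. ?D q w \<partial>M) + (\<integral>w. ?D (prev Q q) w \<partial>M))"
      using p by (subst Bochner_Integration.integral_sum) (auto intro!: sum.cong Bochner_Integration.integral_add Bochner_Integration.integrable_add Di)
    also have "\<dots> \<le> (\<Sum>q\<in>Q \<inter> {0<..b}. \<epsilon> + \<epsilon>)" using p by (intro sum_mono add_mono h2) auto
    also have "\<dots> = real (card (Q \<inter> {0<..b})) * (2 * \<epsilon>)" by simp
    also have "\<dots> \<le> (real (card Q) + 1) * (2 * (d / (4 * (real (card Q) + 1))))"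
    proof (rule mult_mono)
      have "card (Q \<inter> {0<..b}) \<le> card Q" by (intro card_mono Qf) auto
      then show "real (card (Q \<inter> {0<..b})) \<le> real (card Q) + 1" by simp
    qed (use \<epsilon> in auto)
    also have "\<dots> = d / 2" by (simp add: field_simps)
    finally show ?thesis using 1 by linarith
  qed
  moreover have "0 < \<eta> / 4" using \<nu>(3) by simp
  ultimately show ?thesis using that[OF \<nu>(1,2)] by blast
qed

lemma grid_sum_eq_riemann_sum:
  assumes Q: "time_grid Q" and ab: "a < b" and sub: "grid a b n ` {..2 ^ n} \<subseteq> Q"
  shows "grid_sum a b n (\<lambda>t. C t w) (\<lambda>u. J u w) =
    riemann_sum Q (\<lambda>s. elementary_process (2 ^ n) (grid a b n) (\<lambda>_. 0) (\<lambda>k. C (grid a b n k)) s w) (\<lambda>u. J u w) b"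
proof -
  have "b \<in> Q" using sub grid_last[of a b n] by force
  have "elementary_integral J (2 ^ n) (grid a b n) (\<lambda>k. C (grid a b n k)) b w = grid_sum a b n (\<lambda>t. C t w) (\<lambda>u. J u w)"
    unfolding elementary_integral_def grid_sum_def using grid_le[OF ab] by (simp add: min_absorb1)
  with elementary_integral_eq_riemann_sum[OF Q grid_mono[OF ab] sub \<open>b \<in> Q\<close>] show ?thesis by metis
qed

lemma grid_sum_measurable:
  assumes ab: "0 \<le> a" "a < b" and "adapted F C" "adapted F J"
  shows "(\<lambda>w. grid_sum a b n (\<lambda>t. C t w) (\<lambda>u. J u w)) \<in> borel_measurable M"
proof -
  have "0 \<le> grid a b n k" for k using grid_ge[OF ab(2), of n k] ab(1) by simp
  then have "C (grid a b n k) \<in> borel_measurable M" "J (grid a b n k) \<in> borel_measurable M" for k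
    using assms(3,4) unfolding adapted_def by (auto intro: measurable_F_M[of _ "grid a b n k"])
  then show ?thesis unfolding grid_sum_def by (intro borel_measurable_sum borel_measurable_times borel_measurable_diff)
qed

text \<open>The double limit is the form of dominated convergence used for the localizations of Tanaka's
  formula: \<open>n\<close> refines the grid, \<open>m\<close> is the localization parameter.\<close>

lemma grid_sum_vanishes:
  assumes H: "approximable Z H J" and Z: "controlled Z b" "adapted F Z" and J: "adapted F J"
    and ab: "0 \<le> a" "a < b"
    and C: "\<And>m. adapted F (C m)" "\<And>m s w. \<bar>C m s w\<bar> \<le> 1"
    and L: "AE w in M. \<forall>s. a < s \<and> s \<le> b \<longrightarrow> (\<forall>m. ((\<lambda>u. C m u w) \<longlongrightarrow> L m s w) (at_left s)) \<and>
      (\<lambda>m. L m s w * H s w) \<longlonglongrightarrow> 0"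
    and d: "0 < d"
  shows "\<forall>\<^sub>F m in sequentially. \<forall>\<^sub>F n in sequentially.
    L0 (\<lambda>w. grid_sum a b n (\<lambda>t. C m t w) (\<lambda>u. J u w)) \<le> d"
proof -
  obtain \<nu> \<eta> where \<nu>: "finite_measure \<nu>" "sets \<nu> = sets \<P>" "0 < \<eta>"
    and small: "\<And>Q c. elementary_predictable Q c \<Longrightarrow> b \<in> Q \<Longrightarrow> (\<And>s w. \<bar>c s w\<bar> \<le> 1) \<Longrightarrow>
      energy \<nu> (\<lambda>s w. c s w * H s w) \<le> ennreal \<eta> \<Longrightarrow>
      L0 (path_sum Q c J b) \<le> d"
    by (rule approximable_transform_small[OF H Z J d]) blast
  interpret \<nu>: finite_measure \<nu> by fact
  have sp: "space \<nu> = {0..} \<times> space M" using sets_eq_imp_space_eq[OF \<nu>(2)] by simp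
  from L obtain G where G: "G \<in> sets (F 0)" "AE w in M. w \<in> G"
    and G': "\<And>w. w \<in> G \<Longrightarrow> w \<in> space M \<and> (\<forall>s. a < s \<and> s \<le> b \<longrightarrow> (\<forall>m. ((\<lambda>u. C m u w) \<longlongrightarrow> L m s w) (at_left s)) \<and>
      (\<lambda>m. L m s w * H s w) \<longlonglongrightarrow> 0)"
    by (rule prob_one_F0) blast
  obtain B where B: "\<And>s w. 0 \<le> s \<Longrightarrow> w \<in> space M \<Longrightarrow> \<bar>H s w\<bar> \<le> B"
    using H[unfolded approximable_def, THEN conjunct2, THEN conjunct1] by blast
  \<comment> \<open>The indicator of \<open>G\<close> makes the limits below hold on every path
    while the weights stay adapted.\<close>
  define c where "c m n = elementary_process (2 ^ n) (grid a b n) (\<lambda>_. 0) (\<lambda>k w. C m (grid a b n k) w * indicator G w)" for m n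
  have c_eq: "c m n s w = grid_step a b n (\<lambda>t. C m t w * indicator G w) s" for m n s w
    by (simp add: c_def elementary_process_def grid_step_def)
  have C1: "\<bar>C m t w * indicator G w\<bar> \<le> 1" for m t w using C(2)[of m t w] by (simp add: indicator_def)
  have c1: "\<bar>c m n s w\<bar> \<le> 1" for m n s w unfolding c_eq by (rule grid_step_bound[OF ab(2) C1]) simp
  define Q where "Q n = insert 0 (grid a b n ` {..2 ^ n})" for n
  have grid0: "0 \<le> grid a b n k" for n k using grid_ge[OF ab(2), of n k] ab(1) by simp
  have Q: "time_grid (Q n)" "grid a b n ` {..2 ^ n} \<subseteq> Q n" "b \<in> Q n" for n
    using grid0 grid_last[of a b n] by (force simp: Q_def time_grid_def)+
  have cel: "elementary_predictable (Q n) (c m n)" for m n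
    unfolding c_def
  proof (rule elementary_process_elementary_predictable[where C = 1])
    show "\<forall>i<2 ^ n. (\<lambda>w. C m (grid a b n i) w * indicator G w) \<in> borel_measurable (F (grid a b n i)) \<and>
      (\<forall>w\<in>space M. \<bar>C m (grid a b n i) w * indicator G w\<bar> \<le> 1)"
    proof (intro allI impI conjI ballI C1)
      fix i
      have "G \<in> sets (F (grid a b n i))" using G(1) sets_F_mono[OF grid0] by blast
      moreover have "C m (grid a b n i) \<in> borel_measurable (F (grid a b n i))"
        using C(1)[of m] grid0 by (simp add: adapted_def)
      ultimately show "(\<lambda>w. C m (grid a b n i) w * indicator G w) \<in> borel_measurable (F (grid a b n i))"
        by (intro borel_measurable_times borel_measurable_indicator)
    qed
  qed (use grid0[of n 0] grid_mono[OF ab(2)] Q in auto)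
  define \<Lambda> where "\<Lambda> m s w = (if a < s \<and> s \<le> b then L m s w * indicator G w else 0)" for m s w
  have c_lim: "(\<lambda>n. c m n s w) \<longlonglongrightarrow> \<Lambda> m s w" for m s w
  proof (cases "a < s \<and> s \<le> b")
    case True
    have "((\<lambda>u. C m u w * indicator G w) \<longlongrightarrow> L m s w * indicator G w) (at_left s)"
    proof (cases "w \<in> G")
      case True': True
      have "((\<lambda>u. C m u w) \<longlongrightarrow> L m s w) (at_left s)" using G'[OF True'] True by blast
      then show ?thesis by (rule tendsto_mult_right)
    qed simp
    then show ?thesis using True unfolding c_eq \<Lambda>_def by (simp add: grid_step_tendsto[OF ab(2)])
  next
    case False
    then have "\<Lambda> m s w = 0" unfolding \<Lambda>_def by (rule if_not_P)
    moreover have "s \<notin> {a<..b}" using False by auto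
    ultimately show ?thesis by (simp add: c_eq grid_step_outside[OF ab(2)])
  qed
  have \<Lambda>1: "\<bar>\<Lambda> m s w\<bar> \<le> 1" for m s w
    by (rule LIMSEQ_le_const2[OF tendsto_rabs[OF c_lim]]) (use c1 in auto)
  have \<Lambda>_lim: "(\<lambda>m. \<Lambda> m s w * H s w) \<longlonglongrightarrow> 0" for s w
  proof (cases "w \<in> G \<and> a < s \<and> s \<le> b")
    case True
    then have "(\<lambda>m. L m s w * H s w) \<longlonglongrightarrow> 0" using G'[of w] by blast
    then show ?thesis using True by (simp add: \<Lambda>_def)
  next
    case False
    then have "\<Lambda> m s w = 0" for m by (auto simp: \<Lambda>_def)
    then show ?thesis by simp
  qed
  have Hm: "(\<lambda>x. H (fst x) (snd x)) \<in> borel_measurable \<nu>"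
    using H unfolding measurable_cong_sets[OF \<nu>(2) refl] approximable_def predictable_def by (simp add: split_def)
  have cm: "(\<lambda>x. c m n (fst x) (snd x)) \<in> borel_measurable \<nu>" for m n
    using elementary_predictable_measurable[OF cel[of n m]] unfolding measurable_cong_sets[OF \<nu>(2) refl] by (simp add: split_def)
  have \<Lambda>m: "(\<lambda>x. \<Lambda> m (fst x) (snd x)) \<in> borel_measurable \<nu>" for m
    by (rule borel_measurable_LIMSEQ_real[OF c_lim cm])
  have fin: "(\<integral>\<^sup>+x. ennreal (B\<^sup>2) \<partial>\<nu>) < \<infinity>"
    by (simp add: ennreal_mult_eq_top_iff \<nu>.emeasure_eq_measure less_top[symmetric])
  have dom: "AE x in \<nu>. ennreal ((z x * H (fst x) (snd x))\<^sup>2) \<le> ennreal (B\<^sup>2)" if "\<And>x. \<bar>z x\<bar> \<le> 1" for z :: "real \<times> 'a \<Rightarrow> real"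
  proof (intro AE_I2 ennreal_leI)
    fix x assume "x \<in> space \<nu>"
    then have "\<bar>H (fst x) (snd x)\<bar> \<le> B" by (intro B) (auto simp: sp)
    then have "\<bar>z x * H (fst x) (snd x)\<bar> \<le> 1 * B" unfolding abs_mult using that[of x] by (intro mult_mono) auto
    then have "\<bar>z x * H (fst x) (snd x)\<bar>\<^sup>2 \<le> B\<^sup>2" by (intro power_mono) auto
    then show "(z x * H (fst x) (snd x))\<^sup>2 \<le> B\<^sup>2" by simp
  qed
  let ?E = "\<lambda>m x. ennreal ((\<Lambda> m (fst x) (snd x) * H (fst x) (snd x))\<^sup>2)"
  \<comment> \<open>For fixed \<open>m\<close>, refining the grid replaces the step weights by their
    left limits. Only afterwards does \<open>m\<close> grow and the product with \<open>H\<close>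
    vanish.\<close>
  have lim1: "(\<lambda>n. \<integral>\<^sup>+x. ennreal ((c m n (fst x) (snd x) * H (fst x) (snd x))\<^sup>2) \<partial>\<nu>)
    \<longlonglongrightarrow> (\<integral>\<^sup>+x. ?E m x \<partial>\<nu>)" for m
  proof (rule nn_integral_dominated_convergence[OF _ _ _ dom fin])
    show "AE x in \<nu>. (\<lambda>n. ennreal ((c m n (fst x) (snd x) * H (fst x) (snd x))\<^sup>2)) \<longlonglongrightarrow> ?E m x"
      by (intro AE_I2 tendsto_ennrealI tendsto_power tendsto_mult c_lim tendsto_const)
  qed (use cm \<Lambda>m Hm c1 in \<open>simp_all\<close>)
  have "(\<lambda>m. \<integral>\<^sup>+x. ?E m x \<partial>\<nu>) \<longlonglongrightarrow> (\<integral>\<^sup>+x. 0 \<partial>\<nu>)"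
  proof (rule nn_integral_dominated_convergence[OF _ _ _ dom fin])
    show "AE x in \<nu>. (\<lambda>m. ?E m x) \<longlonglongrightarrow> 0"
    proof (rule AE_I2)
      fix x
      from tendsto_ennrealI[OF tendsto_power[OF \<Lambda>_lim[of "fst x" "snd x"], of 2]]
      show "(\<lambda>m. ?E m x) \<longlonglongrightarrow> 0" by simp
    qed
  qed (use \<Lambda>m Hm \<Lambda>1 in \<open>simp_all\<close>)
  then have "\<forall>\<^sub>F m in sequentially. (\<integral>\<^sup>+x. ?E m x \<partial>\<nu>) < ennreal \<eta>"
    by (intro order_tendstoD(2)[of _ 0]) (use \<nu>(3) in simp_all)
  then show ?thesis
  proof eventually_elim
    case (elim m)
    from order_tendstoD(2)[OF lim1 elim] show ?case
    proof eventually_elim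
      case (elim n)
      have "L0 (\<lambda>w. path_sum (Q n) (c m n) J b w) \<le> d"
        using elim by (intro small[OF cel Q(3) c1]) (simp add: split_def less_imp_le)
      moreover have "L0 (\<lambda>w. path_sum (Q n) (c m n) J b w) =
        L0 (\<lambda>w. grid_sum a b n (\<lambda>t. C m t w) (\<lambda>u. J u w))"
      proof (rule integral_cong_AE)
        have b0: "0 \<le> b" using ab by simp
        show "(\<lambda>w. min 1 \<bar>path_sum (Q n) (c m n) J b w\<bar>) \<in> borel_measurable M"
          by (rule borel_measurable_integrable[OF integrable_min_1_abs[OF measurable_F_M[OF riemann_sum_measurable[OF cel J b0]]]])
        show "(\<lambda>w. min 1 \<bar>grid_sum a b n (\<lambda>t. C m t w) (\<lambda>u. J u w)\<bar>) \<in> borel_measurable M"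
          by (rule borel_measurable_integrable[OF integrable_min_1_abs[OF grid_sum_measurable[OF ab C(1) J]]])
        show "AE w in M. min 1 \<bar>path_sum (Q n) (c m n) J b w\<bar> = min 1 \<bar>grid_sum a b n (\<lambda>t. C m t w) (\<lambda>u. J u w)\<bar>"
          using G(2)
        proof eventually_elim
          case (elim w)
          then show ?case
            unfolding grid_sum_eq_riemann_sum[OF Q(1) ab(2) Q(2)] c_def by (simp add: elementary_process_def)
        qed
      qed
      ultimately show ?case by simp
    qed
  qed
qed

text \<open>Fatou's lemma, applied twice, shows that the iterated lower limit has mean at most every
  positive \<open>d\<close>. Smallness in probability yields pathwise smallness along subsequences
  only, hence \<open>frequently\<close> in place of \<open>eventually\<close>.\<close>

lemma frequently_small:
  assumes X: "\<And>m n. X m n \<in> borel_measurable M"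
    and small: "\<And>d. 0 < d \<Longrightarrow> \<forall>\<^sub>F m in sequentially. \<forall>\<^sub>F n in sequentially. L0 (X m n) \<le> d"
  shows "AE w in M. \<forall>e>0. \<exists>\<^sub>F m in sequentially. \<exists>\<^sub>F n in sequentially. \<bar>X m n w :: real\<bar> < e"
proof -
  let ?g = "\<lambda>m n w. ennreal (min 1 \<bar>X m n w\<bar>)"
  have gm: "?g m n \<in> borel_measurable M" for m n using X[of m n] by measurable
  have gi: "(\<integral>\<^sup>+w. ?g m n w \<partial>M) = ennreal (L0 (X m n))" for m n
    by (rule nn_integral_eq_integral[OF integrable_min_1_abs[OF X]]) simp
  let ?r = "\<lambda>m w. liminf (\<lambda>n. ?g m n w)"
  have rm: "?r m \<in> borel_measurable M" for m using gm by measurable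
  have "(\<integral>\<^sup>+w. liminf (\<lambda>m. ?r m w) \<partial>M) \<le> ennreal d" if "0 < d" for d
  proof -
    have "(\<integral>\<^sup>+w. liminf (\<lambda>m. ?r m w) \<partial>M) \<le> liminf (\<lambda>m. \<integral>\<^sup>+w. ?r m w \<partial>M)"
      by (rule nn_integral_liminf[OF rm])
    also have "\<dots> \<le> liminf (\<lambda>m. liminf (\<lambda>n. \<integral>\<^sup>+w. ?g m n w \<partial>M))"
      by (intro Liminf_mono always_eventually allI nn_integral_liminf[OF gm])
    also have "\<dots> \<le> liminf (\<lambda>m. ennreal d)"
    proof (rule Liminf_mono)
      show "\<forall>\<^sub>F m in sequentially. liminf (\<lambda>n. \<integral>\<^sup>+w. ?g m n w \<partial>M) \<le> ennreal d"
        using small[OF that]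
      proof eventually_elim
        case (elim m)
        then have "\<forall>\<^sub>F n in sequentially. (\<integral>\<^sup>+w. ?g m n w \<partial>M) \<le> ennreal d"
          by eventually_elim (simp only: gi ennreal_leI)
        then have "liminf (\<lambda>n. \<integral>\<^sup>+w. ?g m n w \<partial>M) \<le> liminf (\<lambda>n. ennreal d)" by (rule Liminf_mono)
        then show ?case by (simp add: Liminf_const)
      qed
    qed
    finally show ?thesis by (simp add: Liminf_const)
  qed
  then have "(\<integral>\<^sup>+w. liminf (\<lambda>m. ?r m w) \<partial>M) \<le> 0 + ennreal d" if "0 < d" for d using that by simp
  then have "(\<integral>\<^sup>+w. liminf (\<lambda>m. ?r m w) \<partial>M) \<le> 0" by (rule ennreal_le_epsilon)
  moreover have "(\<lambda>w. liminf (\<lambda>m. ?r m w)) \<in> borel_measurable M" using rm by measurable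
  ultimately have "AE w in M. liminf (\<lambda>m. ?r m w) = 0" by (simp add: nn_integral_0_iff_AE)
  then show ?thesis
  proof eventually_elim
    case (elim w)
    show ?case
    proof (intro allI impI, rule ccontr)
      fix e :: real assume e: "0 < e"
      assume "\<not> (\<exists>\<^sub>F m in sequentially. \<exists>\<^sub>F n in sequentially. \<bar>X m n w\<bar> < e)"
      then have "\<forall>\<^sub>F m in sequentially. \<forall>\<^sub>F n in sequentially. e \<le> \<bar>X m n w\<bar>"
        by (simp add: frequently_def not_less)
      then have "\<forall>\<^sub>F m in sequentially. ennreal (min 1 e) \<le> ?r m w"
      proof eventually_elim
        case (elim m)
        then have "\<forall>\<^sub>F n in sequentially. ennreal (min 1 e) \<le> ?g m n w"
          by eventually_elim (intro ennreal_leI min.mono order_refl)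
        then have "liminf (\<lambda>n. ennreal (min 1 e)) \<le> ?r m w" by (rule Liminf_mono)
        then show ?case by (simp add: Liminf_const)
      qed
      then have "liminf (\<lambda>m. ennreal (min 1 e)) \<le> liminf (\<lambda>m. ?r m w)" by (rule Liminf_mono)
      then have "ennreal (min 1 e) \<le> 0" using elim by (simp add: Liminf_const)
      then show False using e by simp
    qed
  qed
qed

end

subsection \<open>Lebesgue-Stieltjes measures on the line\<close>

text \<open>The difference of the distribution functions is nondecreasing: at rational points by
  assumption, elsewhere by right-continuity. It generates a measure \<open>\<gamma>\<close>, and
  uniqueness of distribution functions identifies \<open>\<mu> + \<gamma>\<close> with
  \<open>\<nu>\<close>.\<close>

lemma measure_le_Ioc_finite:
  fixes \<mu> \<nu> :: "real measure"
  assumes \<mu>: "finite_measure \<mu>" "sets \<mu> = sets borel" and \<nu>: "finite_measure \<nu>" "sets \<nu> = sets borel"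
    and le: "\<And>a b. a \<in> \<rat> \<Longrightarrow> b \<in> \<rat> \<Longrightarrow> a < b \<Longrightarrow> emeasure \<mu> {a<..b} \<le> emeasure \<nu> {a<..b}"
    and B: "B \<in> sets borel"
  shows "emeasure \<mu> B \<le> emeasure \<nu> B"
proof -
  interpret \<mu>: finite_borel_measure \<mu> using \<mu> by (simp add: finite_borel_measure_def finite_borel_measure_axioms_def)
  interpret \<nu>: finite_borel_measure \<nu> using \<nu> by (simp add: finite_borel_measure_def finite_borel_measure_axioms_def)
  define G where "G x = cdf \<nu> x - cdf \<mu> x" for x
  have rat: "G a \<le> G b" if "a \<in> \<rat>" "b \<in> \<rat>" "a < b" for a b
    using le[OF that] \<mu>.cdf_diff_eq[OF that(3)] \<nu>.cdf_diff_eq[OF that(3)]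
    by (simp add: G_def \<mu>.emeasure_eq_measure \<nu>.emeasure_eq_measure)
  have rc: "continuous (at_right x) G" for x
    unfolding G_def by (intro continuous_diff \<mu>.cdf_is_right_cont \<nu>.cdf_is_right_cont)
  have approx: "\<exists>q\<in>\<rat>. x < q \<and> q < y \<and> \<bar>G q - G x\<bar> < e" if "x < y" "0 < e" for x y e
  proof -
    have "(G \<longlongrightarrow> G x) (at_right x)" using rc[of x] by (simp add: continuous_within)
    from tendstoD[OF this that(2)] obtain b where b: "x < b" "\<And>u. x < u \<Longrightarrow> u < b \<Longrightarrow> dist (G u) (G x) < e"
      unfolding eventually_at_right_field by blast
    have "x < min b y" using b(1) that by simp
    then obtain q where "q \<in> \<rat>" "x < q" "q < min b y" using Rats_dense_in_real by blast
    then show ?thesis using b(2)[of q] by (intro bexI[of _ q]) (auto simp: dist_real_def)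
  qed
  have mono: "G x \<le> G y" if "x \<le> y" for x y
  proof (cases "x = y")
    case False
    then have xy: "x < y" using that by simp
    show ?thesis
    proof (rule field_le_epsilon)
      fix e :: real assume e: "0 < e"
      obtain q where q: "q \<in> \<rat>" "x < q" "q < y" "\<bar>G q - G x\<bar> < e / 2"
        using approx[OF xy half_gt_zero[OF e]] by blast
      obtain r where r: "r \<in> \<rat>" "y < r" "\<bar>G r - G y\<bar> < e / 2"
        using approx[of y "y + 1", OF _ half_gt_zero[OF e]] by auto
      have "G q \<le> G r" using q r by (intro rat) auto
      then show "G x \<le> G y + e" using q r by linarith
    qed
  qed simp
  have bot: "(G \<longlongrightarrow> 0) at_bot"
    unfolding G_def using tendsto_diff[OF \<nu>.cdf_lim_at_bot \<mu>.cdf_lim_at_bot] by simp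
  have top: "(G \<longlongrightarrow> measure \<nu> (space \<nu>) - measure \<mu> (space \<mu>)) at_top"
    unfolding G_def by (intro tendsto_diff \<nu>.cdf_lim_at_top \<mu>.cdf_lim_at_top)
  have G0: "0 \<le> G x" for x
    by (rule tendsto_upperbound[OF bot]) (auto intro!: eventually_at_bot_linorderI[of x] mono)
  have m: "0 \<le> measure \<nu> (space \<nu>) - measure \<mu> (space \<mu>)"
    by (rule tendsto_lowerbound[OF top]) (auto simp: G0)
  define \<gamma> where "\<gamma> = interval_measure G"
  interpret \<gamma>: finite_borel_measure \<gamma>
    unfolding \<gamma>_def by (rule finite_borel_measure_interval_measure[OF mono rc bot top m])
  have \<gamma>: "finite_measure \<gamma>" "sets \<gamma> = sets borel"
    by (rule \<gamma>.finite_measure_axioms) (simp add: \<gamma>_def)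
  have "sets \<mu> = sets \<gamma>" using \<mu>(2) \<gamma>(2) by simp
  from finite_measure_sum[OF \<mu>(1) \<gamma>(1) this] obtain \<rho> where
    \<rho>: "finite_measure \<rho>" "sets \<rho> = sets \<gamma>" "\<And>A. A \<in> sets \<gamma> \<Longrightarrow> emeasure \<rho> A = emeasure \<mu> A + emeasure \<gamma> A"
    by metis
  interpret \<rho>: finite_borel_measure \<rho> using \<rho> \<gamma> by (simp add: finite_borel_measure_def finite_borel_measure_axioms_def)
  have "cdf \<rho> x = cdf \<nu> x" for x
  proof -
    have "ennreal (measure \<rho> {..x}) = ennreal (measure \<mu> {..x} + measure \<gamma> {..x})"
      using \<rho>(3)[of "{..x}"] \<gamma>(2) by (simp add: \<rho>.emeasure_eq_measure \<mu>.emeasure_eq_measure \<gamma>.emeasure_eq_measure ennreal_plus)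
    then have "cdf \<rho> x = cdf \<mu> x + cdf \<gamma> x"
      by (subst (asm) ennreal_inj) (auto simp: cdf_def)
    also have "cdf \<gamma> x = G x" unfolding \<gamma>_def by (subst cdf_interval_measure[OF mono rc bot]) auto
    finally show ?thesis by (simp add: G_def)
  qed
  then have "\<rho> = \<nu>" by (intro cdf_unique' \<rho>.finite_borel_measure_axioms \<nu>.finite_borel_measure_axioms ext)
  then show ?thesis using \<rho>(3)[of B] B \<gamma>(2) by simp
qed

lemma emeasure_density_indicator:
  fixes \<kappa> :: "real measure"
  assumes "sets \<kappa> = sets borel" "A \<in> sets borel" "E \<in> sets borel"
  shows "emeasure (density \<kappa> (indicator E)) A = emeasure \<kappa> (E \<inter> A)"
proof -
  have "indicator E \<in> borel_measurable \<kappa>" "A \<in> sets \<kappa>" "E \<inter> A \<in> sets \<kappa>"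
    using assms by (auto simp: measurable_cong_sets[OF assms(1) refl])
  then have "emeasure (density \<kappa> (indicator E)) A = (\<integral>\<^sup>+x. indicator E x * indicator A x \<partial>\<kappa>)"
    by (intro emeasure_density)
  also have "\<dots> = (\<integral>\<^sup>+x. indicator (E \<inter> A) x \<partial>\<kappa>)" by (simp add: indicator_inter_arith)
  also have "\<dots> = emeasure \<kappa> (E \<inter> A)" using \<open>E \<inter> A \<in> sets \<kappa>\<close> by simp
  finally show ?thesis .
qed

text \<open>Restriction to \<open>(-n, n]\<close> leads back to finite measures. Rational end points
  matter because exceptional null sets of paths can be united over countably many intervals
  only.\<close>

lemma measure_le_Ioc:
  fixes \<mu> \<nu> :: "real measure"
  assumes \<mu>: "sets \<mu> = sets borel" and \<nu>: "sets \<nu> = sets borel" "\<And>a b. emeasure \<nu> {a<..b} < \<infinity>"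
    and le: "\<And>a b. a \<in> \<rat> \<Longrightarrow> b \<in> \<rat> \<Longrightarrow> a < b \<Longrightarrow> emeasure \<mu> {a<..b} \<le> emeasure \<nu> {a<..b}"
    and B: "B \<in> sets borel"
  shows "emeasure \<mu> B \<le> emeasure \<nu> B"
proof -
  define I where "I n = {- real n<..real n}" for n
  have I: "I n \<in> sets borel" for n by (simp add: I_def)
  note D = emeasure_density_indicator[OF \<mu> _ I] emeasure_density_indicator[OF \<nu>(1) _ I]
  have J: "I n \<inter> {a<..b} = {max a (- real n)<..min b (real n)}" for n a b by (auto simp: I_def)
  have step: "emeasure \<mu> (I n \<inter> A) \<le> emeasure \<nu> (I n \<inter> A)" if A: "A \<in> sets borel" for n A
  proof -
    have le': "emeasure \<mu> (I n \<inter> {a<..b}) \<le> emeasure \<nu> (I n \<inter> {a<..b})" if "a \<in> \<rat>" "b \<in> \<rat>" for a b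
    proof (cases "max a (- real n) < min b (real n)")
      case True
      have "max a (- real n) \<in> \<rat>" "min b (real n) \<in> \<rat>" using that by (auto simp: max_def min_def)
      then show ?thesis unfolding J using True by (rule le)
    next
      case False
      then have e: "{max a (- real n)<..min b (real n)} = {}" by auto
      show ?thesis unfolding J e by simp
    qed
    have "emeasure \<nu> (I n) < \<infinity>" unfolding I_def by (rule \<nu>(2))
    moreover have "emeasure \<mu> (I n) \<le> emeasure \<nu> (I n)"
      using le'[of "- real n" "real n"] by (simp add: I_def[symmetric])
    ultimately have f: "emeasure \<mu> (I n) < \<infinity>" "emeasure \<nu> (I n) < \<infinity>" by auto
    have "emeasure (density \<mu> (indicator (I n))) A \<le> emeasure (density \<nu> (indicator (I n))) A"
    proof (rule measure_le_Ioc_finite[OF _ _ _ _ _ A])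
      show "finite_measure (density \<mu> (indicator (I n)))" "finite_measure (density \<nu> (indicator (I n)))"
        using f \<mu> \<nu>(1) D[of UNIV] by (auto intro!: finite_measureI simp: sets_eq_imp_space_eq)
    qed (use \<mu> \<nu>(1) D le' in auto)
    then show ?thesis using D[OF A] by simp
  qed
  have U: "(\<Union>n. I n \<inter> B) = B" using UN_Ioc_eq_UNIV unfolding I_def by blast
  have inc: "incseq (\<lambda>n. I n \<inter> B)" by (auto simp: incseq_def I_def)
  have "emeasure \<mu> B = (SUP n. emeasure \<mu> (I n \<inter> B))"
    using SUP_emeasure_incseq[OF _ inc, of \<mu>] \<mu> B I U by (simp add: image_subset_iff)
  also have "\<dots> \<le> (SUP n. emeasure \<nu> (I n \<inter> B))" using step[OF B] by (intro SUP_mono) auto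
  also have "\<dots> = emeasure \<nu> B"
    using SUP_emeasure_incseq[OF _ inc, of \<nu>] \<nu>(1) B I U by (simp add: image_subset_iff)
  finally show ?thesis .
qed

lemma grid_sum_eq_integral:
  fixes G :: "real \<Rightarrow> real"
  assumes ab: "a < b" and G: "\<And>x y. x \<le> y \<Longrightarrow> G x \<le> G y" "\<And>x. continuous (at_right x) G"
  shows "grid_sum a b n f G = (\<integral>s. grid_step a b n f s \<partial>interval_measure G)"
    and "integrable (interval_measure G) (grid_step a b n f)"
proof -
  let ?I = "\<lambda>k. {grid a b n k<..grid a b n (Suc k)}"
  have le: "grid a b n k \<le> grid a b n (Suc k)" for k by (rule monoD[OF grid_mono[OF ab]]) simp
  have i: "integrable (interval_measure G) (\<lambda>s. f (grid a b n k) * indicator (?I k) s)" for k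
    using emeasure_interval_measure_Ioc[OF le G, of k] by (intro integrable_mult_right integrable_real_indicator) auto
  have m: "measure (interval_measure G) (?I k) = G (grid a b n (Suc k)) - G (grid a b n k)" for k
    by (rule measure_interval_measure_Ioc[OF le G])
  show "integrable (interval_measure G) (grid_step a b n f)"
    unfolding grid_step_def[abs_def] by (rule Bochner_Integration.integrable_sum[OF i])
  have "(\<integral>s. grid_step a b n f s \<partial>interval_measure G) = (\<Sum>k<2 ^ n. \<integral>s. f (grid a b n k) * indicator (?I k) s \<partial>interval_measure G)"
    unfolding grid_step_def by (rule Bochner_Integration.integral_sum[OF i])
  also have "\<dots> = grid_sum a b n f G" unfolding grid_sum_def by (intro sum.cong refl) (simp add: m)
  finally show "grid_sum a b n f G = (\<integral>s. grid_step a b n f s \<partial>interval_measure G)" ..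
qed

lemma grid_step_borel [measurable]: "grid_step a b n f \<in> borel_measurable borel"
  unfolding grid_step_def[abs_def] by measurable

lemma left_limit_measurable:
  assumes ab: "a < b" and l: "\<And>s. a < s \<Longrightarrow> s \<le> b \<Longrightarrow> (f \<longlongrightarrow> l s) (at_left s)"
  shows "(\<lambda>s. if a < s \<and> s \<le> b then l s else 0) \<in> borel_measurable borel"
    and "(\<lambda>n. grid_step a b n f s) \<longlonglongrightarrow> (if a < s \<and> s \<le> b then l s else 0)"
proof -
  show lim: "(\<lambda>n. grid_step a b n f s) \<longlonglongrightarrow> (if a < s \<and> s \<le> b then l s else 0)" for s
  proof (cases "a < s \<and> s \<le> b")
    case True
    then show ?thesis using grid_step_tendsto[OF ab _ _ l] by simp
  next
    case False
    then have "grid_step a b n f s = 0" for n by (intro grid_step_outside ab) auto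
    then show ?thesis unfolding if_not_P[OF False] by simp
  qed
  show "(\<lambda>s. if a < s \<and> s \<le> b then l s else 0) \<in> borel_measurable borel"
    by (rule borel_measurable_LIMSEQ_real[OF lim]) simp
qed

lemma integrable_Ioc_bounded:
  fixes G h :: "real \<Rightarrow> real"
  assumes G: "\<And>x y. x \<le> y \<Longrightarrow> G x \<le> G y" "\<And>x. continuous (at_right x) G"
    and h: "h \<in> borel_measurable borel" "\<And>s. \<bar>h s\<bar> \<le> indicator {a<..b} s"
  shows "integrable (interval_measure G) h" "integrable (interval_measure G) (indicator {a<..b} :: real \<Rightarrow> real)"
proof -
  show i: "integrable (interval_measure G) (indicator {a<..b} :: real \<Rightarrow> real)"
    using emeasure_interval_measure_Ioc_eq[OF G, of a b] by (intro integrable_real_indicator) auto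
  show "integrable (interval_measure G) h"
    by (rule Bochner_Integration.integrable_bound[OF i]) (use h in auto)
qed

text \<open>Dominated convergence under the Stieltjes measure: the step weights tend to left limits
  and are bounded by the indicator of \<open>(a, b]\<close>.\<close>

lemma grid_sum_tendsto:
  fixes G f l :: "real \<Rightarrow> real"
  assumes ab: "a < b" and G: "\<And>x y. x \<le> y \<Longrightarrow> G x \<le> G y" "\<And>x. continuous (at_right x) G"
    and f: "\<And>s. \<bar>f s\<bar> \<le> 1" and l: "\<And>s. a < s \<Longrightarrow> s \<le> b \<Longrightarrow> (f \<longlongrightarrow> l s) (at_left s)"
  shows "(\<lambda>n. grid_sum a b n f G) \<longlonglongrightarrow> (\<integral>s. (if a < s \<and> s \<le> b then l s else 0) \<partial>interval_measure G)"
proof -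
  have eq: "grid_sum a b n f G = (\<integral>s. grid_step a b n f s \<partial>interval_measure G)" for n :: nat
    by (rule grid_sum_eq_integral(1)[OF ab G])
  show ?thesis unfolding eq
proof (rule integral_dominated_convergence[where w = "indicator {a<..b}"])
  show "integrable (interval_measure G) (indicator {a<..b} :: real \<Rightarrow> real)"
    by (rule integrable_Ioc_bounded(2)[OF G, of "\<lambda>_. 0"]) auto
  show "AE s in interval_measure G. (\<lambda>n. grid_step a b n f s) \<longlonglongrightarrow> (if a < s \<and> s \<le> b then l s else 0)"
    by (intro AE_I2 left_limit_measurable(2)[OF ab l])
  show "AE s in interval_measure G. norm (grid_step a b n f s) \<le> indicator {a<..b} s" for n
  proof (rule AE_I2)
    fix s
    show "norm (grid_step a b n f s) \<le> indicator {a<..b} s"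
      using grid_step_bound[where f = f and n = n and s = s and C = 1, OF ab] f
        grid_step_outside[where f = f and n = n and s = s, OF ab] by (cases "s \<in> {a<..b}") auto
  qed
qed (use left_limit_measurable(1)[OF ab l] in auto)
qed

lemma stieltjes_function:
  fixes f :: "real \<Rightarrow> real"
  assumes "mono_on {0..} f" "\<And>t. 0 \<le> t \<Longrightarrow> continuous (at_right t) f"
  shows "x \<le> y \<Longrightarrow> f (max 0 x) \<le> f (max 0 y)" "continuous (at_right x) (\<lambda>t. f (max 0 t))"
proof -
  show "x \<le> y \<Longrightarrow> f (max 0 x) \<le> f (max 0 y)" by (intro mono_onD[OF assms(1)]) auto
  show "continuous (at_right x) (\<lambda>t. f (max 0 t))"
  proof (cases "0 \<le> x")
    case True
    have "\<forall>\<^sub>F u in at_right x. f (max 0 u) = f u"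
      by (rule eventually_at_rightI[of x "x + 1"]) (use True in auto)
    from tendsto_cong[OF this] assms(2)[OF True] have "((\<lambda>u. f (max 0 u)) \<longlongrightarrow> f x) (at_right x)"
      unfolding continuous_within by (rule iffD2)
    then show ?thesis using True by (simp add: continuous_within)
  next
    case False
    have "\<forall>\<^sub>F u in at_right x. f (max 0 u) = f (max 0 x)"
      by (rule eventually_at_rightI[of x 0]) (use False in auto)
    then show ?thesis unfolding continuous_within by (rule tendsto_eventually)
  qed
qed

text \<open>For each threshold, every time has a right neighbourhood free of jumps exceeding it; a
  rational number in that neighbourhood labels the time.\<close>

lemma countable_jumps:
  fixes f :: "real \<Rightarrow> real"
  assumes rc: "\<And>t. 0 \<le> t \<Longrightarrow> continuous (at_right t) f" and l: "\<And>t. 0 < t \<Longrightarrow> (f \<longlongrightarrow> l t) (at_left t)"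
  shows "countable {t. 0 < t \<and> l t \<noteq> f t}"
proof -
  define A where "A n = {t. 0 < t \<and> 1 / real (Suc n) < \<bar>f t - l t\<bar>}" for n
  have "\<exists>q\<in>\<rat>. t < q \<and> (\<forall>u. t < u \<and> u \<le> q \<longrightarrow> u \<notin> A n)" if t: "0 \<le> t" for n t
  proof -
    define e where "e = 1 / real (Suc n) / 2"
    have e: "0 < e" by (simp add: e_def)
    have "(f \<longlongrightarrow> f t) (at_right t)" using rc[OF t] by (simp add: continuous_within)
    from tendstoD[OF this e] obtain b where b: "t < b" "\<And>u. t < u \<Longrightarrow> u < b \<Longrightarrow> dist (f u) (f t) < e"
      unfolding eventually_at_right_field by auto
    obtain q where q: "q \<in> \<rat>" "t < q" "q < b" using Rats_dense_in_real[OF b(1)] by blast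
    have "u \<notin> A n" if u: "t < u" "u \<le> q" for u
    proof -
      have ub: "u < b" using u q by simp
      have "\<bar>l u - f t\<bar> \<le> e"
      proof (rule tendsto_upperbound)
        show "((\<lambda>v. \<bar>f v - f t\<bar>) \<longlongrightarrow> \<bar>l u - f t\<bar>) (at_left u)"
          using t u by (intro tendsto_rabs tendsto_diff l tendsto_const) simp
        show "\<forall>\<^sub>F v in at_left u. \<bar>f v - f t\<bar> \<le> e"
          using b(2) ub by (intro eventually_at_leftI[of t u] less_imp_le u(1)) (auto simp: dist_real_def)
      qed simp
      moreover have "\<bar>f u - f t\<bar> < e" using b(2)[OF u(1) ub] by (simp add: dist_real_def)
      ultimately have "\<bar>f u - l u\<bar> < e + e" by linarith
      also have "e + e = 1 / real (Suc n)" unfolding e_def by (rule field_sum_of_halves)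
      finally show ?thesis by (simp add: A_def)
    qed
    then show ?thesis using q by blast
  qed
  then have "\<forall>p. \<exists>q. 0 \<le> snd p \<longrightarrow> q \<in> \<rat> \<and> snd p < q \<and> (\<forall>u. snd p < u \<and> u \<le> q \<longrightarrow> u \<notin> A (fst p))"
    unfolding Bex_def by blast
  from choice[OF this] obtain g where g: "\<forall>p. 0 \<le> snd p \<longrightarrow>
      g p \<in> \<rat> \<and> snd p < g p \<and> (\<forall>u. snd p < u \<and> u \<le> g p \<longrightarrow> u \<notin> A (fst p))" ..
  define q where "q n t = g (n, t)" for n t
  have q: "q n t \<in> \<rat>" "t < q n t" "t < u \<Longrightarrow> u \<le> q n t \<Longrightarrow> u \<notin> A n" if "0 \<le> t" for n t u
    using g[rule_format, of "(n, t)"] that by (auto simp: q_def)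
  have "countable (A n)" for n
  proof (rule countableI')
    \<comment> \<open>If two jump times \<open>s < t\<close> shared a label, then \<open>t\<close>
      would lie in the jump-free interval after \<open>s\<close>.\<close>
    have "inj_on (q n) (A n)"
    proof (rule inj_onI, rule ccontr)
      fix s t assume st: "s \<in> A n" "t \<in> A n" "q n s = q n t" "s \<noteq> t"
      then have "0 \<le> s" "0 \<le> t" by (auto simp: A_def)
      then show False using q(2)[of t n] q(3)[of s t n] q(2)[of s n] q(3)[of t s n] st by (cases "s < t") auto
    qed
    moreover have "q n ` A n \<subseteq> \<rat>" using q(1) by (auto simp: A_def)
    ultimately show "inj_on (to_nat_on \<rat> \<circ> q n) (A n)"
      using countable_rat by (intro comp_inj_on) (auto intro: inj_on_subset[OF inj_on_to_nat_on])
  qed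
  moreover have "{t. 0 < t \<and> l t \<noteq> f t} = (\<Union>n. A n)"
  proof -
    have "\<exists>n. 1 / real (Suc n) < \<bar>f t - l t\<bar>" if "l t \<noteq> f t" for t
      by (metis that nat_approx_posE zero_less_abs_iff right_minus_eq)
    then show ?thesis by (auto simp: A_def)
  qed
  ultimately show ?thesis by simp
qed

subsection \<open>Tanaka's formula along a path\<close>

definition path_jump :: "(real \<Rightarrow> real) \<Rightarrow> (real \<Rightarrow> real) \<Rightarrow> real \<Rightarrow> real" where
  "path_jump x xm s = neg_part (x s) * of_bool (xm s > 0) + pos_part (x s) * of_bool (xm s \<le> 0)"

text \<open>One path with the properties that hold almost surely; the comparison inside this locale
  and its extensions is deterministic.\<close>

locale tanaka_path =
  fixes x xm J L :: "real \<Rightarrow> real"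
  assumes right: "\<And>t. 0 \<le> t \<Longrightarrow> continuous (at_right t) x"
    and left: "\<And>t. 0 < t \<Longrightarrow> (x \<longlongrightarrow> xm t) (at_left t)"
    and J_right: "\<And>t. 0 \<le> t \<Longrightarrow> continuous (at_right t) J"
    and L_continuous: "continuous_on {0..} L" and L_mono: "mono_on {0..} L"
    and summable: "\<And>t. 0 \<le> t \<Longrightarrow> path_jump x xm summable_on {0<..t}"
    and tanaka: "\<And>t. 0 \<le> t \<Longrightarrow> \<bar>x t\<bar> = \<bar>x 0\<bar> + J t +
      2 * infsum (path_jump x xm) {0<..t} + L t"
begin

abbreviation "jump \<equiv> path_jump x xm"

text \<open>By Tanaka's formula this is the sum of the jump terms plus half of \<open>L\<close>.
  Written through \<open>x\<close> and \<open>J\<close> its right-continuity is immediate, and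
  clamping the time makes it a Stieltjes function on the whole line.\<close>

definition \<Lambda> :: "real \<Rightarrow> real" where
  "\<Lambda> t = (\<bar>x (max 0 t)\<bar> - \<bar>x 0\<bar> - J (max 0 t)) / 2"

definition \<l> :: "real \<Rightarrow> real" where
  "\<l> t = L (max 0 t)"

text \<open>As \<open>J\<close> integrates the sign of the left limit, this is the path of the
  integral of the indicator of \<open>{xm > 0}\<close>.\<close>

definition K :: "real \<Rightarrow> real" where
  "K t = (x t - x 0 + J t) / 2"

text \<open>The complementary integral, of the indicator of \<open>{xm \<le> 0}\<close>.\<close>

definition K' :: "real \<Rightarrow> real" where
  "K' t = (x t - x 0 - J t) / 2"

lemma jump_nonneg: "0 \<le> jump s"
  by (simp add: path_jump_def neg_part_def pos_part_def)

lemma pos_part_eq: "0 \<le> t \<Longrightarrow> pos_part (x t) = pos_part (x 0) + K t + \<Lambda> t"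
  by (auto simp: pos_part_def K_def \<Lambda>_def max_def abs_if field_simps)

lemma neg_part_eq: "0 \<le> t \<Longrightarrow> neg_part (x t) = neg_part (x 0) - K' t + \<Lambda> t"
  by (auto simp: neg_part_def K'_def \<Lambda>_def max_def abs_if field_simps)

lemma \<l>_mono: "a \<le> b \<Longrightarrow> \<l> a \<le> \<l> b"
  unfolding \<l>_def by (intro mono_onD[OF L_mono]) auto

lemma \<l>_continuous: "continuous (at t) \<l>"
proof -
  have "continuous_on UNIV (L \<circ> max 0)"
    by (intro continuous_on_compose continuous_on_max continuous_on_subset[OF L_continuous]) (auto intro!: continuous_intros)
  then show ?thesis by (simp add: \<l>_def[abs_def] comp_def continuous_on_eq_continuous_at)
qed

lemma \<l>_right: "continuous (at_right t) \<l>"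
  using \<l>_continuous by (rule continuous_within_subset) simp

lemma \<Lambda>_diff:
  assumes "a \<le> b"
  shows "\<Lambda> b - \<Lambda> a = infsum jump {max 0 a<..max 0 b} + (\<l> b - \<l> a) / 2"
    and "jump summable_on {max 0 a<..max 0 b}"
proof -
  have sum: "jump summable_on {0<..max 0 t}" and \<Lambda>: "\<Lambda> t = infsum jump {0<..max 0 t} + \<l> t / 2" for t
    using summable[of "max 0 t"] tanaka[of "max 0 t"]
    by (simp_all add: \<Lambda>_def \<l>_def)
  show s: "jump summable_on {max 0 a<..max 0 b}"
    by (rule summable_on_subset_banach[OF sum[of b]]) auto
  have "{0<..max 0 b} = {0<..max 0 a} \<union> {max 0 a<..max 0 b}" using assms by auto
  then have "infsum jump {0<..max 0 b} = infsum jump {0<..max 0 a} + infsum jump {max 0 a<..max 0 b}"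
    using infsum_Un_disjoint[OF sum[of a] s] by auto
  then show "\<Lambda> b - \<Lambda> a = infsum jump {max 0 a<..max 0 b} + (\<l> b - \<l> a) / 2" by (simp add: \<Lambda> field_simps)
qed

lemma \<l>_le_\<Lambda>: "a \<le> b \<Longrightarrow> \<l> b - \<l> a \<le> 2 * (\<Lambda> b - \<Lambda> a)"
proof -
  assume ab: "a \<le> b"
  have "0 \<le> infsum jump {max 0 a<..max 0 b}" by (rule infsum_nonneg) (rule jump_nonneg)
  then show ?thesis using \<Lambda>_diff(1)[OF ab] by argo
qed

lemma \<Lambda>_mono: "a \<le> b \<Longrightarrow> \<Lambda> a \<le> \<Lambda> b"
  using \<l>_le_\<Lambda>[of a b] \<l>_mono[of a b] by simp

lemma \<Lambda>_right: "continuous (at_right t) \<Lambda>"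
proof -
  define f where "f t = (\<bar>x t\<bar> - \<bar>x 0\<bar> - J t) / 2" for t
  have f: "f (max 0 t) = \<Lambda> t" for t by (simp add: f_def \<Lambda>_def)
  have "mono_on {0..} f"
  proof (rule mono_onI)
    fix r s :: real assume "r \<in> {0..}" "s \<in> {0..}" "r \<le> s"
    then show "f r \<le> f s" using \<Lambda>_mono[of r s] by (simp add: f[symmetric])
  qed
  moreover have "continuous (at_right t) f" if "0 \<le> t" for t
    unfolding f_def[abs_def]
    by (intro continuous_intros continuous_divide right[OF that] J_right[OF that] continuous_rabs) auto
  ultimately have "continuous (at_right t) (\<lambda>t. f (max 0 t))" by (rule stieltjes_function(2))
  then show ?thesis by (simp add: f)
qed

abbreviation "d\<Lambda> \<equiv> interval_measure \<Lambda>"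
abbreviation "d\<l> \<equiv> interval_measure \<l>"

lemma emeasure_d\<Lambda>: "a \<le> b \<Longrightarrow> emeasure d\<Lambda> {a<..b} = ennreal (\<Lambda> b - \<Lambda> a)"
  by (rule emeasure_interval_measure_Ioc[OF _ \<Lambda>_mono \<Lambda>_right])

lemma emeasure_d\<l>: "a \<le> b \<Longrightarrow> emeasure d\<l> {a<..b} = ennreal (\<l> b - \<l> a)"
  by (rule emeasure_interval_measure_Ioc[OF _ \<l>_mono \<l>_right])

lemma d\<Lambda>_finite: "emeasure d\<Lambda> {a<..b} < \<infinity>"
  by (cases "a \<le> b") (auto simp: emeasure_d\<Lambda>)

lemma d\<l>_finite: "emeasure d\<l> {a<..b} < \<infinity>"
  by (cases "a \<le> b") (auto simp: emeasure_d\<l>)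

lemma d\<l>_le_d\<Lambda>:
  assumes "B \<in> sets borel" shows "emeasure d\<l> B \<le> 2 * emeasure d\<Lambda> B"
proof -
  have eq: "emeasure (density d\<Lambda> (\<lambda>_. 2)) A = 2 * emeasure d\<Lambda> A" if "A \<in> sets borel" for A
    using that by (simp add: emeasure_density_const)
  have "emeasure d\<l> B \<le> emeasure (density d\<Lambda> (\<lambda>_. 2)) B"
  proof (rule measure_le_Ioc[OF _ _ _ _ assms])
    show "emeasure (density d\<Lambda> (\<lambda>_. 2)) {a<..b} < \<infinity>" for a b
      using d\<Lambda>_finite[of a b] by (simp add: eq ennreal_mult_less_top)
    show "emeasure d\<l> {a<..b} \<le> emeasure (density d\<Lambda> (\<lambda>_. 2)) {a<..b}" if "a < b" for a b
      using that \<l>_le_\<Lambda>[of a b] \<Lambda>_mono[of a b] ennreal_mult'[of 2 "\<Lambda> b - \<Lambda> a"]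
      by (simp add: eq emeasure_d\<Lambda> emeasure_d\<l>) (metis ennreal_leI ennreal_numeral)
  qed auto
  then show ?thesis using eq[OF assms] by simp
qed

text \<open>The jump term at \<open>s\<close> is part of the increment over every interval ending at
  \<open>s\<close>; the intervals shrink to \<open>s\<close>.\<close>

lemma d\<Lambda>_atom: "ennreal (jump s) \<le> emeasure d\<Lambda> {s}" if "0 < s"
proof -
  have inc: "jump s \<le> \<Lambda> s - \<Lambda> a" if "a < s" for a
  proof -
    have "sum jump {s} \<le> infsum jump {max 0 a<..max 0 s}"
      using that \<open>0 < s\<close> by (intro finite_sum_le_infsum \<Lambda>_diff(2) jump_nonneg) auto
    then have "jump s \<le> infsum jump {max 0 a<..max 0 s}" by simp
    moreover have "a \<le> s" using that by simp
    ultimately show ?thesis using \<Lambda>_diff(1)[of a s] \<l>_mono[of a s] by argo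
  qed
  have "(\<lambda>n. emeasure d\<Lambda> {s - 1 / real (Suc n)<..s}) \<longlonglongrightarrow> emeasure d\<Lambda> (\<Inter>n. {s - 1 / real (Suc n)<..s})"
  proof (rule Lim_emeasure_decseq)
    show "decseq (\<lambda>n. {s - 1 / real (Suc n)<..s})"
    proof (rule decseq_SucI)
      fix n
      have "1 / real (Suc (Suc n)) \<le> 1 / real (Suc n)" by (simp add: field_simps)
      then show "{s - 1 / real (Suc (Suc n))<..s} \<subseteq> {s - 1 / real (Suc n)<..s}" by auto
    qed
    show "emeasure d\<Lambda> {s - 1 / real (Suc n)<..s} \<noteq> \<infinity>" for n
      using d\<Lambda>_finite[of "s - 1 / real (Suc n)" s] by simp
  qed (simp add: image_subset_iff)
  moreover have "(\<Inter>n. {s - 1 / real (Suc n)<..s}) = {s}"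
  proof -
    have "u = s" if "\<And>n. s - 1 / real (Suc n) < u" "u \<le> s" for u
    proof (rule ccontr)
      assume "u \<noteq> s"
      then have "0 < s - u" using that(2) by simp
      then obtain n where "1 / real (Suc n) < s - u" using nat_approx_posE by blast
      then show False using that(1)[of n] by linarith
    qed
    moreover have "s - 1 / real (Suc n) < s" for n by simp
    ultimately show ?thesis by (intro set_eqI iffI) (simp_all only: INT_iff greaterThanAtMost_iff singleton_iff UNIV_I, blast+)
  qed
  ultimately have "(\<lambda>n. emeasure d\<Lambda> {s - 1 / real (Suc n)<..s}) \<longlonglongrightarrow> emeasure d\<Lambda> {s}" by simp
  then show ?thesis
    by (rule LIMSEQ_le_const) (auto intro!: exI[of _ 0] ennreal_leI inc simp: emeasure_d\<Lambda>)
qed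

lemma countable_jump: "countable {s. 0 < s \<and> jump s \<noteq> 0}"
proof -
  have "countable {s \<in> {0<..real n}. jump s \<noteq> 0}" for n
    using \<Lambda>_diff(2)[of 0 "real n"] by (intro summable_countable_real) simp
  then have "countable (\<Union>n. {s \<in> {0<..real n}. jump s \<noteq> 0})" by simp
  then show ?thesis by (rule countable_subset[rotated]) (use real_arch_simple in auto)
qed

text \<open>The atoms at the jump times carry at least the whole jump sum, so off these times at
  most half the increment of \<open>\<l>\<close> remains.\<close>

lemma d\<Lambda>_le_d\<l>:
  assumes ab: "a \<le> b"
  shows "2 * emeasure d\<Lambda> ({a<..b} - {s. 0 < s \<and> jump s \<noteq> 0}) \<le> emeasure d\<l> {a<..b}"
proof -
  define D where "D = {s. 0 < s \<and> jump s \<noteq> 0}"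
  have cb: "C \<in> sets borel" if "countable C" for C :: "real set"
    by (rule sets.countable[OF _ that]) simp
  have D: "D \<in> sets borel" unfolding D_def by (rule cb[OF countable_jump])
  have fin: "emeasure d\<Lambda> A \<noteq> \<infinity>" if "A \<subseteq> {a<..b}" for A
    using emeasure_mono[OF that, of d\<Lambda>] d\<Lambda>_finite[of a b] by (auto simp: top_unique)
  have "infsum jump {max 0 a<..max 0 b} \<le> measure d\<Lambda> ({a<..b} \<inter> D)"
  proof (rule infsum_le_finite_sums[OF \<Lambda>_diff(2)[OF ab]])
    fix S assume S: "finite S" "S \<subseteq> {max 0 a<..max 0 b}"
    have fin': "emeasure d\<Lambda> {s} \<noteq> \<infinity>" if "s \<in> S" for s using S that by (intro fin) (auto simp: max_def split: if_splits)
    have "sum jump S = sum jump (S \<inter> D)"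
      using S by (intro sum.mono_neutral_right) (auto simp: D_def)
    also have "\<dots> \<le> (\<Sum>s\<in>S \<inter> D. measure d\<Lambda> {s})"
    proof (rule sum_mono)
      fix s assume "s \<in> S \<inter> D"
      then have "ennreal (jump s) \<le> ennreal (measure d\<Lambda> {s})"
        using d\<Lambda>_atom[of s] fin'[of s] by (simp add: D_def emeasure_eq_ennreal_measure)
      then show "jump s \<le> measure d\<Lambda> {s}" by simp
    qed
    also have "\<dots> = measure d\<Lambda> (S \<inter> D)"
      using S fin' by (intro measure_eq_sum_singleton[symmetric]) auto
    also have "\<dots> \<le> measure d\<Lambda> ({a<..b} \<inter> D)"
    proof (rule measure_mono_fmeasurable)
      show "S \<inter> D \<subseteq> {a<..b} \<inter> D" using S by (auto simp: max_def split: if_splits)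
      show "S \<inter> D \<in> sets d\<Lambda>" using S by (simp add: cb countable_finite)
      show "{a<..b} \<inter> D \<in> fmeasurable d\<Lambda>"
        using fin[of "{a<..b} \<inter> D"] D by (intro fmeasurableI) (auto simp: less_top[symmetric])
    qed
    finally show "sum jump S \<le> measure d\<Lambda> ({a<..b} \<inter> D)" .
  qed
  moreover have "measure d\<Lambda> {a<..b} = measure d\<Lambda> ({a<..b} \<inter> D) + measure d\<Lambda> ({a<..b} - D)"
    using D fin[of "{a<..b} \<inter> D"] fin[of "{a<..b} - D"]
    by (subst measure_Union[symmetric]) (auto simp: Int_Diff_Un)
  moreover have "measure d\<Lambda> {a<..b} = \<Lambda> b - \<Lambda> a"
    by (rule measure_interval_measure_Ioc[OF ab \<Lambda>_mono \<Lambda>_right])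
  ultimately have "2 * measure d\<Lambda> ({a<..b} - D) \<le> \<l> b - \<l> a"
    using \<Lambda>_diff(1)[OF ab] by argo
  moreover have "2 * emeasure d\<Lambda> ({a<..b} - D) = ennreal (2 * measure d\<Lambda> ({a<..b} - D))"
    using fin[of "{a<..b} - D"] by (simp add: emeasure_eq_ennreal_measure ennreal_mult')
  ultimately show ?thesis unfolding D_def[symmetric] emeasure_d\<l>[OF ab] by (metis ennreal_leI)
qed

lemma d\<l>_singleton: "emeasure d\<l> {s} = 0"
proof (rule antisym)
  have le: "emeasure d\<l> {s} \<le> ennreal e" if "0 < e" for e
  proof -
    have "(\<l> \<longlongrightarrow> \<l> s) (at_left s)"
      by (rule tendsto_within_subset[OF isContD[OF \<l>_continuous] subset_UNIV])
    from tendstoD[OF this that] obtain b where b: "b < s" "\<And>u. b < u \<Longrightarrow> u < s \<Longrightarrow> dist (\<l> u) (\<l> s) < e"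
      unfolding eventually_at_left_field by blast
    obtain u where u: "b < u" "u < s" using dense[OF b(1)] by blast
    have "emeasure d\<l> {s} \<le> emeasure d\<l> {u<..s}" using u by (intro emeasure_mono) auto
    also have "\<dots> \<le> ennreal e"
      using b(2)[OF u] u by (simp add: emeasure_d\<l> dist_real_def)
    finally show ?thesis .
  qed
  show "emeasure d\<l> {s} \<le> 0"
  proof (rule ennreal_le_epsilon)
    fix e :: real assume "0 < e"
    from le[OF this] show "emeasure d\<l> {s} \<le> 0 + ennreal e" by (simp only: add_0)
  qed
qed simp

lemma d\<l>_nonpos: "emeasure d\<l> {..0} = 0"
proof -
  have "{- real n<..0} \<in> null_sets d\<l>" for n
    by (intro null_setsI) (simp_all add: emeasure_d\<l> \<l>_def)
  then have "(\<Union>n. {- real n<..0}) \<in> null_sets d\<l>" by (rule null_sets_UN)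
  moreover have "(\<Union>n. {- real n<..0}) = {..0::real}"
    using reals_Archimedean2 by (force simp: minus_less_iff)
  ultimately show ?thesis by auto
qed

text \<open>On each bounded interval the left limit is a limit of step functions; the set is
  assembled from these intervals.\<close>

lemma left_measurable: "{s. 0 < s \<and> xm s \<le> 0} \<in> sets borel"
proof -
  have "{s. 0 < s \<and> xm s \<le> 0} =
    (\<Union>n. {0<..real (Suc n)} \<inter> (\<lambda>s. if 0 < s \<and> s \<le> real (Suc n) then xm s else 0) -` {..0})"
  proof (intro set_eqI iffI)
    fix s assume "s \<in> {s. 0 < s \<and> xm s \<le> 0}"
    moreover obtain n where "s \<le> real n" using real_arch_simple by blast
    ultimately show "s \<in> (\<Union>n. {0<..real (Suc n)} \<inter> (\<lambda>s. if 0 < s \<and> s \<le> real (Suc n) then xm s else 0) -` {..0})"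
      by (auto intro!: exI[of _ n])
  qed auto
  moreover have "(\<lambda>s. if 0 < s \<and> s \<le> real (Suc n) then xm s else 0) -` {..0} \<in> sets borel" for n
    using measurable_sets_borel[OF left_limit_measurable(1)[of 0 "real (Suc n)" x xm], of "{..0}"] left by auto
  ultimately show ?thesis by auto
qed

end

section \<open>Localizing weights\<close>

definition ramp :: "nat \<Rightarrow> real \<Rightarrow> real" where
  "ramp j u = min 1 (max 0 (real (Suc j) * u))"

text \<open>The positive part of \<open>w\<close>, rescaled by its maximal height for
  \<open>0 \<le> u \<le> v\<close>; the outer \<open>min\<close> secures the bound 1 for arbitrary
  arguments.\<close>

definition cutoff :: "real \<Rightarrow> real \<Rightarrow> real \<Rightarrow> real" where
  "cutoff d u v = min 1 (max 0 ((d\<^sup>2 - d * v - (v - u)) / d\<^sup>2))"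

lemma grid_sum_const:
  assumes ab: "a < b" and f: "\<And>t. a \<le> t \<Longrightarrow> t \<le> b \<Longrightarrow> f t = 1"
  shows "grid_sum a b n f z = z b - z a"
proof -
  have "grid_sum a b n f z = (\<Sum>k<2 ^ n. z (grid a b n (Suc k)) - z (grid a b n k))"
    unfolding grid_sum_def by (intro sum.cong refl) (simp add: f grid_ge[OF ab] grid_le[OF ab])
  then show ?thesis using sum_lessThan_telescope[of "\<lambda>k. z (grid a b n k)" "2 ^ n"] by (simp add: grid_last)
qed

text \<open>The weights are multiples of the derivative of the convex function \<open>(w\<^sup>+)\<^sup>2 / 2\<close> along
  \<open>w = d\<^sup>2 - d v - (v - u)\<close>.\<close>
lemma cutoff_grid_sum:
  assumes d: "0 < d" and uv: "\<And>t. a \<le> t \<Longrightarrow> t \<le> b \<Longrightarrow> 0 \<le> u t \<and> u t \<le> v t" and ab: "a < b"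
  shows "grid_sum a b n (\<lambda>t. cutoff d (u t) (v t)) u
    \<le> (1 + d) * grid_sum a b n (\<lambda>t. cutoff d (u t) (v t)) v + d\<^sup>2 / 2"
proof -
  define w where "w t = d\<^sup>2 - d * v t - (v t - u t)" for t
  define p where "p t = max 0 (w t)" for t
  have w_le: "w t \<le> d\<^sup>2" if "a \<le> t" "t \<le> b" for t
  proof -
    have "0 \<le> d * v t" using uv[OF that] d by (intro mult_nonneg_nonneg) auto
    then show ?thesis using uv[OF that] by (simp add: w_def)
  qed
  have c: "d\<^sup>2 * cutoff d (u t) (v t) = p t" if "a \<le> t" "t \<le> b" for t
  proof (cases "w t \<le> 0")
    case True
    then have "w t / d\<^sup>2 \<le> 0" by (simp add: divide_nonpos_nonneg)
    then show ?thesis using True by (simp add: cutoff_def p_def w_def[symmetric])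
  next
    case False
    then have "0 < w t / d\<^sup>2" "w t / d\<^sup>2 \<le> 1" using w_le[OF that] d by simp_all
    then show ?thesis using False d by (simp add: cutoff_def p_def w_def[symmetric])
  qed
  have convex: "p t * (w s - w t) \<le> (p s)\<^sup>2 / 2 - (p t)\<^sup>2 / 2" for s t
  proof -
    have "p t * (w s - w t) \<le> p t * (p s - p t)"
      by (cases "w t \<le> 0") (auto simp: p_def intro!: mult_left_mono)
    also have "\<dots> \<le> (p s)\<^sup>2 / 2 - (p t)\<^sup>2 / 2"
      using zero_le_power2[of "p s - p t"] by (simp add: power2_eq_square algebra_simps)
    finally show ?thesis .
  qed
  let ?g = "grid a b n" and ?c = "\<lambda>t. cutoff d (u t) (v t)"
  have "d\<^sup>2 * (grid_sum a b n ?c u - (1 + d) * grid_sum a b n ?c v)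
    = (\<Sum>k<2 ^ n. d\<^sup>2 * ?c (?g k) * (w (?g (Suc k)) - w (?g k)))"
    unfolding grid_sum_def w_def by (simp add: sum_distrib_left sum_subtractf[symmetric] algebra_simps)
  also have "\<dots> \<le> (\<Sum>k<2 ^ n. (p (?g (Suc k)))\<^sup>2 / 2 - (p (?g k))\<^sup>2 / 2)"
  proof (rule sum_mono)
    fix k
    have "d\<^sup>2 * ?c (?g k) = p (?g k)" by (rule c) (auto simp: grid_ge[OF ab] grid_le[OF ab])
    then show "d\<^sup>2 * ?c (?g k) * (w (?g (Suc k)) - w (?g k)) \<le> (p (?g (Suc k)))\<^sup>2 / 2 - (p (?g k))\<^sup>2 / 2"
      using convex by simp
  qed
  also have "\<dots> = (p b)\<^sup>2 / 2 - (p a)\<^sup>2 / 2"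
    using sum_lessThan_telescope[of "\<lambda>k. (p (?g k))\<^sup>2 / 2" "2 ^ n"] by (simp add: grid_last)
  also have "\<dots> \<le> (d\<^sup>2)\<^sup>2 / 2"
  proof -
    have "p b \<le> d\<^sup>2" "0 \<le> p b" using w_le[of b] ab by (auto simp: p_def)
    then have "(p b)\<^sup>2 \<le> (d\<^sup>2)\<^sup>2" by (rule power_mono)
    moreover have "0 \<le> (p a)\<^sup>2" by simp
    ultimately show ?thesis by linarith
  qed
  also have "\<dots> = d\<^sup>2 * (d\<^sup>2 / 2)" by (simp add: power2_eq_square)
  finally have "grid_sum a b n ?c u - (1 + d) * grid_sum a b n ?c v \<le> d\<^sup>2 / 2"
    by (rule mult_left_le_imp_le) (use d in simp)
  then show ?thesis by simp
qed

section \<open>The support of the local time along one path\<close>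

lemma frequently_abs_le_zero:
  assumes "\<And>e::real. 0 < e \<Longrightarrow> \<exists>\<^sub>F m in sequentially. \<exists>\<^sub>F n in sequentially. \<bar>c\<bar> < e"
  shows "c = (0::real)"
  using assms[of "\<bar>c\<bar>"] by (cases "c = 0") auto

locale tanaka_support = tanaka_path +
  assumes negative: "\<And>j a b e. a \<in> \<rat> \<Longrightarrow> b \<in> \<rat> \<Longrightarrow> 0 \<le> a \<Longrightarrow> a < b \<Longrightarrow> 0 < e \<Longrightarrow>
      \<exists>\<^sub>F m in sequentially. \<exists>\<^sub>F n in sequentially. \<bar>grid_sum a b n (\<lambda>t. ramp j (- x t)) K\<bar> < e"
    and positive: "\<And>j a b e. a \<in> \<rat> \<Longrightarrow> b \<in> \<rat> \<Longrightarrow> 0 \<le> a \<Longrightarrow> a < b \<Longrightarrow> 0 < e \<Longrightarrow>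
      \<exists>\<^sub>F m in sequentially. \<exists>\<^sub>F n in sequentially. \<bar>grid_sum a b n (\<lambda>t. ramp j (x t)) K'\<bar> < e"
begin

text \<open>On such an interval the ramp equals 1 and the grid sum telescopes, so \<open>K'\<close>
  (for positive \<open>x\<close>) or \<open>K\<close> (for negative \<open>x\<close>) has no
  increment. The opposite part of \<open>x\<close> vanishes at both ends, so Tanaka's formula for it
  leaves \<open>\<Lambda>\<close> without increment as well.\<close>

lemma constant_off_zero:
  assumes ab: "a \<in> \<rat>" "b \<in> \<rat>" "0 \<le> a" "a < b"
    and off: "(\<forall>t\<in>{a..b}. 1 / real (Suc j) \<le> x t) \<or> (\<forall>t\<in>{a..b}. 1 / real (Suc j) \<le> - x t)"
  shows "\<l> b = \<l> a"
proof -
  have r: "ramp j u = 1" if "1 / real (Suc j) \<le> u" for u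
    using that by (simp add: ramp_def field_simps)
  have j: "0 < 1 / real (Suc j)" by simp
  have "\<Lambda> b = \<Lambda> a"
    using off
  proof
    assume *: "\<forall>t\<in>{a..b}. 1 / real (Suc j) \<le> x t"
    then have "grid_sum a b n (\<lambda>t. ramp j (x t)) K' = K' b - K' a" for n
      by (intro grid_sum_const ab r) auto
    then have "K' b - K' a = 0" using positive[OF ab, of _ j] by (intro frequently_abs_le_zero) simp
    moreover have "0 < x a" "0 < x b" using * j ab by (auto intro!: less_le_trans[OF j])
    ultimately show ?thesis using neg_part_eq[of a] neg_part_eq[of b] ab by (simp add: neg_part_def)
  next
    assume *: "\<forall>t\<in>{a..b}. 1 / real (Suc j) \<le> - x t"
    then have "grid_sum a b n (\<lambda>t. ramp j (- x t)) K = K b - K a" for n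
      by (intro grid_sum_const ab r) auto
    then have "K b - K a = 0" using negative[OF ab, of _ j] by (intro frequently_abs_le_zero) simp
    moreover have "0 < - x a" "0 < - x b" using ab by (auto intro!: less_le_trans[OF j] *[rule_format] simp del: neg_0_less_iff_less of_nat_Suc)
    ultimately show ?thesis using pos_part_eq[of a] pos_part_eq[of b] ab by (simp add: pos_part_def)
  qed
  then show ?thesis using \<l>_le_\<Lambda>[of a b] \<l>_mono[of a b] ab by simp
qed

text \<open>Jump times are countable and hence null for a measure without atoms. At any other time
  with \<open>x s \<noteq> 0\<close> the path is continuous, so \<open>s\<close> lies in one of the
  countably many rational intervals on which \<open>\<l>\<close> is constant.\<close>

lemma support: "AE s in d\<l>. 0 < s \<and> x s = 0 \<and> xm s = 0"
proof -
  define R where "R = {(a, b). a \<in> \<rat> \<and> b \<in> \<rat> \<and> a < b \<and> \<l> b = \<l> a}"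
  have "countable R" by (rule countable_subset[of _ "\<rat> \<times> \<rat>"]) (auto simp: R_def countable_rat)
  then have "(\<Union>p\<in>R. {fst p<..snd p}) \<in> null_sets d\<l>"
    by (rule null_sets_UN') (auto intro!: null_setsI simp: R_def emeasure_d\<l>)
  then have 1: "AE s in d\<l>. s \<notin> (\<Union>p\<in>R. {fst p<..snd p})" by (rule AE_not_in)
  have "(\<Union>s\<in>{t. 0 < t \<and> xm t \<noteq> x t}. {s}) \<in> null_sets d\<l>"
    by (rule null_sets_UN'[OF countable_jumps[OF right left]]) (auto intro!: null_setsI simp: d\<l>_singleton)
  then have 2: "AE s in d\<l>. s \<notin> {t. 0 < t \<and> xm t \<noteq> x t}" by (intro AE_not_in) simp
  have 3: "AE s in d\<l>. s \<notin> {..0}" by (intro AE_not_in null_setsI d\<l>_nonpos) simp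
  from 1 2 3 show ?thesis
  proof eventually_elim
    case (elim s)
    then have s: "0 < s" "xm s = x s" by auto
    have "x s = 0"
    proof (rule ccontr)
      assume xs: "x s \<noteq> 0"
      have "(x \<longlongrightarrow> x s) (at s)"
        using left[OF s(1)] right[of s] s by (simp add: filterlim_at_split continuous_within)
      from tendstoD[OF this, of "\<bar>x s\<bar> / 2"] xs obtain d where d: "0 < d"
        "\<And>u. u \<noteq> s \<Longrightarrow> dist u s < d \<Longrightarrow> dist (x u) (x s) < \<bar>x s\<bar> / 2"
        unfolding eventually_at by auto
      have near: "\<bar>x u - x s\<bar> < \<bar>x s\<bar> / 2" if "\<bar>u - s\<bar> < d" for u
        using d(2)[of u] that xs by (cases "u = s") (auto simp: dist_real_def)
      obtain a where a: "a \<in> \<rat>" "max 0 (s - d) < a" "a < s" using Rats_dense_in_real[of "max 0 (s - d)" s] s d by auto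
      obtain b where b: "b \<in> \<rat>" "s < b" "b < s + d" using Rats_dense_in_real[of s "s + d"] d by auto
      obtain j where j: "1 / real (Suc j) < \<bar>x s\<bar> / 2" using nat_approx_posE[of "\<bar>x s\<bar> / 2"] xs by auto
      have near': "\<bar>x t - x s\<bar> < \<bar>x s\<bar> / 2" if "t \<in> {a..b}" for t
        using that a b by (intro near) (auto simp: abs_if)
      have "(\<forall>t\<in>{a..b}. 1 / real (Suc j) \<le> x t) \<or> (\<forall>t\<in>{a..b}. 1 / real (Suc j) \<le> - x t)"
      proof (cases "0 < x s")
        case True
        have "1 / real (Suc j) \<le> x t" if "t \<in> {a..b}" for t
          using near'[OF that] j True by (simp add: abs_if split: if_splits)
        then show ?thesis by blast
      next
        case False
        have "1 / real (Suc j) \<le> - x t" if "t \<in> {a..b}" for t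
          using near'[OF that] j False xs by (simp add: abs_if split: if_splits)
        then show ?thesis by blast
      qed
      then have "\<l> b = \<l> a" using a b by (intro constant_off_zero) auto
      then have "(a, b) \<in> R" using a b by (simp add: R_def)
      then show False using elim(1) a b by force
    qed
    then show ?case using s by simp
  qed
qed

end

section \<open>Comparison of two paths\<close>

lemma cutoff_bounds: "0 \<le> cutoff d u v" "\<bar>cutoff d u v\<bar> \<le> 1"
  by (auto simp: cutoff_def)

lemma cutoff_tendsto:
  assumes "(u \<longlongrightarrow> u') F" "(v \<longlongrightarrow> v') F" "0 < d"
  shows "((\<lambda>t. cutoff d (u t) (v t)) \<longlongrightarrow> cutoff d u' v') F"
  unfolding cutoff_def using assms by (intro tendsto_intros) auto

text \<open>At \<open>u = v = 0\<close> the quotient is 1 for every parameter; for positive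
  \<open>v\<close> it is nonpositive once the parameter falls below \<open>v\<close>.\<close>

lemma cutoff_limit:
  assumes "0 \<le> u" "u \<le> v"
  shows "(\<lambda>m. cutoff (1 / real (Suc m)) u v) \<longlonglongrightarrow> (if v \<le> 0 then 1 else 0)"
proof (cases "v \<le> 0")
  case True
  then have "u = 0" "v = 0" using assms by auto
  then show ?thesis by (simp add: cutoff_def)
next
  case False
  then have v: "0 < v" by simp
  have "\<forall>\<^sub>F m in sequentially. 1 / real (Suc m) < v"
    using order_tendstoD(2)[OF LIMSEQ_inverse_real_of_nat v] by (simp add: inverse_eq_divide)
  then have "\<forall>\<^sub>F m in sequentially. cutoff (1 / real (Suc m)) u v = 0"
  proof eventually_elim
    case (elim m)
    define \<delta> where "\<delta> = 1 / real (Suc m)"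
    have \<delta>: "0 < \<delta>" "\<delta> < v" using elim by (simp_all add: \<delta>_def)
    have "\<delta>\<^sup>2 \<le> \<delta> * v" using \<delta> by (simp add: power2_eq_square)
    then have "\<delta>\<^sup>2 - \<delta> * v - (v - u) \<le> 0" using assms by simp
    then have "(\<delta>\<^sup>2 - \<delta> * v - (v - u)) / \<delta>\<^sup>2 \<le> 0" by (rule divide_nonpos_nonneg) simp
    then show ?case unfolding \<delta>_def[symmetric] by (simp add: cutoff_def)
  qed
  then show ?thesis unfolding if_not_P[OF False] by (rule tendsto_eventually)
qed

lemma frequently_le_limit:
  fixes h :: "nat \<Rightarrow> real"
  assumes "h \<longlonglongrightarrow> l" "\<exists>\<^sub>F n in sequentially. h n \<le> c"
  shows "l \<le> c"
proof (rule ccontr)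
  assume "\<not> l \<le> c"
  then have "c < l" by simp
  from order_tendstoD(1)[OF assms(1) this] have "\<forall>\<^sub>F n in sequentially. \<not> h n \<le> c" by (auto elim: eventually_mono)
  then show False using assms(2) by (simp add: frequently_def)
qed

lemma pos_part_tendsto: "(f \<longlongrightarrow> l) F \<Longrightarrow> ((\<lambda>t. pos_part (f t)) \<longlongrightarrow> pos_part l) F"
  unfolding pos_part_def by (intro tendsto_intros)

lemma (in tanaka_path) grid_sum_pos_part:
  assumes "0 \<le> a" "a < b"
  shows "grid_sum a b n f (\<lambda>t. pos_part (x t)) = grid_sum a b n f K + grid_sum a b n f \<Lambda>"
proof -
  have "0 \<le> grid a b n k" for k using grid_ge[OF assms(2), of n k] assms(1) by simp
  then have "pos_part (x (grid a b n (Suc k))) - pos_part (x (grid a b n k)) =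
    (K (grid a b n (Suc k)) - K (grid a b n k)) + (\<Lambda> (grid a b n (Suc k)) - \<Lambda> (grid a b n k))" for k
    using pos_part_eq[of "grid a b n k"] pos_part_eq[of "grid a b n (Suc k)"] by simp
  then show ?thesis unfolding grid_sum_def by (simp only: distrib_left sum.distrib)
qed

lemma (in tanaka_path) set_limit:
  assumes E: "E \<in> sets borel" and ab: "a < b"
    and h: "\<And>m. (\<lambda>s. if a < s \<and> s \<le> b then h m s else 0) \<in> borel_measurable borel" "\<And>m s. \<bar>h m s\<bar> \<le> 1"
      "\<And>s. a < s \<Longrightarrow> s \<le> b \<Longrightarrow> (\<lambda>m. h m s) \<longlonglongrightarrow> indicator E s"
  shows "(\<lambda>m. \<integral>s. (if a < s \<and> s \<le> b then h m s else 0) \<partial>d\<Lambda>) \<longlonglongrightarrow> measure d\<Lambda> (E \<inter> {a<..b})"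
proof -
  have "(\<lambda>m. \<integral>s. (if a < s \<and> s \<le> b then h m s else 0) \<partial>d\<Lambda>) \<longlonglongrightarrow> (\<integral>s. indicator (E \<inter> {a<..b}) s \<partial>d\<Lambda>)"
  proof (rule integral_dominated_convergence[where w = "indicator {a<..b}"])
    show "integrable d\<Lambda> (indicator {a<..b} :: real \<Rightarrow> real)"
      by (rule integrable_Ioc_bounded(2)[OF \<Lambda>_mono \<Lambda>_right, of "\<lambda>_. 0"]) auto
    show "AE s in d\<Lambda>. (\<lambda>m. if a < s \<and> s \<le> b then h m s else 0) \<longlonglongrightarrow> indicator (E \<inter> {a<..b}) s"
    proof (rule AE_I2)
      fix s
      show "(\<lambda>m. if a < s \<and> s \<le> b then h m s else 0) \<longlonglongrightarrow> indicator (E \<inter> {a<..b}) s"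
        using h(3)[of s] by (cases "a < s \<and> s \<le> b") (auto simp: indicator_def)
    qed
  qed (use E h in \<open>auto simp: indicator_def\<close>)
  then show ?thesis using E by simp
qed

text \<open>In \<open>small\<close> the two terms are added because \<open>frequently\<close> is not
  stable under conjunction: both must be small at the same indices. The coefficient 2 absorbs the
  factor \<open>1 + \<delta> m\<close>, which is at most 2.\<close>

locale tanaka_pair = X: tanaka_support x xm J L + Y: tanaka_path y ym J' L' for x xm J L y ym J' L' +
  assumes zero: "\<And>s. 0 < s \<Longrightarrow> x s = 0 \<Longrightarrow> xm s = 0 \<Longrightarrow> y s = 0 \<and> ym s = 0"
    and le: "\<And>t. 0 \<le> t \<Longrightarrow> pos_part (x t) \<le> pos_part (y t)"
    and small: "\<And>a b e. a \<in> \<rat> \<Longrightarrow> b \<in> \<rat> \<Longrightarrow> 0 \<le> a \<Longrightarrow> a < b \<Longrightarrow> 0 < e \<Longrightarrow>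
      \<exists>\<^sub>F m in sequentially. \<exists>\<^sub>F n in sequentially.
        \<bar>grid_sum a b n (\<lambda>t. cutoff (1 / real (Suc m)) (pos_part (x t)) (pos_part (y t))) X.K\<bar> +
        2 * \<bar>grid_sum a b n (\<lambda>t. cutoff (1 / real (Suc m)) (pos_part (x t)) (pos_part (y t))) Y.K\<bar> < e"
begin

definition C :: "nat \<Rightarrow> real \<Rightarrow> real" where
  "C m t = cutoff (1 / real (Suc m)) (pos_part (x t)) (pos_part (y t))"

definition C_left :: "nat \<Rightarrow> real \<Rightarrow> real" where
  "C_left m t = cutoff (1 / real (Suc m)) (pos_part (xm t)) (pos_part (ym t))"

definition E :: "real set" where
  "E = {s. 0 < s \<and> ym s \<le> 0}"

lemma E: "E \<in> sets borel"
  unfolding E_def by (rule Y.left_measurable)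

lemma C_left_limit: "0 < s \<Longrightarrow> (C m \<longlongrightarrow> C_left m s) (at_left s)"
  unfolding C_def C_left_def by (intro cutoff_tendsto pos_part_tendsto X.left Y.left) auto

lemma C_left_indicator:
  assumes "0 < s" shows "(\<lambda>m. C_left m s) \<longlonglongrightarrow> indicator E s"
proof -
  have "pos_part (xm s) \<le> pos_part (ym s)"
  proof (rule tendsto_le)
    show "\<forall>\<^sub>F u in at_left s. pos_part (x u) \<le> pos_part (y u)"
      by (rule eventually_at_leftI[OF _ assms]) (auto intro: le)
  qed (auto intro!: pos_part_tendsto X.left Y.left assms)
  then have "(\<lambda>m. C_left m s) \<longlonglongrightarrow> (if pos_part (ym s) \<le> 0 then 1 else 0)"
    unfolding C_left_def by (intro cutoff_limit) (simp_all add: pos_part_def)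
  then show ?thesis using assms by (cases "ym s \<le> 0") (simp_all add: pos_part_def E_def indicator_def)
qed

text \<open>The increments of the positive parts are those of \<open>K\<close> plus those of
  \<open>\<Lambda>\<close>, so the convexity estimate compares the two \<open>\<Lambda>\<close> up
  to the \<open>K\<close> terms, which are small along subsequences.\<close>

lemma \<Lambda>_le_Ioc:
  assumes ab: "a \<in> \<rat>" "b \<in> \<rat>" "0 \<le> a" "a < b"
  shows "measure X.d\<Lambda> (E \<inter> {a<..b}) \<le> measure Y.d\<Lambda> (E \<inter> {a<..b})"
proof -
  define A where "A m = (\<integral>s. (if a < s \<and> s \<le> b then C_left m s else 0) \<partial>X.d\<Lambda>)" for m
  define B where "B m = (\<integral>s. (if a < s \<and> s \<le> b then C_left m s else 0) \<partial>Y.d\<Lambda>)" for m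
  define \<delta> where "\<delta> m = 1 / real (Suc m)" for m
  have \<delta>: "0 < \<delta> m" "\<delta> m \<le> 1" for m by (simp_all add: \<delta>_def)
  have l: "(C m \<longlongrightarrow> C_left m s) (at_left s)" if "a < s" for m s using that ab by (intro C_left_limit) simp
  have C1: "\<bar>C m s\<bar> \<le> 1" "\<bar>C_left m s\<bar> \<le> 1" for m s unfolding C_def C_left_def by (rule cutoff_bounds)+
  have meas: "(\<lambda>s. if a < s \<and> s \<le> b then C_left m s else 0) \<in> borel_measurable borel" for m
    by (rule left_limit_measurable(1)[OF ab(4) l])
  have AB: "A \<longlonglongrightarrow> measure X.d\<Lambda> (E \<inter> {a<..b})" "B \<longlonglongrightarrow> measure Y.d\<Lambda> (E \<inter> {a<..b})"
    unfolding A_def B_def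
    using ab by (intro X.set_limit Y.set_limit E meas C1 C_left_indicator; simp)+
  have gs: "(\<lambda>n. grid_sum a b n (C m) X.\<Lambda>) \<longlonglongrightarrow> A m" "(\<lambda>n. grid_sum a b n (C m) Y.\<Lambda>) \<longlonglongrightarrow> B m" for m
    unfolding A_def B_def
    by (rule grid_sum_tendsto[OF ab(4) X.\<Lambda>_mono X.\<Lambda>_right C1(1) l] grid_sum_tendsto[OF ab(4) Y.\<Lambda>_mono Y.\<Lambda>_right C1(1) l]; assumption)+
  \<comment> \<open>The estimate of \<open>cutoff_grid_sum\<close> with both positive parts
    decomposed and the \<open>K\<close> terms moved to the right.\<close>
  have key: "grid_sum a b n (C m) X.\<Lambda> - (1 + \<delta> m) * grid_sum a b n (C m) Y.\<Lambda> - (\<delta> m)\<^sup>2 / 2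
    \<le> \<bar>grid_sum a b n (C m) X.K\<bar> + 2 * \<bar>grid_sum a b n (C m) Y.K\<bar>" for m n
  proof -
    have "grid_sum a b n (C m) (\<lambda>t. pos_part (x t))
      \<le> (1 + \<delta> m) * grid_sum a b n (C m) (\<lambda>t. pos_part (y t)) + (\<delta> m)\<^sup>2 / 2"
      unfolding C_def \<delta>_def using ab le by (intro cutoff_grid_sum) (auto simp: pos_part_def)
    moreover have "(1 + \<delta> m) * grid_sum a b n (C m) Y.K \<le> 2 * \<bar>grid_sum a b n (C m) Y.K\<bar>"
    proof (rule order_trans[OF mult_left_mono mult_right_mono])
      show "grid_sum a b n (C m) Y.K \<le> \<bar>grid_sum a b n (C m) Y.K\<bar>" by simp
    qed (use \<delta>[of m] in auto)
    ultimately show ?thesis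
      unfolding X.grid_sum_pos_part[OF ab(3,4)] Y.grid_sum_pos_part[OF ab(3,4)] distrib_left by linarith
  qed
  \<comment> \<open>For fixed \<open>m\<close> the grid is refined first, which turns the sums into
    \<open>A m\<close> and \<open>B m\<close>; as \<open>m\<close> grows, the weights become the
    indicator of \<open>E\<close> and the terms with \<open>\<delta> m\<close> disappear.\<close>
  show ?thesis
  proof (rule field_le_epsilon)
    fix e :: real assume e: "0 < e"
    have "\<exists>\<^sub>F m in sequentially. A m - (1 + \<delta> m) * B m - (\<delta> m)\<^sup>2 / 2 \<le> e"
      using small[OF ab e]
    proof (rule frequently_elim1)
      fix m
      assume *: "\<exists>\<^sub>F n in sequentially.
        \<bar>grid_sum a b n (\<lambda>t. cutoff (1 / real (Suc m)) (pos_part (x t)) (pos_part (y t))) X.K\<bar> +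
        2 * \<bar>grid_sum a b n (\<lambda>t. cutoff (1 / real (Suc m)) (pos_part (x t)) (pos_part (y t))) Y.K\<bar> < e"
      show "A m - (1 + \<delta> m) * B m - (\<delta> m)\<^sup>2 / 2 \<le> e"
      proof (rule frequently_le_limit)
        show "(\<lambda>n. grid_sum a b n (C m) X.\<Lambda> - (1 + \<delta> m) * grid_sum a b n (C m) Y.\<Lambda> - (\<delta> m)\<^sup>2 / 2)
          \<longlonglongrightarrow> A m - (1 + \<delta> m) * B m - (\<delta> m)\<^sup>2 / 2"
          by (intro tendsto_intros gs)
        show "\<exists>\<^sub>F n in sequentially. grid_sum a b n (C m) X.\<Lambda> - (1 + \<delta> m) * grid_sum a b n (C m) Y.\<Lambda> - (\<delta> m)\<^sup>2 / 2 \<le> e"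
          using * unfolding C_def[symmetric] by (rule frequently_elim1) (rule order_trans[OF key less_imp_le])
      qed
    qed
    moreover have "(\<lambda>m. A m - (1 + \<delta> m) * B m - (\<delta> m)\<^sup>2 / 2) \<longlonglongrightarrow>
        measure X.d\<Lambda> (E \<inter> {a<..b}) - (1 + 0) * measure Y.d\<Lambda> (E \<inter> {a<..b}) - 0\<^sup>2 / 2"
      using LIMSEQ_inverse_real_of_nat by (intro tendsto_intros AB) (auto simp: \<delta>_def[abs_def] inverse_eq_divide)
    ultimately have "measure X.d\<Lambda> (E \<inter> {a<..b}) - (1 + 0) * measure Y.d\<Lambda> (E \<inter> {a<..b}) - 0\<^sup>2 / 2 \<le> e"
      by (rule frequently_le_limit[rotated])
    then show "measure X.d\<Lambda> (E \<inter> {a<..b}) \<le> measure Y.d\<Lambda> (E \<inter> {a<..b}) + e" by simp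
  qed
qed

lemma \<Lambda>_le:
  assumes B: "B \<in> sets borel"
  shows "emeasure X.d\<Lambda> (E \<inter> B) \<le> emeasure Y.d\<Lambda> (E \<inter> B)"
proof -
  note D = emeasure_density_indicator[OF sets_interval_measure _ E]
  have finX: "emeasure X.d\<Lambda> (E \<inter> {a<..b}) \<noteq> \<top>" and finY: "emeasure Y.d\<Lambda> (E \<inter> {a<..b}) \<noteq> \<top>" for a b
    using emeasure_mono[of "E \<inter> {a<..b}" "{a<..b}" X.d\<Lambda>] X.d\<Lambda>_finite[of a b]
      emeasure_mono[of "E \<inter> {a<..b}" "{a<..b}" Y.d\<Lambda>] Y.d\<Lambda>_finite[of a b] by (auto simp: top_unique)
  have "emeasure (density X.d\<Lambda> (indicator E)) B \<le> emeasure (density Y.d\<Lambda> (indicator E)) B"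
  proof (rule measure_le_Ioc[OF _ _ _ _ B])
    show "emeasure (density Y.d\<Lambda> (indicator E)) {a<..b} < \<infinity>" for a b
      using finY[of a b] by (simp add: D less_top[symmetric])
    fix a b :: real assume ab: "a \<in> \<rat>" "b \<in> \<rat>" "a < b"
    have "emeasure X.d\<Lambda> (E \<inter> {a<..b}) \<le> emeasure Y.d\<Lambda> (E \<inter> {a<..b})"
    proof (cases "b \<le> 0")
      case True
      then have "E \<inter> {a<..b} = {}" by (auto simp: E_def)
      then show ?thesis by simp
    next
      case False
      \<comment> \<open>\<open>E\<close> contains positive times only, so the left end can be raised
        to 0, where the comparison of intervals starts.\<close>
      have eq: "E \<inter> {a<..b} = E \<inter> {max 0 a<..b}" by (auto simp: E_def)
      have "measure X.d\<Lambda> (E \<inter> {max 0 a<..b}) \<le> measure Y.d\<Lambda> (E \<inter> {max 0 a<..b})"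
        using ab False by (intro \<Lambda>_le_Ioc) (auto simp: max_def)
      then show ?thesis
        unfolding eq emeasure_eq_ennreal_measure[OF finX] emeasure_eq_ennreal_measure[OF finY]
        by (rule ennreal_leI)
    qed
    then show "emeasure (density X.d\<Lambda> (indicator E)) {a<..b} \<le> emeasure (density Y.d\<Lambda> (indicator E)) {a<..b}"
      by (simp add: D)
  qed auto
  then show ?thesis using B by (simp add: D)
qed

text \<open>The jumps of \<open>Y.\<Lambda>\<close> can be discarded because \<open>X.\<l>\<close> is continuous.\<close>
lemma \<l>_le:
  assumes B: "B \<in> sets borel"
  shows "emeasure X.d\<l> B \<le> emeasure Y.d\<l> B"
proof (rule measure_le_Ioc[OF _ _ _ _ B])
  show "emeasure Y.d\<l> {a<..b} < \<infinity>" for a b by (rule Y.d\<l>_finite)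
  fix a b :: real assume ab: "a < b"
  define D where "D = {s. 0 < s \<and> Y.jump s \<noteq> 0}"
  have D: "countable D" "D \<in> sets borel"
    using Y.countable_jump sets.countable[OF _ Y.countable_jump, of borel] by (auto simp: D_def)
  have "(\<Union>s\<in>D. {s}) \<in> null_sets X.d\<l>"
    by (rule null_sets_UN'[OF D(1)]) (auto intro!: null_setsI simp: X.d\<l>_singleton)
  then have "AE s in X.d\<l>. s \<notin> D" by (intro AE_not_in) simp
  \<comment> \<open>The measure is carried by the common zeros of \<open>x\<close> and
    \<open>xm\<close>, which \<open>zero\<close> places in \<open>E\<close>; the countable set
    \<open>D\<close> is null because there are no atoms.\<close>
  with X.support have "AE s in X.d\<l>. s \<in> {a<..b} \<longleftrightarrow> s \<in> E \<inter> ({a<..b} - D)"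
    by eventually_elim (use zero in \<open>auto simp: E_def\<close>)
  then have "emeasure X.d\<l> {a<..b} = emeasure X.d\<l> (E \<inter> ({a<..b} - D))"
    using D E by (intro emeasure_eq_AE) auto
  also have "\<dots> \<le> 2 * emeasure X.d\<Lambda> (E \<inter> ({a<..b} - D))" using D E by (intro X.d\<l>_le_d\<Lambda>) auto
  also have "\<dots> \<le> 2 * emeasure Y.d\<Lambda> (E \<inter> ({a<..b} - D))" using D by (intro mult_left_mono \<Lambda>_le) auto
  also have "\<dots> \<le> 2 * emeasure Y.d\<Lambda> ({a<..b} - D)" using D by (intro mult_left_mono emeasure_mono) auto
  also have "\<dots> \<le> emeasure Y.d\<l> {a<..b}" unfolding D_def using ab by (intro Y.d\<Lambda>_le_d\<l>) simp
  finally show "emeasure X.d\<l> {a<..b} \<le> emeasure Y.d\<l> {a<..b}" .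
qed auto

end

section \<open>Local times of two semimartingales\<close>

lemma left_lim_tendsto:
  assumes "cadlag_path (\<lambda>t. Z t w)" "0 < s"
  shows "((\<lambda>t. Z t w) \<longlongrightarrow> left_lim Z s w) (at_left s)"
proof -
  obtain l where l: "((\<lambda>t. Z t w) \<longlongrightarrow> l) (at_left s)" using assms by (auto simp: cadlag_path_def)
  moreover have "left_lim Z s w = l" using tendsto_Lim[OF _ l] assms(2) by (simp add: left_lim_def)
  ultimately show ?thesis by simp
qed

lemma ramp_abs_le: "\<bar>ramp j u\<bar> \<le> 1"
  by (auto simp: ramp_def)

lemma ramp_tendsto: "(f \<longlongrightarrow> l) G \<Longrightarrow> ((\<lambda>t. ramp j (f t)) \<longlongrightarrow> ramp j l) G"
  unfolding ramp_def by (intro tendsto_intros)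

context usual_filtered_prob_space
begin

text \<open>With the sign of the left limit for \<open>H\<close>, the new integrand is the indicator
  of \<open>{Z\<^sub>- > 0}\<close> for \<open>\<sigma> = 1\<close> and of
  \<open>{Z\<^sub>- \<le> 0}\<close> for \<open>\<sigma> = -1\<close>. The integrals are the
  processes behind \<open>K\<close> and \<open>K'\<close>.\<close>

lemma approximable_half:
  assumes H: "approximable Z H J" and Z: "adapted F Z" and J: "adapted F J" and \<sigma>: "\<bar>\<sigma>\<bar> = 1"
  shows "approximable Z (\<lambda>s w. (1 + \<sigma> * H s w) / 2) (\<lambda>t w. (Z t w - Z 0 w + \<sigma> * J t w) / 2)"
  unfolding approximable_def
proof (intro conjI allI impI)
  note H' = H[unfolded approximable_def]
  show "predictable M F (\<lambda>s w. (1 + \<sigma> * H s w) / 2)"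
    using H'[THEN conjunct1] by (simp add: predictable_def split_def)
  obtain C where C: "\<And>s w. 0 \<le> s \<Longrightarrow> w \<in> space M \<Longrightarrow> \<bar>H s w\<bar> \<le> C"
    using H'[THEN conjunct2, THEN conjunct1] by blast
  have "\<bar>(1 + \<sigma> * H s w) / 2\<bar> \<le> (1 + C) / 2" if "0 \<le> s" "w \<in> space M" for s w
    using C[OF that] \<sigma> abs_triangle_ineq[of 1 "\<sigma> * H s w"] by (simp add: abs_mult)
  then show "\<exists>C. \<forall>s\<ge>0. \<forall>w\<in>space M. \<bar>(1 + \<sigma> * H s w) / 2\<bar> \<le> C" by blast
  fix \<nu> :: "(real \<times> 'a) measure" and \<Theta> :: "real set" and e :: real
  assume "finite_measure \<nu>" "sets \<nu> = sets \<P>" "finite \<Theta>" "\<Theta> \<subseteq> {0..}" "0 < e"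
  from H'[THEN conjunct2, THEN conjunct2, rule_format, OF this]
  obtain Q h where h: "elementary_predictable Q h" "\<Theta> \<subseteq> Q"
    and h1: "energy \<nu> (\<lambda>s w. H s w - h s w) \<le> ennreal e"
    and h2: "\<And>t. t \<in> \<Theta> \<Longrightarrow> L0 (\<lambda>w. J t w - path_sum Q h Z t w) \<le> e"
    by (elim exE conjE) blast
  note Q = elementary_predictableD(1)[OF h(1)]
  let ?h = "\<lambda>s w. 1 / 2 + (\<sigma> / 2) * h s w"
  show "\<exists>Q h. elementary_predictable Q h \<and> \<Theta> \<subseteq> Q \<and>
    energy \<nu> (\<lambda>s w. (1 + \<sigma> * H s w) / 2 - h s w) \<le> ennreal e \<and>
    (\<forall>t\<in>\<Theta>. L0 (\<lambda>w. (Z t w - Z 0 w + \<sigma> * J t w) / 2 -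
      path_sum Q h Z t w) \<le> e)"
  proof (intro exI[of _ Q] exI[of _ ?h] conjI ballI)
    show "elementary_predictable Q ?h"
      by (intro elementary_predictable_add elementary_predictable_mult elementary_predictable_const Q h(1))
    show "\<Theta> \<subseteq> Q" by fact
    have "((1 + \<sigma> * H s w) / 2 - ?h s w)\<^sup>2 \<le> (H s w - h s w)\<^sup>2" for s w
    proof -
      have "(1 + \<sigma> * H s w) / 2 - ?h s w = \<sigma> * (H s w - h s w) / 2" by (simp add: field_simps)
      then have "\<bar>(1 + \<sigma> * H s w) / 2 - ?h s w\<bar> = \<bar>\<sigma> * (H s w - h s w) / 2\<bar>" by (simp only:)
      also have "\<dots> = \<bar>H s w - h s w\<bar> / 2" using \<sigma> by (simp add: abs_mult)
      also have "\<dots> \<le> \<bar>H s w - h s w\<bar>" by simp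
      finally have "\<bar>(1 + \<sigma> * H s w) / 2 - ?h s w\<bar> \<le> \<bar>H s w - h s w\<bar>" .
      then show ?thesis unfolding abs_le_square_iff .
    qed
    then have "energy \<nu> (\<lambda>s w. (1 + \<sigma> * H s w) / 2 - ?h s w) \<le>
        energy \<nu> (\<lambda>s w. H s w - h s w)"
      by (intro nn_integral_mono) (simp add: split_def ennreal_leI)
    then show "energy \<nu> (\<lambda>s w. (1 + \<sigma> * H s w) / 2 - ?h s w) \<le> ennreal e"
      using h1 by (rule order_trans)
    fix t assume t: "t \<in> \<Theta>"
    have "path_sum Q ?h Z t w =
      1 / 2 * (Z t w - Z 0 w) + (\<sigma> / 2) * path_sum Q h Z t w" for w
      using riemann_sum_const[OF Q subsetD[OF h(2) t], of "1 / 2" "\<lambda>u. Z u w"] by (simp only: riemann_sum_add riemann_sum_cmult)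
    then have eq: "(Z t w - Z 0 w + \<sigma> * J t w) / 2 - path_sum Q ?h Z t w =
      \<sigma> * (J t w - path_sum Q h Z t w) / 2" for w
      by (simp add: field_simps)
    show "L0 (\<lambda>w. (Z t w - Z 0 w + \<sigma> * J t w) / 2 - path_sum Q ?h Z t w) \<le> e"
      unfolding eq
    proof (rule order_trans[OF integral_mono' h2[OF t]])
      have t0: "0 \<le> t" using t \<open>\<Theta> \<subseteq> {0..}\<close> by auto
      show "integrable M (\<lambda>w. min 1 \<bar>J t w - path_sum Q h Z t w\<bar>)"
        using J t0 by (intro integrable_min_1_abs borel_measurable_diff measurable_F_M[OF riemann_sum_measurable[OF h(1) Z t0]])
          (auto simp: adapted_def intro: measurable_F_M[of _ t])
      have "min 1 (y / 2) \<le> min 1 y" if "0 \<le> y" for y :: real using that by (auto simp: min_def)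
      then show "min 1 \<bar>\<sigma> * (J t w - path_sum Q h Z t w) / 2\<bar> \<le>
          min 1 \<bar>J t w - path_sum Q h Z t w\<bar>" for w
        using \<sigma> by (simp only: abs_mult abs_divide mult_1 abs_numeral abs_ge_zero)
    qed simp
  qed
qed

lemma adapted_half:
  assumes "adapted F Z" "adapted F J"
  shows "adapted F (\<lambda>t w. (Z t w - Z 0 w + \<sigma> * J t w) / 2)"
  unfolding adapted_def
proof (intro allI impI)
  fix t :: real assume t: "0 \<le> t"
  have "Z t \<in> borel_measurable (F t)" "J t \<in> borel_measurable (F t)" "Z 0 \<in> borel_measurable (F t)"
    using assms t measurable_F_mono[OF _ t, of "Z 0" borel] unfolding adapted_def by blast+
  then show "(\<lambda>w. (Z t w - Z 0 w + \<sigma> * J t w) / 2) \<in> borel_measurable (F t)" by measurable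
qed

text \<open>\<open>C m\<close> localizes \<open>Z\<close> away from \<open>{Z\<^sub>- > 0}\<close> for \<open>\<sigma> = 1\<close> and away from \<open>{Z\<^sub>- \<le> 0}\<close> for \<open>\<sigma> = -1\<close>.\<close>
lemma local_time_localization:
  assumes Z: "semimartingale M F Z" and J: "stochastic_integral M F Z (\<lambda>s w. sgn_left (left_lim Z s w)) J"
    and \<sigma>: "\<bar>\<sigma>\<bar> = 1" and ab: "0 \<le> a" "a < b"
    and C: "\<And>m. adapted F (C m)" "\<And>m s w. \<bar>C m s w\<bar> \<le> 1"
    and L: "AE w in M. \<forall>s>0. (\<forall>m. ((\<lambda>u. C m u w) \<longlongrightarrow> L m s w) (at_left s)) \<and>
      (sgn_left (left_lim Z s w) = \<sigma> \<longrightarrow> (\<lambda>m. L m s w) \<longlonglongrightarrow> 0)"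
    and d: "0 < d"
  shows "\<forall>\<^sub>F m in sequentially. \<forall>\<^sub>F n in sequentially.
    L0 (\<lambda>w. grid_sum a b n (\<lambda>t. C m t w) (\<lambda>t. (Z t w - Z 0 w + \<sigma> * J t w) / 2)) \<le> d"
proof -
  have cZ: "cadlag_adapted M F Z" using Z by (simp add: semimartingale_def)
  then have Za: "adapted F Z" by (simp add: cadlag_adapted_def)
  obtain H where H: "approximable Z H J" "AE w in M. \<forall>s\<ge>0. H s w = sgn_left (left_lim Z s w)"
    using stochastic_integral_approximable[OF J cZ] by blast
  have Ja: "adapted F J" using stochastic_integral_regular[OF J cZ] by blast
  have "adapted F (\<lambda>t w. (Z t w - Z 0 w + \<sigma> * J t w) / 2)" by (rule adapted_half[OF Za Ja])
  moreover have "AE w in M. \<forall>s. a < s \<and> s \<le> b \<longrightarrow> (\<forall>m. ((\<lambda>u. C m u w) \<longlongrightarrow> L m s w) (at_left s)) \<and>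
      (\<lambda>m. L m s w * ((1 + \<sigma> * H s w) / 2)) \<longlonglongrightarrow> 0"
    using H(2) L
  proof eventually_elim
    case (elim w)
    show ?case
    proof (intro allI impI conjI)
      fix s assume "a < s \<and> s \<le> b"
      then have s: "0 < s" using ab by simp
      from elim(2) s show "((\<lambda>u. C m u w) \<longlongrightarrow> L m s w) (at_left s)" for m by blast
      have Hs: "H s w = sgn_left (left_lim Z s w)" using elim(1) s by simp
      show "(\<lambda>m. L m s w * ((1 + \<sigma> * H s w) / 2)) \<longlonglongrightarrow> 0"
      proof (cases "sgn_left (left_lim Z s w) = \<sigma>")
        case True
        then have "(\<lambda>m. L m s w) \<longlonglongrightarrow> 0" using elim(2) s by blast
        from tendsto_mult_left_zero[OF this] show ?thesis .
      next
        case False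
        moreover have "\<sigma> = 1 \<or> \<sigma> = - 1" using \<sigma> by linarith
        \<comment> \<open>Here the integrand itself is 0, whatever the weight does.\<close>
        ultimately have "\<sigma> * sgn_left (left_lim Z s w) = - 1" unfolding sgn_left_def by auto
        then show ?thesis by (simp add: Hs)
      qed
    qed
  qed
  ultimately show ?thesis
    using ab d by (intro grid_sum_vanishes[OF approximable_half[OF H(1) Za Ja \<sigma>] semimartingale_controlled[OF Z] Za _ ab C]) simp_all
qed

lemma AE_rational_intervals:
  assumes "\<And>a b. 0 \<le> a \<Longrightarrow> a < b \<Longrightarrow> AE w in M. P a b w"
  shows "AE w in M. \<forall>a b :: real. a \<in> \<rat> \<longrightarrow> b \<in> \<rat> \<longrightarrow> 0 \<le> a \<longrightarrow> a < b \<longrightarrow> P a b w"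
proof -
  have "AE w in M. \<forall>a\<in>\<rat>. \<forall>b\<in>\<rat>. 0 \<le> a \<longrightarrow> a < b \<longrightarrow> P a b w"
    using assms by (simp add: AE_ball_countable countable_rat)
  then show ?thesis by eventually_elim blast
qed

lemma local_time_paths:
  assumes Z: "semimartingale M F Z" and J: "stochastic_integral M F Z (\<lambda>s w. sgn_left (left_lim Z s w)) J"
    and L: "AE w in M. continuous_on {0..} (\<lambda>t. L t w) \<and> mono_on {0..} (\<lambda>t. L t w)"
    and tanaka: "AE w in M. \<forall>t\<ge>0. jump_term Z w summable_on {0<..t} \<and>
      \<bar>Z t w\<bar> = \<bar>Z 0 w\<bar> + J t w + 2 * (\<Sum>\<^sub>\<infinity>s\<in>{0<..t}. jump_term Z w s) + L t w"
  shows "AE w in M. tanaka_path (\<lambda>t. Z t w) (\<lambda>t. left_lim Z t w) (\<lambda>t. J t w) (\<lambda>t. L t w)"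
proof -
  have cZ: "cadlag_adapted M F Z" using Z by (simp add: semimartingale_def)
  then have "AE w in M. cadlag_path (\<lambda>t. Z t w)" by (simp add: cadlag_adapted_def)
  moreover have "AE w in M. \<forall>t\<ge>0. continuous (at_right t) (\<lambda>t. J t w)"
    using stochastic_integral_regular[OF J cZ] by blast
  ultimately show ?thesis
    using L tanaka
  proof eventually_elim
    case (elim w)
    show ?case
    proof (rule tanaka_path.intro)
      show "((\<lambda>t. Z t w) \<longlongrightarrow> left_lim Z t w) (at_left t)" if "0 < t" for t
        using elim(1) that by (rule left_lim_tendsto)
      have j: "jump_term Z w = path_jump (\<lambda>t. Z t w) (\<lambda>t. left_lim Z t w)"
        by (simp add: jump_term_def path_jump_def fun_eq_iff)
      fix t :: real assume t: "0 \<le> t"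
      show "continuous (at_right t) (\<lambda>t. Z t w)" using elim(1) t unfolding cadlag_path_def by blast
      show "continuous (at_right t) (\<lambda>t. J t w)" using elim(2) t by blast
      show "path_jump (\<lambda>t. Z t w) (\<lambda>t. left_lim Z t w) summable_on {0<..t}"
        using elim(4) t unfolding j by blast
      show "\<bar>Z t w\<bar> = \<bar>Z 0 w\<bar> + J t w + 2 * infsum (path_jump (\<lambda>t. Z t w) (\<lambda>t. left_lim Z t w)) {0<..t} + L t w"
        using elim(4) t unfolding j by blast
    qed (use elim(3) in blast)+
  qed
qed

text \<open>\<open>\<sigma> = 1\<close> treats the times where \<open>Z\<close> is negative and
  \<open>\<sigma> = -1\<close> those where it is positive: in each case the left limit of the ramp
  vanishes wherever the integrand does not.\<close>

lemma local_time_support: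
  assumes Z: "semimartingale M F Z" and J: "stochastic_integral M F Z (\<lambda>s w. sgn_left (left_lim Z s w)) J"
    and paths: "AE w in M. tanaka_path (\<lambda>t. Z t w) (\<lambda>t. left_lim Z t w) (\<lambda>t. J t w) (\<lambda>t. L t w)"
  shows "AE w in M. tanaka_support (\<lambda>t. Z t w) (\<lambda>t. left_lim Z t w) (\<lambda>t. J t w) (\<lambda>t. L t w)"
proof -
  have cZ: "cadlag_adapted M F Z" using Z by (simp add: semimartingale_def)
  then have Za: "adapted F Z" and cad: "AE w in M. cadlag_path (\<lambda>t. Z t w)" by (simp_all add: cadlag_adapted_def)
  have Ja: "adapted F J" using stochastic_integral_regular[OF J cZ] by blast
  have *: "AE w in M. \<forall>a b. a \<in> \<rat> \<longrightarrow> b \<in> \<rat> \<longrightarrow> 0 \<le> a \<longrightarrow> a < b \<longrightarrow> (\<forall>j. \<forall>e>0.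
    \<exists>\<^sub>F m in sequentially. \<exists>\<^sub>F n in sequentially.
      \<bar>grid_sum a b n (\<lambda>t. ramp j (- \<sigma> * Z t w)) (\<lambda>t. (Z t w - Z 0 w + \<sigma> * J t w) / 2)\<bar> < e)"
    if \<sigma>: "\<bar>\<sigma>\<bar> = 1" for \<sigma>
  proof (rule AE_rational_intervals, unfold AE_all_countable, rule allI)
    fix a b :: real and j assume ab: "0 \<le> a" "a < b"
    let ?C = "\<lambda>m t w. ramp j (- \<sigma> * Z t w)" and ?K = "\<lambda>t w. (Z t w - Z 0 w + \<sigma> * J t w) / 2"
    have C: "adapted F (?C m)" for m :: nat
      using Za unfolding adapted_def ramp_def by (auto intro!: borel_measurable_min borel_measurable_max borel_measurable_times)
    have K: "adapted F ?K" by (rule adapted_half[OF Za Ja])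
    show "AE w in M. \<forall>e>0. \<exists>\<^sub>F m in sequentially. \<exists>\<^sub>F n in sequentially.
      \<bar>grid_sum a b n (\<lambda>t. ?C m t w) (\<lambda>t. ?K t w)\<bar> < e"
    proof (rule frequently_small)
      show "(\<lambda>w. grid_sum a b n (\<lambda>t. ?C m t w) (\<lambda>t. ?K t w)) \<in> borel_measurable M" for m n :: nat
        by (rule grid_sum_measurable[OF ab C K])
      fix d :: real assume "0 < d"
      show "\<forall>\<^sub>F m in sequentially. \<forall>\<^sub>F n in sequentially.
        L0 (\<lambda>w. grid_sum a b n (\<lambda>t. ?C m t w) (\<lambda>t. ?K t w)) \<le> d"
      proof (rule local_time_localization[OF Z J \<sigma> ab C ramp_abs_le _ \<open>0 < d\<close>])
        show "AE w in M. \<forall>s>0. (\<forall>m. ((\<lambda>u. ?C m u w) \<longlongrightarrow> ramp j (- \<sigma> * left_lim Z s w)) (at_left s)) \<and>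
          (sgn_left (left_lim Z s w) = \<sigma> \<longrightarrow> (\<lambda>m :: nat. ramp j (- \<sigma> * left_lim Z s w)) \<longlonglongrightarrow> 0)"
          using cad
        proof eventually_elim
          case (elim w)
          have "ramp j (- \<sigma> * left_lim Z s w) = 0" if "sgn_left (left_lim Z s w) = \<sigma>" for s
          proof -
            have "- \<sigma> * left_lim Z s w \<le> 0"
              unfolding that[symmetric] by (simp add: sgn_left_def)
            then have "real (Suc j) * (- \<sigma> * left_lim Z s w) \<le> 0" by (rule mult_nonneg_nonpos[OF of_nat_0_le_iff])
            then show ?thesis unfolding ramp_def by (simp only: max_absorb1)
          qed
          note zero = this
          show ?case
          proof (intro allI impI conjI)
            fix s :: real and m :: nat assume s: "0 < s"
            show "((\<lambda>u. ?C m u w) \<longlongrightarrow> ramp j (- \<sigma> * left_lim Z s w)) (at_left s)"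
              by (intro ramp_tendsto tendsto_mult tendsto_const left_lim_tendsto[where Z = Z and w = w, OF elim s])
          next
            fix s assume "sgn_left (left_lim Z s w) = \<sigma>"
            then show "(\<lambda>m :: nat. ramp j (- \<sigma> * left_lim Z s w)) \<longlonglongrightarrow> 0" by (simp only: zero tendsto_const)
          qed
        qed
      qed
    qed
  qed
  have one: "\<bar>1 :: real\<bar> = 1" "\<bar>- 1 :: real\<bar> = 1" by simp_all
  show ?thesis
    using paths *[OF one(1)] *[OF one(2)]
  proof eventually_elim
    case (elim w)
    then interpret tanaka_path "\<lambda>t. Z t w" "\<lambda>t. left_lim Z t w" "\<lambda>t. J t w" "\<lambda>t. L t w" by blast
    show ?case
    proof
      fix j and a b e :: real assume ab: "a \<in> \<rat>" "b \<in> \<rat>" "0 \<le> a" "a < b" "0 < e"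
      show "\<exists>\<^sub>F m in sequentially. \<exists>\<^sub>F n in sequentially. \<bar>grid_sum a b n (\<lambda>t. ramp j (- Z t w)) K\<bar> < e"
        using elim(2)[rule_format, OF ab, of j] unfolding K_def[abs_def] by (simp only: mult_minus1 mult_1)
      show "\<exists>\<^sub>F m in sequentially. \<exists>\<^sub>F n in sequentially. \<bar>grid_sum a b n (\<lambda>t. ramp j (Z t w)) K'\<bar> < e"
        using elim(3)[rule_format, OF ab, of j] unfolding K'_def[abs_def]
        by (simp only: minus_minus mult_1 mult_minus1 add_uminus_conv_diff)
    qed
  qed
qed

text \<open>Supplies the hypotheses of \<open>tanaka_pair\<close> on almost every path. The two
  localized integrals enter one estimate so that they become small at common indices.\<close>

lemma local_time_measure_le:
  assumes X: "semimartingale M F X" and Y: "semimartingale M F Y"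
    and LX: "local_time M F X LX" and LY: "local_time M F Y LY"
    and zero: "AE w in M. \<forall>s>0. X s w = 0 \<and> left_lim X s w = 0 \<longrightarrow> Y s w = 0 \<and> left_lim Y s w = 0"
    and le: "AE w in M. \<forall>t\<ge>0. pos_part (X t w) \<le> pos_part (Y t w)"
  shows "AE w in M. \<forall>B\<in>sets borel. emeasure (stieltjes LX w) B \<le> emeasure (stieltjes LY w) B"
proof -
  obtain JX where JX: "stochastic_integral M F X (\<lambda>s w. sgn_left (left_lim X s w)) JX"
    and pX: "AE w in M. tanaka_path (\<lambda>t. X t w) (\<lambda>t. left_lim X t w) (\<lambda>t. JX t w) (\<lambda>t. LX t w)"
    using LX local_time_paths[OF X] unfolding local_time_def by blast
  obtain JY where JY: "stochastic_integral M F Y (\<lambda>s w. sgn_left (left_lim Y s w)) JY"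
    and pY: "AE w in M. tanaka_path (\<lambda>t. Y t w) (\<lambda>t. left_lim Y t w) (\<lambda>t. JY t w) (\<lambda>t. LY t w)"
    using LY local_time_paths[OF Y] unfolding local_time_def by blast
  have c: "cadlag_adapted M F X" "cadlag_adapted M F Y" using X Y by (simp_all add: semimartingale_def)
  then have a: "adapted F X" "adapted F Y"
    and cad: "AE w in M. cadlag_path (\<lambda>t. X t w)" "AE w in M. cadlag_path (\<lambda>t. Y t w)"
    by (simp_all add: cadlag_adapted_def)
  have J: "adapted F JX" "adapted F JY"
    using stochastic_integral_regular[OF JX c(1)] stochastic_integral_regular[OF JY c(2)] by blast+
  let ?C = "\<lambda>m t w. cutoff (1 / real (Suc m)) (pos_part (X t w)) (pos_part (Y t w))"
  let ?L = "\<lambda>m s w. cutoff (1 / real (Suc m)) (pos_part (left_lim X s w)) (pos_part (left_lim Y s w))"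
  let ?KX = "\<lambda>t w. (X t w - X 0 w + 1 * JX t w) / 2" and ?KY = "\<lambda>t w. (Y t w - Y 0 w + 1 * JY t w) / 2"
  have C: "adapted F (?C m)" for m
    unfolding adapted_def
  proof (intro allI impI)
    fix t :: real assume "0 \<le> t"
    then have [measurable]: "X t \<in> borel_measurable (F t)" "Y t \<in> borel_measurable (F t)"
      using a by (simp_all add: adapted_def)
    show "?C m t \<in> borel_measurable (F t)" unfolding cutoff_def pos_part_def by measurable
  qed
  have K: "adapted F ?KX" "adapted F ?KY" by (rule adapted_half[OF a(1) J(1)] adapted_half[OF a(2) J(2)])+
  have left: "AE w in M. \<forall>s>0. (\<forall>m. ((\<lambda>u. ?C m u w) \<longlongrightarrow> ?L m s w) (at_left s)) \<and>
    (0 < left_lim X s w \<or> 0 < left_lim Y s w \<longrightarrow> (\<lambda>m. ?L m s w) \<longlonglongrightarrow> 0)"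
    using cad le
  proof eventually_elim
    case (elim w)
    show ?case
    proof (intro allI impI conjI)
      fix s :: real assume s: "0 < s"
      note lX = left_lim_tendsto[where Z = X and w = w, OF elim(1) s]
      note lY = left_lim_tendsto[where Z = Y and w = w, OF elim(2) s]
      show "((\<lambda>u. ?C m u w) \<longlongrightarrow> ?L m s w) (at_left s)" for m
        by (intro cutoff_tendsto pos_part_tendsto lX lY) simp
      have v: "pos_part (left_lim X s w) \<le> pos_part (left_lim Y s w)"
      proof (rule tendsto_le[OF _ pos_part_tendsto[OF lY] pos_part_tendsto[OF lX]])
        show "\<forall>\<^sub>F u in at_left s. pos_part (X u w) \<le> pos_part (Y u w)"
          by (rule eventually_at_leftI[OF _ s]) (use elim(3) in auto)
      qed simp
      assume "0 < left_lim X s w \<or> 0 < left_lim Y s w"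
      with v have "\<not> pos_part (left_lim Y s w) \<le> 0" by (auto simp: pos_part_def)
      moreover have "(\<lambda>m. ?L m s w) \<longlonglongrightarrow> (if pos_part (left_lim Y s w) \<le> 0 then 1 else 0)"
        using v by (intro cutoff_limit) (auto simp: pos_part_def)
      ultimately show "(\<lambda>m. ?L m s w) \<longlonglongrightarrow> 0" by (simp only: if_False)
    qed
  qed
  have small: "AE w in M. \<forall>a b. a \<in> \<rat> \<longrightarrow> b \<in> \<rat> \<longrightarrow> 0 \<le> a \<longrightarrow> a < b \<longrightarrow> (\<forall>e>0.
    \<exists>\<^sub>F m in sequentially. \<exists>\<^sub>F n in sequentially.
      \<bar>\<bar>grid_sum a b n (\<lambda>t. ?C m t w) (\<lambda>t. ?KX t w)\<bar> + 2 * \<bar>grid_sum a b n (\<lambda>t. ?C m t w) (\<lambda>t. ?KY t w)\<bar>\<bar> < e)"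
  proof (rule AE_rational_intervals)
    fix a b :: real assume ab: "0 \<le> a" "a < b"
    let ?U = "\<lambda>m n w. grid_sum a b n (\<lambda>t. ?C m t w) (\<lambda>t. ?KX t w)"
    let ?V = "\<lambda>m n w. grid_sum a b n (\<lambda>t. ?C m t w) (\<lambda>t. ?KY t w)"
    have UV: "?U m n \<in> borel_measurable M" "?V m n \<in> borel_measurable M" for m n
      by (rule grid_sum_measurable[OF ab C K(1)] grid_sum_measurable[OF ab C K(2)])+
    show "AE w in M. \<forall>e>0. \<exists>\<^sub>F m in sequentially. \<exists>\<^sub>F n in sequentially. \<bar>\<bar>?U m n w\<bar> + 2 * \<bar>?V m n w\<bar>\<bar> < e"
    proof (rule frequently_small)
      show "(\<lambda>w. \<bar>?U m n w\<bar> + 2 * \<bar>?V m n w\<bar>) \<in> borel_measurable M" for m n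
        by (intro borel_measurable_add borel_measurable_abs borel_measurable_times borel_measurable_const UV)
      \<comment> \<open>The shares \<open>d / 3\<close> below match the coefficients 1 and 2 of the
        two terms.\<close>
      fix d :: real assume d: "0 < d"
      have one: "\<bar>1 :: real\<bar> = 1" by simp
      have "\<forall>\<^sub>F m in sequentially. \<forall>\<^sub>F n in sequentially. L0 (?U m n) \<le> d / 3"
      proof (rule local_time_localization[OF X JX one ab C cutoff_bounds(2)])
        show "AE w in M. \<forall>s>0. (\<forall>m. ((\<lambda>u. ?C m u w) \<longlongrightarrow> ?L m s w) (at_left s)) \<and>
            (sgn_left (left_lim X s w) = 1 \<longrightarrow> (\<lambda>m. ?L m s w) \<longlonglongrightarrow> 0)"
          using left by eventually_elim (simp add: sgn_left_def)
      qed (use d in simp)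
      moreover have "\<forall>\<^sub>F m in sequentially. \<forall>\<^sub>F n in sequentially. L0 (?V m n) \<le> d / 3"
      proof (rule local_time_localization[OF Y JY one ab C cutoff_bounds(2)])
        show "AE w in M. \<forall>s>0. (\<forall>m. ((\<lambda>u. ?C m u w) \<longlongrightarrow> ?L m s w) (at_left s)) \<and>
            (sgn_left (left_lim Y s w) = 1 \<longrightarrow> (\<lambda>m. ?L m s w) \<longlonglongrightarrow> 0)"
          using left by eventually_elim (simp add: sgn_left_def)
      qed (use d in simp)
      ultimately show "\<forall>\<^sub>F m in sequentially. \<forall>\<^sub>F n in sequentially.
        L0 (\<lambda>w. \<bar>?U m n w\<bar> + 2 * \<bar>?V m n w\<bar>) \<le> d"
      proof eventually_elim
        case (elim m)
        then show ?case
        proof eventually_elim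
          case (elim n)
          have iU: "integrable M (\<lambda>w. min 1 \<bar>?U m n w\<bar>)" and iV: "integrable M (\<lambda>w. min 1 \<bar>?V m n w\<bar>)"
            by (rule integrable_min_1_abs[OF UV(1)[of n m]] integrable_min_1_abs[OF UV(2)[of n m]])+
          have le: "min 1 \<bar>\<bar>u\<bar> + 2 * \<bar>v\<bar>\<bar> \<le> min 1 \<bar>u\<bar> + 2 * min 1 \<bar>v\<bar>" for u v :: real
            by (auto simp: min_def)
          have "L0 (\<lambda>w. \<bar>?U m n w\<bar> + 2 * \<bar>?V m n w\<bar>) \<le>
              (\<integral>w. min 1 \<bar>?U m n w\<bar> + 2 * min 1 \<bar>?V m n w\<bar> \<partial>M)"
            by (rule integral_mono'[OF Bochner_Integration.integrable_add[OF iU integrable_mult_right[OF iV]] le]) simp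
          also have "\<dots> = L0 (?U m n) + 2 * L0 (?V m n)"
            using iU iV by simp
          also have "\<dots> \<le> d" using elim by linarith
          finally show ?case .
        qed
      qed
    qed
  qed
  show ?thesis
    using local_time_support[OF X JX pX] pY zero le small
  proof eventually_elim
    case (elim w)
    interpret X: tanaka_support "\<lambda>t. X t w" "\<lambda>t. left_lim X t w" "\<lambda>t. JX t w" "\<lambda>t. LX t w" by (fact elim(1))
    interpret Y: tanaka_path "\<lambda>t. Y t w" "\<lambda>t. left_lim Y t w" "\<lambda>t. JY t w" "\<lambda>t. LY t w" by (fact elim(2))
    interpret tanaka_pair "\<lambda>t. X t w" "\<lambda>t. left_lim X t w" "\<lambda>t. JX t w" "\<lambda>t. LX t w"
      "\<lambda>t. Y t w" "\<lambda>t. left_lim Y t w" "\<lambda>t. JY t w" "\<lambda>t. LY t w"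
    proof
      fix a b e :: real assume ab: "a \<in> \<rat>" "b \<in> \<rat>" "0 \<le> a" "a < b" "0 < e"
      have pos: "\<bar>\<bar>u\<bar> + 2 * \<bar>v\<bar>\<bar> = \<bar>u\<bar> + 2 * \<bar>v\<bar>" for u v :: real by simp
      show "\<exists>\<^sub>F m in sequentially. \<exists>\<^sub>F n in sequentially.
        \<bar>grid_sum a b n (\<lambda>t. ?C m t w) X.K\<bar> + 2 * \<bar>grid_sum a b n (\<lambda>t. ?C m t w) Y.K\<bar> < e"
        using elim(5)[rule_format, OF ab] unfolding X.K_def[abs_def] Y.K_def[abs_def] pos mult_1 .
    qed (use elim(3,4) in blast)+
    have "stieltjes LX w = X.d\<l>" "stieltjes LY w = Y.d\<l>"
      by (simp_all add: stieltjes_def X.\<l>_def[abs_def] Y.\<l>_def[abs_def])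
    then show ?case using \<l>_le by simp
  qed
qed

text \<open>At time 0 the formula reads \<open>L 0 = - J 0\<close>, and elementary integrals start
  at 0.\<close>

lemma local_time_zero:
  assumes Z: "semimartingale M F Z" and L: "local_time M F Z L"
  shows "AE w in M. L 0 w = 0"
proof -
  have cZ: "cadlag_adapted M F Z" using Z by (simp add: semimartingale_def)
  obtain J where J: "stochastic_integral M F Z (\<lambda>s w. sgn_left (left_lim Z s w)) J"
    and eq: "AE w in M. \<forall>t\<ge>0. jump_term Z w summable_on {0<..t} \<and>
      \<bar>Z t w\<bar> = \<bar>Z 0 w\<bar> + J t w + 2 * (\<Sum>\<^sub>\<infinity>s\<in>{0<..t}. jump_term Z w s) + L t w"
    using L unfolding local_time_def by blast
  obtain H where H: "approximable Z H J" using stochastic_integral_approximable[OF J cZ] by blast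
  have "adapted F J" using stochastic_integral_regular[OF J cZ] by blast
  then have i: "integrable M (\<lambda>w. min 1 \<bar>J 0 w\<bar>)"
    by (intro integrable_min_1_abs) (auto simp: adapted_def intro: measurable_F_M[of _ 0])
  \<comment> \<open>The null measure makes the energy condition void; what remains is the
    approximation of \<open>J 0\<close> by sums over no cells.\<close>
  have fin: "finite_measure (null_measure \<P>)" by (rule finite_measureI) simp
  have "L0 (J 0) \<le> 0 + e" if "0 < e" for e
    using H[unfolded approximable_def, THEN conjunct2, THEN conjunct2, rule_format,
        of "null_measure \<P>" "{0}" e, OF fin] that by auto
  then have "L0 (J 0) \<le> 0" by (rule field_le_epsilon)
  moreover have "0 \<le> L0 (J 0)" by (rule Bochner_Integration.integral_nonneg) simp
  ultimately have "L0 (J 0) = 0" by (rule antisym)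
  then have "AE w in M. min 1 \<bar>J 0 w\<bar> = 0"
    by (rule integral_nonneg_eq_0_iff_AE[OF i, THEN iffD1, rotated]) simp
  with eq show ?thesis
    by eventually_elim (auto simp: min_def split: if_splits)
qed

end

subsection \<open>Predictable densities of continuous increasing processes\<close>

context usual_filtered_prob_space
begin

text \<open>The properties hold on every path and the process is frozen at negative times, so each
  path generates a Stieltjes measure on the line without exceptions.\<close>

definition increasing_process :: "(real \<Rightarrow> 'a \<Rightarrow> real) \<Rightarrow> bool" where
  "increasing_process Z \<longleftrightarrow> adapted F Z \<and>
    (\<forall>w. mono (\<lambda>t. Z t w) \<and> (\<forall>t. isCont (\<lambda>t. Z t w) t) \<and> (\<forall>t\<le>0. Z t w = 0))"

lemma increasing_processD:
  assumes "increasing_process Z"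
  shows "adapted F Z" "\<And>s t w. s \<le> t \<Longrightarrow> Z s w \<le> Z t w" "\<And>t w. isCont (\<lambda>t. Z t w) t"
    "\<And>t w. continuous (at_right t) (\<lambda>t. Z t w)" "\<And>t w. t \<le> 0 \<Longrightarrow> Z t w = 0" "\<And>t w. 0 \<le> Z t w"
proof -
  show 1: "adapted F Z" "\<And>t w. isCont (\<lambda>t. Z t w) t" "\<And>t w. t \<le> 0 \<Longrightarrow> Z t w = 0"
    using assms by (auto simp: increasing_process_def)
  show 2: "\<And>s t w. s \<le> t \<Longrightarrow> Z s w \<le> Z t w" using assms by (auto simp: increasing_process_def mono_def)
  show "continuous (at_right t) (\<lambda>t. Z t w)" for t w using 1(2) by (rule continuous_within_subset) simp
  show "0 \<le> Z t w" for t w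
    using 1(3)[of t w] 1(3)[of 0 w] 2[of 0 t w] by (cases "t \<le> 0") auto
qed

lemma emeasure_increasing:
  assumes "increasing_process Z" "a \<le> b"
  shows "emeasure (interval_measure (\<lambda>t. Z t w)) {a<..b} = ennreal (Z b w - Z a w)"
  by (rule emeasure_interval_measure_Ioc[OF assms(2) increasing_processD(2)[OF assms(1)] increasing_processD(4)[OF assms(1)]])

lemma increasing_process_measurable:
  assumes "increasing_process Z" "r \<le> s" "0 \<le> s"
  shows "Z r \<in> borel_measurable (F s)"
proof (cases "0 \<le> r")
  case True
  then have "Z r \<in> borel_measurable (F r)" using increasing_processD(1)[OF assms(1)] by (simp add: adapted_def)
  then show ?thesis using assms(2) by (rule measurable_F_mono)
next
  case False
  then have "Z r = (\<lambda>_. 0)" using increasing_processD(5)[OF assms(1)] by auto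
  then show ?thesis by simp
qed

text \<open>The factor \<open>W\<close> is there to bring the mass on \<open>(u, v]\<close> down to
  at most 1. The path measures thus form a sub-probability kernel even when the process has no
  moments.\<close>

definition kernel :: "(real \<Rightarrow> 'a \<Rightarrow> real) \<Rightarrow> ('a \<Rightarrow> real) \<Rightarrow> real \<Rightarrow> real \<Rightarrow> 'a \<Rightarrow> real measure" where
  "kernel Z W u v w = density (interval_measure (\<lambda>t. Z t w)) (\<lambda>r. ennreal (W w) * indicator {u<..v} r)"

text \<open>Measurability is checked on half-open intervals, a generator stable under intersection
  on which the mass is \<open>W\<close> times an increment of \<open>Z\<close>.\<close>

lemma kernel_measurable:
  assumes Z: "increasing_process Z" and W: "W \<in> borel_measurable N" "\<And>w. 0 \<le> W w" "\<And>w. W w * Z v w \<le> 1"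
    and u: "0 \<le> u" "u \<le> v" and N: "\<And>r. r \<le> v \<Longrightarrow> Z r \<in> borel_measurable N"
  shows "kernel Z W u v \<in> measurable N (subprob_algebra borel)"
proof (rule measurable_subprob_algebra_generated)
  show "sets (borel :: real measure) = sigma_sets UNIV (range (\<lambda>(a, b). {a<..b}))"
    by (subst borel_sigma_sets_Ioc) (rule sets_measure_of, simp)
  show "Int_stable (range (\<lambda>(a, b). {a<..b :: real}))"
  proof (rule Int_stableI)
    fix A B :: "real set" assume "A \<in> range (\<lambda>(a, b). {a<..b})" "B \<in> range (\<lambda>(a, b). {a<..b})"
    then obtain a b c d where "A = {a<..b}" "B = {c<..d}" by auto
    then have "A \<inter> B = (\<lambda>(a, b). {a<..b}) (max a c, min b d)" by auto
    then show "A \<inter> B \<in> range (\<lambda>(a, b). {a<..b})" by (rule range_eqI)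
  qed
  have em: "emeasure (kernel Z W u v w) A = ennreal (W w) * emeasure (interval_measure (\<lambda>t. Z t w)) ({u<..v} \<inter> A)"
    if "A \<in> sets borel" for A w
  proof -
    have "emeasure (kernel Z W u v w) A = (\<integral>\<^sup>+r. ennreal (W w) * (indicator {u<..v} r * indicator A r) \<partial>interval_measure (\<lambda>t. Z t w))"
      unfolding kernel_def using that by (subst emeasure_density) (auto simp: mult.assoc)
    also have "\<dots> = (\<integral>\<^sup>+r. ennreal (W w) * indicator ({u<..v} \<inter> A) r \<partial>interval_measure (\<lambda>t. Z t w))"
      by (simp add: indicator_inter_arith)
    finally show ?thesis using that by (simp add: nn_integral_cmult_indicator)
  qed
  have U: "emeasure (kernel Z W u v w) UNIV = ennreal (W w * (Z v w - Z u w))" for w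
    using em[of UNIV w] W(2)[of w] increasing_processD(2)[OF Z u(2), of w]
    by (simp add: emeasure_increasing[OF Z u(2)] ennreal_mult)
  show "subprob_space (kernel Z W u v w)" for w
  proof (rule subprob_spaceI)
    have "0 \<le> W w * Z u w" using W(2) increasing_processD(6)[OF Z] by simp
    then have "W w * (Z v w - Z u w) \<le> 1" using W(3)[of w] by (simp add: right_diff_distrib)
    then show "emeasure (kernel Z W u v w) (space (kernel Z W u v w)) \<le> 1"
      using U[of w] by (simp add: kernel_def)
  qed (simp add: kernel_def)
  show "sets (kernel Z W u v w) = sets borel" for w
    unfolding kernel_def sets_density by (rule sets_interval_measure)
  show "(\<lambda>w. emeasure (kernel Z W u v w) UNIV) \<in> borel_measurable N"
  proof -
    have [measurable]: "Z v \<in> borel_measurable N" "Z u \<in> borel_measurable N" using u by (auto intro: N)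
    show ?thesis unfolding U using W(1) by measurable
  qed
  show "(\<lambda>w. emeasure (kernel Z W u v w) A) \<in> borel_measurable N" if "A \<in> range (\<lambda>(a, b). {a<..b})" for A
  proof -
    obtain a b where A: "A = {a<..b}" using \<open>A \<in> range (\<lambda>(a, b). {a<..b})\<close> by auto
    have I: "{u<..v} \<inter> A = {max u a<..min v b}" unfolding A by auto
    show ?thesis
    proof (cases "max u a \<le> min v b")
      case True
      then have eq: "(\<lambda>w. emeasure (kernel Z W u v w) A) = (\<lambda>w. ennreal (W w) * ennreal (Z (min v b) w - Z (max u a) w))"
        using em[of A] A emeasure_increasing[OF Z True] unfolding I by auto
      have "max u a \<le> v" "min v b \<le> v" using True by auto
      then have [measurable]: "Z (min v b) \<in> borel_measurable N" "Z (max u a) \<in> borel_measurable N" by (auto intro: N)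
      show ?thesis unfolding eq using W(1) by measurable
    next
      case False
      then have e: "{u<..v} \<inter> A = {}" unfolding I by auto
      have eq: "(\<lambda>w. emeasure (kernel Z W u v w) A) = (\<lambda>w. 0)" using em[of A] A unfolding e by auto
      show ?thesis unfolding eq by simp
    qed
  qed
qed simp

lemma nn_integral_kernel:
  assumes g: "g \<in> borel_measurable borel"
  shows "(\<integral>\<^sup>+r. g r \<partial>kernel Z W u v w) =
    ennreal (W w) * (\<integral>\<^sup>+r. g r * indicator {u<..v} r \<partial>interval_measure (\<lambda>t. Z t w))"
proof -
  have "(\<integral>\<^sup>+r. g r \<partial>kernel Z W u v w) =
      (\<integral>\<^sup>+r. ennreal (W w) * (g r * indicator {u<..v} r) \<partial>interval_measure (\<lambda>t. Z t w))"
    unfolding kernel_def using g by (subst nn_integral_density) (auto simp: ac_simps)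
  then show ?thesis using g by (simp add: nn_integral_cmult)
qed

text \<open>Stopping the time coordinate at \<open>s\<close> makes predictable processes measurable with respect to the
  information at time \<open>s\<close>.\<close>
lemma predictable_progressive:
  assumes N: "space N = space M" "\<And>r. r \<le> s \<Longrightarrow> 0 \<le> r \<Longrightarrow> sets (F r) \<subseteq> sets N" and s: "0 \<le> s"
  shows "(\<lambda>(w, r). (max 0 (min r s), w)) \<in> measurable (N \<Otimes>\<^sub>M borel) \<P>"
  unfolding predictable_sigma_def
proof (rule measurable_measure_of)
  let ?f = "\<lambda>(w, r). (max 0 (min r s), w)"
  show "?f \<in> space (N \<Otimes>\<^sub>M borel) \<rightarrow> {0..} \<times> space M"
    using N(1) by (auto simp: space_pair_measure)
  fix G assume "G \<in> {{0} \<times> A | A. A \<in> sets (F 0)} \<union> {{r<..t} \<times> A | r t A. 0 \<le> r \<and> r \<le> t \<and> A \<in> sets (F r)}"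
  then consider A where "G = {0} \<times> A" "A \<in> sets (F 0)" | r t A where "G = {r<..t} \<times> A" "0 \<le> r" "r \<le> t" "A \<in> sets (F r)" by blast
  then show "?f -` G \<inter> space (N \<Otimes>\<^sub>M borel) \<in> sets (N \<Otimes>\<^sub>M borel)"
  proof cases
    case 1
    have A: "A \<in> sets N" using 1 N(2)[of 0] s by auto
    have "?f -` G \<inter> space (N \<Otimes>\<^sub>M borel) = A \<times> {r. max 0 (min r s) = 0}"
      unfolding 1 using sets.sets_into_space[OF A] by (auto simp: space_pair_measure)
    moreover have "{r :: real. max 0 (min r s) = 0} \<in> sets borel" by measurable
    ultimately show ?thesis using A by (simp add: pair_measureI)
  next
    case 2
    have B: "{q :: real. r < max 0 (min q s) \<and> max 0 (min q s) \<le> t} \<in> sets borel" by measurable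
    show ?thesis
    proof (cases "r < s")
      case True
      then have A: "A \<in> sets N" using 2 N(2)[of r] by auto
      have "?f -` G \<inter> space (N \<Otimes>\<^sub>M borel) = A \<times> {q. r < max 0 (min q s) \<and> max 0 (min q s) \<le> t}"
        unfolding 2 using sets.sets_into_space[OF A] by (auto simp: space_pair_measure)
      then show ?thesis using A B by (simp add: pair_measureI)
    next
      case False
      \<comment> \<open>A rectangle that begins at or after \<open>s\<close> is never entered by the
        clamped time, so its preimage is empty even if its base is not measurable at
        \<open>s\<close>.\<close>
      then have "s \<le> r" by simp
      then have "max 0 (min q s) \<le> r" for q using 2(2) min.cobounded2[of q s] by linarith
      then have "?f -` G = {}" unfolding 2 by (auto simp: not_less[symmetric])
      then show ?thesis by (simp only: Int_empty_left sets.empty_sets)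
    qed
  qed
next
  have "A \<subseteq> space M" if "A \<in> sets (F r)" for A r using sets.sets_into_space[OF that] by (simp add: space_F)
  then show "{{0} \<times> A | A. A \<in> sets (F 0)} \<union> {{r<..t} \<times> A | r t A. 0 \<le> r \<and> r \<le> t \<and> A \<in> sets (F r)}
      \<subseteq> Pow ({0..} \<times> space M)"
    by (auto dest: subsetD)
qed

lemma predictable_section:
  assumes s: "0 \<le> s" and w: "w \<in> space M"
  shows "(\<lambda>r. (max 0 (min r s), w)) \<in> measurable borel \<P>"
proof -
  have "(\<lambda>(w, r). (max 0 (min r s), w)) \<in> measurable (M \<Otimes>\<^sub>M borel) \<P>"
    using s by (intro predictable_progressive sets_F_subset) auto
  from measurable_compose[OF measurable_Pair1'[OF w] this] show ?thesis by simp
qed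

text \<open>The Doleans measure of \<open>Z\<close> on \<open>(u, v]\<close>, with paths weighted by
  \<open>W\<close>. Clamping the time to \<open>[0, v]\<close> brings it into the space of the
  predictable sets and changes nothing on \<open>(u, v]\<close>.\<close>

definition weighted_measure :: "(real \<Rightarrow> 'a \<Rightarrow> real) \<Rightarrow> ('a \<Rightarrow> real) \<Rightarrow> real \<Rightarrow> real \<Rightarrow> (real \<times> 'a) measure" where
  "weighted_measure Z W u v =
    M \<bind> (\<lambda>w. distr (kernel Z W u v w) \<P> (\<lambda>r. (max 0 (min r v), w)))"

context
  fixes Z W u v
  assumes Z: "increasing_process Z" and W: "W \<in> borel_measurable M" "\<And>w. 0 \<le> W w" "\<And>w. W w * Z v w \<le> 1"
    and u: "0 \<le> u" "u \<le> v"
begin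

lemma weighted_kernel:
  "(\<lambda>w. distr (kernel Z W u v w) \<P> (\<lambda>r. (max 0 (min r v), w)))
    \<in> measurable M (subprob_algebra \<P>)"
proof (rule measurable_distr2[where M = borel])
  show "kernel Z W u v \<in> measurable M (subprob_algebra borel)"
    using u by (intro kernel_measurable[OF Z W] measurable_F_M[OF increasing_process_measurable[OF Z, of _ v]]) auto
  show "(\<lambda>(w, r). (max 0 (min r v), w)) \<in> measurable (M \<Otimes>\<^sub>M borel) \<P>"
    using u by (intro predictable_progressive sets_F_subset) auto
qed

lemma finite_weighted_measure: "finite_measure (weighted_measure Z W u v)"
  and sets_weighted_measure: "sets (weighted_measure Z W u v) = sets \<P>"
proof -
  have "subprob_space (weighted_measure Z W u v)"
    unfolding weighted_measure_def
    by (rule subprob_space_bind[OF _ weighted_kernel]) (rule prob_space_imp_subprob_space, rule prob_space_axioms)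
  then show "finite_measure (weighted_measure Z W u v)" by (simp add: subprob_space_def)
  show "sets (weighted_measure Z W u v) = sets \<P>"
    unfolding weighted_measure_def by (rule sets_bind_measurable[OF weighted_kernel not_empty])
qed

lemma nn_integral_weighted_measure:
  assumes g: "g \<in> borel_measurable \<P>"
  shows "(\<integral>\<^sup>+x. g x \<partial>weighted_measure Z W u v) =
    (\<integral>\<^sup>+w. ennreal (W w) * (\<integral>\<^sup>+r. g (r, w) * indicator {u<..v} r \<partial>interval_measure (\<lambda>t. Z t w)) \<partial>M)"
  unfolding weighted_measure_def nn_integral_bind[OF g weighted_kernel]
proof (rule nn_integral_cong)
  fix w assume w: "w \<in> space M"
  have v: "0 \<le> v" using u by simp
  have sk: "sets (kernel Z W u v w) = sets borel" by (simp add: kernel_def)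
  have m: "(\<lambda>r. (max 0 (min r v), w)) \<in> measurable (kernel Z W u v w) \<P>"
    unfolding measurable_cong_sets[OF sk refl] by (rule predictable_section[OF v w])
  have "(\<integral>\<^sup>+x. g x \<partial>distr (kernel Z W u v w) \<P> (\<lambda>r. (max 0 (min r v), w))) =
      (\<integral>\<^sup>+r. g (max 0 (min r v), w) \<partial>kernel Z W u v w)"
    by (rule nn_integral_distr[OF m]) (use g in simp)
  also have "\<dots> = ennreal (W w) * (\<integral>\<^sup>+r. g (max 0 (min r v), w) * indicator {u<..v} r \<partial>interval_measure (\<lambda>t. Z t w))"
    by (rule nn_integral_kernel[OF measurable_compose[OF predictable_section[OF v w] g]])
  also have "(\<integral>\<^sup>+r. g (max 0 (min r v), w) * indicator {u<..v} r \<partial>interval_measure (\<lambda>t. Z t w)) =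
      (\<integral>\<^sup>+r. g (r, w) * indicator {u<..v} r \<partial>interval_measure (\<lambda>t. Z t w))"
    using u by (intro nn_integral_cong) (auto simp: indicator_def max_def min_def)
  finally show "(\<integral>\<^sup>+x. g x \<partial>distr (kernel Z W u v w) \<P> (\<lambda>r. (max 0 (min r v), w))) =
      ennreal (W w) * (\<integral>\<^sup>+r. g (r, w) * indicator {u<..v} r \<partial>interval_measure (\<lambda>t. Z t w))" .
qed

end

end

text \<open>The set where the Radon-Nikodym derivative exceeds 1 is null by domination; truncating
  there gives the bounds at every point.\<close>

lemma dominated_density:
  assumes M: "finite_measure M" and N: "sets N = sets M"
    and le: "\<And>A. A \<in> sets M \<Longrightarrow> emeasure N A \<le> emeasure M A"
  shows "\<exists>\<theta> :: 'a \<Rightarrow> real. \<theta> \<in> borel_measurable M \<and> (\<forall>x. 0 \<le> \<theta> x \<and> \<theta> x \<le> 1) \<and>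
    (\<forall>A\<in>sets M. emeasure N A = (\<integral>\<^sup>+x. ennreal (\<theta> x) * indicator A x \<partial>M))"
proof -
  interpret M: finite_measure M by fact
  have "absolutely_continuous M N"
    unfolding absolutely_continuous_def using le N by (fastforce simp: null_sets_def)
  from M.Radon_Nikodym[OF this N] obtain f where f [measurable]: "f \<in> borel_measurable M" and fN: "density M f = N" by blast
  have Nf: "emeasure N A = (\<integral>\<^sup>+x. f x * indicator A x \<partial>M)" if "A \<in> sets M" for A
    unfolding fN[symmetric] by (rule emeasure_density[OF f that])
  define S where "S = {x \<in> space M. 1 < f x}"
  have S [measurable]: "S \<in> sets M" unfolding S_def by measurable
  have "(\<integral>\<^sup>+x. (f x - 1) * indicator S x \<partial>M) + emeasure M S = (\<integral>\<^sup>+x. (f x - 1) * indicator S x + indicator S x \<partial>M)"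
    by (subst nn_integral_add) auto
  also have "\<dots> = (\<integral>\<^sup>+x. f x * indicator S x \<partial>M)"
    by (intro nn_integral_cong) (auto simp: S_def indicator_def diff_add_cancel_ennreal)
  also have "\<dots> \<le> emeasure M S" using le[OF S] by (simp add: Nf)
  finally have "emeasure M S + (\<integral>\<^sup>+x. (f x - 1) * indicator S x \<partial>M) \<le> emeasure M S + 0" by (simp add: add.commute)
  then have "(\<integral>\<^sup>+x. (f x - 1) * indicator S x \<partial>M) \<le> 0"
    using M.emeasure_finite[of S] by (simp only: ennreal_add_left_cancel_le) simp
  then have "(\<integral>\<^sup>+x. (f x - 1) * indicator S x \<partial>M) = 0" by simp
  then have "AE x in M. (f x - 1) * indicator S x = 0" by (subst (asm) nn_integral_0_iff_AE) auto
  then have "AE x in M. ennreal (min 1 (enn2real (f x))) = f x"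
  proof (rule AE_mp[OF _ AE_I2], intro impI)
    fix x assume x: "x \<in> space M" "(f x - 1) * indicator S x = 0"
    have "f x \<le> 1"
    proof (rule ccontr)
      assume "\<not> f x \<le> 1"
      then have "x \<in> S" "1 < f x" using x by (auto simp: S_def)
      then show False using x(2) by (auto simp: diff_eq_0_iff_ennreal dest: leD)
    qed
    then have "enn2real (f x) \<le> 1" "f x < \<top>" by (auto intro: enn2real_leI le_less_trans)
    then show "ennreal (min 1 (enn2real (f x))) = f x" by (simp add: min_absorb2)
  qed
  then have eq: "(\<integral>\<^sup>+x. f x * indicator A x \<partial>M) = (\<integral>\<^sup>+x. ennreal (min 1 (enn2real (f x))) * indicator A x \<partial>M)" for A
    by (intro nn_integral_cong_AE) auto
  show ?thesis
    by (rule exI[of _ "\<lambda>x. min 1 (enn2real (f x))"]) (auto simp: Nf eq)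
qed

section \<open>Path integrals of bounded predictable processes\<close>

context usual_filtered_prob_space
begin

definition path_integral :: "(real \<Rightarrow> 'a \<Rightarrow> real) \<Rightarrow> (real \<Rightarrow> 'a \<Rightarrow> real) \<Rightarrow> real \<Rightarrow> real \<Rightarrow> 'a \<Rightarrow> real" where
  "path_integral \<theta> B s t w = (\<integral>r. indicator {s<..t} r * \<theta> r w \<partial>interval_measure (\<lambda>t. B t w))"

context
  fixes \<theta> B
  assumes \<theta>: "predictable M F \<theta>" "\<And>s w. 0 \<le> \<theta> s w" "\<And>s w. \<theta> s w \<le> 1"
    and B: "increasing_process B"
begin

lemma path_measurable:
  assumes "0 \<le> s" "w \<in> space M"
  shows "(\<lambda>r. indicator {s<..t} r * \<theta> r w) \<in> borel_measurable borel"
proof (cases "0 \<le> t")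
  case True
  have "(\<lambda>r. \<theta> (max 0 (min r t)) w) \<in> borel_measurable borel"
    using measurable_compose[OF predictable_section[OF True assms(2)] \<theta>(1)[unfolded predictable_def]] by simp
  then have "(\<lambda>r. indicator {s<..t} r * \<theta> (max 0 (min r t)) w) \<in> borel_measurable borel" by measurable
  moreover have "indicator {s<..t} r * \<theta> (max 0 (min r t)) w = indicator {s<..t} r * \<theta> r w" for r
    using assms(1) by (auto simp: indicator_def)
  ultimately show ?thesis by simp
next
  case False
  then have e: "{s<..t} = {}" using assms(1) by auto
  show ?thesis unfolding e by simp
qed

lemma path_integrable:
  assumes "0 \<le> s" "w \<in> space M"
  shows "integrable (interval_measure (\<lambda>t. B t w)) (\<lambda>r. indicator {s<..t} r * \<theta> r w)"
proof (rule integrable_Ioc_bounded(1)[where a = s and b = t,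
      OF increasing_processD(2)[OF B] increasing_processD(4)[OF B] path_measurable[OF assms]])
  show "\<bar>indicator {s<..t} r * \<theta> r w\<bar> \<le> indicator {s<..t} r" for r
    using \<theta>(2,3)[of r w] by (auto simp: indicator_def)
qed

lemma path_integral_add:
  assumes "0 \<le> r" "r \<le> s" "s \<le> t" "w \<in> space M"
  shows "path_integral \<theta> B r t w = path_integral \<theta> B r s w + path_integral \<theta> B s t w"
proof -
  have "indicator {r<..t} q * \<theta> q w = indicator {r<..s} q * \<theta> q w + indicator {s<..t} q * \<theta> q w" for q
    using assms by (auto simp: indicator_def)
  then show ?thesis
    unfolding path_integral_def using assms by (simp add: path_integrable)
qed

lemma path_integral_nn:
  assumes "0 \<le> s" "w \<in> space M"
  shows "ennreal (path_integral \<theta> B s t w) =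
    (\<integral>\<^sup>+r. ennreal (\<theta> r w) * indicator {s<..t} r \<partial>interval_measure (\<lambda>t. B t w))"
proof -
  have "ennreal (path_integral \<theta> B s t w) = (\<integral>\<^sup>+r. ennreal (indicator {s<..t} r * \<theta> r w) \<partial>interval_measure (\<lambda>t. B t w))"
    unfolding path_integral_def using \<theta>(2) by (intro nn_integral_eq_integral[symmetric] path_integrable assms) auto
  also have "\<dots> = (\<integral>\<^sup>+r. ennreal (\<theta> r w) * indicator {s<..t} r \<partial>interval_measure (\<lambda>t. B t w))"
    by (intro nn_integral_cong) (auto simp: indicator_def)
  finally show ?thesis .
qed

lemma path_integral_bounds:
  assumes "0 \<le> s" "s \<le> t" "w \<in> space M"
  shows "0 \<le> path_integral \<theta> B s t w" "path_integral \<theta> B s t w \<le> B t w - B s w"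
proof -
  show "0 \<le> path_integral \<theta> B s t w"
    unfolding path_integral_def using \<theta>(2) by (intro Bochner_Integration.integral_nonneg) simp
  have "path_integral \<theta> B s t w \<le> (\<integral>r. indicator {s<..t} r \<partial>interval_measure (\<lambda>t. B t w))"
    unfolding path_integral_def
    using \<theta>(3) by (intro integral_mono path_integrable assms
        integrable_Ioc_bounded(2)[OF increasing_processD(2)[OF B] increasing_processD(4)[OF B], of "\<lambda>_. 0"])
      (auto simp: indicator_def)
  also have "\<dots> = B t w - B s w"
    using measure_interval_measure_Ioc[OF assms(2) increasing_processD(2)[OF B] increasing_processD(4)[OF B]] by simp
  finally show "path_integral \<theta> B s t w \<le> B t w - B s w" .
qed

text \<open>Up to time \<open>s\<close> both the integrand with clamped time and the kernel of
  \<open>B\<close> are measurable with respect to \<open>F s\<close>. The normalization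
  \<open>1 / (1 + B s w)\<close>, introduced to obtain a sub-probability kernel, is multiplied back
  at the end.\<close>

lemma path_integral_measurable:
  assumes u: "0 \<le> u" "u \<le> s"
  shows "path_integral \<theta> B u s \<in> borel_measurable (F s)"
proof -
  define W where "W w = 1 / (1 + B s w)" for w
  have s: "0 \<le> s" using u by simp
  note Bs = increasing_process_measurable[OF B _ s]
  have B0: "0 \<le> B s w" for w by (rule increasing_processD(6)[OF B])
  have W0: "0 < 1 + B s w" for w using B0[of w] by simp
  have W: "W \<in> borel_measurable (F s)" "0 \<le> W w" "W w * B s w \<le> 1" for w
    using Bs[OF order_refl] W0[of w] B0[of w] unfolding W_def[abs_def] by (auto simp: divide_simps)
  have k: "kernel B W u s \<in> measurable (F s) (subprob_algebra borel)"
    by (rule kernel_measurable[OF B W u Bs])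
  have "(\<lambda>(w, r). ennreal (\<theta> (max 0 (min r s)) w)) \<in> borel_measurable (F s \<Otimes>\<^sub>M borel)"
  proof -
    have "(\<lambda>(w, r). (max 0 (min r s), w)) \<in> measurable (F s \<Otimes>\<^sub>M borel) \<P>"
      by (rule predictable_progressive[OF space_F sets_F_mono s])
    from measurable_compose[OF this \<theta>(1)[unfolded predictable_def]]
    have "(\<lambda>(w, r). \<theta> (max 0 (min r s)) w) \<in> borel_measurable (F s \<Otimes>\<^sub>M borel)" by (simp add: split_def)
    then show ?thesis by (simp add: split_def)
  qed
  from nn_integral_measurable_subprob_algebra2[OF this k]
  have "(\<lambda>w. enn2real (\<integral>\<^sup>+r. ennreal (\<theta> (max 0 (min r s)) w) \<partial>kernel B W u s w)) \<in> borel_measurable (F s)" by simp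
  then have "(\<lambda>w. enn2real (\<integral>\<^sup>+r. ennreal (\<theta> (max 0 (min r s)) w) \<partial>kernel B W u s w) * (1 + B s w)) \<in> borel_measurable (F s)"
    using Bs[OF order_refl] by measurable
  moreover have "enn2real (\<integral>\<^sup>+r. ennreal (\<theta> (max 0 (min r s)) w) \<partial>kernel B W u s w) * (1 + B s w) = path_integral \<theta> B u s w"
    if w: "w \<in> space (F s)" for w
  proof -
    have w': "w \<in> space M" using w by (simp add: space_F)
    have "(\<lambda>r. ennreal (\<theta> (max 0 (min r s)) w)) \<in> borel_measurable borel"
      using measurable_compose[OF predictable_section[OF s w'] \<theta>(1)[unfolded predictable_def]] by simp
    from nn_integral_kernel[OF this]
    have "(\<integral>\<^sup>+r. ennreal (\<theta> (max 0 (min r s)) w) \<partial>kernel B W u s w) =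
      ennreal (W w) * (\<integral>\<^sup>+r. ennreal (\<theta> (max 0 (min r s)) w) * indicator {u<..s} r \<partial>interval_measure (\<lambda>t. B t w))" .
    also have "(\<integral>\<^sup>+r. ennreal (\<theta> (max 0 (min r s)) w) * indicator {u<..s} r \<partial>interval_measure (\<lambda>t. B t w)) =
        (\<integral>\<^sup>+r. ennreal (\<theta> r w) * indicator {u<..s} r \<partial>interval_measure (\<lambda>t. B t w))"
      using u by (intro nn_integral_cong) (auto simp: indicator_def)
    also have "\<dots> = ennreal (path_integral \<theta> B u s w)" by (rule path_integral_nn[OF u(1) w', symmetric])
    finally have "enn2real (\<integral>\<^sup>+r. ennreal (\<theta> (max 0 (min r s)) w) \<partial>kernel B W u s w) = W w * path_integral \<theta> B u s w"
      using W(2)[of w] path_integral_bounds(1)[OF u w'] by (simp add: ennreal_mult[symmetric])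
    then show ?thesis using W0[of w] by (simp add: W_def)
  qed
  ultimately show ?thesis by (subst measurable_cong[symmetric]) auto
qed

end

end

text \<open>The sum of squares is at most the largest increment times the total one, and uniform
  continuity makes the largest increment small.\<close>

lemma grid_quadratic_variation:
  fixes f :: "real \<Rightarrow> real"
  assumes ab: "a < b" and mono: "\<And>x y. x \<le> y \<Longrightarrow> f x \<le> f y" and cont: "\<And>x. isCont f x"
  shows "(\<lambda>n. \<Sum>k<2 ^ n. (f (grid a b n (Suc k)) - f (grid a b n k))\<^sup>2) \<longlonglongrightarrow> 0"
proof (rule LIMSEQ_I)
  fix e :: real assume e: "0 < e"
  define c where "c = e / (f b - f a + 1)"
  have fab: "f a \<le> f b" using ab by (intro mono) simp
  then have c: "0 < c" using e by (simp add: c_def add_nonneg_pos)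
  have "uniformly_continuous_on {a..b} f"
    using cont by (intro compact_uniformly_continuous continuous_at_imp_continuous_on) auto
  then obtain d where d: "0 < d" "\<And>x y. x \<in> {a..b} \<Longrightarrow> y \<in> {a..b} \<Longrightarrow> dist y x < d \<Longrightarrow> dist (f y) (f x) < c"
    using c unfolding uniformly_continuous_on_def by metis
  obtain n0 where n0: "(b - a) / d < 2 ^ n0" using real_arch_pow[of 2 "(b - a) / d"] by auto
  show "\<exists>n0. \<forall>n\<ge>n0. norm ((\<Sum>k<2 ^ n. (f (grid a b n (Suc k)) - f (grid a b n k))\<^sup>2) - 0) < e"
  proof (intro exI allI impI)
    fix n assume "n0 \<le> n"
    then have "(2 :: real) ^ n0 \<le> 2 ^ n" by (intro power_increasing) auto
    then have "(b - a) / d < 2 ^ n" using n0 by linarith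
    then have gap: "(b - a) / 2 ^ n < d" using d(1) by (simp add: field_simps)
    let ?D = "\<lambda>k. f (grid a b n (Suc k)) - f (grid a b n k)"
    have D0: "0 \<le> ?D k" for k using mono[OF monoD[OF grid_mono[OF ab], of k "Suc k" n]] by simp
    have "(?D k)\<^sup>2 \<le> c * ?D k" if "k < 2 ^ n" for k
    proof -
      have "dist (f (grid a b n (Suc k))) (f (grid a b n k)) < c"
      proof (rule d(2))
        show "dist (grid a b n (Suc k)) (grid a b n k) < d"
          using ab gap grid_Suc[OF ab that] by (simp add: dist_real_def)
      qed (simp_all add: grid_ge[OF ab] grid_le[OF ab])
      then have "?D k \<le> c" using D0[of k] by (simp add: dist_real_def)
      then show ?thesis using D0[of k] by (simp add: power2_eq_square mult_right_mono)
    qed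
    then have "(\<Sum>k<2 ^ n. (?D k)\<^sup>2) \<le> (\<Sum>k<2 ^ n. c * ?D k)" by (intro sum_mono) simp
    also have "\<dots> = c * (f b - f a)"
      using sum_lessThan_telescope[of "\<lambda>k. f (grid a b n k)" "2 ^ n"]
      by (simp add: sum_distrib_left[symmetric] grid_last)
    also have "\<dots> < c * (f b - f a + 1)" using c by simp
    also have "\<dots> = e" using fab by (simp add: c_def)
    finally have "(\<Sum>k<2 ^ n. (?D k)\<^sup>2) < e" .
    moreover have "0 \<le> (\<Sum>k<2 ^ n. (?D k)\<^sup>2)" by (intro sum_nonneg) simp
    ultimately show "norm ((\<Sum>k<2 ^ n. (?D k)\<^sup>2) - 0) < e" by simp
  qed
qed

section \<open>Existence of the predictable density\<close>

context usual_filtered_prob_space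
begin

text \<open>The assumption says that the conditional expectation of \<open>D\<close> given
  \<open>F s\<close> is 0, so orthogonality extends from indicators to factors that may be
  unbounded.\<close>

lemma orthogonal_increment:
  fixes D \<phi> :: "'a \<Rightarrow> real"
  assumes D: "integrable M D" and zero: "\<And>C. C \<in> sets (F s) \<Longrightarrow> (\<integral>w. indicator C w * D w \<partial>M) = 0"
    and \<phi>: "\<phi> \<in> borel_measurable (F s)" "integrable M (\<lambda>w. \<phi> w * D w)"
  shows "(\<integral>w. \<phi> w * D w \<partial>M) = (0 :: real)"
proof -
  interpret sub: finite_measure_subalgebra M "F s"
    by unfold_locales (rule subalgebra_F)
  have AE: "AE w in M. real_cond_exp M (F s) D w = 0"
    using D zero by (intro sub.real_cond_exp_charact) (auto simp: set_lebesgue_integral_def)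
  have "(\<integral>w. \<phi> w * D w \<partial>M) = (\<integral>w. \<phi> w * real_cond_exp M (F s) D w \<partial>M)"
    using \<phi> D by (intro sub.real_cond_exp_intg(2)[symmetric]) auto
  also have "\<dots> = (\<integral>w. 0 \<partial>M)"
    using AE measurable_F_M[OF \<phi>(1)] by (intro integral_cong_AE) auto
  finally show ?thesis by simp
qed

text \<open>Once the probability is weighted by \<open>W\<close>, the process \<open>N\<close> is a
  martingale starting at 0, so its second moment is the sum of those of its increments. The two
  bounds on \<open>W\<close> make every product integrable although \<open>B\<close> may have no
  moments.\<close>

lemma vanishing_increments:
  fixes B N :: "real \<Rightarrow> 'a \<Rightarrow> real" and W :: "'a \<Rightarrow> real"
  assumes B: "increasing_process B" and ut: "0 \<le> u" "u < t"
    and N: "\<And>s. u \<le> s \<Longrightarrow> s \<le> t \<Longrightarrow> N s \<in> borel_measurable (F s)" "\<And>w. w \<in> space M \<Longrightarrow> N u w = 0"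
      "\<And>r s w. u \<le> r \<Longrightarrow> r \<le> s \<Longrightarrow> s \<le> t \<Longrightarrow> w \<in> space M \<Longrightarrow> \<bar>N s w - N r w\<bar> \<le> B s w - B r w"
    and W: "W \<in> borel_measurable M" "\<And>w. 0 < W w" "\<And>w. W w * B t w \<le> 1" "\<And>w. W w * (B t w)\<^sup>2 \<le> 1"
    and zero: "\<And>r s C. u \<le> r \<Longrightarrow> r \<le> s \<Longrightarrow> s \<le> t \<Longrightarrow> C \<in> sets (F r) \<Longrightarrow>
      (\<integral>w. indicator C w * (W w * (N s w - N r w)) \<partial>M) = 0"
  shows "AE w in M. N t w = 0"
proof -
  note B' = increasing_processD[OF B]
  let ?g = "grid u t"
  have g: "u \<le> ?g n k" "?g n k \<le> t" "?g n k \<le> ?g n (Suc k)" for n k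
    using grid_ge[OF ut(2)] grid_le[OF ut(2)] monoD[OF grid_mono[OF ut(2)], of k "Suc k" n] by auto
  have Nm: "N (?g n k) \<in> borel_measurable M" for n k by (rule measurable_F_M[OF N(1)[OF g(1,2)]])
  have Bm: "B s \<in> borel_measurable M" if "s \<le> t" for s
    using ut that by (intro measurable_F_M[OF increasing_process_measurable[OF B, of s t]]) auto
  have Nb: "\<bar>N s w\<bar> \<le> B t w" if "u \<le> s" "s \<le> t" "w \<in> space M" for s w
    using N(3)[of u s w] N(2)[of w] that B'(2)[of s t w] B'(6)[of u w] by simp
  have Db: "\<bar>N (?g n (Suc k)) w - N (?g n k) w\<bar> \<le> B (?g n (Suc k)) w - B (?g n k) w"
    if "w \<in> space M" for n k w using g that by (intro N(3)) auto
  have DB: "B (?g n (Suc k)) w - B (?g n k) w \<le> B t w" "0 \<le> B (?g n (Suc k)) w - B (?g n k) w" for n k w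
    using B'(2)[OF g(2)[of n "Suc k"], of w] B'(6)[of "?g n k" w] B'(2)[OF g(3)[of n k], of w] by simp_all
  define D where "D n k w = N (?g n (Suc k)) w - N (?g n k) w" for n k w
  define E where "E n k w = B (?g n (Suc k)) w - B (?g n k) w" for n k w
  have DE: "\<bar>D n k w\<bar> \<le> E n k w" if "w \<in> space M" for n k w using Db[OF that] by (simp add: D_def E_def)
  have E: "0 \<le> E n k w" "E n k w \<le> B t w" for n k w using DB by (simp_all add: E_def)
  have Dm [measurable]: "D n k \<in> borel_measurable M" for n k
    unfolding D_def[abs_def] by (intro borel_measurable_diff Nm)
  have Em [measurable]: "E n k \<in> borel_measurable M" for n k
    unfolding E_def[abs_def] by (intro borel_measurable_diff Bm g)
  note Nm [measurable] and W(1) [measurable]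
  have WB: "W w * x \<le> 1" if "x \<le> (B t w)\<^sup>2" for x w
    using mult_left_mono[OF that less_imp_le[OF W(2)], of w] W(4)[of w] by linarith
  have bounded: "integrable M h" if "h \<in> borel_measurable M" "\<And>w. w \<in> space M \<Longrightarrow> \<bar>h w\<bar> \<le> 1" for h :: "'a \<Rightarrow> real"
    using that by (intro integrable_const_bound[of _ 1]) (auto intro!: AE_I2)
  have iD: "integrable M (\<lambda>w. W w * D n k w)" for n k
  proof (rule bounded)
    fix w assume w: "w \<in> space M"
    have "\<bar>W w * D n k w\<bar> \<le> W w * B t w"
      using order_trans[OF DE[OF w] E(2)] W(2)[of w] by (simp add: abs_mult)
    then show "\<bar>W w * D n k w\<bar> \<le> 1" using W(3)[of w] by linarith
  qed measurable
  have iND: "integrable M (\<lambda>w. N (?g n k) w * (W w * D n k w))" for n k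
  proof (rule bounded)
    fix w assume w: "w \<in> space M"
    have "\<bar>N (?g n k) w\<bar> * \<bar>D n k w\<bar> \<le> B t w * B t w"
      by (intro mult_mono Nb g w order_trans[OF DE[OF w] E(2)] B'(6)) simp
    then have "W w * (\<bar>N (?g n k) w\<bar> * \<bar>D n k w\<bar>) \<le> 1" by (intro WB) (simp add: power2_eq_square)
    then show "\<bar>N (?g n k) w * (W w * D n k w)\<bar> \<le> 1" using W(2)[of w] by (simp add: abs_mult ac_simps)
  qed measurable
  have orth: "(\<integral>w. N (?g n k) w * (W w * D n k w) \<partial>M) = 0" for n k
    by (rule orthogonal_increment[OF iD _ N(1)[OF g(1,2)] iND]) (unfold D_def, rule zero[OF g(1,3,2)])
  define Q where "Q n w = (\<Sum>k<2 ^ n. (E n k w)\<^sup>2)" for n w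
  have Q: "Q n w \<le> (B t w)\<^sup>2" "0 \<le> Q n w" for n w
  proof -
    have "Q n w \<le> (\<Sum>k<2 ^ n. B t w * E n k w)"
      unfolding Q_def power2_eq_square by (intro sum_mono mult_right_mono E)
    also have "\<dots> = B t w * (B t w - B u w)"
      using sum_lessThan_telescope[of "\<lambda>k. B (?g n k) w" "2 ^ n"]
      by (simp add: sum_distrib_left[symmetric] grid_last E_def)
    also have "\<dots> \<le> (B t w)\<^sup>2" using B'(6)[of t w] B'(6)[of u w] by (simp add: power2_eq_square mult_left_mono)
    finally show "Q n w \<le> (B t w)\<^sup>2" .
    show "0 \<le> Q n w" unfolding Q_def by (intro sum_nonneg) simp
  qed
  have Qm [measurable]: "Q n \<in> borel_measurable M" for n unfolding Q_def[abs_def] by measurable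
  have WQ: "\<bar>W w * Q n w\<bar> \<le> 1" for n w using WB[OF Q(1)] Q(2)[of n w] W(2)[of w] by (simp add: abs_mult)
  have iQ: "integrable M (\<lambda>w. W w * Q n w)" for n by (rule bounded[OF _ WQ]) measurable
  have iN2: "integrable M (\<lambda>w. W w * (N t w)\<^sup>2)"
  proof (rule bounded)
    have "N t \<in> borel_measurable M" using Nm[of 0 "2 ^ 0"] by (simp add: grid_last[of u t 0, simplified])
    then show "(\<lambda>w. W w * (N t w)\<^sup>2) \<in> borel_measurable M" by measurable
    fix w assume "w \<in> space M"
    then have "(N t w)\<^sup>2 \<le> (B t w)\<^sup>2" using Nb[of t w] ut by (simp add: abs_le_square_iff[symmetric] abs_of_nonneg[OF B'(6)])
    then show "\<bar>W w * (N t w)\<^sup>2\<bar> \<le> 1" using WB W(2)[of w] by (simp add: abs_mult)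
  qed
  \<comment> \<open>Expanding the square along the grid leaves squared increments, dominated by
    those of \<open>B\<close>, and cross terms whose weighted mean is 0 by
    \<open>orth\<close>.\<close>
  have le: "(\<integral>w. W w * (N t w)\<^sup>2 \<partial>M) \<le> (\<integral>w. W w * Q n w \<partial>M)" for n
  proof -
    have "(\<integral>w. W w * (N t w)\<^sup>2 \<partial>M) \<le> (\<integral>w. W w * Q n w + (\<Sum>k<2 ^ n. 2 * (N (?g n k) w * (W w * D n k w))) \<partial>M)"
    proof (rule integral_mono[OF iN2])
      show "integrable M (\<lambda>w. W w * Q n w + (\<Sum>k<2 ^ n. 2 * (N (?g n k) w * (W w * D n k w))))"
        by (intro Bochner_Integration.integrable_add iQ Bochner_Integration.integrable_sum integrable_mult_right iND)
      fix w assume w: "w \<in> space M"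
      have "(N t w)\<^sup>2 = (\<Sum>k<2 ^ n. (N (?g n (Suc k)) w)\<^sup>2 - (N (?g n k) w)\<^sup>2)"
        using sum_lessThan_telescope[of "\<lambda>k. (N (?g n k) w)\<^sup>2" "2 ^ n"] N(2)[OF w] by (simp add: grid_last)
      also have "\<dots> = (\<Sum>k<2 ^ n. (D n k w)\<^sup>2 + 2 * (N (?g n k) w * D n k w))"
        by (intro sum.cong refl) (simp add: D_def power2_eq_square algebra_simps)
      also have "\<dots> \<le> (\<Sum>k<2 ^ n. (E n k w)\<^sup>2 + 2 * (N (?g n k) w * D n k w))"
        using DE[OF w] E(1) by (intro sum_mono add_right_mono) (simp add: abs_le_square_iff[symmetric])
      also have "\<dots> = Q n w + (\<Sum>k<2 ^ n. 2 * (N (?g n k) w * D n k w))"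
        by (simp add: Q_def sum.distrib)
      finally have "W w * (N t w)\<^sup>2 \<le> W w * (Q n w + (\<Sum>k<2 ^ n. 2 * (N (?g n k) w * D n k w)))"
        using W(2)[of w] by (intro mult_left_mono) auto
      then show "W w * (N t w)\<^sup>2 \<le> W w * Q n w + (\<Sum>k<2 ^ n. 2 * (N (?g n k) w * (W w * D n k w)))"
        by (simp add: distrib_left sum_distrib_left ac_simps)
    qed
    also have "\<dots> = (\<integral>w. W w * Q n w \<partial>M) + (\<Sum>k<2 ^ n. 2 * (\<integral>w. N (?g n k) w * (W w * D n k w) \<partial>M))"
      using iQ iND by (subst Bochner_Integration.integral_add) (auto simp: Bochner_Integration.integral_sum)
    finally show ?thesis by (simp add: orth)
  qed
  have "(\<lambda>n. \<integral>w. W w * Q n w \<partial>M) \<longlonglongrightarrow> (\<integral>w. 0 \<partial>M)"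
  proof (rule integral_dominated_convergence[where w = "\<lambda>_. 1"])
    show "AE w in M. (\<lambda>n. W w * Q n w) \<longlonglongrightarrow> 0"
      unfolding Q_def E_def by (intro AE_I2 tendsto_mult_right_zero grid_quadratic_variation[OF ut(2) B'(2,3)])
    show "AE w in M. norm (W w * Q n w) \<le> 1" for n using WQ by (intro AE_I2) simp
  qed simp_all
  then have "(\<integral>w. W w * (N t w)\<^sup>2 \<partial>M) \<le> 0"
    by (intro LIMSEQ_le_const[of _ 0]) (use le in auto)
  moreover have nn: "AE w in M. 0 \<le> W w * (N t w)\<^sup>2" using W(2) by (intro AE_I2 mult_nonneg_nonneg) (auto intro: less_imp_le)
  ultimately have "(\<integral>w. W w * (N t w)\<^sup>2 \<partial>M) = 0" by (intro antisym integral_nonneg_AE)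
  then have "AE w in M. W w * (N t w)\<^sup>2 = 0" by (rule integral_nonneg_eq_0_iff_AE[OF iN2 nn, THEN iffD1])
  then show ?thesis using W(2) by (auto elim!: eventually_mono simp: less_imp_neq[symmetric])
qed

context
  fixes A B :: "real \<Rightarrow> 'a \<Rightarrow> real"
  assumes A: "increasing_process A" and B: "increasing_process B"
    and dom: "\<And>w E. E \<in> sets borel \<Longrightarrow>
      emeasure (interval_measure (\<lambda>t. A t w)) E \<le> emeasure (interval_measure (\<lambda>t. B t w)) E"
begin

lemma increment_le:
  assumes "s \<le> t" shows "A t w - A s w \<le> B t w - B s w"
  using dom[of "{s<..t}" w] increasing_processD(2)[OF B assms, of w]
  by (simp add: emeasure_increasing[OF A assms] emeasure_increasing[OF B assms])

text \<open>With the same weight, the predictable measure of \<open>A\<close> lies below that of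
  \<open>B\<close>, so a density with values in \<open>[0, 1]\<close> exists; it is tested on
  rectangles \<open>{r<..s} \<times> C\<close>.\<close>

lemma weighted_density:
  assumes uv: "0 \<le> u" "u \<le> v" and W: "W \<in> borel_measurable M" "\<And>w. 0 \<le> W w" "\<And>w. W w * B v w \<le> 1"
  obtains \<theta> where "predictable M F \<theta>" "\<And>s w. 0 \<le> \<theta> s w" "\<And>s w. \<theta> s w \<le> 1"
    "\<And>r s C. u \<le> r \<Longrightarrow> r \<le> s \<Longrightarrow> s \<le> v \<Longrightarrow> C \<in> sets (F r) \<Longrightarrow>
      (\<integral>\<^sup>+w. ennreal (indicator C w * (W w * (A s w - A r w))) \<partial>M) =
      (\<integral>\<^sup>+w. ennreal (indicator C w * (W w * path_integral \<theta> B r s w)) \<partial>M)"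
proof -
  have v: "0 \<le> v" using uv by simp
  have "A v w \<le> B v w" for w
    using increment_le[OF v, of w] increasing_processD(5)[OF A, of 0 w] increasing_processD(5)[OF B, of 0 w] by simp
  then have WA: "W w * A v w \<le> 1" for w using mult_left_mono[OF _ W(2)] W(3) order_trans by blast
  let ?P = "\<P>"
  let ?\<nu>A = "weighted_measure A W u v" and ?\<nu>B = "weighted_measure B W u v"
  note nA = nn_integral_weighted_measure[OF A W(1,2) WA uv] and nB = nn_integral_weighted_measure[OF B W uv]
  note sA = sets_weighted_measure[OF A W(1,2) WA uv] and sB = sets_weighted_measure[OF B W uv]
  have le: "emeasure ?\<nu>A G \<le> emeasure ?\<nu>B G" if G: "G \<in> sets ?\<nu>B" for G
  proof -
    have G': "G \<in> sets ?P" using G sB by simp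
    then have Gi: "indicator G \<in> borel_measurable ?P" by simp
    have "emeasure ?\<nu>A G = (\<integral>\<^sup>+x. indicator G x \<partial>?\<nu>A)" using G' sA by simp
    also have "\<dots> \<le> (\<integral>\<^sup>+x. indicator G x \<partial>?\<nu>B)"
      unfolding nA[OF Gi] nB[OF Gi]
    proof (intro nn_integral_mono mult_left_mono)
      fix w assume w: "w \<in> space M"
      define S where "S = {u<..v} \<inter> (\<lambda>r. (max 0 (min r v), w)) -` G"
      have S: "S \<in> sets borel"
        unfolding S_def using measurable_sets_borel[OF predictable_section[OF v w] G'] by simp
      have eq: "indicator G (r, w) * indicator {u<..v} r = (indicator S r :: ennreal)" for r
        using uv by (auto simp: S_def indicator_def)
      show "(\<integral>\<^sup>+r. indicator G (r, w) * indicator {u<..v} r \<partial>interval_measure (\<lambda>t. A t w)) \<le>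
          (\<integral>\<^sup>+r. indicator G (r, w) * indicator {u<..v} r \<partial>interval_measure (\<lambda>t. B t w))"
        unfolding eq using dom[OF S, of w] S by simp
    qed simp
    also have "\<dots> = emeasure ?\<nu>B G" using G by simp
    finally show ?thesis .
  qed
  from sA sB have "sets ?\<nu>A = sets ?\<nu>B" by simp
  then obtain \<theta> :: "real \<times> 'a \<Rightarrow> real" where \<theta>: "\<theta> \<in> borel_measurable ?\<nu>B" "\<And>x. 0 \<le> \<theta> x" "\<And>x. \<theta> x \<le> 1"
    "\<And>G. G \<in> sets ?\<nu>B \<Longrightarrow> emeasure ?\<nu>A G = (\<integral>\<^sup>+x. ennreal (\<theta> x) * indicator G x \<partial>?\<nu>B)"
    using dominated_density[OF finite_weighted_measure[OF B W uv] _ le] by blast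
  have \<theta>P: "\<theta> \<in> borel_measurable ?P" using \<theta>(1) measurable_cong_sets[OF sB refl] by blast
  have pred: "predictable M F (\<lambda>s w. \<theta> (s, w))" using \<theta>P by (simp add: predictable_def)
  show ?thesis
  proof (rule that[OF pred \<theta>(2,3)])
    fix r s C assume rs: "u \<le> r" "r \<le> s" "s \<le> v" and C: "C \<in> sets (F r)"
    have r0: "0 \<le> r" using uv rs by simp
    define G where "G = {r<..s} \<times> C"
    have G: "G \<in> sets ?P" unfolding G_def by (rule predictable_rectangle(2)[OF r0 C])
    then have Gi: "indicator G \<in> borel_measurable ?P" by simp
    have ind: "indicator G (q, w) * indicator {u<..v} q = (indicator C w * indicator {r<..s} q :: ennreal)" for q w
      using rs by (auto simp: G_def indicator_def)
    have iC: "ennreal (indicator C w) = indicator C w" for w by (auto simp: indicator_def)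
    have "(\<integral>\<^sup>+w. ennreal (indicator C w * (W w * (A s w - A r w))) \<partial>M) = (\<integral>\<^sup>+x. indicator G x \<partial>?\<nu>A)"
      unfolding nA[OF Gi] ind
    proof (rule nn_integral_cong)
      fix w
      have "(\<integral>\<^sup>+q. indicator C w * indicator {r<..s} q \<partial>interval_measure (\<lambda>t. A t w)) = indicator C w * ennreal (A s w - A r w)"
        by (simp add: nn_integral_cmult_indicator emeasure_increasing[OF A rs(2)])
      then show "ennreal (indicator C w * (W w * (A s w - A r w))) =
          ennreal (W w) * (\<integral>\<^sup>+q. indicator C w * indicator {r<..s} q \<partial>interval_measure (\<lambda>t. A t w))"
        using W(2)[of w] increasing_processD(2)[OF A rs(2), of w] by (simp add: ennreal_mult iC ac_simps)
    qed
    also have "\<dots> = (\<integral>\<^sup>+x. ennreal (\<theta> x) * indicator G x \<partial>?\<nu>B)" using \<theta>(4)[of G] G sA sB by simp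
    also have "\<dots> = (\<integral>\<^sup>+w. ennreal (W w) * (\<integral>\<^sup>+q. ennreal (\<theta> (q, w)) * indicator G (q, w) * indicator {u<..v} q
        \<partial>interval_measure (\<lambda>t. B t w)) \<partial>M)"
      using \<theta>P Gi by (intro nB) measurable
    also have "\<dots> = (\<integral>\<^sup>+w. ennreal (indicator C w * (W w * path_integral (\<lambda>s w. \<theta> (s, w)) B r s w)) \<partial>M)"
    proof (rule nn_integral_cong)
      fix w assume w: "w \<in> space M"
      have "(\<integral>\<^sup>+q. ennreal (\<theta> (q, w)) * indicator G (q, w) * indicator {u<..v} q \<partial>interval_measure (\<lambda>t. B t w)) =
          indicator C w * ennreal (path_integral (\<lambda>s w. \<theta> (s, w)) B r s w)"
        unfolding mult.assoc ind path_integral_nn[OF pred \<theta>(2,3) B r0 w]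
        by (cases "w \<in> C") simp_all
      then show "ennreal (W w) * (\<integral>\<^sup>+q. ennreal (\<theta> (q, w)) * indicator G (q, w) * indicator {u<..v} q
          \<partial>interval_measure (\<lambda>t. B t w)) = ennreal (indicator C w * (W w * path_integral (\<lambda>s w. \<theta> (s, w)) B r s w))"
        using W(2)[of w] path_integral_bounds(1)[OF pred \<theta>(2,3) B r0 rs(2) w]
        by (simp add: ennreal_mult iC ac_simps)
    qed
    finally show "(\<integral>\<^sup>+w. ennreal (indicator C w * (W w * (A s w - A r w))) \<partial>M) =
        (\<integral>\<^sup>+w. ennreal (indicator C w * (W w * path_integral (\<lambda>s w. \<theta> (s, w)) B r s w)) \<partial>M)" .
  qed
qed

text \<open>On a bounded block one weight, built from the value of \<open>B\<close> at the right
  end, serves all times. The weight is not known at earlier times, which does no harm because the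
  density was taken with the same weight.\<close>

lemma block_density:
  assumes uv: "0 \<le> u" "u < v"
  shows "\<exists>\<theta>. predictable M F \<theta> \<and> (\<forall>s w. 0 \<le> \<theta> s w \<and> \<theta> s w \<le> 1) \<and>
    (AE w in M. \<forall>t\<in>{u..v}. A t w - A u w = path_integral \<theta> B u t w)"
proof -
  note A' = increasing_processD[OF A] and B' = increasing_processD[OF B]
  \<comment> \<open>The square in the denominator is what bounds \<open>W * B\<^sup>2\<close>; it
    bounds \<open>W * B\<close> as well.\<close>
  define W where "W w = 1 / (1 + B v w)\<^sup>2" for w
  have uv': "u \<le> v" "0 \<le> v" using uv by auto
  have m: "A s \<in> borel_measurable M" "B s \<in> borel_measurable M" if "s \<le> v" for s
    by (rule measurable_F_M[OF increasing_process_measurable[OF A that uv'(2)]]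
        measurable_F_M[OF increasing_process_measurable[OF B that uv'(2)]])+
  have W: "W \<in> borel_measurable M" unfolding W_def[abs_def] using m(2)[of v] by measurable
  have W0: "0 < W w" for w using B'(6)[of v w] by (simp add: W_def add_nonneg_pos)
  have Wb: "W w * x \<le> 1" if "x \<le> (1 + B v w)\<^sup>2" for x w
    using that B'(6)[of v w] by (simp add: W_def divide_le_eq add_nonneg_pos)
  have sq: "x \<le> (1 + x)\<^sup>2" "x\<^sup>2 \<le> (1 + x)\<^sup>2" if "0 \<le> x" for x :: real
    using that by (simp_all add: power2_eq_square algebra_simps)
  have W1: "W w * B t w \<le> 1" "W w * (B t w)\<^sup>2 \<le> 1" if "t \<le> v" for t w
  proof -
    show "W w * B t w \<le> 1" using order_trans[OF B'(2)[OF that] sq(1)[OF B'(6)]] by (rule Wb)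
    have "(B t w)\<^sup>2 \<le> (B v w)\<^sup>2" by (intro power_mono B'(2,6) that)
    from order_trans[OF this sq(2)[OF B'(6)]] show "W w * (B t w)\<^sup>2 \<le> 1" by (rule Wb)
  qed
  obtain \<theta> where
    \<theta>: "predictable M F \<theta>" "\<And>s w. 0 \<le> \<theta> s w" "\<And>s w. \<theta> s w \<le> 1"
    and eq: "\<And>r s C. u \<le> r \<Longrightarrow> r \<le> s \<Longrightarrow> s \<le> v \<Longrightarrow> C \<in> sets (F r) \<Longrightarrow>
      (\<integral>\<^sup>+w. ennreal (indicator C w * (W w * (A s w - A r w))) \<partial>M) =
      (\<integral>\<^sup>+w. ennreal (indicator C w * (W w * path_integral \<theta> B r s w)) \<partial>M)"
    by (rule weighted_density[OF uv(1) uv'(1) W less_imp_le[OF W0] W1(1)[OF order_refl]]) blast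
  note PI = path_integral_bounds[OF \<theta> B] and PIm = path_integral_measurable[OF \<theta> B]
  define N where "N s w = A s w - A u w - path_integral \<theta> B u s w" for s w
  have N_diff: "N s w - N r w = (A s w - A r w) - path_integral \<theta> B r s w"
    if "u \<le> r" "r \<le> s" "w \<in> space M" for r s w
    using path_integral_add[OF \<theta> B uv(1) that] by (simp add: N_def)
  have N_bound: "\<bar>N s w - N r w\<bar> \<le> B s w - B r w" if "u \<le> r" "r \<le> s" "w \<in> space M" for r s w
  proof -
    have "0 \<le> r" using uv that by simp
    from PI[OF this that(2,3)] A'(2)[OF that(2), of w] increment_le[OF that(2), of w]
    show ?thesis unfolding N_diff[OF that] by (simp add: abs_le_iff)
  qed
  have N_u: "N u w = 0" for w by (simp add: N_def path_integral_def)
  have zero: "(\<integral>w. indicator C w * (W w * (N s w - N r w)) \<partial>M) = 0"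
    if rs: "u \<le> r" "r \<le> s" "s \<le> v" and C: "C \<in> sets (F r)" for r s C
  proof -
    have r0: "0 \<le> r" using uv rs by simp
    have [measurable]: "C \<in> sets M" by (rule sets_F_M[OF C])
    have [measurable]: "A s \<in> borel_measurable M" "A r \<in> borel_measurable M" using m rs by auto
    have [measurable]: "path_integral \<theta> B r s \<in> borel_measurable M" by (rule measurable_F_M[OF PIm[OF r0 rs(2)]])
    note W [measurable]
    have bd: "\<bar>indicator C w * (W w * x)\<bar> \<le> 1" if "0 \<le> x" "x \<le> B s w - B r w" for x w
    proof -
      have "x \<le> B s w" using that B'(6)[of r w] by simp
      then have "W w * x \<le> 1" using mult_left_mono[OF _ less_imp_le[OF W0]] W1(1)[OF rs(3)] order_trans by blast
      moreover have "0 \<le> W w * x" using W0[of w] that by simp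
      ultimately show ?thesis by (auto simp: indicator_def)
    qed
    have i1: "integrable M (\<lambda>w. indicator C w * (W w * (A s w - A r w)))"
      by (rule integrable_const_bound[of _ 1])
        (use bd A'(2)[OF rs(2)] increment_le[OF rs(2)] in \<open>auto intro!: AE_I2 simp del: abs_mult\<close>)
    have i2: "integrable M (\<lambda>w. indicator C w * (W w * path_integral \<theta> B r s w))"
      by (rule integrable_const_bound[of _ 1])
        (use bd PI[OF r0 rs(2)] in \<open>auto intro!: AE_I2 simp del: abs_mult\<close>)
    have "(\<integral>w. indicator C w * (W w * (A s w - A r w)) \<partial>M) =
        enn2real (\<integral>\<^sup>+w. ennreal (indicator C w * (W w * (A s w - A r w))) \<partial>M)"
      using A'(2)[OF rs(2)] less_imp_le[OF W0] by (intro integral_eq_nn_integral) auto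
    also have "\<dots> = enn2real (\<integral>\<^sup>+w. ennreal (indicator C w * (W w * path_integral \<theta> B r s w)) \<partial>M)"
      by (simp only: eq[OF rs C])
    also have "\<dots> = (\<integral>w. indicator C w * (W w * path_integral \<theta> B r s w) \<partial>M)"
      using PI(1)[OF r0 rs(2)] less_imp_le[OF W0] by (intro integral_eq_nn_integral[symmetric]) (auto intro!: AE_I2)
    finally have e: "(\<integral>w. indicator C w * (W w * (A s w - A r w)) \<partial>M) =
        (\<integral>w. indicator C w * (W w * path_integral \<theta> B r s w) \<partial>M)" .
    have "(\<integral>w. indicator C w * (W w * (N s w - N r w)) \<partial>M) =
        (\<integral>w. indicator C w * (W w * (A s w - A r w)) - indicator C w * (W w * path_integral \<theta> B r s w) \<partial>M)"
      using rs by (intro Bochner_Integration.integral_cong refl) (simp add: N_diff right_diff_distrib)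
    also have "\<dots> = 0" using e by (simp add: Bochner_Integration.integral_diff[OF i1 i2])
    finally show ?thesis .
  qed
  have AEt: "AE w in M. N t w = 0" if t: "u < t" "t \<le> v" for t
  proof (rule vanishing_increments[where N = N, OF B uv(1) t(1) _ N_u _ W W0 W1[OF t(2)]])
    fix s assume s: "u \<le> s" "s \<le> t"
    have s0: "0 \<le> s" using uv s by simp
    have "A s \<in> borel_measurable (F s)" "A u \<in> borel_measurable (F s)"
      using increasing_process_measurable[OF A _ s0] s by auto
    then show "N s \<in> borel_measurable (F s)"
      unfolding N_def[abs_def] using PIm[OF uv(1) s(1)] by measurable
  next
    fix r s C assume "u \<le> r" "r \<le> s" "s \<le> t" "C \<in> sets (F r)"
    then show "(\<integral>w. indicator C w * (W w * (N s w - N r w)) \<partial>M) = 0" using t by (intro zero) auto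
  qed (use N_bound in auto)
  have "AE w in M. \<forall>q\<in>\<rat>. u < q \<longrightarrow> q \<le> v \<longrightarrow> N q w = 0"
    using AEt by (subst AE_ball_countable[OF countable_rat]) (auto intro!: AE_impI)
  then have "AE w in M. \<forall>t\<in>{u..v}. A t w - A u w = path_integral \<theta> B u t w"
  proof (rule AE_mp[OF _ AE_I2], intro impI ballI)
    fix w t assume w: "w \<in> space M" and rat: "\<forall>q\<in>\<rat>. u < q \<longrightarrow> q \<le> v \<longrightarrow> N q w = 0" and t: "t \<in> {u..v}"
    \<comment> \<open>The exceptional sets were united over rational times. \<open>B\<close> is
      continuous and dominates the increments of \<open>N\<close>, which carries the identity to all
      times of the block.\<close>
    have "\<bar>N t w\<bar> \<le> 0 + \<epsilon>" if \<epsilon>: "0 < \<epsilon>" for \<epsilon>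
    proof -
      have "((\<lambda>t. B t w) \<longlongrightarrow> B t w) (at t)" using B'(3) by (rule isContD)
      from tendstoD[OF this \<epsilon>] obtain d where d: "0 < d" "\<And>q. q \<noteq> t \<Longrightarrow> dist q t < d \<Longrightarrow> dist (B q w) (B t w) < \<epsilon>"
        unfolding eventually_at by blast
      have "max u (t - d) < min v (t + d)" using t uv d(1) by auto
      then obtain q where q: "q \<in> \<rat>" "max u (t - d) < q" "q < min v (t + d)" using Rats_dense_in_real by blast
      have "dist (B q w) (B t w) < \<epsilon>" using d(2)[of q] q \<epsilon> by (cases "q = t") (auto simp: dist_real_def abs_less_iff)
      moreover have "\<bar>N q w - N t w\<bar> \<le> dist (B q w) (B t w)"
        using N_bound[of t q w] N_bound[of q t w] q t w by (cases "t \<le> q") (auto simp: dist_real_def abs_minus_commute)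
      moreover have "N q w = 0" using rat q by auto
      ultimately show ?thesis by simp
    qed
    then have "\<bar>N t w\<bar> \<le> 0" by (rule field_le_epsilon)
    then show "A t w - A u w = path_integral \<theta> B u t w" by (simp add: N_def)
  qed
  then show ?thesis using \<theta> by blast
qed

end

lemma predictable_glue:
  assumes "\<And>k :: nat. predictable M F (\<theta> k)"
  shows "predictable M F (\<lambda>s. \<theta> (nat \<lceil>s\<rceil> - 1) s)"
proof -
  have fst: "fst \<in> borel_measurable \<P>"
  proof (rule borel_measurableI_le)
    fix a :: real
    have "{x \<in> space \<P>. fst x \<le> a} =
        (if 0 \<le> a then {0} \<times> space M \<union> {0<..a} \<times> space M else {})"
      by auto
    moreover have "space M \<in> sets (F 0)" using sets.top[of "F 0"] by (simp add: space_F)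
    ultimately show "{x \<in> space \<P>. fst x \<le> a} \<in> sets \<P>"
      using predictable_rectangle(1,2) by auto
  qed
  \<comment> \<open>Times in \<open>(k, k + 1]\<close> get the index \<open>k\<close>; time 0 gets
    index 0 by truncated subtraction.\<close>
  have "(\<lambda>x. nat \<lceil>fst x\<rceil> - 1) \<in> measurable \<P> (count_space UNIV)"
    by (rule measurable_compose[OF fst]) simp
  from measurable_compose_countable[OF _ this, of "\<lambda>k x. \<theta> k (fst x) (snd x)"] assms
  show ?thesis by (simp add: predictable_def split_def)
qed

text \<open>The weight of \<open>block_density\<close> depends on the right end of its block, so the
  half-line is cut into unit blocks; by additivity of the path integral the identities are chained
  from block to block.\<close>

lemma increasing_density:
  assumes A: "increasing_process A" and B: "increasing_process B"
    and dom: "\<And>w E. E \<in> sets borel \<Longrightarrow>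
      emeasure (interval_measure (\<lambda>t. A t w)) E \<le> emeasure (interval_measure (\<lambda>t. B t w)) E"
  shows "\<exists>\<theta>. predictable M F \<theta> \<and> (\<forall>s w. 0 \<le> \<theta> s w \<and> \<theta> s w \<le> 1) \<and>
    (AE w in M. \<forall>t\<ge>0. A t w = path_integral \<theta> B 0 t w)"
proof -
  have "\<exists>\<theta>. predictable M F \<theta> \<and> (\<forall>s w. 0 \<le> \<theta> s w \<and> \<theta> s w \<le> 1) \<and>
    (AE w in M. \<forall>t\<in>{real k..real (Suc k)}. A t w - A (real k) w = path_integral \<theta> B (real k) t w)" for k
    by (rule block_density[OF A B dom]) auto
  then have "\<forall>k. \<exists>\<theta>. predictable M F \<theta> \<and> (\<forall>s w. 0 \<le> \<theta> s w \<and> \<theta> s w \<le> 1) \<and>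
    (AE w in M. \<forall>t\<in>{real k..real (Suc k)}. A t w - A (real k) w = path_integral \<theta> B (real k) t w)" ..
  from choice[OF this] obtain \<theta>' where \<theta>': "\<And>k. predictable M F (\<theta>' k)" "\<And>k s w. 0 \<le> \<theta>' k s w" "\<And>k s w. \<theta>' k s w \<le> 1"
    "\<And>k. AE w in M. \<forall>t\<in>{real k..real (Suc k)}. A t w - A (real k) w = path_integral (\<theta>' k) B (real k) t w"
    by blast
  define \<theta> where "\<theta> s = \<theta>' (nat \<lceil>s\<rceil> - 1) s" for s
  have \<theta>: "predictable M F \<theta>" "0 \<le> \<theta> s w" "\<theta> s w \<le> 1" for s w
    using \<theta>'(2,3) predictable_glue[OF \<theta>'(1)] by (simp_all add: \<theta>_def[abs_def])
  have agree: "\<theta> r = \<theta>' k r" if "real k < r" "r \<le> real (Suc k)" for k r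
  proof -
    have "\<lceil>r\<rceil> = int (Suc k)" using that by (intro ceiling_unique) auto
    then have "nat \<lceil>r\<rceil> - 1 = k" by simp
    then show ?thesis by (simp add: \<theta>_def)
  qed
  have block: "path_integral (\<theta>' k) B (real k) t w = path_integral \<theta> B (real k) t w" if "t \<le> real (Suc k)" for k t w
    unfolding path_integral_def
  proof (rule Bochner_Integration.integral_cong[OF refl])
    show "indicator {real k<..t} r * \<theta>' k r w = indicator {real k<..t} r * \<theta> r w" for r
      using agree[of k r] that by (cases "r \<in> {real k<..t}") simp_all
  qed
  have "AE w in M. \<forall>k. \<forall>t\<in>{real k..real (Suc k)}. A t w - A (real k) w = path_integral (\<theta>' k) B (real k) t w"
    unfolding AE_all_countable using \<theta>'(4) by blast
  then have "AE w in M. \<forall>t\<ge>0. A t w = path_integral \<theta> B 0 t w"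
  proof (rule AE_mp[OF _ AE_I2], intro impI)
    fix w assume w: "w \<in> space M"
      and eq: "\<forall>k. \<forall>t\<in>{real k..real (Suc k)}. A t w - A (real k) w = path_integral (\<theta>' k) B (real k) t w"
    have "A t w = path_integral \<theta> B 0 t w" if "0 \<le> t" "t \<le> real n" for t n
      using that
    proof (induction n arbitrary: t)
      case 0
      then show ?case using increasing_processD(5)[OF A, of 0 w] by (simp add: path_integral_def)
    next
      case (Suc n)
      show ?case
      proof (cases "t \<le> real n")
        case True
        then show ?thesis using Suc by blast
      next
        case False
        then have t: "real n \<le> t" "t \<le> real (Suc n)" using Suc.prems by auto
        have "A t w - A (real n) w = path_integral \<theta> B (real n) t w"
          using eq t block[OF t(2)] by auto
        moreover have "A (real n) w = path_integral \<theta> B 0 (real n) w" by (rule Suc.IH) auto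
        moreover have "path_integral \<theta> B 0 t w = path_integral \<theta> B 0 (real n) w + path_integral \<theta> B (real n) t w"
          using t by (intro path_integral_add[OF \<theta> B _ _ _ w]) auto
        ultimately show ?thesis by linarith
      qed
    qed
    then show "\<forall>t\<ge>0. A t w = path_integral \<theta> B 0 t w" using real_arch_simple by blast
  qed
  then show ?thesis using \<theta> by blast
qed

text \<open>Setting the process to 0 off a set of \<open>F 0\<close> makes the path properties hold
  on every path and keeps adaptedness.\<close>

lemma increasing_process_version:
  assumes G: "G \<in> sets (F 0)" and L: "adapted F L"
    and path: "\<And>w. w \<in> G \<Longrightarrow> continuous_on {0..} (\<lambda>t. L t w) \<and> mono_on {0..} (\<lambda>t. L t w) \<and> L 0 w = 0"
  shows "increasing_process (\<lambda>t w. L (max 0 t) w * indicator G w)"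
  unfolding increasing_process_def
proof (intro conjI allI impI)
  show "adapted F (\<lambda>t w. L (max 0 t) w * indicator G w)"
    unfolding adapted_def
  proof (intro allI impI)
    fix t :: real assume t: "0 \<le> t"
    have "L t \<in> borel_measurable (F t)" "(indicator G :: 'a \<Rightarrow> real) \<in> borel_measurable (F t)"
      using L t G sets_F_mono[OF t] by (auto simp: adapted_def)
    then show "(\<lambda>w. L (max 0 t) w * indicator G w) \<in> borel_measurable (F t)" using t by (simp add: max_absorb2)
  qed
  fix w
  show "mono (\<lambda>t. L (max 0 t) w * indicator G w)"
    using path[of w] by (cases "w \<in> G") (auto simp: mono_def intro!: mono_onD[of "{0..}" "\<lambda>t. L t w"])
  show "L (max 0 t) w * indicator G w = 0" if "t \<le> 0" for t
    using path[of w] that by (cases "w \<in> G") (simp_all add: max_absorb1)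
  show "isCont (\<lambda>t. L (max 0 t) w * indicator G w) t" for t
  proof (cases "w \<in> G")
    case True
    have "continuous_on UNIV (\<lambda>t. L (max 0 t) w)"
      by (rule continuous_on_compose2[OF path[OF True, THEN conjunct1], of UNIV "max 0"]) (auto intro!: continuous_intros)
    then show ?thesis using True by (simp add: continuous_on_eq_continuous_at)
  qed simp
qed

text \<open>The closed interval adds the point 0, which has no mass because the process is constant
  up to time 0.\<close>

lemma path_integral_Icc:
  assumes \<theta>: "predictable M F \<theta>" "\<And>s w. 0 \<le> \<theta> s w" "\<And>s w. \<theta> s w \<le> 1"
    and B: "increasing_process B" and w: "w \<in> space M"
  shows "path_integral \<theta> B 0 t w = (LINT s:{0..t}|interval_measure (\<lambda>t. B t w). \<theta> s w)"
proof -
  note m = path_measurable[OF \<theta> B order_refl w, of t]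
  let ?g = "\<lambda>s. indicator {0<..t} s * \<theta> s w + indicator {0} s * (indicator {0..t} 0 * \<theta> 0 w)"
  have eq: "indicator {0..t} s *\<^sub>R \<theta> s w = ?g s" for s
    by (auto simp: indicator_def)
  have "{-1<..0 :: real} \<in> null_sets (interval_measure (\<lambda>t. B t w))"
    using increasing_processD(5)[OF B, of _ w] by (intro null_setsI) (simp_all add: emeasure_increasing[OF B])
  from AE_not_in[OF this] have "AE s in interval_measure (\<lambda>t. B t w). indicator {0<..t} s * \<theta> s w = ?g s"
    by eventually_elim (auto simp: indicator_def)
  then show ?thesis
    unfolding path_integral_def set_lebesgue_integral_def eq
    using m by (intro integral_cong_AE) auto
qed

end

theorem theorem3p1:
  fixes M :: "'a measure" and F :: "real \<Rightarrow> 'a measure"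
    and X Y LX LY :: "real \<Rightarrow> 'a \<Rightarrow> real"
  assumes "usual_filtered_prob_space M F"
    and "semimartingale M F X" and "semimartingale M F Y"
    and "local_time M F X LX" and "local_time M F Y LY"
    and "AE \<omega> in M. \<forall>s>0. X s \<omega> = 0 \<and> left_lim X s \<omega> = 0 \<longrightarrow> Y s \<omega> = 0 \<and> left_lim Y s \<omega> = 0"
    and "AE \<omega> in M. \<forall>t\<ge>0. pos_part (X t \<omega>) \<le> pos_part (Y t \<omega>)"
  shows "(AE \<omega> in M. \<forall>t>0. absolutely_continuous
            (restrict_space (stieltjes LY \<omega>) {0..t}) (restrict_space (stieltjes LX \<omega>) {0..t})) \<and>
         (\<exists>\<theta>. predictable M F \<theta> \<and>
            (\<forall>s\<ge>0. \<forall>\<omega>\<in>space M. \<theta> s \<omega> \<in> {0..1}) \<and>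
            (AE \<omega> in M. \<forall>t\<ge>0. LX t \<omega> = (LINT s:{0..t}|stieltjes LY \<omega>. \<theta> s \<omega>)))"
proof -
  interpret usual_filtered_prob_space M F by fact
  note X = assms(2) and Y = assms(3) and LX = assms(4) and LY = assms(5)
  define P where "P \<omega> \<longleftrightarrow>
      (\<forall>E\<in>sets borel. emeasure (stieltjes LX \<omega>) E \<le> emeasure (stieltjes LY \<omega>) E) \<and>
      (continuous_on {0..} (\<lambda>t. LX t \<omega>) \<and> mono_on {0..} (\<lambda>t. LX t \<omega>) \<and> LX 0 \<omega> = 0) \<and>
      (continuous_on {0..} (\<lambda>t. LY t \<omega>) \<and> mono_on {0..} (\<lambda>t. LY t \<omega>) \<and> LY 0 \<omega> = 0)" for \<omega>
  have reg: "AE \<omega> in M. continuous_on {0..} (\<lambda>t. LX t \<omega>) \<and> mono_on {0..} (\<lambda>t. LX t \<omega>)"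
    "AE \<omega> in M. continuous_on {0..} (\<lambda>t. LY t \<omega>) \<and> mono_on {0..} (\<lambda>t. LY t \<omega>)"
    and adapted: "adapted F LX" "adapted F LY"
    using LX LY by (simp_all add: local_time_def)
  have "AE \<omega> in M. P \<omega>"
    using reg local_time_measure_le[OF X Y LX LY assms(6,7)] local_time_zero[OF X LX] local_time_zero[OF Y LY]
    unfolding P_def by eventually_elim blast
  then obtain G where G: "G \<in> sets (F 0)" "AE \<omega> in M. \<omega> \<in> G" "\<And>\<omega>. \<omega> \<in> G \<Longrightarrow> \<omega> \<in> space M \<and> P \<omega>"
    by (rule prob_one_F0) blast
  \<comment> \<open>Off \<open>G\<close> both processes are 0, so the domination needed by
    \<open>increasing_density\<close> holds on every path; on \<open>G\<close> their measures are
    the given Stieltjes measures.\<close>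
  define A where "A t \<omega> = LX (max 0 t) \<omega> * indicator G \<omega>" for t \<omega>
  define B where "B t \<omega> = LY (max 0 t) \<omega> * indicator G \<omega>" for t \<omega>
  have A: "increasing_process A" and B: "increasing_process B"
    unfolding A_def B_def using G(3) by (auto intro!: increasing_process_version[OF G(1)] adapted simp: P_def)
  have on_G: "interval_measure (\<lambda>t. A t \<omega>) = stieltjes LX \<omega>" "interval_measure (\<lambda>t. B t \<omega>) = stieltjes LY \<omega>"
    if "\<omega> \<in> G" for \<omega>
    using that by (simp_all add: A_def B_def stieltjes_def)
  have dom: "emeasure (interval_measure (\<lambda>t. A t \<omega>)) E \<le> emeasure (interval_measure (\<lambda>t. B t \<omega>)) E"
    if E: "E \<in> sets borel" for \<omega> E
  proof (cases "\<omega> \<in> G")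
    case True
    then show ?thesis using G(3)[OF True] E by (simp add: on_G P_def)
  qed (simp add: A_def B_def)
  obtain \<theta> where \<theta>: "predictable M F \<theta>" "\<And>s \<omega>. 0 \<le> \<theta> s \<omega>" "\<And>s \<omega>. \<theta> s \<omega> \<le> 1"
    and eq: "AE \<omega> in M. \<forall>t\<ge>0. A t \<omega> = path_integral \<theta> B 0 t \<omega>"
    using increasing_density[OF A B dom] by blast
  have "AE \<omega> in M. \<forall>t>0. absolutely_continuous
      (restrict_space (stieltjes LY \<omega>) {0..t}) (restrict_space (stieltjes LX \<omega>) {0..t})"
    using G(2)
  proof eventually_elim
    case (elim \<omega>)
    have sets: "sets (stieltjes LX \<omega>) = sets borel" "sets (stieltjes LY \<omega>) = sets borel" by (simp_all add: stieltjes_def)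
    have le: "emeasure (stieltjes LX \<omega>) E \<le> emeasure (stieltjes LY \<omega>) E" if "E \<in> sets borel" for E
      using G(3)[OF elim] that by (simp add: P_def)
    have null: "E \<in> null_sets (stieltjes LX \<omega>)" if "E \<in> null_sets (stieltjes LY \<omega>)" for E
      using that le[of E] by (simp add: null_sets_def sets)
    show ?case
      unfolding absolutely_continuous_def using null by (auto simp: null_sets_restrict_space sets)
  qed
  moreover have "AE \<omega> in M. \<forall>t\<ge>0. LX t \<omega> = (LINT s:{0..t}|stieltjes LY \<omega>. \<theta> s \<omega>)"
    using eq G(2)
  proof eventually_elim
    case (elim \<omega>)
    have "\<omega> \<in> space M" using G(3)[OF elim(2)] by simp
    then show ?case
      using elim(1) elim(2) path_integral_Icc[OF \<theta> B] by (simp add: on_G(2) A_def max_absorb2)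
  qed
  ultimately show ?thesis using \<theta> by (intro conjI exI[of _ \<theta>]) auto
qed

end
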